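(* For every $\alpha\ge1$ there exist integers $a_{j,i},b_{j,i},c_{j,i}$ such that $$L_{2\alpha-1}=7^{\alpha+1}a_{2\alpha-1,1}u+7^{\alpha+1}a_{2\alpha-1,2}u^2+7^{\alpha+1}\sum_{i=3}^{(7^{2\alpha}-1)/6}7^{\lceil\frac{7i-24}{26}\rceil}a_{2\alpha-1,i}u^i+7^{\alpha}b_{2\alpha-1,1}ut+7^{\alpha}b_{2\alpha-1,2}u^2t$$ $$\quad+7^{\alpha+1}\sum_{i=3}^{(7^{2\alpha}-1)/6}7^{\lceil\frac{7i-24}{26}\rceil}b_{2\alpha-1,i}u^it+7^{\alpha}c_{2\alpha-1,2}u^2t^2+7^{\alpha+1}\sum_{i=3}^{(7^{2\alpha}-1)/6}7^{\lceil\frac{7i-24}{26}\rceil}c_{2\alpha-1,i}u^it^2,$$ and $$L_{2\alpha}=7^{\alpha+1}a_{2\alpha,1}u+7^{\alpha+1}a_{2\alpha,2}u^2+7^{\alpha+1}\sum_{i=3}^{(7^{2\alpha+1}-7)/6}7^{\lceil\frac{7i+3}{26}\rceil}a_{2\alpha,i}u^i+7^{\alpha+1}b_{2\alpha,1}ut+7^{\alpha+1}b_{2\alpha,2}u^2t$$ $$\quad+7^{\alpha+1}\sum_{i=3}^{(7^{2\alpha+1}-7)/6}7^{\lceil\frac{7i+3}{26}\rceil}b_{2\alpha,i}u^it+7^{\alpha+1}c_{2\alpha,2}u^2t^2+7^{\alpha+1}\sum_{i=3}^{(7^{2\alpha+1}-7)/6}7^{\lceil\frac{7i+3}{26}\r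ceil}c_{2\alpha,i}u^it^2.$$
   Context: Notation: - $\tau\in\mathbb{H}$ (the upper half-plane) and $q=e^{2\pi i\tau}$. - $\eta(\tau)=q^{1/24}\prod_{n\ge1}(1-q^n)$ is the Dedekind eta function. - $t=\dfrac{\eta(2\tau)\eta^7(7\tau)}{\eta(\tau)\eta^7(14\tau)}$, $u=\dfrac{\eta^7(14\tau)}{\eta^3(\tau)\eta(2\tau)\eta^3(7\tau)}$ and $A=\dfrac{\eta^2(2\tau)\eta^5(49\tau)}{\eta^5(\tau)\eta^2(98\tau)}$. - For $f:\mathbb{H}\to\mathbb{C}$, the Atkin operator is $U_7(f)(\tau)=\frac17\sum_{\lambda=0}^{6}f\big(\frac{\tau+\lambda}{7}\big)$. On $q$-expansions, $U_7(\sum a(n)q^n)=\sum a(7n)q^n$. - Set $L_0=1$, and for $\alpha\ge1$ set $L_{2\alpha-1}=U_7(AL_{2\alpha-2})$ and $L_{2\alpha}=U_7(L_{2\alpha-1})$. Equalities are identities of functions on $\mathbb{H}$. *)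

theory Defs
  imports "HOL-Analysis.Analysis"
begin

text \<open>
  Functions on the upper half-plane are represented by total functions on \<^typ>\<open>complex\<close>;
  only their values at arguments with positive imaginary part are meaningful.
\<close>

definition upper_half_plane :: "complex set" where
  "upper_half_plane = {\<tau>. Im \<tau> > 0}"

definition nome :: "complex \<Rightarrow> complex" where
  "nome \<tau> = exp (2 * of_real pi * \<i> * \<tau>)"

text \<open>
  The factor $q^{1/24}$ stands for $e^{2 \pi i \tau / 24}$, not for the principal root of $q$.
\<close>

definition dedekind_eta :: "complex \<Rightarrow> complex" where
  "dedekind_eta \<tau> =
     exp (2 * of_real pi * \<i> * \<tau> / 24) * prodinf (\<lambda>n. 1 - nome \<tau> ^ Suc n)"

definition mod_t :: "complex \<Rightarrow> complex" where
  "mod_t \<tau> =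
     (dedekind_eta (2 * \<tau>) * dedekind_eta (7 * \<tau>) ^ 7) /
     (dedekind_eta \<tau> * dedekind_eta (14 * \<tau>) ^ 7)"

definition mod_u :: "complex \<Rightarrow> complex" where
  "mod_u \<tau> =
     dedekind_eta (14 * \<tau>) ^ 7 /
     (dedekind_eta \<tau> ^ 3 * dedekind_eta (2 * \<tau>) * dedekind_eta (7 * \<tau>) ^ 3)"

definition mod_A :: "complex \<Rightarrow> complex" where
  "mod_A \<tau> =
     (dedekind_eta (2 * \<tau>) ^ 2 * dedekind_eta (49 * \<tau>) ^ 5) /
     (dedekind_eta \<tau> ^ 5 * dedekind_eta (98 * \<tau>) ^ 2)"

definition atkin_U7 :: "(complex \<Rightarrow> complex) \<Rightarrow> complex \<Rightarrow> complex" where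
  "atkin_U7 f \<tau> = 1 / 7 * (\<Sum>l = 0..(6::nat). f ((\<tau> + of_nat l) / 7))"

text \<open>
  The step from an even index multiplies by \<^const>\<open>mod_A\<close> before applying \<^const>\<open>atkin_U7\<close>;
  the step from an odd index applies \<^const>\<open>atkin_U7\<close> alone.
\<close>

fun L_seq :: "nat \<Rightarrow> complex \<Rightarrow> complex" where
  "L_seq 0 = (\<lambda>\<tau>. 1)"
| "L_seq (Suc n) =
     (if even n then atkin_U7 (\<lambda>\<tau>. mod_A \<tau> * L_seq n \<tau>) else atkin_U7 (L_seq n))"

end

theory Submission
  imports Defs "HOL-Complex_Analysis.Complex_Analysis"
begin

text \<open>
  Put \<open>T = u t\<close>, which is \<open>(\<eta>(7\<tau>) / \<eta>(\<tau>))^4\<close>. The functions \<open>T\<close> and \<open>u\<close> satisfy a cubic relation, and \<open>T U(T^a u^b)\<close> and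
  \<open>U(A T^a u^b)\<close> are polynomials in \<open>T\<close> and \<open>u\<close> for seven consecutive exponents \<open>a\<close> and each \<open>b \<le> 2\<close>. To prove such an
  identity one embeds the difference of its sides in a finite family of functions that the modular group permutes; its
  members are built from Klein forms of level 7 in the arguments \<open>\<tau>\<close>, \<open>2\<tau>\<close>, \<open>\<tau>/2\<close>, \<open>(\<tau>+1)/2\<close>. If 25 coefficients of the
  expansion in \<open>q\<close> agree, then after division by \<open>u^8\<close> every member is bounded at the cusp and one member tends to 0, so
  that the maximum principle forces the family to vanish.

  The power sums of \<open>1 / T((\<tau> + l) / 7)\<close> yield the modular equation, hence a recurrence of order 7 in \<open>a\<close> for
  \<open>U(T^a u^b)\<close> and \<open>U(A T^a u^b)\<close>. It propagates a linear lower bound for the 7-adic valuation of the coefficients, and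
  this bound, with one extra factor 7 in a few low cases, carries the induction on \<open>\<alpha>\<close>. The coefficients so obtained
  may have powers of 2 in the denominator. After reduction by the cubic relation, the basis \<open>u^n T^j\<close> with \<open>j \<le> 2\<close> has
  distinct orders \<open>3n + j\<close> and leading coefficient 1, so the integrality of the expansion of \<open>L\<close> in \<open>q\<close> shows that the
  denominators are 1.
\<close>

text \<open>The initial values are taken at negative exponents of \<open>TT\<close> for reasons of
  size: \<open>U(TT^a u^b)\<close> has degree about 7 (a + b) for positive a but only about -a for
  negative a, so degree 8 suffices. As \<open>mod_u\<close> has order 3 at infinity, a difference of
  degree at most 8 needs 3 * 8 + 1 coefficients. Indexed families leave only the generators \<tau> +
  1 and -1/\<tau> to check; congruence subgroups and the valence formula do not enter, and even the
  law of the discriminant is drawn from that of one theta quotient.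

  Two normal forms compete: the tables for the Atkin operator need exponents of \<open>mod_u\<close>
  at most 2, the theorem needs exponents of \<open>TT\<close> at most 2. The cubic is monic in
  \<open>TT\<close> but has coefficient 64 at \<open>mod_u^3\<close>, which is where powers of 2 can
  come from. Hence the induction runs in the first form, and the second is reached at the end.

  The exponent of 7 is bounded below in terms of the total degree d. An Atkin step costs d/4; the
  slope 7/26 of the theorem exceeds 1/4, so degrees d >= 3 take care of themselves and only d <= 2
  calls for the extra factors.\<close>

definition qp :: "complex \<Rightarrow> complex \<Rightarrow> complex" where
  "qp a q = prodinf (\<lambda>n. 1 - a * q ^ n)"

definition eul :: "complex \<Rightarrow> complex" where
  "eul q = prodinf (\<lambda>n. 1 - q ^ Suc n)"

lemma eul_qp: "eul q = qp q q"
  by (simp add: eul_def qp_def)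

lemma qp_convergent:
  fixes a q :: complex
  assumes "norm q < 1"
  shows "convergent_prod (\<lambda>n. 1 - a * q ^ n)"
proof -
  have "summable (\<lambda>n. norm ((1 - a * q ^ n) - 1))"
    using summable_mult[OF summable_geometric, of "norm q" "norm a"] assms
    by (simp add: norm_mult norm_power)
  then show ?thesis
    by (intro abs_convergent_prod_imp_convergent_prod summable_imp_abs_convergent_prod)
qed

lemma qp_tendsto:
  assumes "norm q < 1"
  shows "(\<lambda>N. \<Prod>n<N. 1 - a * q ^ n) \<longlonglongrightarrow> qp a q"
  unfolding qp_def by (intro has_prod_imp_tendsto' convergent_prod_has_prod qp_convergent assms)

lemma qp_eq_0_iff:
  assumes "norm q < 1"
  shows "qp a q = 0 \<longleftrightarrow> (\<exists>n. a * q ^ n = 1)"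
proof -
  have "(\<lambda>n. 1 - a * q ^ n) has_prod qp a q"
    unfolding qp_def by (intro convergent_prod_has_prod qp_convergent assms)
  from has_prod_eq_0_iff[OF this] show ?thesis by (force simp: image_iff)
qed

lemma eul_nonzero:
  assumes "norm q < 1"
  shows "eul q \<noteq> 0"
proof
  assume "eul q = 0"
  then obtain n where "q * q ^ n = 1"
    using qp_eq_0_iff[OF assms] by (auto simp: eul_qp)
  then have "norm q ^ Suc n = 1" by (metis norm_one norm_power power_Suc)
  moreover have "norm q ^ Suc n < 1" using assms by (subst power_less_one_iff) auto
  ultimately show False by simp
qed

lemma qp_step:
  assumes "norm q < 1"
  shows "qp a q = (1 - a) * qp (a * q) q"
proof -
  have "(\<lambda>N. \<Prod>n<Suc N. 1 - a * q ^ n) \<longlonglongrightarrow> qp a q"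
    by (rule LIMSEQ_Suc[OF qp_tendsto[OF assms]])
  moreover have "(\<lambda>N. \<Prod>n<Suc N. 1 - a * q ^ n) = (\<lambda>N. (1 - a) * (\<Prod>n<N. 1 - (a * q) * q ^ n))"
    by (simp add: prod.lessThan_Suc_shift mult.assoc del: prod.lessThan_Suc)
  moreover have "(\<lambda>N. (1 - a) * (\<Prod>n<N. 1 - (a * q) * q ^ n)) \<longlonglongrightarrow> (1 - a) * qp (a * q) q"
    by (intro tendsto_mult tendsto_const qp_tendsto assms)
  ultimately show ?thesis using LIMSEQ_unique by metis
qed

lemma qp_bound:
  assumes "norm q < 1"
  shows "norm (qp a q - 1) \<le> exp (norm a / (1 - norm q)) - 1"
proof (rule LIMSEQ_le_const2)
  show "(\<lambda>N. norm ((\<Prod>n<N. 1 - a * q ^ n) - 1)) \<longlonglongrightarrow> norm (qp a q - 1)"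
    by (intro tendsto_intros qp_tendsto assms)
  have "norm ((\<Prod>n<N. 1 - a * q ^ n) - 1) \<le> exp (norm a / (1 - norm q)) - 1" for N
  proof -
    have "norm ((\<Prod>n<N. 1 + - (a * q ^ n)) - 1) \<le> (\<Prod>n<N. 1 + norm (- (a * q ^ n))) - 1"
      by (rule norm_prod_minus1_le_prod_minus1)
    also have "(\<Prod>n<N. 1 + norm (- (a * q ^ n))) \<le> (\<Prod>n<N. exp (norm (a * q ^ n)))"
      by (intro prod_mono) (auto simp: exp_ge_add_one_self)
    also have "\<dots> = exp (\<Sum>n<N. norm (a * q ^ n))" by (simp add: exp_sum)
    also have "(\<Sum>n<N. norm (a * q ^ n)) = norm a * (\<Sum>n<N. norm q ^ n)"
      by (simp add: norm_mult norm_power sum_distrib_left)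
    also have "(\<Sum>n<N. norm q ^ n) \<le> (\<Sum>n. norm q ^ n)"
      using assms by (intro sum_le_suminf summable_geometric) auto
    also have "\<dots> = 1 / (1 - norm q)" using assms by (intro suminf_geometric) auto
    finally show ?thesis by (simp add: mult_left_mono)
  qed
  then show "\<exists>N. \<forall>n\<ge>N. norm ((\<Prod>n<n. 1 - a * q ^ n) - 1) \<le> exp (norm a / (1 - norm q)) - 1"
    by blast
qed

text \<open>Sorts the exponents by their residue mod \<open>k\<close>; the partial products agree
  along the subsequence \<open>N * k\<close>.\<close>

lemma qp_dissect:
  assumes "norm q < 1" "k > 0"
  shows "(\<Prod>r<k. qp (a * q ^ r) (q ^ k)) = qp a q"
proof -
  have qk: "norm (q ^ k) < 1" using assms by (simp add: norm_power power_less_one_iff)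
  have "(\<lambda>N. \<Prod>r<k. \<Prod>n<N. 1 - (a * q ^ r) * (q ^ k) ^ n) \<longlonglongrightarrow> (\<Prod>r<k. qp (a * q ^ r) (q ^ k))"
    by (intro tendsto_prod qp_tendsto qk)
  moreover have "(\<Prod>r<k. \<Prod>n<N. 1 - (a * q ^ r) * (q ^ k) ^ n) = (\<Prod>n<N * k. 1 - a * q ^ n)" for N
  proof -
    have "(\<Prod>n<N * k. 1 - a * q ^ n) = (\<Prod>m<N. \<Prod>n = m * k..<m * k + k. 1 - a * q ^ n)"
      by (simp add: prod.nat_group)
    also have "\<dots> = (\<Prod>m<N. \<Prod>r<k. 1 - (a * q ^ r) * (q ^ k) ^ m)"
    proof (rule prod.cong)
      fix m
      have "(\<Prod>n = m * k..<m * k + k. 1 - a * q ^ n) = (\<Prod>n = 0 + m * k..<k + m * k. 1 - a * q ^ n)"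
        by (simp add: add.commute)
      also have "\<dots> = (\<Prod>n = 0..<k. 1 - a * q ^ (n + m * k))"
        by (rule prod.shift_bounds_nat_ivl)
      finally show "(\<Prod>n = m * k..<m * k + k. 1 - a * q ^ n) = (\<Prod>r<k. 1 - (a * q ^ r) * (q ^ k) ^ m)"
        by (simp add: atLeast0LessThan power_add power_mult [symmetric] mult.commute [of m k] mult.assoc)
    qed simp
    also have "\<dots> = (\<Prod>r<k. \<Prod>m<N. 1 - (a * q ^ r) * (q ^ k) ^ m)" by (rule prod.swap)
    finally show ?thesis by simp
  qed
  ultimately have "(\<lambda>N. \<Prod>n<N * k. 1 - a * q ^ n) \<longlonglongrightarrow> (\<Prod>r<k. qp (a * q ^ r) (q ^ k))" by simp
  moreover have "(\<lambda>N. \<Prod>n<N * k. 1 - a * q ^ n) \<longlonglongrightarrow> qp a q"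
  proof -
    have "strict_mono (\<lambda>N. N * k)" using assms by (auto simp: strict_mono_def)
    from LIMSEQ_subseq_LIMSEQ[OF qp_tendsto[OF assms(1), of a] this] show ?thesis
      by (simp add: o_def)
  qed
  ultimately show ?thesis using LIMSEQ_unique by blast
qed

text \<open>Multiplies over roots of unity in the base instead of splitting the exponents. The
  hypothesis on \<open>J\<close> is an identity in \<open>y\<close> applied to each factor, so signs
  (\<open>k = 2\<close>) and seventh roots of unity (\<open>k = 7\<close>) are both covered.\<close>

lemma qp_roots:
  assumes "norm q < 1" "k > 0" and J: "\<And>y. (\<Prod>j\<in>J. 1 - w j * y) = 1 - c * y ^ k"
  shows "(\<Prod>j\<in>J. qp (w j * a) q) = qp (c * a ^ k) (q ^ k)"
proof -
  have qk: "norm (q ^ k) < 1" using assms by (simp add: norm_power power_less_one_iff)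
  have "(\<lambda>N. \<Prod>j\<in>J. \<Prod>n<N. 1 - (w j * a) * q ^ n) \<longlonglongrightarrow> (\<Prod>j\<in>J. qp (w j * a) q)"
    by (intro tendsto_prod qp_tendsto assms)
  moreover have "(\<Prod>j\<in>J. \<Prod>n<N. 1 - (w j * a) * q ^ n) = (\<Prod>n<N. 1 - (c * a ^ k) * (q ^ k) ^ n)" for N
  proof -
    have "(\<Prod>j\<in>J. \<Prod>n<N. 1 - (w j * a) * q ^ n) = (\<Prod>n<N. \<Prod>j\<in>J. 1 - w j * (a * q ^ n))"
      by (subst prod.swap) (simp add: mult.assoc)
    moreover have "(a * q ^ n) ^ k = a ^ k * (q ^ k) ^ n" for n
      by (metis power_mult power_mult_distrib mult.commute)
    ultimately show ?thesis by (simp only: J mult.assoc)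
  qed
  moreover have "(\<lambda>N. \<Prod>n<N. 1 - (c * a ^ k) * (q ^ k) ^ n) \<longlonglongrightarrow> qp (c * a ^ k) (q ^ k)"
    by (intro qp_tendsto qk)
  ultimately show ?thesis using LIMSEQ_unique by auto
qed

text \<open>A summable bound for \<open>f n - 1\<close> near each point makes the partial products
  converge locally uniformly, so the limit is holomorphic. The limit is given in advance as
  \<open>g\<close>, which fits \<open>qp\<close> and \<open>eul\<close>.\<close>

lemma holomorphic_prodinf_aux:
  fixes f :: "nat \<Rightarrow> complex \<Rightarrow> complex"
  assumes S: "open S" and hol: "\<And>n. f n holomorphic_on S"
    and bnd: "\<And>x. x \<in> S \<Longrightarrow> \<exists>d>0. cball x d \<subseteq> S \<and> (\<exists>M. summable M \<and> (\<forall>n. \<forall>y\<in>cball x d. norm (f n y - 1) \<le> M n))"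
    and lim: "\<And>x. x \<in> S \<Longrightarrow> (\<lambda>N. \<Prod>n<N. f n x) \<longlonglongrightarrow> g x"
  shows "g holomorphic_on S"
proof (rule holomorphic_uniform_sequence[OF S, of "\<lambda>N x. \<Prod>n<N. f n x"])
  show "(\<lambda>x. \<Prod>n<N. f n x) holomorphic_on S" for N by (intro holomorphic_intros hol)
  fix x assume x: "x \<in> S"
  from bnd[OF this] obtain d where "d > 0" "cball x d \<subseteq> S"
    and "\<exists>M. summable M \<and> (\<forall>n. \<forall>y\<in>cball x d. norm (f n y - 1) \<le> M n)" by metis
  then obtain M where d: "d > 0" "cball x d \<subseteq> S" "summable M"
    "\<And>n y. y \<in> cball x d \<Longrightarrow> norm (f n y - 1) \<le> M n" by (elim exE conjE) simp
  have "uniformly_convergent_on (cball x d) (\<lambda>N y. \<Prod>n<N. f n y)"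
  proof (rule uniformly_convergent_on_prod')
    show "continuous_on (cball x d) (f n)" for n
      using hol d(2) holomorphic_on_imp_continuous_on holomorphic_on_subset by blast
    show "uniformly_convergent_on (cball x d) (\<lambda>N x. \<Sum>n<N. norm (f n x - 1))"
      by (rule Weierstrass_m_test'[OF _ d(3)]) (use d(4) in auto)
  qed auto
  then obtain l where l: "uniform_limit (cball x d) (\<lambda>N y. \<Prod>n<N. f n y) l sequentially"
    by (auto simp: uniformly_convergent_on_def)
  have "l y = g y" if "y \<in> cball x d" for y
  proof -
    have "(\<lambda>N. \<Prod>n<N. f n y) \<longlonglongrightarrow> l y" using tendsto_uniform_limitI[OF l that] .
    moreover have "(\<lambda>N. \<Prod>n<N. f n y) \<longlonglongrightarrow> g y" using lim that d(2) by blast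
    ultimately show ?thesis using LIMSEQ_unique by blast
  qed
  then have "uniform_limit (cball x d) (\<lambda>N y. \<Prod>n<N. f n y) g sequentially"
    using l uniform_limit_cong' by (metis (no_types, lifting))
  then show "\<exists>d>0. cball x d \<subseteq> S \<and> uniform_limit (cball x d) (\<lambda>N x. \<Prod>n<N. f n x) g sequentially"
    using d by blast
qed

lemma qp_holomorphic:
  assumes "norm q < 1"
  shows "(\<lambda>a. qp a q) holomorphic_on UNIV"
proof (rule holomorphic_prodinf_aux[where f = "\<lambda>n a. 1 - a * q ^ n"])
  fix x :: complex
  have "summable (\<lambda>n. (norm x + 1) * norm q ^ n)"
    using assms by (intro summable_mult summable_geometric) auto
  moreover have "norm ((1 - y * q ^ n) - 1) \<le> (norm x + 1) * norm q ^ n" if "y \<in> cball x 1" for y n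
  proof -
    have "norm y \<le> norm x + 1" using that by (smt (verit) dist_commute dist_norm mem_cball norm_triangle_sub)
    then show ?thesis by (simp add: norm_mult norm_power mult_right_mono)
  qed
  ultimately show "\<exists>d>0. cball x d \<subseteq> UNIV \<and> (\<exists>M. summable M \<and> (\<forall>n. \<forall>y\<in>cball x d. norm (1 - y * q ^ n - 1) \<le> M n))"
    by (intro exI[of _ 1] conjI exI[of _ "\<lambda>n. (norm x + 1) * norm q ^ n"]) simp_all
qed (auto intro!: holomorphic_intros qp_tendsto assms)

lemma eul_holomorphic: "eul holomorphic_on ball 0 1"
proof (rule holomorphic_prodinf_aux[where f = "\<lambda>n q. 1 - q ^ Suc n"])
  fix x :: complex assume x: "x \<in> ball 0 1"
  define d where "d = (1 - norm x) / 2"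
  define r where "r = norm x + d"
  have d: "d > 0" "r < 1" "r \<ge> 0" using x by (auto simp: d_def r_def field_simps)
  have nb: "norm y \<le> r" if "y \<in> cball x d" for y
    using that by (smt (verit) dist_commute dist_norm mem_cball norm_triangle_sub r_def)
  have "summable (\<lambda>n. r ^ Suc n)"
    using d by (simp add: summable_Suc_iff summable_geometric del: power_Suc)
  moreover have "norm ((1 - y ^ Suc n) - 1) \<le> r ^ Suc n" if "y \<in> cball x d" for y n
    using nb[OF that] by (simp add: norm_power power_mono del: power_Suc)
  moreover have "cball x d \<subseteq> ball 0 1" using nb d(2) by force
  ultimately show "\<exists>d>0. cball x d \<subseteq> ball 0 1 \<and> (\<exists>M. summable M \<and> (\<forall>n. \<forall>y\<in>cball x d. norm (1 - y ^ Suc n - 1) \<le> M n))"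
    using d(1) by (intro exI[of _ d] conjI exI[of _ "\<lambda>n. r ^ Suc n"]) simp_all
next
  fix x :: complex assume x: "x \<in> ball 0 1"
  then show "(\<lambda>N. \<Prod>n<N. 1 - x ^ Suc n) \<longlonglongrightarrow> eul x"
    using qp_tendsto[of x x] by (simp add: eul_qp)
qed (auto intro!: holomorphic_intros)

text \<open>\<open>eul\<close> is continuous and without zeros on a compact disc. The lower bound is
  what later yields exact orders at infinity and allows factors \<open>eul\<close> to be
  cancelled.\<close>

lemma eul_bounds:
  assumes "0 \<le> r" "r < 1"
  obtains c C where "c > 0" "\<And>x. norm x \<le> r \<Longrightarrow> c \<le> norm (eul x)" "\<And>x. norm x \<le> r \<Longrightarrow> norm (eul x) \<le> C"
proof -
  have sub: "cball (0::complex) r \<subseteq> ball 0 1" using assms by auto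
  have cont: "continuous_on (cball 0 r) eul"
    using eul_holomorphic sub holomorphic_on_imp_continuous_on holomorphic_on_subset by blast
  then have cn: "continuous_on (cball 0 r) (\<lambda>x. norm (eul x))" by (intro continuous_intros)
  have ne: "cball (0::complex) r \<noteq> {}" using assms by auto
  obtain a where a: "a \<in> cball 0 r" "\<forall>y\<in>cball 0 r. norm (eul a) \<le> norm (eul y)"
    using continuous_attains_inf[OF compact_cball ne cn] by blast
  obtain b where b: "b \<in> cball 0 r" "\<forall>y\<in>cball 0 r. norm (eul y) \<le> norm (eul b)"
    using continuous_attains_sup[OF compact_cball ne cn] by blast
  have "eul a \<noteq> 0" using a(1) sub by (intro eul_nonzero) auto
  then show ?thesis using that[of "norm (eul a)" "norm (eul b)"] a b by auto
qed

section \<open>The nome and the theta quotient\<close>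

lemma nome_add: "nome (a + b) = nome a * nome b"
  by (simp add: nome_def algebra_simps exp_add)

lemma nome_diff: "nome (a - b) = nome a / nome b"
  by (simp add: nome_def algebra_simps exp_diff)

lemma nome_minus: "nome (- a) = inverse (nome a)"
  by (simp add: nome_def exp_minus)

lemma nome_nonzero [simp]: "nome a \<noteq> 0"
  by (simp add: nome_def)

lemma nome_of_nat_mult: "nome (of_nat n * a) = nome a ^ n"
  by (simp add: nome_def exp_of_nat_mult [symmetric] algebra_simps)

lemma nome_numeral_mult: "nome (numeral n * a) = nome a ^ numeral n"
  using nome_of_nat_mult[of "numeral n" a] by simp

lemma nome_eq_1_iff: "nome z = 1 \<longleftrightarrow> (\<exists>n::int. z = of_int n)"
proof -
  have "nome z = 1 \<longleftrightarrow> (\<exists>n::int. 2 * of_real pi * \<i> * z = of_int (2 * n) * of_real pi * \<i>)"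
    unfolding nome_def exp_eq_1 by (auto simp: complex_eq_iff)
  also have "\<dots> \<longleftrightarrow> (\<exists>n::int. z = of_int n)" by (auto simp: field_simps)
  finally show ?thesis .
qed

lemma nome_of_int [simp]: "nome (of_int n) = 1"
  by (auto simp: nome_eq_1_iff)

lemma nome_1 [simp]: "nome 1 = 1"
  using nome_of_int[of 1] by simp

lemma nome_0 [simp]: "nome 0 = 1"
  by (simp add: nome_def)

lemma norm_nome: "norm (nome z) = exp (- 2 * pi * Im z)"
  by (simp add: nome_def)

lemma norm_nome_less_1: "Im z > 0 \<Longrightarrow> norm (nome z) < 1"
  by (simp add: norm_nome)

lemma norm_nome_power_less_1: "Im z > 0 \<Longrightarrow> k > 0 \<Longrightarrow> norm (nome z ^ k) < 1"
  by (simp add: norm_power power_less_one_iff norm_nome_less_1)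

lemma nome_holomorphic [holomorphic_intros]:
  "f holomorphic_on S \<Longrightarrow> (\<lambda>z. nome (f z)) holomorphic_on S"
  unfolding nome_def by (intro holomorphic_intros)

text \<open>Up to a constant this is the Jacobi theta function theta_1 divided by the cube of eta.
  Division by \<open>eul^2\<close> makes the derivative at 0 equal to 2 pi i for every \<tau>, so
  the law under -1/\<tau> contains neither a root of unity nor a square root of \<tau>.\<close>

definition th :: "complex \<Rightarrow> complex \<Rightarrow> complex" where
  "th z \<tau> = - exp (- (of_real pi * \<i> * z)) * qp (nome z) (nome \<tau>) * qp (nome \<tau> / nome z) (nome \<tau>) / eul (nome \<tau>) ^ 2"

lemma th_add_1: "th (z + 1) \<tau> = - th z \<tau>"
proof -
  have "exp (- (of_real pi * \<i> * (z + 1))) = - exp (- (of_real pi * \<i> * z))"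
    by (simp add: algebra_simps exp_add exp_minus exp_diff inverse_eq_divide)
  then show ?thesis by (simp add: th_def nome_add)
qed

lemma th_minus:
  assumes "Im \<tau> > 0"
  shows "th (- z) \<tau> = - th z \<tau>"
proof -
  let ?q = "nome \<tau>"
  have q: "norm ?q < 1" using assms by (rule norm_nome_less_1)
  have 1: "qp (nome z) ?q = (1 - nome z) * qp (nome z * ?q) ?q" by (rule qp_step[OF q])
  have 2: "qp (inverse (nome z)) ?q = (1 - inverse (nome z)) * qp (?q / nome z) ?q"
    using qp_step[OF q, of "inverse (nome z)"] by (simp add: field_simps)
  have 3: "exp (of_real pi * \<i> * z) = exp (- (of_real pi * \<i> * z)) * nome z"
    unfolding nome_def by (simp add: exp_add [symmetric] algebra_simps)
  show ?thesis
    unfolding th_def nome_minus 1 using eul_nonzero[OF q] by (simp add: 2 3) (simp add: field_simps)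
qed

lemma th_add_tau:
  assumes "Im \<tau> > 0"
  shows "th (z + \<tau>) \<tau> = - exp (- (of_real pi * \<i> * \<tau>)) / nome z * th z \<tau>"
proof -
  let ?q = "nome \<tau>"
  have q: "norm ?q < 1" using assms by (rule norm_nome_less_1)
  have 1: "qp (nome z) ?q = (1 - nome z) * qp (nome z * ?q) ?q" by (rule qp_step[OF q])
  have 2: "qp (1 / nome z) ?q = (1 - 1 / nome z) * qp (?q / nome z) ?q"
    using qp_step[OF q, of "1 / nome z"] by simp
  have 3: "exp (- (of_real pi * \<i> * (z + \<tau>))) = exp (- (of_real pi * \<i> * z)) * exp (- (of_real pi * \<i> * \<tau>))"
    by (simp add: algebra_simps exp_add [symmetric])
  have 4: "?q / nome (z + \<tau>) = 1 / nome z" by (simp add: nome_add)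
  show ?thesis
    unfolding th_def 4 1 2 3 using eul_nonzero[OF q] by (simp add: nome_add field_simps)
qed

lemma th_eq_0_iff:
  assumes "Im \<tau> > 0"
  shows "th z \<tau> = 0 \<longleftrightarrow> (\<exists>m n::int. z = of_int m * \<tau> + of_int n)"
proof
  let ?q = "nome \<tau>"
  have q: "norm ?q < 1" using assms by (rule norm_nome_less_1)
  have e: "eul ?q \<noteq> 0" by (rule eul_nonzero[OF q])
  { assume "th z \<tau> = 0"
    then have "qp (nome z) ?q = 0 \<or> qp (?q / nome z) ?q = 0" using e by (simp add: th_def)
    then obtain k where "nome z * ?q ^ k = 1 \<or> ?q / nome z * ?q ^ k = 1"
      using qp_eq_0_iff[OF q] by blast
    then have "nome (z + of_nat k * \<tau>) = 1 \<or> nome (of_nat (Suc k) * \<tau> - z) = 1"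
      unfolding nome_add nome_diff nome_of_nat_mult by auto
    then obtain n :: int where "z + of_nat k * \<tau> = of_int n \<or> of_nat (Suc k) * \<tau> - z = of_int n"
      unfolding nome_eq_1_iff by blast
    then have "z = of_int (- int k) * \<tau> + of_int n \<or> z = of_int (int (Suc k)) * \<tau> + of_int (- n)"
      by (auto simp: algebra_simps)
    then show "\<exists>m n::int. z = of_int m * \<tau> + of_int n" by blast }
  { assume "\<exists>m n::int. z = of_int m * \<tau> + of_int n"
    then obtain m n :: int where z: "z = of_int m * \<tau> + of_int n" by blast
    show "th z \<tau> = 0"
    proof (cases "m \<le> 0")
      case True
      then have "of_int m = - (of_nat (nat (- m)) :: complex)" by simp
      then have "z + of_nat (nat (- m)) * \<tau> = of_int n" by (simp add: z)
      then have "nome z * ?q ^ nat (- m) = 1"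
        by (metis nome_add nome_of_nat_mult nome_of_int)
      then have "qp (nome z) ?q = 0" using qp_eq_0_iff[OF q] by blast
      then show ?thesis by (simp add: th_def)
    next
      case False
      define k where "k = nat (m - 1)"
      have "(of_int m :: complex) = of_nat (Suc k)" using False by (simp add: k_def)
      then have "of_nat (Suc k) * \<tau> - z = of_int (- n)" by (simp add: z)
      then have "?q ^ Suc k / nome z = 1" by (metis nome_diff nome_of_nat_mult nome_of_int)
      then have "?q / nome z * ?q ^ k = 1" by simp
      then have "qp (?q / nome z) ?q = 0" using qp_eq_0_iff[OF q] by blast
      then show ?thesis by (simp add: th_def)
    qed }
qed

lemma qp_compose_holomorphic:
  assumes "norm q < 1" "f holomorphic_on S"
  shows "(\<lambda>z. qp (f z) q) holomorphic_on S"
  using holomorphic_on_compose[OF assms(2), of "\<lambda>a. qp a q"]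
    holomorphic_on_subset[OF qp_holomorphic[OF assms(1)], of "f ` S"] by (simp add: o_def)

lemma th_holomorphic:
  assumes "Im \<tau> > 0"
  shows "(\<lambda>z. th z \<tau>) holomorphic_on UNIV"
proof -
  have q: "norm (nome \<tau>) < 1" using assms by (rule norm_nome_less_1)
  have e: "eul (nome \<tau>) \<noteq> 0" by (rule eul_nonzero[OF q])
  show ?thesis unfolding th_def
    by (intro holomorphic_intros qp_compose_holomorphic[OF q]) (simp_all add: e)
qed

lemma th_deriv_0:
  assumes "Im \<tau> > 0"
  shows "((\<lambda>z. th z \<tau>) has_field_derivative 2 * of_real pi * \<i>) (at 0)"
proof -
  let ?q = "nome \<tau>"
  have q: "norm ?q < 1" using assms by (rule norm_nome_less_1)
  have e: "eul ?q \<noteq> 0" by (rule eul_nonzero[OF q])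
  \<comment> \<open>The simple zero \<open>1 - nome z\<close> is split off; the derivative at 0 is
    then that of this factor times \<open>h 0 = -1\<close>, and about \<open>h\<close> only
    differentiability has to be known.\<close>
  define h where "h = (\<lambda>z. - exp (- (of_real pi * \<i> * z)) * qp (nome z * ?q) ?q * qp (?q / nome z) ?q / eul ?q ^ 2)"
  have "h holomorphic_on UNIV" unfolding h_def
    by (intro holomorphic_intros qp_compose_holomorphic[OF q]) (simp_all add: e)
  then obtain d where d: "(h has_field_derivative d) (at 0)"
    by (metis UNIV_I field_differentiable_def holomorphic_on_imp_differentiable_at open_UNIV)
  have h0: "h 0 = -1" using e by (simp add: h_def eul_qp [symmetric] power2_eq_square)
  have "th z \<tau> = (1 - nome z) * h z" for z
    unfolding th_def h_def qp_step[OF q, of "nome z"] by simp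
  then have eq: "(\<lambda>z. th z \<tau>) = (\<lambda>z. (1 - nome z) * h z)" by auto
  have "((\<lambda>z. 1 - nome z) has_field_derivative (- (2 * of_real pi * \<i>))) (at 0)"
    unfolding nome_def by (auto intro!: derivative_eq_intros)
  from DERIV_mult[OF this d] show ?thesis unfolding eq by (simp add: h0)
qed

lemma th_lattice:
  assumes "Im \<tau> > 0"
  shows "th (z + (of_int m * \<tau> + of_int n)) \<tau> = 0 \<longleftrightarrow> th z \<tau> = 0"
proof -
  have *: "th (z + (of_int m * \<tau> + of_int n)) \<tau> = 0" if z: "th z \<tau> = 0" for z and m n :: int
  proof -
    obtain a b :: int where "z = of_int a * \<tau> + of_int b" using z th_eq_0_iff[OF assms] by blast
    then have "z + (of_int m * \<tau> + of_int n) = of_int (a + m) * \<tau> + of_int (b + n)"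
      by (simp add: algebra_simps)
    then show ?thesis using th_eq_0_iff[OF assms] by blast
  qed
  from *[of z m n] *[of "z + (of_int m * \<tau> + of_int n)" "-m" "-n"] show ?thesis
    by (auto simp: algebra_simps)
qed

lemma period_int:
  assumes "\<And>z::complex. f (z + p) = f z"
  shows "f (z + of_int n * p) = f z"
proof -
  have nat: "f (z + of_nat k * p) = f z" for z k
  proof (induction k)
    case (Suc k)
    have "z + of_nat (Suc k) * p = (z + of_nat k * p) + p" by (simp add: algebra_simps)
    then show ?case using assms Suc by metis
  qed simp
  show ?thesis
  proof (cases "n \<ge> 0")
    case True
    then show ?thesis using nat[of z "nat n"] by simp
  next
    case False
    then show ?thesis using nat[of "z + of_int n * p" "nat (-n)"] by (simp add: algebra_simps)
  qed
qed

text \<open>Both sides have the same factors of quasi-periodicity under z + 1 and z + \<tau>, so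
  their quotient is elliptic. Both vanish on the lattice and have the same derivative 2 pi i at 0,
  so the quotient extends to an entire function, and Liouville's theorem makes it constant, equal to
  1.\<close>

theorem th_S:
  assumes tau: "Im \<tau> > 0"
  shows "th (z / \<tau>) (- 1 / \<tau>) = exp (of_real pi * \<i> * z ^ 2 / \<tau>) / \<tau> * th z \<tau>"
proof -
  define \<sigma> where "\<sigma> = - 1 / \<tau>"
  have t0: "\<tau> \<noteq> 0" using tau by auto
  have sig: "Im \<sigma> > 0" using tau by (simp add: \<sigma>_def Im_divide divide_pos_pos sum_power2_gt_zero_iff)
  define N where "N = (\<lambda>z. \<tau> * exp (- (of_real pi * \<i> * z ^ 2 / \<tau>)) * th (z / \<tau>) \<sigma>)"
  \<comment> \<open>The value 1 at lattice points is the limit that the two derivatives at 0 give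
    below.\<close>
  define R where "R = (\<lambda>z. if th z \<tau> = 0 then 1 else N z / th z \<tau>)"
  have N1: "N (z + 1) = - N z" for z
  proof -
    have "th (z / \<tau>) \<sigma> = - exp (- (of_real pi * \<i> * \<sigma>)) / nome (z / \<tau> - \<sigma>) * th (z / \<tau> - \<sigma>) \<sigma>"
      using th_add_tau[OF sig, of "z / \<tau> - \<sigma>"] by simp
    then have "th (z / \<tau> - \<sigma>) \<sigma> = - exp (of_real pi * \<i> * \<sigma>) * nome (z / \<tau> - \<sigma>) * th (z / \<tau>) \<sigma>"
      by (simp add: exp_minus field_simps)
    moreover have "(z + 1) / \<tau> = z / \<tau> - \<sigma>" using t0 by (simp add: \<sigma>_def field_simps)
    moreover have "exp (- (of_real pi * \<i> * (z + 1) ^ 2 / \<tau>)) * (exp (of_real pi * \<i> * \<sigma>) * nome (z / \<tau> - \<sigma>)) = exp (- (of_real pi * \<i> * z ^ 2 / \<tau>))"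
      unfolding nome_def exp_add [symmetric] \<sigma>_def using t0
      by (intro arg_cong[of _ _ exp]) (simp add: field_simps power2_eq_square)
    ultimately have "N (z + 1) = \<tau> * exp (- (of_real pi * \<i> * (z + 1) ^ 2 / \<tau>)) *
        (- exp (of_real pi * \<i> * \<sigma>) * nome (z / \<tau> - \<sigma>) * th (z / \<tau>) \<sigma>)"
      and e: "exp (- (of_real pi * \<i> * (z + 1) ^ 2 / \<tau>)) * (exp (of_real pi * \<i> * \<sigma>) * nome (z / \<tau> - \<sigma>)) = exp (- (of_real pi * \<i> * z ^ 2 / \<tau>))"
      unfolding N_def by simp_all
    then have "N (z + 1) = - \<tau> * (exp (- (of_real pi * \<i> * (z + 1) ^ 2 / \<tau>)) * (exp (of_real pi * \<i> * \<sigma>) * nome (z / \<tau> - \<sigma>))) * th (z / \<tau>) \<sigma>"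
      by simp
    then show ?thesis unfolding e by (simp add: N_def)
  qed
  have Nt: "N (z + \<tau>) = - exp (- (of_real pi * \<i> * \<tau>)) / nome z * N z" for z
  proof -
    have "(z + \<tau>) / \<tau> = z / \<tau> + 1" using t0 by (simp add: field_simps)
    moreover have "exp (- (of_real pi * \<i> * (z + \<tau>) ^ 2 / \<tau>)) = exp (- (of_real pi * \<i> * z ^ 2 / \<tau>)) * (exp (- (of_real pi * \<i> * \<tau>)) * inverse (nome z))"
      unfolding nome_def exp_add [symmetric] exp_minus [symmetric] using t0
      by (intro arg_cong[of _ _ exp]) (simp add: field_simps power2_eq_square)
    ultimately show ?thesis unfolding N_def by (simp add: th_add_1 divide_inverse)
  qed
  have R1: "R (z + 1) = R z" for z
    using th_lattice[OF tau, of z 0 1] by (simp add: R_def N1 th_add_1)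
  have Rt: "R (z + \<tau>) = R z" for z
    using th_lattice[OF tau, of z 1 0] by (simp add: R_def Nt th_add_tau[OF tau])
  have Rl: "R (z + (of_int m * \<tau> + of_int n)) = R z" for z and m n :: int
  proof -
    have "R (z + (of_int m * \<tau> + of_int n)) = R ((z + of_int m * \<tau>) + of_int n * 1)" by (simp add: algebra_simps)
    also have "\<dots> = R (z + of_int m * \<tau>)" by (rule period_int) (rule R1)
    also have "\<dots> = R z" by (rule period_int) (rule Rt)
    finally show ?thesis .
  qed
  have th0: "th 0 \<tau> = 0" "th 0 \<sigma> = 0"
    using th_eq_0_iff[OF tau, of 0] th_eq_0_iff[OF sig, of 0] by (force intro!: exI[of _ 0])+
  have comp: "(\<lambda>z. th (z / \<tau>) \<sigma>) holomorphic_on UNIV"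
    using holomorphic_on_compose[of "\<lambda>z. z / \<tau>" UNIV "\<lambda>z. th z \<sigma>"] t0
      holomorphic_on_subset[OF th_holomorphic[OF sig], of "range (\<lambda>z. z / \<tau>)"]
    by (simp add: o_def holomorphic_intros)
  have holN: "N holomorphic_on UNIV" unfolding N_def using t0 by (intro holomorphic_intros comp) auto
  have holth: "(\<lambda>z. th z \<tau>) holomorphic_on UNIV" by (rule th_holomorphic[OF tau])
  have dN: "(N has_field_derivative 2 * of_real pi * \<i>) (at 0)"
  proof -
    have "((\<lambda>z. th (z / \<tau>) \<sigma>) has_field_derivative 2 * of_real pi * \<i> * (1 / \<tau>)) (at 0)"
      by (rule DERIV_chain2[where f = "\<lambda>z. th z \<sigma>" and g = "\<lambda>z. z / \<tau>"])
         (use th_deriv_0[OF sig] t0 in \<open>auto intro!: derivative_eq_intros\<close>)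
    moreover have "((\<lambda>z. \<tau> * exp (- (of_real pi * \<i> * z ^ 2 / \<tau>))) has_field_derivative 0) (at 0)"
      using t0 by (auto intro!: derivative_eq_intros)
    ultimately show ?thesis unfolding N_def
      using DERIV_mult[of "\<lambda>z. \<tau> * exp (- (of_real pi * \<i> * z ^ 2 / \<tau>))" 0 0 UNIV "\<lambda>z. th (z / \<tau>) \<sigma>" "2 * of_real pi * \<i> * (1 / \<tau>)"] t0
      by simp
  qed
  have limth: "((\<lambda>z. th z \<tau> / z) \<longlongrightarrow> 2 * of_real pi * \<i>) (at 0)"
    using th_deriv_0[OF tau] th0 by (simp add: has_field_derivative_iff)
  have limN: "((\<lambda>z. N z / z) \<longlongrightarrow> 2 * of_real pi * \<i>) (at 0)"
    using dN th0 by (simp add: has_field_derivative_iff N_def)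
  have "\<forall>\<^sub>F z in at 0. th z \<tau> / z \<noteq> 0" by (rule tendsto_imp_eventually_ne[OF limth]) simp
  then have evnz: "\<forall>\<^sub>F z in at 0. th z \<tau> \<noteq> 0" by eventually_elim auto
  have "((\<lambda>z. (N z / z) / (th z \<tau> / z)) \<longlongrightarrow> (2 * of_real pi * \<i>) / (2 * of_real pi * \<i>)) (at 0)"
    by (intro tendsto_divide limN limth) simp
  moreover have "\<forall>\<^sub>F z in at 0. (N z / z) / (th z \<tau> / z) = R z"
    using evnz eventually_neq_at_within[of 0] by eventually_elim (simp add: R_def)
  ultimately have lim0: "(R \<longlongrightarrow> 1) (at 0)"
    using Lim_transform_eventually by fastforce
  have contth: "continuous_on UNIV (\<lambda>z. th z \<tau>)" using holth holomorphic_on_imp_continuous_on by blast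
  define S where "S = {z. th z \<tau> \<noteq> 0}"
  have opS: "open S" unfolding S_def
    using contth by (intro open_Collect_neq continuous_intros)
  have holS: "R holomorphic_on S"
  proof (rule holomorphic_transform[of "\<lambda>z. N z / th z \<tau>"])
    show "(\<lambda>z. N z / th z \<tau>) holomorphic_on S"
      by (intro holomorphic_intros holomorphic_on_subset[OF holN] holomorphic_on_subset[OF holth]) (auto simp: S_def)
  qed (auto simp: S_def R_def)
  have diff: "R field_differentiable at z0" for z0
  proof (cases "th z0 \<tau> = 0")
    case False
    then show ?thesis using holomorphic_on_imp_differentiable_at[OF holS opS] by (auto simp: S_def)
  next
    case True
    then obtain m n :: int where z0: "z0 = of_int m * \<tau> + of_int n" using th_eq_0_iff[OF tau] by blast
    have "R (x - z0) = R x" for x using Rl[of x "-m" "-n"] by (simp add: z0 algebra_simps)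
    then have lz: "(R \<longlongrightarrow> 1) (at z0)" using LIM_offset[OF lim0, of "- z0"] by simp
    have "\<forall>\<^sub>F z in at z0. th z \<tau> \<noteq> 0"
      using evnz by (subst eventually_at_to_0) (simp add: z0 th_lattice[OF tau])
    then obtain r where r: "r > 0" "\<And>z. z \<noteq> z0 \<Longrightarrow> dist z z0 < r \<Longrightarrow> th z \<tau> \<noteq> 0"
      unfolding eventually_at by blast
    have "R holomorphic_on ball z0 r"
    proof (rule no_isolated_singularity'[of "{z0}"])
      show "(R \<longlongrightarrow> R z) (at z within ball z0 r)" if "z \<in> {z0}" for z
        using lz that True by (auto simp: R_def intro: tendsto_within_subset)
      show "R holomorphic_on ball z0 r - {z0}"
        by (rule holomorphic_on_subset[OF holS]) (use r in \<open>auto simp: S_def dist_commute\<close>)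
    qed auto
    then show ?thesis using r(1) holomorphic_on_imp_differentiable_at[of R "ball z0 r" z0] by auto
  qed
  then have holR: "R holomorphic_on UNIV"
    by (simp add: holomorphic_on_def field_differentiable_at_within)
  have "bounded (R ` cball 0 (norm \<tau> + 1))"
    using holR by (intro compact_imp_bounded compact_continuous_image holomorphic_on_imp_continuous_on)
      (auto intro: holomorphic_on_subset)
  \<comment> \<open>Each value is already taken in the fundamental parallelogram spanned by \<tau>
    and 1, which lies in this disc.\<close>
  moreover have "range R \<subseteq> R ` cball 0 (norm \<tau> + 1)"
  proof
    fix v assume "v \<in> range R"
    then obtain z where v: "v = R z" by blast
    define x where "x = Im z / Im \<tau>"
    define y where "y = Re z - x * Re \<tau>"
    have z: "z = of_real x * \<tau> + of_real y" using tau by (auto simp: x_def y_def complex_eq_iff)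
    define w where "w = of_real (frac x) * \<tau> + of_real (frac y)"
    have "z = w + (of_int \<lfloor>x\<rfloor> * \<tau> + of_int \<lfloor>y\<rfloor>)"
      unfolding z w_def frac_def by (simp add: algebra_simps)
    then have "v = R w" using Rl v by simp
    moreover have "norm w \<le> norm \<tau> + 1"
    proof -
      have "norm w \<le> norm (of_real (frac x) * \<tau>) + norm (of_real (frac y) :: complex)"
        unfolding w_def by (rule norm_triangle_ineq)
      also have "\<dots> = frac x * norm \<tau> + frac y" by (simp add: norm_mult)
      also have "\<dots> \<le> 1 * norm \<tau> + 1"
        by (intro add_mono mult_right_mono) (auto simp: less_imp_le frac_lt_1)
      finally show ?thesis by simp
    qed
    ultimately show "v \<in> R ` cball 0 (norm \<tau> + 1)" by auto
  qed
  ultimately have "bounded (range R)" using bounded_subset by blast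
  from Liouville_theorem[OF holR this] have "R z = R 0" for z by (auto simp: constant_on_def)
  then have R1': "R z = 1" for z by (simp add: R_def th0)
  have "N z = th z \<tau>"
  proof (cases "th z \<tau> = 0")
    case False
    then show ?thesis using R1'[of z] by (simp add: R_def)
  next
    case True
    then obtain m n :: int where "z = of_int m * \<tau> + of_int n" using th_eq_0_iff[OF tau] by blast
    then have "z / \<tau> = of_int (- n) * \<sigma> + of_int m" using t0 by (simp add: \<sigma>_def field_simps)
    then have "th (z / \<tau>) \<sigma> = 0" using th_eq_0_iff[OF sig] by blast
    then show ?thesis using True by (simp add: N_def)
  qed
  then show ?thesis using t0 unfolding N_def \<sigma>_def by (simp add: exp_minus field_simps)
qed

section \<open>Klein forms of level 7\<close>

text \<open>A Klein form of weight -1 up to a constant. The exponential prefactor is chosen so that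
  both generators act on the row vector (a, b) by right multiplication, without any further
  multiplier.\<close>

definition kl :: "complex \<Rightarrow> complex \<Rightarrow> complex \<Rightarrow> complex" where
  "kl a b \<tau> = exp (of_real pi * \<i> * a * (a * \<tau> + b)) * th (a * \<tau> + b) \<tau>"

lemma nome_add_1 [simp]: "nome (\<tau> + 1) = nome \<tau>"
  by (simp add: nome_add)

lemma th_tau_add_1: "th z (\<tau> + 1) = th z \<tau>"
  by (simp add: th_def)

lemma kl_T: "kl a b (\<tau> + 1) = kl a (a + b) \<tau>"
proof -
  have "a * (\<tau> + 1) + b = a * \<tau> + (a + b)" by (simp add: algebra_simps)
  then show ?thesis by (simp only: kl_def th_tau_add_1)
qed

lemma kl_S:
  assumes "Im \<tau> > 0"
  shows "kl a b (- 1 / \<tau>) = kl b (- a) \<tau> / \<tau>"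
proof -
  have t0: "\<tau> \<noteq> 0" using assms by auto
  define z where "z = b * \<tau> - a"
  have z: "a * (- 1 / \<tau>) + b = z / \<tau>" using t0 by (simp add: z_def field_simps)
  have e: "exp (of_real pi * \<i> * a * (z / \<tau>)) * exp (of_real pi * \<i> * z ^ 2 / \<tau>) = exp (of_real pi * \<i> * b * z)"
    unfolding exp_add [symmetric] using t0
    by (intro arg_cong[of _ _ exp]) (simp add: z_def field_simps power2_eq_square)
  have "kl a b (- 1 / \<tau>) = exp (of_real pi * \<i> * a * (z / \<tau>)) * (exp (of_real pi * \<i> * z ^ 2 / \<tau>) / \<tau> * th z \<tau>)"
    unfolding kl_def z by (simp only: th_S[OF assms])
  also have "\<dots> = (exp (of_real pi * \<i> * a * (z / \<tau>)) * exp (of_real pi * \<i> * z ^ 2 / \<tau>)) * th z \<tau> / \<tau>" by simp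
  finally show ?thesis unfolding e by (simp add: kl_def z_def)
qed

lemma kl_minus:
  assumes "Im \<tau> > 0"
  shows "kl (- a) (- b) \<tau> = - kl a b \<tau>"
proof -
  have 1: "- a * \<tau> + - b = - (a * \<tau> + b)" by simp
  have 2: "of_real pi * \<i> * - a * - (a * \<tau> + b) = of_real pi * \<i> * a * (a * \<tau> + b)"
    by (simp only: mult_minus_left mult_minus_right minus_minus)
  show ?thesis unfolding kl_def 1 2 th_minus[OF assms] by simp
qed

lemma kl_shift2: "kl a (b + of_nat n) \<tau> = (- exp (of_real pi * \<i> * a)) ^ n * kl a b \<tau>"
proof (induction n)
  case (Suc n)
  define z where "z = a * \<tau> + (b + of_nat n)"
  have 1: "a * \<tau> + (b + of_nat (Suc n)) = z + 1" by (simp add: z_def algebra_simps)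
  have 2: "exp (of_real pi * \<i> * a * (z + 1)) = exp (of_real pi * \<i> * a) * exp (of_real pi * \<i> * a * z)"
    unfolding exp_add [symmetric] by (simp add: algebra_simps)
  have "kl a (b + of_nat (Suc n)) \<tau> = - exp (of_real pi * \<i> * a) * kl a (b + of_nat n) \<tau>"
    unfolding kl_def 1 2 th_add_1 by (simp add: z_def)
  then show ?case by (simp only: Suc power_Suc mult.assoc)
qed simp

lemma kl_shift1:
  assumes "Im \<tau> > 0"
  shows "kl (a + of_nat n) b \<tau> = (- exp (- (of_real pi * \<i> * b))) ^ n * kl a b \<tau>"
proof (induction n)
  case (Suc n)
  define c where "c = a + of_nat n"
  define z where "z = c * \<tau> + b"
  have c: "a + of_nat (Suc n) = c + 1" by (simp add: c_def)
  have z: "(c + 1) * \<tau> + b = z + \<tau>" by (simp add: z_def algebra_simps)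
  have e: "exp (of_real pi * \<i> * (c + 1) * (z + \<tau>)) * (exp (- (of_real pi * \<i> * \<tau>)) / nome z) =
      exp (- (of_real pi * \<i> * b)) * exp (of_real pi * \<i> * c * z)"
    unfolding nome_def exp_add [symmetric] exp_diff [symmetric]
    by (intro arg_cong[of _ _ exp]) (simp add: z_def algebra_simps)
  have "kl (c + 1) b \<tau> = - (exp (of_real pi * \<i> * (c + 1) * (z + \<tau>)) * (exp (- (of_real pi * \<i> * \<tau>)) / nome z)) * th z \<tau>"
    unfolding kl_def z th_add_tau[OF assms] by simp
  also have "\<dots> = - exp (- (of_real pi * \<i> * b)) * kl c b \<tau>"
    unfolding e by (simp add: kl_def z_def)
  finally show ?case unfolding c by (simp only: c_def Suc power_Suc mult.assoc)
qed simp

text \<open>The multiples 1, 2, 3 represent the units mod 7 up to sign. Since 1 + 4 + 9 = 14 is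
  twice 7, the roots of unity that integral shifts produce cancel, so this product of weight -3
  depends on (v, w) mod 7 only.\<close>

definition a7 :: "int \<Rightarrow> int \<Rightarrow> complex \<Rightarrow> complex" where
  "a7 v w \<tau> = kl (of_int v / 7) (of_int w / 7) \<tau> * kl (2 * of_int v / 7) (2 * of_int w / 7) \<tau> *
     kl (3 * of_int v / 7) (3 * of_int w / 7) \<tau>"

lemma a7_T: "a7 v w (\<tau> + 1) = a7 v (v + w) \<tau>"
  by (simp add: a7_def kl_T add_divide_distrib ring_distribs)

lemma a7_S:
  assumes "Im \<tau> > 0"
  shows "a7 v w (- 1 / \<tau>) = a7 w (- v) \<tau> / \<tau> ^ 3"
  unfolding a7_def kl_S[OF assms] by (simp add: power3_eq_cube)

lemma a7_minus:
  assumes "Im \<tau> > 0"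
  shows "a7 (- v) (- w) \<tau> = - a7 v w \<tau>"
proof -
  have "of_int (- v) / 7 = - (of_int v / 7 :: complex)" "2 * of_int (- v) / 7 = - (2 * of_int v / 7 :: complex)"
    "3 * of_int (- v) / 7 = - (3 * of_int v / 7 :: complex)" for v by auto
  then show ?thesis unfolding a7_def by (simp only: kl_minus[OF assms]) simp
qed

lemma exp_pi_int_even: "exp (of_real pi * \<i> * (2 * of_int n)) = 1"
  using nome_of_int[of n] by (simp add: nome_def algebra_simps)

lemma a7_shift2: "a7 v (w + 7) \<tau> = a7 v w \<tau>"
proof -
  have s: "of_int (w + 7) / 7 = (of_int w / 7 :: complex) + of_nat 1"
    "2 * of_int (w + 7) / 7 = (2 * of_int w / 7 :: complex) + of_nat 2"
    "3 * of_int (w + 7) / 7 = (3 * of_int w / 7 :: complex) + of_nat 3" by (auto simp: field_simps)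
  have e: "exp (of_real pi * \<i> * (of_int v / 7)) ^ 1 * exp (of_real pi * \<i> * (2 * of_int v / 7)) ^ 2 * exp (of_real pi * \<i> * (3 * of_int v / 7)) ^ 3
     = exp (of_real pi * \<i> * (2 * of_int v))"
    unfolding exp_of_nat_mult [symmetric] exp_add [symmetric]
    by (intro arg_cong[of _ _ exp]) (simp add: field_simps)
  show ?thesis unfolding a7_def s kl_shift2 using e exp_pi_int_even[of v]
    by (simp add: power2_eq_square power3_eq_cube algebra_simps)
qed

lemma a7_shift1:
  assumes "Im \<tau> > 0"
  shows "a7 (v + 7) w \<tau> = a7 v w \<tau>"
proof -
  have s: "of_int (v + 7) / 7 = (of_int v / 7 :: complex) + of_nat 1"
    "2 * of_int (v + 7) / 7 = (2 * of_int v / 7 :: complex) + of_nat 2"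
    "3 * of_int (v + 7) / 7 = (3 * of_int v / 7 :: complex) + of_nat 3" by (auto simp: field_simps)
  have e: "exp (- (of_real pi * \<i> * (of_int w / 7))) ^ 1 * exp (- (of_real pi * \<i> * (2 * of_int w / 7))) ^ 2 * exp (- (of_real pi * \<i> * (3 * of_int w / 7))) ^ 3
     = exp (of_real pi * \<i> * (2 * of_int (- w)))"
    unfolding exp_of_nat_mult [symmetric] exp_add [symmetric]
    by (intro arg_cong[of _ _ exp]) (simp add: field_simps)
  show ?thesis unfolding a7_def s kl_shift1[OF assms] using e exp_pi_int_even[of "- w"]
    by (simp add: power2_eq_square power3_eq_cube algebra_simps)
qed

lemma int_period_mod:
  fixes f :: "int \<Rightarrow> 'a"
  assumes "\<And>v. f (v + 7) = f v"
  shows "f (v mod 7) = f v"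
proof -
  have *: "f (v + 7 * int k) = f v" for v k
  proof (induction k)
    case (Suc k)
    then show ?case using assms[of "v + 7 * int k"] by (simp add: algebra_simps)
  qed simp
  show ?thesis
  proof (cases "v div 7 \<ge> 0")
    case True
    then show ?thesis using *[of "v mod 7" "nat (v div 7)"] by (simp add: algebra_simps)
  next
    case False
    then show ?thesis using *[of v "nat (- (v div 7))"] by (simp add: algebra_simps minus_mult_div_eq_mod [symmetric])
  qed
qed

lemma a7_cong:
  assumes "Im \<tau> > 0" "v mod 7 = v' mod 7" "w mod 7 = w' mod 7"
  shows "a7 v w \<tau> = a7 v' w' \<tau>"
proof -
  have "a7 v w \<tau> = a7 (v mod 7) (w mod 7) \<tau>" for v w
    using int_period_mod[of "\<lambda>v. a7 v w \<tau>" v] int_period_mod[of "\<lambda>w. a7 (v mod 7) w \<tau>" w]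
      a7_shift1[OF assms(1)] a7_shift2 by simp
  then show ?thesis using assms by metis
qed

text \<open>Doubling takes the multiples 1, 2, 3 to 2, 4, 6, that is to 2, -3, -1 mod 7, and the two
  sign changes cancel. Thus \<open>a7\<close> sees an index only up to the squares 1, 2, 4 mod
  7.\<close>

lemma a7_double:
  assumes "Im \<tau> > 0"
  shows "a7 (2 * v) (2 * w) \<tau> = a7 v w \<tau>"
proof -
  \<comment> \<open>Natural representatives suffice by \<open>a7_cong\<close>, and for them the
    shift laws have natural exponents.\<close>
  have *: "a7 (2 * int m) (2 * int n) \<tau> = a7 (int m) (int n) \<tau>" for m n
  proof -
    let ?a = "of_nat m :: complex" and ?b = "of_nat n :: complex"
    have sh: "kl (a + of_nat m) (b + of_nat n) \<tau> =
       (- exp (- (of_real pi * \<i> * (b + of_nat n)))) ^ m * ((- exp (of_real pi * \<i> * a)) ^ n * kl a b \<tau>)" for a b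
      unfolding kl_shift1[OF assms, of a m] kl_shift2[of a b] by (rule refl)
    have neg_powers: "(- X) ^ m * (- Y) ^ n = (-1) ^ (m + n) * (X ^ m * Y ^ n)" for X Y :: complex
      by (simp add: power_add power_minus[of X] power_minus[of Y])
    have fac: "(- exp (- (of_real pi * \<i> * (- (c * ?b / 7) + of_nat n)))) ^ m * (- exp (of_real pi * \<i> * (- (c * ?a / 7)))) ^ n
        = (-1) ^ (m + n) * exp (- (of_real pi * \<i> * (?a * ?b)))" for c
    proof -
      have "(- exp (- (of_real pi * \<i> * (- (c * ?b / 7) + of_nat n)))) ^ m * (- exp (of_real pi * \<i> * (- (c * ?a / 7)))) ^ n
         = (-1) ^ (m + n) * (exp (- (of_real pi * \<i> * (- (c * ?b / 7) + of_nat n))) ^ m * exp (of_real pi * \<i> * (- (c * ?a / 7))) ^ n)"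
        by (rule neg_powers)
      also have "exp (- (of_real pi * \<i> * (- (c * ?b / 7) + of_nat n))) ^ m * exp (of_real pi * \<i> * (- (c * ?a / 7))) ^ n = exp (- (of_real pi * \<i> * (?a * ?b)))"
        unfolding exp_of_nat_mult [symmetric] exp_add [symmetric]
        by (intro arg_cong[of _ _ exp]) (simp add: field_simps)
      finally show ?thesis .
    qed
    \<comment> \<open>The factor that arises from writing 4 m / 7 = m - 3 m / 7 and 6 m / 7 = m - m
      / 7, likewise for \<open>n\<close>. By \<open>fac\<close> it is the same for both multiples,
      and its square is 1.\<close>
    define s where "s = (-1) ^ (m + n) * exp (- (of_real pi * \<i> * (?a * ?b)))"
    have s2: "s * s = 1"
    proof -
      have "s * s = ((-1) ^ (m + n)) ^ 2 * (exp (- (of_real pi * \<i> * (?a * ?b))) * exp (- (of_real pi * \<i> * (?a * ?b))))"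
        by (simp add: s_def power2_eq_square)
      also have "exp (- (of_real pi * \<i> * (?a * ?b))) * exp (- (of_real pi * \<i> * (?a * ?b))) = exp (of_real pi * \<i> * (2 * of_int (- (int m * int n))))"
        unfolding exp_add [symmetric] by (intro arg_cong[of _ _ exp]) simp
      also have "\<dots> = 1" by (rule exp_pi_int_even)
      finally show ?thesis by (simp add: power_mult [symmetric])
    qed
    have k4: "kl (4 * ?a / 7) (4 * ?b / 7) \<tau> = - s * kl (3 * ?a / 7) (3 * ?b / 7) \<tau>"
    proof -
      have "kl (4 * ?a / 7) (4 * ?b / 7) \<tau> = kl (- (3 * ?a / 7) + of_nat m) (- (3 * ?b / 7) + of_nat n) \<tau>"
        by (intro arg_cong2[of _ _ _ _ "\<lambda>x y. kl x y \<tau>"]) (auto simp: field_simps)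
      also have "\<dots> = s * kl (- (3 * ?a / 7)) (- (3 * ?b / 7)) \<tau>"
        unfolding sh s_def fac[of 3, symmetric] by simp
      finally show ?thesis by (simp only: kl_minus[OF assms]) simp
    qed
    have k6: "kl (6 * ?a / 7) (6 * ?b / 7) \<tau> = - s * kl (?a / 7) (?b / 7) \<tau>"
    proof -
      have "kl (6 * ?a / 7) (6 * ?b / 7) \<tau> = kl (- (1 * ?a / 7) + of_nat m) (- (1 * ?b / 7) + of_nat n) \<tau>"
        by (intro arg_cong2[of _ _ _ _ "\<lambda>x y. kl x y \<tau>"]) (auto simp: field_simps)
      also have "\<dots> = s * kl (- (1 * ?a / 7)) (- (1 * ?b / 7)) \<tau>"
        unfolding sh s_def fac[of 1, symmetric] by simp
      finally show ?thesis by (simp only: kl_minus[OF assms]) simp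
    qed
    have "a7 (2 * int m) (2 * int n) \<tau> = kl (2 * ?a / 7) (2 * ?b / 7) \<tau> * kl (4 * ?a / 7) (4 * ?b / 7) \<tau> * kl (6 * ?a / 7) (6 * ?b / 7) \<tau>"
      by (simp add: a7_def)
    also have "\<dots> = (s * s) * a7 (int m) (int n) \<tau>" unfolding k4 k6 by (simp add: a7_def)
    finally show ?thesis by (simp add: s2)
  qed
  have "a7 (2 * v) (2 * w) \<tau> = a7 (2 * int (nat (v mod 7))) (2 * int (nat (w mod 7))) \<tau>"
    by (rule a7_cong[OF assms]) (auto simp: mod_mult_right_eq)
  also have "\<dots> = a7 (int (nat (v mod 7))) (int (nat (w mod 7))) \<tau>" by (rule *)
  also have "\<dots> = a7 v w \<tau>" by (rule a7_cong[OF assms]) auto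
  finally show ?thesis .
qed

lemma prod7: "(\<Prod>r<(7::nat). f r) = f 0 * f 1 * f 2 * f 3 * f 4 * f 5 * (f 6 :: complex)"
  by (simp add: eval_nat_numeral)

section \<open>Seventh roots of unity and the product forms of \<open>a7\<close>\<close>

definition z7 :: complex where "z7 = nome (1 / 7)"

lemma z7_pow: "z7 ^ 7 = 1"
  unfolding z7_def nome_of_nat_mult [symmetric] by simp

lemma z7_nonzero: "z7 \<noteq> 0"
  by (simp add: z7_def)

lemma z7_ne_1: "z7 \<noteq> 1"
proof
  assume "z7 = 1"
  then obtain n :: int where "1 / 7 = (of_int n :: complex)" unfolding z7_def nome_eq_1_iff by blast
  then have "(of_int (7 * n) :: complex) = of_int 1" by (simp add: field_simps)
  then have "7 * n = 1" unfolding of_int_eq_iff .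
  then show False by presburger
qed

lemma z7_sum: "1 + z7 + z7 ^ 2 + z7 ^ 3 + z7 ^ 4 + z7 ^ 5 + z7 ^ 6 = 0"
proof -
  have "(z7 - 1) * (1 + z7 + z7 ^ 2 + z7 ^ 3 + z7 ^ 4 + z7 ^ 5 + z7 ^ 6) = z7 ^ 7 - 1"
    by (simp add: algebra_simps eval_nat_numeral)
  then show ?thesis using z7_pow z7_ne_1 by simp
qed

text \<open>The three real periods are the roots of x^3 + x^2 - 2 x - 1. Their elementary symmetric
  functions are all that the factorization of 1 - y^7 and the value of \<open>c7\<close>
  require.\<close>

lemma z7_periods:
  defines "a \<equiv> z7 + z7 ^ 6" and "b \<equiv> z7 ^ 2 + z7 ^ 5" and "c \<equiv> z7 ^ 3 + z7 ^ 4"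
  shows "a + b + c = -1" "a * b + b * c + c * a = -2" "a * b * c = 1"
proof -
  have p: "z7 ^ 7 = 1" "z7 ^ 8 = z7" "z7 ^ 9 = z7 ^ 2" "z7 ^ 10 = z7 ^ 3" "z7 ^ 11 = z7 ^ 4" "z7 ^ 12 = z7 ^ 5"
    "z7 ^ 13 = z7 ^ 6" "z7 ^ 14 = 1" "z7 ^ 15 = z7"
    using z7_pow power_add[of z7 7 1] power_add[of z7 7 2] power_add[of z7 7 3] power_add[of z7 7 4]
      power_add[of z7 7 5] power_add[of z7 7 6] power_add[of z7 7 7] power_add[of z7 14 1]  by auto
  show 1: "a + b + c = -1" using z7_sum unfolding a_def b_def c_def by (simp add: algebra_simps add_eq_0_iff)
  have ab: "a * b = a + c" "b * c = a + b" "c * a = b + c"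
    unfolding a_def b_def c_def by (simp_all add: ring_distribs power_add [symmetric] power_Suc [symmetric] power_Suc2 [symmetric] p del: power_Suc)
  show "a * b + b * c + c * a = -2" unfolding ab using 1 by (simp add: algebra_simps)
  have cc: "c * c = a + 2"
    unfolding a_def c_def by (simp add: ring_distribs power_add [symmetric] p)
  have "a * b * c = (a + c) * c" by (simp add: ab)
  also have "\<dots> = c * a + c * c" by (simp add: algebra_simps)
  also have "\<dots> = (a + b + c) + 2" unfolding ab(3) cc by simp
  finally show "a * b * c = 1" using 1 by simp
qed

lemma z7_factor: "(\<Prod>r<7. 1 - z7 ^ r * y) = 1 - y ^ 7"
proof -
  define a b c where "a = z7 + z7 ^ 6" and "b = z7 ^ 2 + z7 ^ 5" and "c = z7 ^ 3 + z7 ^ 4"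
  have s: "a + b + c = -1" "a * b + b * c + c * a = -2" "a * b * c = 1"
    using z7_periods unfolding a_def b_def c_def by simp_all
  have f: "(1 - z7 * y) * (1 - z7 ^ 6 * y) = 1 - a * y + y ^ 2"
    "(1 - z7 ^ 2 * y) * (1 - z7 ^ 5 * y) = 1 - b * y + y ^ 2"
    "(1 - z7 ^ 3 * y) * (1 - z7 ^ 4 * y) = 1 - c * y + y ^ 2"
  proof -
    have p: "z7 * z7 ^ 6 = 1" "z7 ^ 2 * z7 ^ 5 = 1" "z7 ^ 3 * z7 ^ 4 = 1"
      using z7_pow by (simp_all add: power_add [symmetric] power_Suc [symmetric] del: power_Suc)
    have "(1 - u * y) * (1 - v * y) = 1 - (u + v) * y + (u * v) * y ^ 2" for u v :: complex
      by (simp add: algebra_simps power2_eq_square)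
    then show "(1 - z7 * y) * (1 - z7 ^ 6 * y) = 1 - a * y + y ^ 2"
      "(1 - z7 ^ 2 * y) * (1 - z7 ^ 5 * y) = 1 - b * y + y ^ 2"
      "(1 - z7 ^ 3 * y) * (1 - z7 ^ 4 * y) = 1 - c * y + y ^ 2"
      unfolding a_def b_def c_def by (simp_all only: p mult_1)
  qed
  have "(\<Prod>r<7. 1 - z7 ^ r * y) = (1 - y) * (((1 - z7 * y) * (1 - z7 ^ 6 * y)) * ((1 - z7 ^ 2 * y) * (1 - z7 ^ 5 * y)) * ((1 - z7 ^ 3 * y) * (1 - z7 ^ 4 * y)))"
    unfolding prod7 by simp
  also have "\<dots> = (1 - y) * ((1 - a * y + y ^ 2) * (1 - b * y + y ^ 2) * (1 - c * y + y ^ 2))" unfolding f ..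
  also have "\<dots> = 1 - y ^ 7" using s by algebra
  finally show ?thesis .
qed

lemma eul_z7:
  assumes "norm q < 1"
  shows "(\<Prod>r<7. qp (z7 ^ r * q) q) = eul (q ^ 7)"
  using qp_roots[OF assms, where k = 7 and J = "{..<7}" and w = "\<lambda>r. z7 ^ r" and c = 1 and a = q] z7_factor by (simp add: eul_qp)

definition c7 :: complex where
  "c7 = - (exp (- (of_real pi * \<i> * (1 / 7))) * (1 - z7) * (exp (- (of_real pi * \<i> * (2 / 7))) * (1 - z7 ^ 2)) *
     (exp (- (of_real pi * \<i> * (3 / 7))) * (1 - z7 ^ 3)))"

text \<open>The squares of the three factors are a - 2, b - 2, c - 2 for the real periods a, b, c.
  Their product is -7, the negative of the value at 2 of the cubic of the periods.\<close>

lemma c7_pow4: "c7 ^ 4 = 49"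
proof -
  define a b c where "a = z7 + z7 ^ 6" and "b = z7 ^ 2 + z7 ^ 5" and "c = z7 ^ 3 + z7 ^ 4"
  have s: "a + b + c = -1" "a * b + b * c + c * a = -2" "a * b * c = 1"
    using z7_periods unfolding a_def b_def c_def by simp_all
  have h: "(exp (- (of_real pi * \<i> * (of_nat k / 7))) * (1 - z7 ^ k)) ^ 2 = (z7 ^ k + z7 ^ (7 - k)) - 2" if "k \<le> 7" for k
  proof -
    have "exp (- (of_real pi * \<i> * (of_nat k / 7))) ^ 2 * z7 ^ k = 1"
      unfolding z7_def nome_of_nat_mult [symmetric] nome_def exp_of_nat_mult [symmetric] exp_add [symmetric]
      by (simp add: field_simps)
    moreover have "z7 ^ (7 - k) * z7 ^ k = 1" using that z7_pow by (simp add: power_add [symmetric])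
    ultimately have e: "exp (- (of_real pi * \<i> * (of_nat k / 7))) ^ 2 = z7 ^ (7 - k)"
      by (metis mult_cancel_right power_not_zero z7_nonzero)
    have "(exp (- (of_real pi * \<i> * (of_nat k / 7))) * (1 - z7 ^ k)) ^ 2 = z7 ^ (7 - k) * (1 - z7 ^ k) ^ 2"
      by (simp only: power_mult_distrib e)
    also have "\<dots> = z7 ^ (7 - k) - 2 * (z7 ^ (7 - k) * z7 ^ k) + (z7 ^ (7 - k) * z7 ^ k) * z7 ^ k"
      by (simp add: power2_eq_square algebra_simps)
    finally show ?thesis using \<open>z7 ^ (7 - k) * z7 ^ k = 1\<close> by simp
  qed
  have "c7 ^ 2 = (a - 2) * (b - 2) * (c - 2)"
    using h[of 1] h[of 2] h[of 3] unfolding c7_def a_def b_def c_def by (simp add: power_mult_distrib)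
  also have "\<dots> = -7" using s by algebra
  finally have "c7 ^ 2 = -7" .
  then have "(c7 ^ 2) ^ 2 = 49" by simp
  then show ?thesis by (simp add: power_mult [symmetric])
qed

lemma c7_nonzero: "c7 \<noteq> 0"
  using c7_pow4 by auto

text \<open>The nomes of the three points and of their negatives are the six nontrivial seventh
  roots of unity; with the missing factor \<open>eul\<close> their products combine to
  \<open>eul\<close> at q^7.\<close>

lemma a7_0_1:
  assumes "Im \<tau> > 0"
  shows "a7 0 1 \<tau> = c7 * eul (nome \<tau> ^ 7) / eul (nome \<tau>) ^ 7"
proof -
  let ?q = "nome \<tau>"
  have q: "norm ?q < 1" using assms by (rule norm_nome_less_1)
  have e: "eul ?q \<noteq> 0" by (rule eul_nonzero[OF q])
  have th: "th (of_nat k / 7) \<tau> = - (exp (- (of_real pi * \<i> * (of_nat k / 7))) * (1 - z7 ^ k)) *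
      (qp (z7 ^ k * ?q) ?q * qp (z7 ^ (7 - k) * ?q) ?q) / eul ?q ^ 2" if "k \<le> 7" for k
  proof -
    have n: "nome (of_nat k / 7) = z7 ^ k"
      using nome_of_nat_mult[of k "1 / 7"] by (simp add: z7_def)
    have "z7 ^ k * z7 ^ (7 - k) = 1" using that z7_pow by (simp add: power_add [symmetric])
    then have "?q / z7 ^ k = z7 ^ (7 - k) * ?q" using z7_nonzero by (simp add: field_simps)
    then show ?thesis unfolding th_def n qp_step[OF q, of "z7 ^ k"] by simp
  qed
  have P: "eul ?q * (qp (z7 * ?q) ?q * qp (z7 ^ 2 * ?q) ?q * qp (z7 ^ 3 * ?q) ?q * qp (z7 ^ 4 * ?q) ?q * qp (z7 ^ 5 * ?q) ?q * qp (z7 ^ 6 * ?q) ?q) = eul (?q ^ 7)"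
    using eul_z7[OF q] unfolding prod7 by (simp add: eul_qp mult.assoc)
  have "a7 0 1 \<tau> = th (of_nat 1 / 7) \<tau> * th (of_nat 2 / 7) \<tau> * th (of_nat 3 / 7) \<tau>"
    by (simp add: a7_def kl_def)
  also have "\<dots> = c7 * (qp (z7 * ?q) ?q * qp (z7 ^ 2 * ?q) ?q * qp (z7 ^ 3 * ?q) ?q * qp (z7 ^ 4 * ?q) ?q * qp (z7 ^ 5 * ?q) ?q * qp (z7 ^ 6 * ?q) ?q) / eul ?q ^ 6"
    using th[of 1] th[of 2] th[of 3] by (simp add: c7_def eval_nat_numeral mult_ac)
  also have "\<dots> = c7 * eul (?q ^ 7) / eul ?q ^ 7"
    unfolding P [symmetric] using e by (simp add: eval_nat_numeral)
  finally show ?thesis .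
qed

text \<open>The nomes of the points are powers of x, a seventh root of q, so their products run
  through all residues of the exponent mod 7 and combine to \<open>eul x\<close>. The exponent -2 is
  the sum of (k^2/7 - k)/2 over k = 1, 2, 3.\<close>

lemma a7_1:
  fixes \<mu> :: int
  assumes "Im \<tau> > 0"
  defines "x \<equiv> nome ((\<tau> + of_int \<mu>) / 7)"
  shows "a7 1 \<mu> \<tau> = - eul x / (x ^ 2 * eul (nome \<tau>) ^ 7)"
proof -
  define y where "y = (\<tau> + of_int \<mu>) / 7"
  have x: "x = nome y" by (simp add: x_def y_def)
  have nx: "norm x < 1" unfolding x using assms by (intro norm_nome_less_1) (simp add: y_def)
  have x0: "x \<noteq> 0" by (simp add: x)
  have q: "nome \<tau> = x ^ 7"
  proof -
    have "of_nat 7 * y = \<tau> + of_int \<mu>" by (simp add: y_def)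
    then show ?thesis unfolding x nome_of_nat_mult [symmetric] by (simp add: nome_add)
  qed
  have nq: "norm (x ^ 7) < 1" using norm_nome_less_1[OF assms(1)] q by simp
  have e: "eul (x ^ 7) \<noteq> 0" by (rule eul_nonzero[OF nq])
  have kk: "kl (of_nat k / 7) (of_nat k * of_int \<mu> / 7) \<tau> = - exp (of_real pi * \<i> * ((of_nat k ^ 2 / 7 - of_nat k) * y)) *
      (qp (x ^ k) (x ^ 7) * qp (x ^ (7 - k)) (x ^ 7)) / eul (x ^ 7) ^ 2" if "k \<le> 7" for k
  proof -
    have 1: "of_nat k / 7 * \<tau> + of_nat k * of_int \<mu> / 7 = of_nat k * y" by (simp add: y_def field_simps)
    have 2: "x ^ 7 / x ^ k = x ^ (7 - k)" using that x0 by (simp add: power_diff)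
    have 3: "exp (of_real pi * \<i> * (of_nat k / 7) * (of_nat k * y)) * - exp (- (of_real pi * \<i> * (of_nat k * y))) =
        - exp (of_real pi * \<i> * ((of_nat k ^ 2 / 7 - of_nat k) * y))"
      by (simp add: exp_add [symmetric] power2_eq_square algebra_simps)
    show ?thesis unfolding kl_def th_def 1 nome_of_nat_mult x [symmetric] q 2 3 [symmetric] by simp
  qed
  have E: "exp (of_real pi * \<i> * ((of_nat 1 ^ 2 / 7 - of_nat 1) * y)) * exp (of_real pi * \<i> * ((of_nat 2 ^ 2 / 7 - of_nat 2) * y)) *
     exp (of_real pi * \<i> * ((of_nat 3 ^ 2 / 7 - of_nat 3) * y)) = inverse (x ^ 2)"
    unfolding x nome_of_nat_mult [symmetric] unfolding nome_def exp_minus [symmetric] exp_add [symmetric]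
    by (intro arg_cong[of _ _ exp]) (simp add: field_simps)
  have P: "(qp x (x ^ 7) * qp (x ^ 2) (x ^ 7) * qp (x ^ 3) (x ^ 7) * qp (x ^ 4) (x ^ 7) * qp (x ^ 5) (x ^ 7) * qp (x ^ 6) (x ^ 7)) * eul (x ^ 7) = eul x"
  proof -
    have "x * x ^ 0 = x" "x * x ^ 1 = x ^ 2" "x * x ^ 2 = x ^ 3" "x * x ^ 3 = x ^ 4" "x * x ^ 4 = x ^ 5"
      "x * x ^ 5 = x ^ 6" "x * x ^ 6 = x ^ 7" by (simp_all add: eval_nat_numeral)
    then show ?thesis using qp_dissect[OF nx, of 7 x] unfolding prod7 eul_qp by simp
  qed
  have "a7 1 \<mu> \<tau> = kl (of_nat 1 / 7) (of_nat 1 * of_int \<mu> / 7) \<tau> * kl (of_nat 2 / 7) (of_nat 2 * of_int \<mu> / 7) \<tau> * kl (of_nat 3 / 7) (of_nat 3 * of_int \<mu> / 7) \<tau>"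
    by (simp add: a7_def)
  also have "\<dots> = - (exp (of_real pi * \<i> * ((of_nat 1 ^ 2 / 7 - of_nat 1) * y)) * exp (of_real pi * \<i> * ((of_nat 2 ^ 2 / 7 - of_nat 2) * y)) *
     exp (of_real pi * \<i> * ((of_nat 3 ^ 2 / 7 - of_nat 3) * y))) * (qp x (x ^ 7) * qp (x ^ 2) (x ^ 7) * qp (x ^ 3) (x ^ 7) * qp (x ^ 4) (x ^ 7) * qp (x ^ 5) (x ^ 7) * qp (x ^ 6) (x ^ 7)) / eul (x ^ 7) ^ 6"
    using e by (subst kk, simp, subst kk, simp, subst kk, simp) (simp add: field_simps eval_nat_numeral)
  also have "\<dots> = - inverse (x ^ 2) * ((qp x (x ^ 7) * qp (x ^ 2) (x ^ 7) * qp (x ^ 3) (x ^ 7) * qp (x ^ 4) (x ^ 7) * qp (x ^ 5) (x ^ 7) * qp (x ^ 6) (x ^ 7)) * eul (x ^ 7)) / eul (x ^ 7) ^ 7"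
    unfolding E using e by (simp add: eval_nat_numeral)
  also have "\<dots> = - eul x / (x ^ 2 * eul (nome \<tau>) ^ 7)"
    unfolding P q by (simp add: divide_inverse)
  finally show ?thesis .
qed

section \<open>The discriminant and level 2\<close>

definition dl :: "complex \<Rightarrow> complex" where
  "dl \<tau> = nome \<tau> * eul (nome \<tau>) ^ 24"

lemma dl_nonzero: "Im \<tau> > 0 \<Longrightarrow> dl \<tau> \<noteq> 0"
  by (simp add: dl_def eul_nonzero norm_nome_less_1)

lemma dl_T: "dl (\<tau> + 1) = dl \<tau>"
  by (simp add: dl_def)

text \<open>The indices are the nonzero points of order 2. The generators permute them up to fourth
  roots of unity, which the fourth powers remove; the result has weight -12, and its law under
  -1/\<tau> is passed on to \<open>dl\<close>.\<close>

definition k2 :: "complex \<Rightarrow> complex" where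
  "k2 \<tau> = kl 0 (1/2) \<tau> ^ 4 * kl (1/2) 0 \<tau> ^ 4 * kl (1/2) (1/2) \<tau> ^ 4"

lemma dl_k2:
  assumes "Im \<tau> > 0"
  shows "dl \<tau> * k2 \<tau> = -16"
proof -
  define y where "y = nome (\<tau> / 2)"
  let ?q = "nome \<tau>"
  have y2: "?q = y ^ 2" unfolding y_def nome_of_nat_mult [symmetric] by simp
  have ny: "norm y < 1" unfolding y_def using assms by (intro norm_nome_less_1) simp
  have y0: "y \<noteq> 0" by (simp add: y_def)
  have q: "norm ?q < 1" using assms by (rule norm_nome_less_1)
  have q2: "norm (?q ^ 2) < 1" using norm_nome_power_less_1[OF assms, of 2] by simp
  have e: "eul ?q \<noteq> 0" by (rule eul_nonzero[OF q])
  have nh: "nome (1 / 2) = -1" by (simp add: nome_def)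
  have two: "(\<Prod>r<(2::nat). f r) = f 0 * (f 1 :: complex)" for f by (simp add: eval_nat_numeral)
  have sq: "qp a r * qp (- a) r = qp (a ^ 2) (r ^ 2)" if "norm r < 1" for a r
    using qp_roots[OF that, where k = 2 and J = "{..<2}" and w = "\<lambda>j. (-1) ^ j" and c = 1 and a = a]
    by (simp add: two power2_eq_square algebra_simps)
  \<comment> \<open>Euler's identity: (-q; q) times (q; q^2) is 1, the second factor being split at
    the square root \<open>y\<close> of q.\<close>
  have B: "qp (- ?q) ?q * (qp y ?q * qp (- y) ?q) = 1"
  proof -
    have 1: "qp y ?q * qp (- y) ?q = qp ?q (?q ^ 2)" using sq[OF q, of y] by (simp add: y2)
    have 2: "eul ?q = qp ?q (?q ^ 2) * qp (?q ^ 2) (?q ^ 2)"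
      using qp_dissect[OF q, of 2 ?q] unfolding two by (simp add: eul_qp power2_eq_square)
    have 3: "eul ?q * qp (- ?q) ?q = qp (?q ^ 2) (?q ^ 2)" using sq[OF q, of ?q] by (simp add: eul_qp)
    have "eul ?q * (qp (- ?q) ?q * qp ?q (?q ^ 2)) = (eul ?q * qp (- ?q) ?q) * qp ?q (?q ^ 2)" by simp
    also have "\<dots> = eul ?q * 1" unfolding 3 using 2 by (simp add: mult.commute)
    finally show ?thesis unfolding 1 using e by simp
  qed
  have K1: "kl 0 (1/2) \<tau> = 2 * \<i> * qp (- ?q) ?q ^ 2 / eul ?q ^ 2"
  proof -
    have "exp (- (of_real pi * \<i> * (1 / 2))) = - \<i>"
      using cis_pi_half by (simp add: exp_minus cis_conv_exp mult_ac)
    then show ?thesis unfolding kl_def th_def using qp_step[OF q, of "-1"]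
      by (simp add: nh power2_eq_square)
  qed
  have K2: "kl (1/2) 0 \<tau> = - exp (- (of_real pi * \<i> * \<tau> / 4)) * qp y ?q ^ 2 / eul ?q ^ 2"
  proof -
    have 1: "nome (1 / 2 * \<tau> + 0) = y" by (simp add: y_def)
    have 2: "?q / y = y" using y0 by (simp add: y2 power2_eq_square)
    have 3: "exp (of_real pi * \<i> * (1/2) * (1 / 2 * \<tau> + 0)) * - exp (- (of_real pi * \<i> * (1 / 2 * \<tau> + 0))) = - exp (- (of_real pi * \<i> * \<tau> / 4))"
      by (simp only: mult_minus_right exp_add [symmetric], intro arg_cong[of _ _ "\<lambda>x. - exp x"], simp add: field_simps)
    show ?thesis unfolding kl_def th_def 1 2 3 [symmetric] by (simp add: power2_eq_square)
  qed
  have K3: "kl (1/2) (1/2) \<tau> = - exp (- (of_real pi * \<i> * (\<tau> + 1) / 4)) * qp (- y) ?q ^ 2 / eul ?q ^ 2"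
  proof -
    have 1: "nome (1 / 2 * \<tau> + 1 / 2) = - y" by (simp add: y_def nome_add nh)
    have 2: "?q / (- y) = - y" using y0 by (simp add: y2 power2_eq_square)
    have 3: "exp (of_real pi * \<i> * (1/2) * (1 / 2 * \<tau> + 1/2)) * - exp (- (of_real pi * \<i> * (1 / 2 * \<tau> + 1/2))) = - exp (- (of_real pi * \<i> * (\<tau> + 1) / 4))"
      by (simp only: mult_minus_right exp_add [symmetric], intro arg_cong[of _ _ "\<lambda>x. - exp x"], simp add: field_simps)
    show ?thesis unfolding kl_def th_def 1 2 3 [symmetric] by (simp add: power2_eq_square)
  qed
  have E: "exp (- (of_real pi * \<i> * \<tau> / 4)) ^ 4 * exp (- (of_real pi * \<i> * (\<tau> + 1) / 4)) ^ 4 * ?q = -1"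
  proof -
    have "exp (- (of_real pi * \<i> * \<tau> / 4)) ^ 4 * exp (- (of_real pi * \<i> * (\<tau> + 1) / 4)) ^ 4 * ?q = exp (- (of_real pi * \<i>))"
      unfolding nome_def exp_of_nat_mult [symmetric] exp_add [symmetric]
      by (intro arg_cong[of _ _ exp]) (simp add: field_simps)
    also have "\<dots> = -1" by (simp add: exp_minus)
    finally show ?thesis .
  qed
  have i4: "(2 * \<i>) ^ 4 = 16" by (simp add: eval_nat_numeral)
  have p4: "(a * b ^ 2 / c ^ 2) ^ 4 = a ^ 4 * b ^ 8 / c ^ 8" for a b c :: complex
    by (simp add: power_mult_distrib power_divide power_mult [symmetric])
  have "dl \<tau> * k2 \<tau> = 16 * (exp (- (of_real pi * \<i> * \<tau> / 4)) ^ 4 * exp (- (of_real pi * \<i> * (\<tau> + 1) / 4)) ^ 4 * ?q) *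
      (qp (- ?q) ?q * (qp y ?q * qp (- y) ?q)) ^ 8 * (eul ?q ^ 24 / (eul ?q ^ 8 * eul ?q ^ 8 * eul ?q ^ 8))"
    unfolding dl_def k2_def K1 K2 K3 p4 i4 by (simp add: power_mult_distrib)
  also have "eul ?q ^ 24 / (eul ?q ^ 8 * eul ?q ^ 8 * eul ?q ^ 8) = 1"
    using e by (simp add: power_add [symmetric])
  finally show ?thesis unfolding E B by simp
qed

lemma Im_S: "Im \<tau> > 0 \<Longrightarrow> Im (- 1 / \<tau>) > 0"
  by (simp add: Im_divide divide_pos_pos sum_power2_gt_zero_iff)

text \<open>\<open>dl_k2\<close> at \<tau> and at -1/\<tau> turns the weight -12 of
  \<open>k2\<close> into the weight 12 of \<open>dl\<close>, so that no branch of a logarithm of eta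
  has to be followed.\<close>

lemma dl_S:
  assumes "Im \<tau> > 0"
  shows "dl (- 1 / \<tau>) = \<tau> ^ 12 * dl \<tau>"
proof -
  have t0: "\<tau> \<noteq> 0" using assms by auto
  have 1: "kl 0 (- 1/2) \<tau> ^ 4 = kl 0 (1/2) \<tau> ^ 4"
    using kl_minus[OF assms, of 0 "1/2"] by simp
  have 2: "kl (1/2) (- 1/2) \<tau> ^ 4 = kl (1/2) (1/2) \<tau> ^ 4"
  proof -
    have "kl (1/2) (- 1/2 + of_nat 1) \<tau> = - exp (of_real pi * \<i> * (1/2)) * kl (1/2) (- 1/2) \<tau>"
      unfolding kl_shift2 by simp
    moreover have "(- exp (of_real pi * \<i> * (1/2))) ^ 4 = 1"
      using exp_pi_int_even[of 1] by (simp add: exp_of_nat_mult [symmetric] mult_ac)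
    ultimately show ?thesis by (simp add: power_mult_distrib)
  qed
  have "k2 (- 1 / \<tau>) = k2 \<tau> / \<tau> ^ 12"
    unfolding k2_def kl_S[OF assms] using 1 2
    by (simp add: power_divide power_add [symmetric] mult_ac)
  moreover have "dl (- 1 / \<tau>) * k2 (- 1 / \<tau>) = dl \<tau> * k2 \<tau>"
    using dl_k2[OF assms] dl_k2[OF Im_S[OF assms]] by simp
  moreover have "k2 \<tau> \<noteq> 0" using dl_k2[OF assms] by auto
  ultimately have a: "k2 \<tau> = k2 (- 1 / \<tau>) * \<tau> ^ 12" and b: "dl (- 1 / \<tau>) * k2 (- 1 / \<tau>) = dl \<tau> * k2 \<tau>"
    and c: "k2 \<tau> \<noteq> 0" using t0 by simp_all
  have "dl (- 1 / \<tau>) * k2 \<tau> = (dl (- 1 / \<tau>) * k2 (- 1 / \<tau>)) * \<tau> ^ 12" by (subst a) (simp only: mult.assoc)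
  also have "\<dots> = (\<tau> ^ 12 * dl \<tau>) * k2 \<tau>" unfolding b by (simp only: mult_ac)
  finally show ?thesis using c by (metis mult_cancel_right)
qed

text \<open>
  The index 2 stands for the cusp at infinity of level 2, that is for the argument \<open>2 * \<tau>\<close>.
\<close>

definition a14 :: "nat \<Rightarrow> int \<Rightarrow> int \<Rightarrow> complex \<Rightarrow> complex" where
  "a14 i v w \<tau> = (if i = 2 then a7 (4 * v) w (2 * \<tau>)
     else if i = 0 then 8 * a7 v (4 * w) (\<tau> / 2) else 8 * a7 v (4 * (w - v)) ((\<tau> + 1) / 2))"

text \<open>The factor 4096 = 2^12 here and 8 = 2^3 in \<open>a14\<close> absorb the powers of 2
  that the weights 12 and -3 produce when -1/\<tau> exchanges 2 \<tau> and \<tau>/2.\<close>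

definition d2 :: "nat \<Rightarrow> complex \<Rightarrow> complex" where
  "d2 i \<tau> = (if i = 2 then dl (2 * \<tau>) else if i = 0 then dl (\<tau> / 2) / 4096 else dl ((\<tau> + 1) / 2) / 4096)"

text \<open>The permutations of the three lattices of index 2 under \<tau> + 1 and, for
  \<open>sI\<close>, under -1/\<tau>; the indices 0 and 1 belong to \<tau>/2 and (\<tau> +
  1)/2.\<close>

definition tI :: "nat \<Rightarrow> nat" where "tI i = (if i = 2 then 2 else if i = 0 then 1 else 0)"
definition sI :: "nat \<Rightarrow> nat" where "sI i = (if i = 2 then 0 else if i = 0 then 2 else 1)"

lemma tI_less: "i < 3 \<Longrightarrow> tI i < 3" and sI_less: "i < 3 \<Longrightarrow> sI i < 3"
  by (auto simp: tI_def sI_def)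

lemma index2_cases: "i < 3 \<Longrightarrow> i = 2 \<or> i = 0 \<or> i = (1::nat)"
  by auto

lemma mod7_eqI: "a = b + 7 * k \<Longrightarrow> a mod 7 = b mod (7::int)"
  by simp

text \<open>As 4 is the inverse of 2 mod 7, the indices in the three cases of \<open>a14\<close>
  describe the same point v \<tau> + w, read in three different lattices. Hence the generators act
  on (v, w) as before and merely permute the lattices.\<close>

lemma a14_T:
  assumes "Im \<tau> > 0" "i < 3"
  shows "a14 i v w (\<tau> + 1) = a14 (tI i) v (v + w) \<tau>"
  using index2_cases[OF assms(2)]
proof (elim disjE)
  assume i: "i = 2"
  have "2 * (\<tau> + 1) = (2 * \<tau> + 1) + 1" by simp
  then have "a14 i v w (\<tau> + 1) = a7 (4 * v) (4 * v + (4 * v + w)) (2 * \<tau>)"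
    unfolding a14_def i by (simp only: a7_T) simp
  also have "\<dots> = a7 (4 * v) (v + w) (2 * \<tau>)" by (rule a7_cong) (use assms in simp, simp, rule mod7_eqI[of _ _ v], simp)
  finally show ?thesis by (simp add: a14_def tI_def i)
next
  assume i: "i = 0"
  show ?thesis by (simp add: a14_def tI_def i)
next
  assume i: "i = 1"
  have "(\<tau> + 1 + 1) / 2 = \<tau> / 2 + 1" by (simp add: field_simps)
  then have "a7 v (4 * (w - v)) ((\<tau> + 1 + 1) / 2) = a7 v (v + 4 * (w - v)) (\<tau> / 2)"
    by (simp only: a7_T)
  then have "a14 i v w (\<tau> + 1) = 8 * a7 v (v + 4 * (w - v)) (\<tau> / 2)"
    by (simp add: a14_def i)
  also have "a7 v (v + 4 * (w - v)) (\<tau> / 2) = a7 v (4 * (v + w)) (\<tau> / 2)" by (rule a7_cong) (use assms in simp, simp, rule mod7_eqI[of _ _ "- v"], simp add: algebra_simps)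
  finally show ?thesis by (simp add: a14_def tI_def i)
qed

text \<open>This fractional linear map is the effect of -1/\<tau> on (\<tau> + 1)/2. It is composed
  of a shift by -1, an inversion, a shift by -2 and a second inversion, each of which has a known
  law.\<close>

lemma a7_half:
  assumes "Im \<sigma> > 0"
  shows "a7 v w ((\<sigma> - 1) / (2 * \<sigma> - 1)) = a7 (v + 2 * w) (- v - w) \<sigma> / (2 * \<sigma> - 1) ^ 3"
proof -
  define r where "r = \<sigma> - 1"
  define X where "X = - 1 / r - 2"
  have r: "Im r > 0" using assms by (simp add: r_def)
  have r0: "r \<noteq> 0" using r by auto
  have X: "Im X > 0" using Im_S[OF r] by (simp add: X_def)
  have X0: "X \<noteq> 0" using X by auto
  have T': "a7 a b (z - 1) = a7 a (b - a) z" for a b z using a7_T[of a "b - a" "z - 1"] by simp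
  have "X * r = - 1 - 2 * r" using r0 by (simp add: X_def left_diff_distrib)
  then have Xr: "X * r = - (2 * \<sigma> - 1)" by (simp add: r_def)
  have "(\<sigma> - 1) / (2 * \<sigma> - 1) = - 1 / X"
  proof -
    have "- 1 / X = - r / (X * r)" using r0 by simp
    also have "\<dots> = r / (2 * \<sigma> - 1)" unfolding Xr by (metis minus_divide_left minus_divide_right minus_minus)
    finally show ?thesis by (simp add: r_def)
  qed
  then have "a7 v w ((\<sigma> - 1) / (2 * \<sigma> - 1)) = a7 w (- v) X / X ^ 3" by (simp only: a7_S[OF X])
  also have "a7 w (- v) X = a7 w (- v - 2 * w) (- 1 / r)"
  proof -
    have "X = (- 1 / r - 1) - 1" by (simp add: X_def)
    then show ?thesis by (simp only: T') (simp add: algebra_simps)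
  qed
  also have "\<dots> = a7 (- v - 2 * w) (- w) r / r ^ 3" by (rule a7_S[OF r])
  also have "a7 (- v - 2 * w) (- w) r = a7 (- v - 2 * w) (v + w) \<sigma>"
    unfolding r_def T' by (simp add: algebra_simps)
  also have "a7 (- v - 2 * w) (v + w) \<sigma> = - a7 (v + 2 * w) (- v - w) \<sigma>"
    using a7_minus[OF assms, of "v + 2 * w" "- v - w"] by (simp add: algebra_simps)
  also have "- a7 (v + 2 * w) (- v - w) \<sigma> / r ^ 3 / X ^ 3 = a7 (v + 2 * w) (- v - w) \<sigma> / (2 * \<sigma> - 1) ^ 3"
  proof -
    have "r ^ 3 * X ^ 3 = - ((2 * \<sigma> - 1) ^ 3)" unfolding power_mult_distrib [symmetric] mult.commute[of r] Xr by (simp only: power3_eq_cube mult_minus_left mult_minus_right minus_minus)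
    then show ?thesis by simp
  qed
  finally show ?thesis .
qed

lemma dl_half:
  assumes "Im \<sigma> > 0"
  shows "dl ((\<sigma> - 1) / (2 * \<sigma> - 1)) = (2 * \<sigma> - 1) ^ 12 * dl \<sigma>"
proof -
  define r where "r = \<sigma> - 1"
  define X where "X = - 1 / r - 2"
  have r: "Im r > 0" using assms by (simp add: r_def)
  have r0: "r \<noteq> 0" using r by auto
  have X: "Im X > 0" using Im_S[OF r] by (simp add: X_def)
  have T': "dl (z - 1) = dl z" for z using dl_T[of "z - 1"] by simp
  have "X * r = - 1 - 2 * r" using r0 by (simp add: X_def left_diff_distrib)
  then have Xr: "X * r = - (2 * \<sigma> - 1)" by (simp add: r_def)
  have "(\<sigma> - 1) / (2 * \<sigma> - 1) = - 1 / X"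
  proof -
    have "- 1 / X = - r / (X * r)" using r0 by simp
    also have "\<dots> = r / (2 * \<sigma> - 1)" unfolding Xr by (metis minus_divide_left minus_divide_right minus_minus)
    finally show ?thesis by (simp add: r_def)
  qed
  then have "dl ((\<sigma> - 1) / (2 * \<sigma> - 1)) = X ^ 12 * dl X" by (simp only: dl_S[OF X])
  also have "dl X = dl (- 1 / r)" using T'[of "- 1 / r"] T'[of "- 1 / r - 1"] by (simp add: X_def algebra_simps)
  also have "\<dots> = r ^ 12 * dl r" by (rule dl_S[OF r])
  also have "dl r = dl \<sigma>" unfolding r_def T' ..
  also have "X ^ 12 * (r ^ 12 * dl \<sigma>) = (2 * \<sigma> - 1) ^ 12 * dl \<sigma>"
  proof -
    have neg: "(- a) ^ 12 = a ^ 12" for a :: complex by simp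
    show ?thesis unfolding mult.assoc [symmetric] power_mult_distrib [symmetric] Xr neg ..
  qed
  finally show ?thesis .
qed

lemma a14_S:
  assumes "Im \<tau> > 0" "i < 3"
  shows "a14 i v w (- 1 / \<tau>) = a14 (sI i) w (- v) \<tau> / \<tau> ^ 3"
  using index2_cases[OF assms(2)]
proof (elim disjE)
  assume i: "i = 2"
  have e: "2 * (- 1 / \<tau>) = - 1 / (\<tau> / 2)" by simp
  have "a14 i v w (- 1 / \<tau>) = a7 (4 * v) w (- 1 / (\<tau> / 2))" by (simp add: a14_def i)
  also have "\<dots> = a7 w (- (4 * v)) (\<tau> / 2) / (\<tau> / 2) ^ 3" by (rule a7_S) (use assms in simp)
  finally show ?thesis by (simp add: a14_def sI_def i power_divide)
next
  assume i: "i = 0"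
  have "a14 i v w (- 1 / \<tau>) = 8 * a7 v (4 * w) (- 1 / (2 * \<tau>))" by (simp add: a14_def i mult.commute)
  also have "a7 v (4 * w) (- 1 / (2 * \<tau>)) = a7 (4 * w) (- v) (2 * \<tau>) / (2 * \<tau>) ^ 3" by (rule a7_S) (use assms in simp)
  finally show ?thesis by (simp add: a14_def sI_def i power_mult_distrib)
next
  assume i: "i = 1"
  define s where "s = (\<tau> + 1) / 2"
  have s: "Im s > 0" using assms by (simp add: s_def)
  have t: "2 * s - 1 = \<tau>" by (simp add: s_def add_divide_distrib)
  have t0: "\<tau> \<noteq> 0" using assms by auto
  have "(- 1 / \<tau> + 1) / 2 = (s - 1) / (2 * s - 1)"
    unfolding t using t0 by (simp add: s_def field_simps)
  then have "a7 v (4 * (w - v)) ((- 1 / \<tau> + 1) / 2) = a7 (v + 2 * (4 * (w - v))) (- v - 4 * (w - v)) s / \<tau> ^ 3"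
    using a7_half[OF s, of v "4 * (w - v)"] by (simp only: t)
  then have "a14 i v w (- 1 / \<tau>) = 8 * (a7 (v + 2 * (4 * (w - v))) (- v - 4 * (w - v)) s / \<tau> ^ 3)"
    unfolding a14_def i by (simp only: if_False zero_neq_one one_neq_zero refl) simp
  also have "a7 (v + 2 * (4 * (w - v))) (- v - 4 * (w - v)) s = a7 w (4 * (- v - w)) s"
    by (rule a7_cong[OF s], rule mod7_eqI[of _ _ "w - v"], simp add: algebra_simps, rule mod7_eqI[of _ _ v], simp add: algebra_simps)
  finally show ?thesis by (simp add: a14_def sI_def i s_def)
qed

lemma d2_T:
  assumes "i < 3"
  shows "d2 i (\<tau> + 1) = d2 (tI i) \<tau>"
proof -
  have 1: "dl (2 * \<tau> + 2) = dl (2 * \<tau>)"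
    using dl_T[of "2 * \<tau> + 1"] dl_T[of "2 * \<tau>"] by (simp add: add.assoc)
  have "(2 + \<tau>) / 2 = \<tau> / 2 + 1" by (simp add: field_simps)
  then have 2: "dl ((2 + \<tau>) / 2) = dl (\<tau> / 2)" by (simp only: dl_T)
  show ?thesis using index2_cases[OF assms] 1 2 by (auto simp: d2_def tI_def)
qed

lemma d2_S:
  assumes "Im \<tau> > 0" "i < 3"
  shows "d2 i (- 1 / \<tau>) = \<tau> ^ 12 * d2 (sI i) \<tau>"
  using index2_cases[OF assms(2)]
proof (elim disjE)
  assume i: "i = 2"
  have "dl (- 1 / (\<tau> / 2)) = (\<tau> / 2) ^ 12 * dl (\<tau> / 2)" by (rule dl_S) (use assms in simp)
  then show ?thesis by (simp add: d2_def sI_def i power_divide)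
next
  assume i: "i = 0"
  have "dl (- 1 / (2 * \<tau>)) = (2 * \<tau>) ^ 12 * dl (2 * \<tau>)" by (rule dl_S) (use assms in simp)
  then show ?thesis by (simp add: d2_def sI_def i power_mult_distrib mult.commute)
next
  assume i: "i = 1"
  define s where "s = (\<tau> + 1) / 2"
  have s: "Im s > 0" using assms by (simp add: s_def)
  have t: "2 * s - 1 = \<tau>" by (simp add: s_def add_divide_distrib)
  have t0: "\<tau> \<noteq> 0" using assms by auto
  have "(- 1 / \<tau> + 1) / 2 = (s - 1) / (2 * s - 1)"
    unfolding t using t0 by (simp add: s_def field_simps)
  then have "dl ((- 1 / \<tau> + 1) / 2) = \<tau> ^ 12 * dl s"
    using dl_half[OF s] by (simp only: t)
  then show ?thesis unfolding d2_def sI_def i by (simp add: s_def)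
qed

lemma a14_double:
  assumes "Im \<tau> > 0"
  shows "a14 i (2 * v) (2 * w) \<tau> = a14 i v w \<tau>"
proof -
  have 1: "a7 (2 * (4 * v)) (2 * w) (2 * \<tau>) = a7 (4 * v) w (2 * \<tau>)" by (rule a7_double) (use assms in simp)
  have 2: "a7 (2 * v) (2 * (4 * w)) (\<tau> / 2) = a7 v (4 * w) (\<tau> / 2)" by (rule a7_double) (use assms in simp)
  have 3: "a7 (2 * v) (2 * (4 * (w - v))) ((\<tau> + 1) / 2) = a7 v (4 * (w - v)) ((\<tau> + 1) / 2)" by (rule a7_double) (use assms in simp)
  show ?thesis using 1 2 3 by (simp add: a14_def algebra_simps)
qed

lemma a14_minus:
  assumes "Im \<tau> > 0"
  shows "a14 i (- v) (- w) \<tau> = - a14 i v w \<tau>"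
proof -
  have 1: "a7 (- (4 * v)) (- w) (2 * \<tau>) = - a7 (4 * v) w (2 * \<tau>)" by (rule a7_minus) (use assms in simp)
  have 2: "a7 (- v) (- (4 * w)) (\<tau> / 2) = - a7 v (4 * w) (\<tau> / 2)" by (rule a7_minus) (use assms in simp)
  have 3: "a7 (- v) (- (4 * (w - v))) ((\<tau> + 1) / 2) = - a7 v (4 * (w - v)) ((\<tau> + 1) / 2)" by (rule a7_minus) (use assms in simp)
  show ?thesis using 1 2 3 by (simp add: a14_def algebra_simps)
qed

lemma a14_cong:
  assumes "Im \<tau> > 0" "v mod 7 = v' mod 7" "w mod 7 = w' mod 7"
  shows "a14 i v w \<tau> = a14 i v' w' \<tau>"
proof -
  have 1: "a7 (4 * v) w (2 * \<tau>) = a7 (4 * v') w' (2 * \<tau>)"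
    by (rule a7_cong) (use assms in \<open>auto intro: mod_mult_cong\<close>)
  have 2: "a7 v (4 * w) (\<tau> / 2) = a7 v' (4 * w') (\<tau> / 2)"
    by (rule a7_cong) (use assms in \<open>auto intro: mod_mult_cong\<close>)
  have 3: "a7 v (4 * (w - v)) ((\<tau> + 1) / 2) = a7 v' (4 * (w' - v')) ((\<tau> + 1) / 2)"
    by (rule a7_cong) (use assms in \<open>auto intro: mod_mult_cong mod_diff_cong\<close>)
  show ?thesis using 1 2 3 by (simp add: a14_def)
qed

section \<open>A Liouville theorem for families of functions\<close>

abbreviation H :: "complex set" where "H \<equiv> {\<tau>. Im \<tau> > 0}"

lemma open_H: "open H" and connected_H: "connected H"
  by (auto simp: open_halfspace_Im_gt convex_halfspace_Im_gt convex_connected)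

lemma nome_inverse_Ln:
  assumes "z \<noteq> 0"
  shows "nome (Ln z / (2 * of_real pi * \<i>)) = z"
  using assms by (simp add: nome_def)

text \<open>A function of period \<open>N\<close> factors through nome (\<tau>/N) on the punctured
  disc, and boundedness removes the singularity at 0.\<close>

lemma holomorphic_periodic_descend:
  fixes f :: "complex \<Rightarrow> complex"
  assumes hol: "f holomorphic_on H" and N: "N > 0"
    and per: "\<And>\<tau>. Im \<tau> > 0 \<Longrightarrow> f (\<tau> + of_nat N) = f \<tau>"
    and bd: "\<And>\<tau>. Im \<tau> > 0 \<Longrightarrow> norm (f \<tau>) \<le> M"
  obtains g where "g holomorphic_on ball 0 1" "\<And>\<tau>. Im \<tau> > 0 \<Longrightarrow> g (nome (\<tau> / of_nat N)) = f \<tau>"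
proof -
  have per_int: "f (\<tau> + of_int n * of_nat N) = f \<tau>" if "Im \<tau> > 0" for \<tau> and n :: int
  proof -
    have nat: "f (\<tau> + of_nat k * of_nat N) = f \<tau>" if "Im \<tau> > 0" for \<tau> and k :: nat
    proof (induction k)
      case (Suc k)
      have "\<tau> + of_nat (Suc k) * of_nat N = (\<tau> + of_nat k * of_nat N) + of_nat N" by (simp add: algebra_simps)
      then show ?case using per[of "\<tau> + of_nat k * of_nat N"] Suc that by (simp add: add.assoc)
    qed simp
    show ?thesis
    proof (cases "n \<ge> 0")
      case True
      then show ?thesis using nat[OF that, of "nat n"] by simp
    next
      case False
      then show ?thesis using nat[of "\<tau> + of_int n * of_nat N" "nat (- n)"] that by simp
    qed
  qed
  define l where "l = (\<lambda>z. of_nat N * Ln z / (2 * of_real pi * \<i>))"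
  define h where "h = (\<lambda>z. f (l z))"
  have Nn: "(of_nat N :: complex) \<noteq> 0" using N by simp
  have nl: "nome (l z / of_nat N) = z" if "z \<noteq> 0" for z
    using nome_inverse_Ln[OF that] Nn by (simp add: l_def)
  have Iml: "Im (l z) > 0" if "z \<noteq> 0" "norm z < 1" for z
  proof -
    have "l z = of_real (of_nat N / (2 * pi)) * (- \<i> * Ln z)" by (simp add: l_def field_simps)
    then have "Im (l z) = of_nat N / (2 * pi) * - ln (norm z)"
      using that by simp
    moreover have "ln (norm z) < 0" using that by simp
    ultimately show ?thesis using N by (simp add: zero_less_mult_iff divide_neg_pos mult_neg_neg mult_less_0_iff)
  qed
  have fl: "f \<sigma> = h z" if "Im \<sigma> > 0" "nome (\<sigma> / of_nat N) = z" "z \<noteq> 0" "norm z < 1" for \<sigma> z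
  proof -
    have "nome (\<sigma> / of_nat N - l z / of_nat N) = 1" using that nl[of z] by (simp add: nome_diff)
    then obtain n :: int where "\<sigma> / of_nat N - l z / of_nat N = of_int n" unfolding nome_eq_1_iff by blast
    then have "\<sigma> = l z + of_int n * of_nat N" using Nn by (simp add: field_simps)
    then show ?thesis using per_int[OF Iml[OF that(3,4)]] by (simp add: h_def)
  qed
  have "h field_differentiable at z" if z: "z \<in> ball 0 1 - {0}" for z
  proof -
    \<comment> \<open>The principal logarithm in \<open>l\<close> jumps along the negative axis,
      whereas \<open>Ln (y / z)\<close> is analytic at \<open>y = z\<close>. By periodicity
      \<open>f\<close> takes the same value for either branch.\<close>
    define m where "m = (\<lambda>y. l z + of_nat N * Ln (y / z) / (2 * of_real pi * \<i>))"
    have z': "z \<noteq> 0" "norm z < 1" using z by auto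
    have mz: "m z = l z" using z' by (simp add: m_def)
    have dm: "m field_differentiable at z"
      unfolding m_def using z' by (intro derivative_intros field_differentiable_add field_differentiable_const
        field_differentiable_divide field_differentiable_mult field_differentiable_compose[of "\<lambda>y. y / z" _ Ln, unfolded o_def]
        field_differentiable_at_Ln field_differentiable_ident) auto
    have df: "f field_differentiable at (m z)"
      using holomorphic_on_imp_differentiable_at[OF hol open_H] Iml[OF z'] mz by simp
    have "(\<lambda>y. f (m y)) field_differentiable at z"
      using field_differentiable_compose[OF dm df] by (simp add: o_def)
    moreover have "\<forall>\<^sub>F y in nhds z. f (m y) = h y"
    proof -
      have cm: "isCont m z" using dm field_differentiable_imp_continuous_at by blast
      then have "(m \<longlongrightarrow> m z) (nhds z)" by (simp add: continuous_at tendsto_nhds_iff)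
      then have "\<forall>\<^sub>F y in nhds z. m y \<in> H"
        using topological_tendstoD[of m "m z" "nhds z" H] open_H Iml[OF z'] mz by simp
      moreover have "\<forall>\<^sub>F y in nhds z. y \<in> ball 0 1 - {0}"
        using z by (intro eventually_nhds_in_open) auto
      ultimately show ?thesis
      proof eventually_elim
        case (elim y)
        have "nome (m y / of_nat N) = y"
        proof -
          have "m y / of_nat N = l z / of_nat N + Ln (y / z) / (2 * of_real pi * \<i>)" using Nn by (simp add: m_def add_divide_distrib)
          then show ?thesis using nl[of z] nome_inverse_Ln[of "y / z"] elim z' by (simp add: nome_add)
        qed
        then show ?case using fl[of "m y" y] elim by auto
      qed
    qed
    ultimately show ?thesis
      unfolding field_differentiable_def using DERIV_cong_ev[OF refl _ refl, where f = "\<lambda>y. f (m y)" and g = h] by blast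
  qed
  then have holh: "h holomorphic_on ball 0 1 - {0}"
    by (simp add: holomorphic_on_def field_differentiable_at_within)
  have "\<exists>g. g holomorphic_on ball 0 1 \<and> (\<forall>z\<in>ball 0 1 - {0}. g z = h z)"
  proof (subst holomorphic_on_extend_bounded[OF holh])
    have "norm (h z) \<le> M" if "z \<noteq> 0" "norm z < 1" for z unfolding h_def by (rule bd[OF Iml[OF that]])
    then show "\<exists>B. \<forall>\<^sub>F z in at 0. norm (h z) \<le> B"
      by (intro exI[of _ M]) (auto simp: eventually_at intro!: exI[of _ 1])
  qed auto
  then obtain g where g: "g holomorphic_on ball 0 1" "\<And>z. z \<in> ball 0 1 - {0} \<Longrightarrow> g z = h z" by blast
  have "g (nome (\<tau> / of_nat N)) = f \<tau>" if "Im \<tau> > 0" for \<tau>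
  proof -
    have "norm (nome (\<tau> / of_nat N)) < 1" using that N by (intro norm_nome_less_1) simp
    then show ?thesis using g(2) fl[OF that refl] by simp
  qed
  with g(1) show ?thesis using that by blast
qed

text \<open>Every point can be moved to imaginary part at least 1/2 if the member of the family may
  change. So each value of a member on the whole disc of nome (\<tau>/N) is a value of some member
  on a smaller closed disc. The member with the largest maximum on that disc attains its maximum
  over the open disc in the interior, hence is constant.\<close>

theorem modular_liouville:
  fixes F :: "'x \<Rightarrow> complex \<Rightarrow> complex"
  assumes fin: "finite X" and x0: "x0 \<in> X"
    and clt: "\<And>x. x \<in> X \<Longrightarrow> tX x \<in> X" and cls: "\<And>x. x \<in> X \<Longrightarrow> sX x \<in> X"
    and hol: "\<And>x. x \<in> X \<Longrightarrow> F x holomorphic_on H"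
    and T: "\<And>x \<tau>. x \<in> X \<Longrightarrow> Im \<tau> > 0 \<Longrightarrow> F x (\<tau> + 1) = F (tX x) \<tau>"
    and S: "\<And>x \<tau>. x \<in> X \<Longrightarrow> Im \<tau> > 0 \<Longrightarrow> F x (- 1 / \<tau>) = F (sX x) \<tau>"
    and N: "N > 0" and per: "\<And>x \<tau>. x \<in> X \<Longrightarrow> Im \<tau> > 0 \<Longrightarrow> F x (\<tau> + of_nat N) = F x \<tau>"
    and bd: "\<And>x. x \<in> X \<Longrightarrow> \<exists>M. \<forall>\<tau>. Im \<tau> \<ge> 1/2 \<longrightarrow> norm (F x \<tau>) \<le> M"
  shows "F x0 constant_on H"
proof -
  \<comment> \<open>Each member kept here is \<open>F x0\<close> composed with a map of
    \<open>H\<close> onto itself, so that constancy of any one of them, which is all that the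
    maximum principle gives, returns to \<open>F x0\<close>.\<close>
  define Y where "Y = {x\<in>X. \<exists>\<phi>. \<phi> ` H = H \<and> (\<forall>\<tau>\<in>H. F x \<tau> = F x0 (\<phi> \<tau>))}"
  have YX: "Y \<subseteq> X" by (auto simp: Y_def)
  have Y0: "x0 \<in> Y" using x0 by (auto simp: Y_def intro!: exI[of _ "\<lambda>x. x"])
  have finY: "finite Y" using fin YX finite_subset by blast
  have imT: "(\<lambda>\<tau>. \<tau> + 1) ` H = H"
    by (auto simp: image_iff intro!: exI[of _ "_ - 1"])
  have imS: "(\<lambda>\<tau>. - 1 / \<tau>) ` H = H"
  proof -
    have "\<tau> \<in> (\<lambda>\<tau>. - 1 / \<tau>) ` H" if "Im \<tau> > 0" for \<tau>
    proof -
      have "\<tau> = - 1 / (- 1 / \<tau>)" using that by auto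
      then show ?thesis using Im_S[OF that] by blast
    qed
    then show ?thesis using Im_S by blast
  qed
  have Yt: "tX x \<in> Y" if x: "x \<in> Y" for x
  proof -
    from x obtain \<phi> where phi: "x \<in> X" "\<phi> ` H = H" "\<And>\<tau>. \<tau> \<in> H \<Longrightarrow> F x \<tau> = F x0 (\<phi> \<tau>)"
      unfolding Y_def by blast
    have "(\<lambda>\<tau>. \<phi> (\<tau> + 1)) ` H = \<phi> ` ((\<lambda>\<tau>. \<tau> + 1) ` H)" by (simp add: image_image)
    then have "(\<lambda>\<tau>. \<phi> (\<tau> + 1)) ` H = H" unfolding imT phi(2) .
    moreover have "F (tX x) \<tau> = F x0 (\<phi> (\<tau> + 1))" if "\<tau> \<in> H" for \<tau>
      using T[OF phi(1), of \<tau>] phi(3)[of "\<tau> + 1"] that by simp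
    ultimately show ?thesis unfolding Y_def using clt[OF phi(1)]
      by (intro CollectI conjI exI[of _ "\<lambda>\<tau>. \<phi> (\<tau> + 1)"]) auto
  qed
  have Ys: "sX x \<in> Y" if x: "x \<in> Y" for x
  proof -
    from x obtain \<phi> where phi: "x \<in> X" "\<phi> ` H = H" "\<And>\<tau>. \<tau> \<in> H \<Longrightarrow> F x \<tau> = F x0 (\<phi> \<tau>)"
      unfolding Y_def by blast
    have "(\<lambda>\<tau>. \<phi> (- 1 / \<tau>)) ` H = \<phi> ` ((\<lambda>\<tau>. - 1 / \<tau>) ` H)" by (simp add: image_image)
    then have "(\<lambda>\<tau>. \<phi> (- 1 / \<tau>)) ` H = H" unfolding imS phi(2) .
    moreover have "F (sX x) \<tau> = F x0 (\<phi> (- 1 / \<tau>))" if "\<tau> \<in> H" for \<tau>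
      using S[OF phi(1), of \<tau>] phi(3)[of "- 1 / \<tau>"] Im_S[of \<tau>] that by simp
    ultimately show ?thesis unfolding Y_def using cls[OF phi(1)]
      by (intro CollectI conjI exI[of _ "\<lambda>\<tau>. \<phi> (- 1 / \<tau>)"]) auto
  qed
  have shift_nat: "\<exists>y\<in>Y. F x (\<tau> + of_nat k) = F y \<tau>" if "x \<in> Y" "Im \<tau> > 0" for x \<tau> and k :: nat
    using that(1)
  proof (induction k arbitrary: x)
    case (Suc k)
    have "F x (\<tau> + of_nat (Suc k)) = F (tX x) (\<tau> + of_nat k)"
      using T[of x "\<tau> + of_nat k"] Suc.prems YX that by (auto simp: algebra_simps)
    then show ?case using Suc.IH[OF Yt[OF Suc.prems]] by simp
  qed auto
  have per_nat: "F x (\<tau> + of_nat k * of_nat N) = F x \<tau>" if "x \<in> X" "Im \<tau> > 0" for x \<tau> and k :: nat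
  proof (induction k)
    case (Suc k)
    have "\<tau> + of_nat (Suc k) * of_nat N = (\<tau> + of_nat k * of_nat N) + of_nat N" by (simp add: algebra_simps)
    then show ?case using per[OF that(1), of "\<tau> + of_nat k * of_nat N"] Suc that by (simp add: add.assoc)
  qed simp
  \<comment> \<open>A shift by a negative integer becomes a shift by a natural number after a
    multiple of the period \<open>N\<close> has been added.\<close>
  have shift_int: "\<exists>y\<in>Y. F x \<tau> = F y (\<tau> - of_int k)" if "x \<in> Y" "Im \<tau> > 0" for x \<tau> and k :: int
  proof -
    define j where "j = nat \<bar>k\<bar>"
    have "F x \<tau> = F x (\<tau> + of_nat j * of_nat N)" using per_nat[of x \<tau> j] that YX by auto
    also have "\<tau> + of_nat j * of_nat N = (\<tau> - of_int k) + of_nat (nat (k + int j * int N))"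
    proof -
      have "int j * int N \<ge> int j * 1" using N by (intro mult_left_mono) auto
      then have "k + int j * int N \<ge> 0" by (simp add: j_def)
      then have "(of_nat (nat (k + int j * int N)) :: complex) = of_int (k + int j * int N)" by simp
      then show ?thesis by simp
    qed
    finally show ?thesis using shift_nat[OF that(1), of "\<tau> - of_int k" "nat (k + int j * int N)"] that(2) by simp
  qed
  \<comment> \<open>After translation to real part at most 1/2 in modulus, an imaginary part below
    1/2 means that the squared modulus is at most 1/2, so the inversion at least doubles the
    imaginary part. This explicit factor is what the induction on \<open>n\<close> counts.\<close>
  have red: "\<exists>y\<in>Y. \<exists>\<sigma>. Im \<sigma> \<ge> 1/2 \<and> F x \<tau> = F y \<sigma>" if "x \<in> Y" "Im \<tau> > 0" "Im \<tau> * 2 ^ n \<ge> 1/2" for x \<tau> n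
    using that
  proof (induction n arbitrary: x \<tau>)
    case (Suc n)
    show ?case
    proof (cases "Im \<tau> \<ge> 1/2")
      case False
      obtain y where y: "y \<in> Y" "F x \<tau> = F y (\<tau> - of_int (round (Re \<tau>)))"
        using shift_int[OF Suc.prems(1,2)] by blast
      define s where "s = \<tau> - of_int (round (Re \<tau>))"
      have Is: "Im s = Im \<tau>" by (simp add: s_def)
      have "\<bar>Re s\<bar> \<le> 1/2" using of_int_round_abs_le[of "Re \<tau>"] by (simp add: s_def abs_minus_commute)
      then have "(Re s) ^ 2 \<le> (1/2) ^ 2" by (subst abs_le_square_iff [symmetric]) simp
      moreover have "(Im s) ^ 2 \<le> (1/2) ^ 2" using False Is Suc.prems(2) by (intro power_mono) auto
      ultimately have n2: "(Re s) ^ 2 + (Im s) ^ 2 \<le> 1/2" by (simp add: power2_eq_square)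
      have s0: "s \<noteq> 0" using Is Suc.prems(2) by auto
      have pos: "(Re s) ^ 2 + (Im s) ^ 2 > 0" using s0 by (simp add: complex_eq_iff sum_power2_gt_zero_iff)
      have "Im (- 1 / s) = Im s / ((Re s) ^ 2 + (Im s) ^ 2)" by (simp add: Im_divide)
      also have "\<dots> \<ge> Im s / (1/2)" using n2 pos Is Suc.prems(2) by (intro divide_left_mono) auto
      finally have I2: "Im (- 1 / s) \<ge> 2 * Im \<tau>" using Is by simp
      have "F y s = F y (- 1 / (- 1 / s))" using s0 by simp
      also have "\<dots> = F (sX y) (- 1 / s)"
        using S[of y "- 1 / s"] y(1) YX I2 Suc.prems(2) by auto
      finally have Fs: "F y s = F (sX y) (- 1 / s)" .
      have "Im (- 1 / s) * 2 ^ n \<ge> 1/2"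
      proof -
        have "Im (- 1 / s) * 2 ^ n \<ge> (2 * Im \<tau>) * 2 ^ n" using I2 by (intro mult_right_mono) auto
        then show ?thesis using Suc.prems(3) by simp
      qed
      then show ?thesis using Suc.IH[OF Ys[OF y(1)], of "- 1 / s"] I2 Suc.prems(2) y(2) Fs s_def by auto
    qed (use Suc.prems in blast)
  qed auto
  have red': "\<exists>y\<in>Y. \<exists>\<sigma>. Im \<sigma> \<ge> 1/2 \<and> F x \<tau> = F y \<sigma>" if "x \<in> Y" "Im \<tau> > 0" for x \<tau>
  proof -
    obtain n where "(1/2) / Im \<tau> < 2 ^ n" using real_arch_pow[of 2 "(1/2) / Im \<tau>"] by auto
    then have "Im \<tau> * 2 ^ n \<ge> 1/2" using that(2) by (simp add: field_simps)
    then show ?thesis using red[OF that] by blast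
  qed
  obtain M where M: "\<And>x \<tau>. x \<in> X \<Longrightarrow> Im \<tau> \<ge> 1/2 \<Longrightarrow> norm (F x \<tau>) \<le> M x"
    using bd by metis
  define M' where "M' = Max (M ` Y)"
  have gl: "norm (F x \<tau>) \<le> M'" if x: "x \<in> Y" "Im \<tau> > 0" for x \<tau>
  proof -
    obtain y \<sigma> where y: "y \<in> Y" "Im \<sigma> \<ge> 1/2" "F x \<tau> = F y \<sigma>" using red'[OF x] by blast
    then have "norm (F x \<tau>) \<le> M y" using M YX by auto
    also have "\<dots> \<le> M'" unfolding M'_def using finY y(1) by (intro Max_ge) auto
    finally show ?thesis .
  qed
  have "\<exists>g. g holomorphic_on ball 0 1 \<and> (\<forall>\<tau>. Im \<tau> > 0 \<longrightarrow> g (nome (\<tau> / of_nat N)) = F x \<tau>)" if x: "x \<in> Y" for x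
  proof -
    have xX: "x \<in> X" using x YX by blast
    show ?thesis
      by (rule holomorphic_periodic_descend[OF hol[OF xX] N per[OF xX] gl[OF x]]) blast+
  qed
  then obtain g where g: "\<And>x. x \<in> Y \<Longrightarrow> g x holomorphic_on ball 0 1"
    "\<And>x \<tau>. x \<in> Y \<Longrightarrow> Im \<tau> > 0 \<Longrightarrow> g x (nome (\<tau> / of_nat N)) = F x \<tau>" by metis
  \<comment> \<open>The radius that corresponds to imaginary part 1/2 in the variable nome
    (\<tau>/N).\<close>
  define \<rho> where "\<rho> = exp (- pi / real N)"
  have rho: "\<rho> > 0" "\<rho> < 1" using N by (auto simp: \<rho>_def)
  have ne: "cball (0::complex) \<rho> \<noteq> {}" using rho by auto
  have "\<exists>z\<in>cball 0 \<rho>. \<forall>y\<in>cball 0 \<rho>. norm (g x y) \<le> norm (g x z)" if "x \<in> Y" for x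
  proof (rule continuous_attains_sup[OF compact_cball ne])
    show "continuous_on (cball 0 \<rho>) (\<lambda>z. norm (g x z))"
      using g(1)[OF that] rho by (intro continuous_intros holomorphic_on_imp_continuous_on)
        (auto intro: holomorphic_on_subset)
  qed
  then obtain zz where zz: "\<And>x. x \<in> Y \<Longrightarrow> zz x \<in> cball 0 \<rho>"
    "\<And>x y. x \<in> Y \<Longrightarrow> y \<in> cball 0 \<rho> \<Longrightarrow> norm (g x y) \<le> norm (g x (zz x))" by metis
  obtain xm where xm: "xm \<in> Y" "\<And>x. x \<in> Y \<Longrightarrow> norm (g x (zz x)) \<le> norm (g xm (zz xm))"
  proof -
    let ?A = "(\<lambda>x. norm (g x (zz x))) ` Y"
    have "Max ?A \<in> ?A" using finY Y0 by (intro Max_in) auto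
    then obtain x where "x \<in> Y" "Max ?A = norm (g x (zz x))" by blast
    moreover have "norm (g y (zz y)) \<le> Max ?A" if "y \<in> Y" for y using finY that by (intro Max_ge) auto
    ultimately show ?thesis using that by metis
  qed
  have bnd: "norm (g xm z) \<le> norm (g xm (zz xm))" if "z \<in> ball 0 1" for z
  proof (cases "z = 0")
    case True
    then show ?thesis using zz(2)[OF xm(1)] rho by simp
  next
    case False
    define \<tau> where "\<tau> = of_nat N * (Ln z / (2 * of_real pi * \<i>))"
    have nz: "nome (\<tau> / of_nat N) = z" using nome_inverse_Ln[OF False] N by (simp add: \<tau>_def)
    have It: "Im \<tau> > 0"
    proof (rule ccontr)
      assume "\<not> Im \<tau> > 0"
      then have "norm (nome (\<tau> / of_nat N)) \<ge> 1" by (simp add: norm_nome mult_nonneg_nonpos divide_nonpos_nonneg)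
      then show False using nz that by simp
    qed
    obtain y \<sigma> where y: "y \<in> Y" "Im \<sigma> \<ge> 1/2" "F xm \<tau> = F y \<sigma>" using red'[OF xm(1) It] by blast
    have Is: "Im \<sigma> > 0" using y(2) by simp
    have "norm (nome (\<sigma> / of_nat N)) \<le> \<rho>"
      unfolding norm_nome \<rho>_def using y(2) N by (simp add: field_simps)
    then have "norm (g y (nome (\<sigma> / of_nat N))) \<le> norm (g y (zz y))" using zz(2)[OF y(1)] by simp
    also have "\<dots> \<le> norm (g xm (zz xm))" by (rule xm(2)[OF y(1)])
    finally show ?thesis using g(2)[OF xm(1) It] g(2)[OF y(1) Is] y(3) nz by simp
  qed
  have "g xm constant_on ball 0 1"
    by (rule maximum_modulus_principle[OF g(1)[OF xm(1)], of "ball 0 1" "zz xm"])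
       (use zz(1)[OF xm(1)] rho bnd in auto)
  then obtain c where c: "\<And>z. z \<in> ball 0 1 \<Longrightarrow> g xm z = c" by (auto simp: constant_on_def)
  have Fc: "F xm \<tau> = c" if "Im \<tau> > 0" for \<tau>
  proof -
    have "norm (nome (\<tau> / of_nat N)) < 1" using that N by (intro norm_nome_less_1) simp
    then show ?thesis using g(2)[OF xm(1) that] c by auto
  qed
  obtain \<phi> where phi: "\<phi> ` H = H" "\<forall>\<tau>\<in>H. F xm \<tau> = F x0 (\<phi> \<tau>)" using xm(1) unfolding Y_def by blast
  have "F x0 \<tau> = c" if "\<tau> \<in> H" for \<tau>
  proof -
    obtain \<sigma> where "\<sigma> \<in> H" "\<tau> = \<phi> \<sigma>" using phi(1) \<open>\<tau> \<in> H\<close> by blast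
    then show ?thesis using phi(2) Fc by auto
  qed
  then show ?thesis by (auto simp: constant_on_def)
qed

section \<open>Standard indices, holomorphy and zeros of the Klein products\<close>

lemma a7_scale:
  assumes "Im \<tau> > 0" "c \<in> {1, 2, 4}"
  shows "a7 (c * v) (c * w) \<tau> = a7 v w \<tau>"
  using assms a7_double[OF assms(1), of v w] a7_double[OF assms(1), of "2 * v" "2 * w"] by auto

text \<open>The squares mod 7 are 1, 2, 4, and -1 is not among them, so every unit is a square up to
  sign.\<close>

lemma unit7_cases:
  fixes v :: int
  assumes "v mod 7 \<noteq> 0"
  obtains c where "c \<in> {1, 2, 4}" "(c * v) mod 7 = 1 \<or> (c * (- v)) mod 7 = 1"
proof -
  have "v mod 7 \<in> {1, 2, 3, 4, 5, 6}" using assms pos_mod_bound[of 7 v] pos_mod_sign[of 7 v] by auto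
  moreover have a: "(c * v) mod 7 = (c * (v mod 7)) mod 7" for c
    by (simp add: mod_mult_right_eq)
  have b: "(c * (- v)) mod 7 = (c * (- (v mod 7))) mod 7" for c
    by (rule mod_mult_cong[OF refl mod_minus_eq[symmetric]])
  have "\<exists>c\<in>{1, 2, 4}. (c * k) mod 7 = 1 \<or> (c * (- k)) mod 7 = 1" if "k \<in> {1, 2, 3, 4, 5, 6}" for k :: int
    using that by auto
  ultimately obtain c where "c \<in> {1, 2, 4}" "(c * (v mod 7)) mod 7 = 1 \<or> (c * (- (v mod 7))) mod 7 = 1"
    by blast
  then show ?thesis using that[of c] unfolding a[of c] b[of c] by blast
qed

text \<open>Brings an arbitrary index to one for which \<open>a7_1\<close> gives an explicit
  product; holomorphy, absence of zeros and orders at infinity are all read off there.\<close>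

lemma a7_cases1:
  assumes "v mod 7 \<noteq> 0"
  obtains s \<mu> where "s \<in> {1, -1 :: complex}" "\<And>\<tau>. Im \<tau> > 0 \<Longrightarrow> a7 v w \<tau> = s * a7 1 \<mu> \<tau>"
proof -
  obtain c where c: "c \<in> {1, 2, 4}" "(c * v) mod 7 = 1 \<or> (c * (- v)) mod 7 = 1"
    using unit7_cases[OF assms] by blast
  from c(2) show ?thesis
  proof
    assume "(c * v) mod 7 = 1"
    then have "a7 v w \<tau> = 1 * a7 1 (c * w) \<tau>" if "Im \<tau> > 0" for \<tau>
      using a7_scale[OF that c(1), of v w] a7_cong[OF that, of "c * v" 1 "c * w" "c * w"] by simp
    then show ?thesis using that[of 1 "c * w"] by blast
  next
    assume "(c * (- v)) mod 7 = 1"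
    then have "- a7 v w \<tau> = a7 1 (c * (- w)) \<tau>" if "Im \<tau> > 0" for \<tau>
      using a7_scale[OF that c(1), of "- v" "- w"] a7_minus[OF that, of v w]
        a7_cong[OF that, of "c * (- v)" 1 "c * (- w)" "c * (- w)"] by simp
    then have "a7 v w \<tau> = (- 1) * a7 1 (c * (- w)) \<tau>" if "Im \<tau> > 0" for \<tau>
      using that by (metis minus_minus mult_minus1)
    then show ?thesis using that[of "- 1" "c * (- w)"] by blast
  qed
qed

lemma a7_cases0:
  assumes "v mod 7 = 0" "w mod 7 \<noteq> 0"
  obtains s where "s \<in> {1, -1 :: complex}" "\<And>\<tau>. Im \<tau> > 0 \<Longrightarrow> a7 v w \<tau> = s * a7 0 1 \<tau>"
proof -
  obtain c where c: "c \<in> {1, 2, 4}" "(c * w) mod 7 = 1 \<or> (c * (- w)) mod 7 = 1"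
    using unit7_cases[OF assms(2)] by blast
  have v0: "(c * v) mod 7 = 0" "(c * (- v)) mod 7 = 0" using assms(1) by auto
  from c(2) show ?thesis
  proof
    assume "(c * w) mod 7 = 1"
    then have "a7 v w \<tau> = 1 * a7 0 1 \<tau>" if "Im \<tau> > 0" for \<tau>
      using a7_scale[OF that c(1), of v w] a7_cong[OF that, of "c * v" 0 "c * w" 1] v0 by simp
    then show ?thesis using that[of 1] by blast
  next
    assume "(c * (- w)) mod 7 = 1"
    then have "- a7 v w \<tau> = a7 0 1 \<tau>" if "Im \<tau> > 0" for \<tau>
      using a7_scale[OF that c(1), of "- v" "- w"] a7_minus[OF that, of v w]
        a7_cong[OF that, of "c * (- v)" 0 "c * (- w)" 1] v0 by simp
    then have "a7 v w \<tau> = (- 1) * a7 0 1 \<tau>" if "Im \<tau> > 0" for \<tau>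
      using that by (metis minus_minus mult_minus1)
    then show ?thesis using that[of "- 1"] by blast
  qed
qed

lemma eul_nome_holomorphic [holomorphic_intros]:
  assumes "f holomorphic_on S" "\<And>z. z \<in> S \<Longrightarrow> Im (f z) > 0"
  shows "(\<lambda>z. eul (nome (f z))) holomorphic_on S"
proof -
  have "(\<lambda>z. nome (f z)) holomorphic_on S" by (intro holomorphic_intros assms)
  moreover have "(\<lambda>z. nome (f z)) ` S \<subseteq> ball 0 1" using assms(2) norm_nome_less_1 by auto
  ultimately have "(eul \<circ> (\<lambda>z. nome (f z))) holomorphic_on S"
    using holomorphic_on_compose_gen[OF _ eul_holomorphic] by blast
  then show ?thesis by (simp add: o_def)
qed

lemma dl_holomorphic [holomorphic_intros]:
  assumes "f holomorphic_on S" "\<And>z. z \<in> S \<Longrightarrow> Im (f z) > 0"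
  shows "(\<lambda>z. dl (f z)) holomorphic_on S"
  unfolding dl_def by (intro holomorphic_intros assms)

lemma nome_pow: "nome z ^ n = nome (of_nat n * z)"
  by (simp add: nome_of_nat_mult)

lemma a7_holomorphic_nonzero:
  assumes "v mod 7 \<noteq> 0 \<or> w mod 7 \<noteq> 0"
  shows "a7 v w holomorphic_on H" "Im \<tau> > 0 \<Longrightarrow> a7 v w \<tau> \<noteq> 0"
proof -
  have e: "eul (nome \<tau>) \<noteq> 0" if "Im \<tau> > 0" for \<tau> using that by (intro eul_nonzero norm_nome_less_1)
  have "a7 v w holomorphic_on H \<and> (Im \<tau> > 0 \<longrightarrow> a7 v w \<tau> \<noteq> 0)"
  proof (cases "v mod 7 = 0")
    case True
    then obtain s where s: "s \<in> {1, -1 :: complex}" "\<And>\<tau>. Im \<tau> > 0 \<Longrightarrow> a7 v w \<tau> = s * a7 0 1 \<tau>"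
      using a7_cases0[of v w] assms by auto
    then have eq: "a7 v w \<tau> = s * (c7 * eul (nome (of_nat 7 * \<tau>)) / eul (nome \<tau>) ^ 7)" if "Im \<tau> > 0" for \<tau>
      using a7_0_1[OF that] that by (simp only: nome_pow)
    have "(\<lambda>\<tau>. s * (c7 * eul (nome (of_nat 7 * \<tau>)) / eul (nome \<tau>) ^ 7)) holomorphic_on H"
      by (intro holomorphic_intros) (auto simp: e)
    then show ?thesis using eq s(1) e e[of "of_nat 7 * \<tau>"] c7_nonzero
      by (auto intro: holomorphic_transform)
  next
    case False
    then obtain s \<mu> where s: "s \<in> {1, -1 :: complex}" "\<And>\<tau>. Im \<tau> > 0 \<Longrightarrow> a7 v w \<tau> = s * a7 1 \<mu> \<tau>"
      using a7_cases1[of v w] by blast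
    then have eq: "a7 v w \<tau> = s * (- eul (nome ((\<tau> + of_int \<mu>) / 7)) / (nome ((\<tau> + of_int \<mu>) / 7) ^ 2 * eul (nome \<tau>) ^ 7))" if "Im \<tau> > 0" for \<tau>
      using a7_1[OF that, of \<mu>] that by simp
    have "(\<lambda>\<tau>. s * (- eul (nome ((\<tau> + of_int \<mu>) / 7)) / (nome ((\<tau> + of_int \<mu>) / 7) ^ 2 * eul (nome \<tau>) ^ 7))) holomorphic_on H"
      by (intro holomorphic_intros) (auto simp: e)
    then show ?thesis using eq s(1) e e[of "(\<tau> + of_int \<mu>) / 7"]
      by (auto intro: holomorphic_transform)
  qed
  then show "a7 v w holomorphic_on H" "Im \<tau> > 0 \<Longrightarrow> a7 v w \<tau> \<noteq> 0" by auto
qed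

lemma mod7_4: "(4 * v) mod 7 = 0 \<longleftrightarrow> v mod (7::int) = 0"
  by presburger

lemma nz7_4: 
  assumes "v mod 7 \<noteq> 0 \<or> w mod (7::int) \<noteq> 0"
  shows "(4 * v) mod 7 \<noteq> 0 \<or> w mod 7 \<noteq> 0" "v mod 7 \<noteq> 0 \<or> (4 * w) mod 7 \<noteq> 0" "v mod 7 \<noteq> 0 \<or> (4 * (w - v)) mod 7 \<noteq> 0"
  using assms mod_diff_right_eq[of w v 7] mod_diff_eq[of w 7 v] unfolding mod7_4 by auto

lemma a14_holomorphic_nonzero:
  assumes "v mod 7 \<noteq> 0 \<or> w mod 7 \<noteq> 0"
  shows "a14 i v w holomorphic_on H" "Im \<tau> > 0 \<Longrightarrow> a14 i v w \<tau> \<noteq> 0"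
proof -
  note nz = nz7_4[OF assms]
  have c: "(\<lambda>\<tau>. a7 v w (f \<tau>)) holomorphic_on H"
    if "v mod 7 \<noteq> 0 \<or> w mod 7 \<noteq> 0" "f holomorphic_on H" "\<And>z. z \<in> H \<Longrightarrow> Im (f z) > 0" for v w f
    using holomorphic_on_compose_gen[OF that(2) a7_holomorphic_nonzero(1)[OF that(1)]] that(3) by (auto simp: o_def)
  have "(\<lambda>\<tau>. a7 (4 * v) w (2 * \<tau>)) holomorphic_on H" "(\<lambda>\<tau>. 8 * a7 v (4 * w) (\<tau> / 2)) holomorphic_on H"
    "(\<lambda>\<tau>. 8 * a7 v (4 * (w - v)) ((\<tau> + 1) / 2)) holomorphic_on H"
    using nz by (intro holomorphic_intros c; simp)+
  then show "a14 i v w holomorphic_on H" unfolding a14_def by (cases "i = 2"; cases "i = 0"; simp)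
  show "a14 i v w \<tau> \<noteq> 0" if "Im \<tau> > 0"
    using that nz a7_holomorphic_nonzero(2) by (auto simp: a14_def)
qed

lemma d2_holomorphic_nonzero:
  shows "d2 i holomorphic_on H" "Im \<tau> > 0 \<Longrightarrow> d2 i \<tau> \<noteq> 0"
proof -
  have "(\<lambda>\<tau>. dl (2 * \<tau>)) holomorphic_on H" "(\<lambda>\<tau>. dl (\<tau> / 2) / 4096) holomorphic_on H" "(\<lambda>\<tau>. dl ((\<tau> + 1) / 2) / 4096) holomorphic_on H"
    by (intro holomorphic_intros; simp)+
  then show "d2 i holomorphic_on H" unfolding d2_def by (cases "i = 2"; cases "i = 0"; simp)
  show "d2 i \<tau> \<noteq> 0" if "Im \<tau> > 0" using that by (auto simp: d2_def dl_nonzero)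
qed

section \<open>Families at level 14\<close>

text \<open>The weights of \<open>a7\<close> and \<open>dl\<close> cancel, here and in
  \<open>uw\<close> and \<open>upw\<close>. At (2, 0, 1) the functions \<open>Tw\<close> and
  \<open>uw\<close> are 49 \<open>TT\<close> and 49 \<open>mod_u\<close>; at (2, 1, r) the functions
  \<open>Tw\<close> and \<open>upw\<close> are 1 / \<open>TT\<close> and \<open>mod_u\<close> taken
  at (\<tau> + r)/7, so the summands of the Atkin operator belong to such families too.\<close>

definition Tw :: "nat \<Rightarrow> int \<Rightarrow> int \<Rightarrow> complex \<Rightarrow> complex" where
  "Tw i v w \<tau> = a7 v w \<tau> ^ 4 * dl \<tau>"

definition uw :: "nat \<Rightarrow> int \<Rightarrow> int \<Rightarrow> complex \<Rightarrow> complex" where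
  "uw i v w \<tau> = a14 i v w \<tau> ^ 7 * d2 i \<tau> ^ 2 / (a7 v w \<tau> ^ 3 * dl \<tau>)"

definition upw :: "nat \<Rightarrow> int \<Rightarrow> int \<Rightarrow> complex \<Rightarrow> complex" where
  "upw i v w \<tau> = 1 / (a14 i v w \<tau> * a7 v w \<tau> ^ 3 * dl \<tau>)"

text \<open>The kernel that represents \<open>mod_A\<close> at (\<tau> + r)/7 up to a constant. It
  depends on two index pairs at once, and the odd power of \<open>a7\<close> makes it sensitive to
  the sign of each.\<close>

definition Dw :: "nat \<Rightarrow> int \<Rightarrow> int \<Rightarrow> int \<Rightarrow> int \<Rightarrow> complex \<Rightarrow> complex" where
  "Dw i v w p r \<tau> = (a14 i p r \<tau> / a14 i v w \<tau>) ^ 2 * (a7 v w \<tau> / a7 p r \<tau>) ^ 5"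

abbreviation nz7 :: "int \<Rightarrow> int \<Rightarrow> bool" where "nz7 v w \<equiv> v mod 7 \<noteq> 0 \<or> w mod 7 \<noteq> 0"

text \<open>The clauses on doubling and negation bring every index with v = 0 mod 7 to (0, 1), so
  growth has to be checked there for few members only.\<close>

definition MF :: "(nat \<Rightarrow> int \<Rightarrow> int \<Rightarrow> complex \<Rightarrow> complex) \<Rightarrow> bool" where
  "MF f \<longleftrightarrow> (\<forall>i v w. i < 3 \<longrightarrow> nz7 v w \<longrightarrow> f i v w holomorphic_on H \<and>
     (\<forall>\<tau>. Im \<tau> > 0 \<longrightarrow> f i v w (\<tau> + 1) = f (tI i) v (v + w) \<tau> \<and> f i v w (- 1 / \<tau>) = f (sI i) w (- v) \<tau> \<and>
       (\<forall>v' w'. v' mod 7 = v mod 7 \<longrightarrow> w' mod 7 = w mod 7 \<longrightarrow> f i v' w' \<tau> = f i v w \<tau>) \<and>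
       f i (2 * v) (2 * w) \<tau> = f i v w \<tau> \<and> f i (- v) (- w) \<tau> = f i v w \<tau>))"

lemma MF_I:
  assumes "\<And>i v w. i < 3 \<Longrightarrow> nz7 v w \<Longrightarrow> f i v w holomorphic_on H"
    and "\<And>i v w \<tau>. i < 3 \<Longrightarrow> nz7 v w \<Longrightarrow> Im \<tau> > 0 \<Longrightarrow> f i v w (\<tau> + 1) = f (tI i) v (v + w) \<tau>"
    and "\<And>i v w \<tau>. i < 3 \<Longrightarrow> nz7 v w \<Longrightarrow> Im \<tau> > 0 \<Longrightarrow> f i v w (- 1 / \<tau>) = f (sI i) w (- v) \<tau>"
    and "\<And>i v w v' w' \<tau>. i < 3 \<Longrightarrow> nz7 v w \<Longrightarrow> Im \<tau> > 0 \<Longrightarrow> v' mod 7 = v mod 7 \<Longrightarrow> w' mod 7 = w mod 7 \<Longrightarrow> f i v' w' \<tau> = f i v w \<tau>"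
    and "\<And>i v w \<tau>. i < 3 \<Longrightarrow> nz7 v w \<Longrightarrow> Im \<tau> > 0 \<Longrightarrow> f i (2 * v) (2 * w) \<tau> = f i v w \<tau>"
    and "\<And>i v w \<tau>. i < 3 \<Longrightarrow> nz7 v w \<Longrightarrow> Im \<tau> > 0 \<Longrightarrow> f i (- v) (- w) \<tau> = f i v w \<tau>"
  shows "MF f"
  unfolding MF_def by (intro allI impI conjI) (fact assms)+

lemma MF_D:
  assumes "MF f" "i < 3" "nz7 v w"
  shows "f i v w holomorphic_on H"
    and "Im \<tau> > 0 \<Longrightarrow> f i v w (\<tau> + 1) = f (tI i) v (v + w) \<tau>"
    and "Im \<tau> > 0 \<Longrightarrow> f i v w (- 1 / \<tau>) = f (sI i) w (- v) \<tau>"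
    and "Im \<tau> > 0 \<Longrightarrow> v' mod 7 = v mod 7 \<Longrightarrow> w' mod 7 = w mod 7 \<Longrightarrow> f i v' w' \<tau> = f i v w \<tau>"
    and "Im \<tau> > 0 \<Longrightarrow> f i (2 * v) (2 * w) \<tau> = f i v w \<tau>"
    and "Im \<tau> > 0 \<Longrightarrow> f i (- v) (- w) \<tau> = f i v w \<tau>"
proof -
  have "f i v w holomorphic_on H \<and>
     (\<forall>\<tau>. Im \<tau> > 0 \<longrightarrow> f i v w (\<tau> + 1) = f (tI i) v (v + w) \<tau> \<and> f i v w (- 1 / \<tau>) = f (sI i) w (- v) \<tau> \<and>
       (\<forall>v' w'. v' mod 7 = v mod 7 \<longrightarrow> w' mod 7 = w mod 7 \<longrightarrow> f i v' w' \<tau> = f i v w \<tau>) \<and>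
       f i (2 * v) (2 * w) \<tau> = f i v w \<tau> \<and> f i (- v) (- w) \<tau> = f i v w \<tau>)"
    by (rule assms(1)[unfolded MF_def, THEN spec, THEN spec, THEN spec, THEN mp, THEN mp, OF assms(2,3)])
  then show "f i v w holomorphic_on H"
    and "Im \<tau> > 0 \<Longrightarrow> f i v w (\<tau> + 1) = f (tI i) v (v + w) \<tau>"
    and "Im \<tau> > 0 \<Longrightarrow> f i v w (- 1 / \<tau>) = f (sI i) w (- v) \<tau>"
    and "Im \<tau> > 0 \<Longrightarrow> v' mod 7 = v mod 7 \<Longrightarrow> w' mod 7 = w mod 7 \<Longrightarrow> f i v' w' \<tau> = f i v w \<tau>"
    and "Im \<tau> > 0 \<Longrightarrow> f i (2 * v) (2 * w) \<tau> = f i v w \<tau>"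
    and "Im \<tau> > 0 \<Longrightarrow> f i (- v) (- w) \<tau> = f i v w \<tau>" by blast+
qed

lemma MF_const: "MF (\<lambda>i v w \<tau>. c)"
  by (rule MF_I) auto

lemma MF_comp2:
  assumes f: "MF f" and g: "MF g"
    and hol: "\<And>a b. a holomorphic_on H \<Longrightarrow> b holomorphic_on H \<Longrightarrow> (\<lambda>\<tau>. op (a \<tau>) (b \<tau>)) holomorphic_on H"
  shows "MF (\<lambda>i v w \<tau>. op (f i v w \<tau>) (g i v w \<tau>))"
proof (rule MF_I, goal_cases)
  case (1 i v w)
  then show ?case by (intro hol MF_D(1)[OF f] MF_D(1)[OF g])
next
  case (2 i v w \<tau>)
  show ?case by (simp only: MF_D(2)[OF f 2] MF_D(2)[OF g 2])
next
  case (3 i v w \<tau>)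
  show ?case by (simp only: MF_D(3)[OF f 3] MF_D(3)[OF g 3])
next
  case (4 i v w v' w' \<tau>)
  show ?case by (simp only: MF_D(4)[OF f 4] MF_D(4)[OF g 4])
next
  case (5 i v w \<tau>)
  show ?case by (simp only: MF_D(5)[OF f 5] MF_D(5)[OF g 5])
next
  case (6 i v w \<tau>)
  show ?case by (simp only: MF_D(6)[OF f 6] MF_D(6)[OF g 6])
qed

lemma MF_add: "MF f \<Longrightarrow> MF g \<Longrightarrow> MF (\<lambda>i v w \<tau>. f i v w \<tau> + g i v w \<tau>)"
  by (rule MF_comp2) (auto intro: holomorphic_intros)

lemma MF_diff: "MF f \<Longrightarrow> MF g \<Longrightarrow> MF (\<lambda>i v w \<tau>. f i v w \<tau> - g i v w \<tau>)"
  by (rule MF_comp2) (auto intro: holomorphic_intros)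

lemma MF_mult: "MF f \<Longrightarrow> MF g \<Longrightarrow> MF (\<lambda>i v w \<tau>. f i v w \<tau> * g i v w \<tau>)"
  by (rule MF_comp2) (auto intro: holomorphic_intros)

lemma MF_power: "MF f \<Longrightarrow> MF (\<lambda>i v w \<tau>. f i v w \<tau> ^ n)"
  by (induction n) (auto intro: MF_const MF_mult)

lemma MF_sum_list: "(\<And>x. x \<in> set xs \<Longrightarrow> MF (f x)) \<Longrightarrow> MF (\<lambda>i v w \<tau>. \<Sum>x\<leftarrow>xs. f x i v w \<tau>)"
  by (induction xs) (auto intro: MF_const MF_add)

lemma MF_divide:
  assumes f: "MF f" and g: "MF g" and nz: "\<And>i v w \<tau>. i < 3 \<Longrightarrow> nz7 v w \<Longrightarrow> Im \<tau> > 0 \<Longrightarrow> g i v w \<tau> \<noteq> 0"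
  shows "MF (\<lambda>i v w \<tau>. f i v w \<tau> / g i v w \<tau>)"
proof (rule MF_I, goal_cases)
  case (1 i v w)
  then show ?case using nz by (intro holomorphic_intros MF_D(1)[OF f] MF_D(1)[OF g]) auto
next
  case (2 i v w \<tau>)
  show ?case by (simp only: MF_D(2)[OF f 2] MF_D(2)[OF g 2])
next
  case (3 i v w \<tau>)
  show ?case by (simp only: MF_D(3)[OF f 3] MF_D(3)[OF g 3])
next
  case (4 i v w v' w' \<tau>)
  show ?case by (simp only: MF_D(4)[OF f 4] MF_D(4)[OF g 4])
next
  case (5 i v w \<tau>)
  show ?case by (simp only: MF_D(5)[OF f 5] MF_D(5)[OF g 5])
next
  case (6 i v w \<tau>)
  show ?case by (simp only: MF_D(6)[OF f 6] MF_D(6)[OF g 6])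
qed

lemma nz_tau: "Im \<tau> > 0 \<Longrightarrow> \<tau> \<noteq> 0"
  by auto

lemma Tw_MF: "MF Tw"
proof (rule MF_I)
  fix i v w assume "i < (3::nat)" "nz7 v w"
  then show "Tw i v w holomorphic_on H"
    unfolding Tw_def by (intro holomorphic_intros a7_holomorphic_nonzero) auto
next
  fix i v w and \<tau> :: complex assume "i < (3::nat)" "nz7 v w" "Im \<tau> > 0"
  then show "Tw i v w (- 1 / \<tau>) = Tw (sI i) w (- v) \<tau>"
    unfolding Tw_def by (simp only: a7_S dl_S) (simp add: nz_tau power_divide power_mult [symmetric])
next
  fix i and v w v' w' :: int and \<tau> :: complex assume "Im \<tau> > 0" "v' mod 7 = v mod 7" "w' mod 7 = w mod 7"
  from a7_cong[OF this] show "Tw i v' w' \<tau> = Tw i v w \<tau>" by (simp add: Tw_def)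
qed (simp_all add: Tw_def a7_T dl_T a7_double a7_minus)

lemma uw_MF: "MF uw"
proof (rule MF_I)
  fix i v w assume "i < (3::nat)" "nz7 v w"
  then show "uw i v w holomorphic_on H"
    unfolding uw_def using a7_holomorphic_nonzero(2) dl_nonzero
    by (intro holomorphic_intros a7_holomorphic_nonzero(1) a14_holomorphic_nonzero(1) d2_holomorphic_nonzero(1)) auto
next
  fix i v w and \<tau> :: complex assume a: "i < (3::nat)" "nz7 v w" "Im \<tau> > 0"
  then show "uw i v w (- 1 / \<tau>) = uw (sI i) w (- v) \<tau>"
    unfolding uw_def by (simp only: a7_S dl_S a14_S d2_S)
      (simp add: nz_tau power_divide power_mult_distrib power_mult [symmetric] power_add [symmetric] divide_simps)
next
  fix i and v w v' w' :: int and \<tau> :: complex assume a: "Im \<tau> > 0" "v' mod 7 = v mod 7" "w' mod 7 = w mod 7"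
  from a7_cong[OF a] a14_cong[OF a, of i] show "uw i v' w' \<tau> = uw i v w \<tau>" by (simp add: uw_def)
qed (simp_all add: uw_def a7_T dl_T a7_double a7_minus a14_T a14_double a14_minus d2_T)

lemma upw_MF: "MF upw"
proof (rule MF_I)
  fix i v w assume "i < (3::nat)" "nz7 v w"
  then show "upw i v w holomorphic_on H"
    unfolding upw_def using a7_holomorphic_nonzero(2) a14_holomorphic_nonzero(2) dl_nonzero
    by (intro holomorphic_intros a7_holomorphic_nonzero(1) a14_holomorphic_nonzero(1)) auto
next
  fix i v w and \<tau> :: complex assume a: "i < (3::nat)" "nz7 v w" "Im \<tau> > 0"
  then show "upw i v w (- 1 / \<tau>) = upw (sI i) w (- v) \<tau>"
    unfolding upw_def by (simp only: a7_S dl_S a14_S)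
      (simp add: nz_tau power_divide power_mult_distrib power_mult [symmetric] power_add [symmetric] divide_simps)
next
  fix i and v w v' w' :: int and \<tau> :: complex assume a: "Im \<tau> > 0" "v' mod 7 = v mod 7" "w' mod 7 = w mod 7"
  from a7_cong[OF a] a14_cong[OF a, of i] show "upw i v' w' \<tau> = upw i v w \<tau>" by (simp add: upw_def)
qed (simp_all add: upw_def a7_T dl_T a7_double a7_minus a14_T a14_double a14_minus)

text \<open>Pairs of determinant -1 mod 7 with (v, w); for (0, 1) they are the seven pairs (1, r) of
  the Atkin operator. Fixing the determinant, and not merely the line of (p, r), also fixes the
  signs in \<open>Dw\<close>.\<close>

definition Sset :: "int \<Rightarrow> int \<Rightarrow> (int \<times> int) set" where
  "Sset v w = {(p, r). p \<in> {0..6} \<and> r \<in> {0..6} \<and> (v * r - w * p + 1) mod 7 = 0}"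

lemma finite_Sset: "finite (Sset v w)"
  by (rule finite_subset[of _ "{0..6} \<times> {0..6}"]) (auto simp: Sset_def)

lemma Sset_nz: "(p, r) \<in> Sset v w \<Longrightarrow> nz7 p r"
  by (auto simp: Sset_def)

text \<open>The entries \<open>a'\<close>, \<open>b'\<close>, \<open>c'\<close>, \<open>d'\<close>
  form the inverse matrix mod 7, and \<open>det\<close> says that the substitution carries one
  determinant condition into the other.\<close>

lemma sum_Sset_reindex:
  fixes h :: "int \<Rightarrow> int \<Rightarrow> complex"
  assumes per: "\<And>p r. nz7 p r \<Longrightarrow> h (p mod 7) (r mod 7) = h p r"
    and det: "\<And>p r. (v' * (c * p + d * r) - w' * (a * p + b * r) - (v * r - w * p)) mod 7 = 0"
    and inv: "\<And>p r. (a' * (a * p + b * r) + b' * (c * p + d * r) - p) mod 7 = 0"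
      "\<And>p r. (c' * (a * p + b * r) + d' * (c * p + d * r) - r) mod 7 = 0"
      "\<And>p r. (a * (a' * p + b' * r) + b * (c' * p + d' * r) - p) mod 7 = 0"
      "\<And>p r. (c * (a' * p + b' * r) + d * (c' * p + d' * r) - r) mod 7 = 0"
  shows "(\<Sum>(p, r)\<in>Sset v w. h (a * p + b * r) (c * p + d * r)) = (\<Sum>(p, r)\<in>Sset v' w'. h p r)"
proof -
  have meq: "x mod 7 = y mod 7" if "(x - y) mod 7 = 0" for x y :: int
    using that by (simp add: mod_eq_dvd_iff mod_eq_0_iff_dvd)
  have red: "(x * (y mod 7) + z * (u mod 7)) mod 7 = (x * y + z * u) mod 7" for x y z u :: int
    by (intro mod_add_cong mod_mult_cong refl mod_mod_trivial)
  define A where "A = (\<lambda>(p, r). ((a * p + b * r) mod 7, (c * p + d * r) mod 7))"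
  define B where "B = (\<lambda>(p, r). ((a' * p + b' * r) mod 7, (c' * p + d' * r) mod 7))"
  have BA: "B (A (p, r)) = (p mod 7, r mod 7)" for p r
    unfolding A_def B_def by (auto simp: red intro!: meq inv)
  have AB: "A (B (p, r)) = (p mod 7, r mod 7)" for p r
    unfolding A_def B_def by (auto simp: red intro!: meq inv)
  have small: "p mod 7 = p" if "p \<in> {0..6}" for p :: int using that by auto
  have bd7: "x mod 7 \<le> 6" for x :: int using pos_mod_bound[of 7 x] by simp
  have memA: "A (p, r) \<in> Sset v' w'" if "(p, r) \<in> Sset v w" for p r
  proof -
    have "(v' * ((c * p + d * r) mod 7) - w' * ((a * p + b * r) mod 7) + 1) mod 7 = (v' * (c * p + d * r) - w' * (a * p + b * r) + 1) mod 7"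
      by (intro mod_add_cong mod_diff_cong mod_mult_cong refl mod_mod_trivial mod_mod_trivial[symmetric])
    also have "\<dots> = (v * r - w * p + 1) mod 7"
      using det[of p r] by (intro meq) (simp add: algebra_simps)
    also have "\<dots> = 0" using that by (simp add: Sset_def)
    finally show ?thesis by (simp add: A_def Sset_def bd7)
  qed
  have memB: "B (p, r) \<in> Sset v w" if "(p, r) \<in> Sset v' w'" for p r
  proof -
    define x y where "x = (a' * p + b' * r) mod 7" and "y = (c' * p + d' * r) mod 7"
    have AB': "A (x, y) = (p, r)" using AB[of p r] that small by (auto simp: B_def x_def y_def Sset_def)
    have "(v * y - w * x + 1) mod 7 = (v' * (c * x + d * y) - w' * (a * x + b * y) + 1) mod 7"
      using det[of x y] by (intro meq[symmetric]) (simp add: algebra_simps)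
    also have "\<dots> = (v' * ((c * x + d * y) mod 7) - w' * ((a * x + b * y) mod 7) + 1) mod 7"
      by (intro mod_add_cong mod_diff_cong mod_mult_cong refl mod_mod_trivial mod_mod_trivial[symmetric])
    also have "\<dots> = (v' * r - w' * p + 1) mod 7" using AB' by (simp add: A_def)
    also have "\<dots> = 0" using that by (simp add: Sset_def)
    finally show ?thesis by (simp add: B_def Sset_def x_def y_def bd7)
  qed
  show ?thesis
  proof (rule sum.reindex_bij_witness[of _ B A])
    fix x assume x: "x \<in> Sset v w"
    obtain p r where pr: "x = (p, r)" by (cases x)
    show "B (A x) = x" using BA[of p r] x small pr by (auto simp: Sset_def)
    show "A x \<in> Sset v' w'" using memA x pr by simp
    have "nz7 ((a * p + b * r) mod 7) ((c * p + d * r) mod 7)"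
      using Sset_nz[of "(a * p + b * r) mod 7" "(c * p + d * r) mod 7" v' w'] memA[of p r] x pr by (simp add: A_def)
    then show "(case A x of (p, r) \<Rightarrow> h p r) = (case x of (p, r) \<Rightarrow> h (a * p + b * r) (c * p + d * r))"
      using per[of "a * p + b * r" "c * p + d * r"] by (simp add: A_def pr)
  next
    fix x assume x: "x \<in> Sset v' w'"
    obtain p r where pr: "x = (p, r)" by (cases x)
    show "A (B x) = x" using AB[of p r] x small pr by (auto simp: Sset_def)
    show "B x \<in> Sset v w" using memB x pr by simp
  qed
qed

lemma MF_Sset_sum:
  fixes K :: "nat \<Rightarrow> int \<Rightarrow> int \<Rightarrow> int \<Rightarrow> int \<Rightarrow> complex \<Rightarrow> complex"
  assumes hol: "\<And>i v w p r. i < 3 \<Longrightarrow> nz7 v w \<Longrightarrow> nz7 p r \<Longrightarrow> K i v w p r holomorphic_on H"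
    and T: "\<And>i v w p r \<tau>. i < 3 \<Longrightarrow> nz7 v w \<Longrightarrow> nz7 p r \<Longrightarrow> Im \<tau> > 0 \<Longrightarrow> K i v w p r (\<tau> + 1) = K (tI i) v (v + w) p (p + r) \<tau>"
    and S: "\<And>i v w p r \<tau>. i < 3 \<Longrightarrow> nz7 v w \<Longrightarrow> nz7 p r \<Longrightarrow> Im \<tau> > 0 \<Longrightarrow> K i v w p r (- 1 / \<tau>) = K (sI i) w (- v) r (- p) \<tau>"
    and cong: "\<And>i v w p r v' w' p' r' \<tau>. i < 3 \<Longrightarrow> Im \<tau> > 0 \<Longrightarrow> v' mod 7 = v mod 7 \<Longrightarrow> w' mod 7 = w mod 7 \<Longrightarrow>
       p' mod 7 = p mod 7 \<Longrightarrow> r' mod 7 = r mod 7 \<Longrightarrow> K i v' w' p' r' \<tau> = K i v w p r \<tau>"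
    and dbl: "\<And>i v w p r \<tau>. i < 3 \<Longrightarrow> nz7 v w \<Longrightarrow> nz7 p r \<Longrightarrow> Im \<tau> > 0 \<Longrightarrow> K i (2 * v) (2 * w) (4 * p) (4 * r) \<tau> = K i v w p r \<tau>"
    and neg: "\<And>i v w p r \<tau>. i < 3 \<Longrightarrow> nz7 v w \<Longrightarrow> nz7 p r \<Longrightarrow> Im \<tau> > 0 \<Longrightarrow> K i (- v) (- w) (- p) (- r) \<tau> = K i v w p r \<tau>"
  shows "MF (\<lambda>i v w \<tau>. \<Sum>(p, r)\<in>Sset v w. K i v w p r \<tau>)"
proof (rule MF_I)
  fix i v w assume a: "i < (3::nat)" "nz7 v w"
  have "(\<lambda>\<tau>. case x of (p, r) \<Rightarrow> K i v w p r \<tau>) holomorphic_on H" if "x \<in> Sset v w" for x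
    using that Sset_nz[of "fst x" "snd x" v w] hol[OF a, of "fst x" "snd x"] by (cases x) simp
  then show "(\<lambda>\<tau>. \<Sum>(p, r)\<in>Sset v w. K i v w p r \<tau>) holomorphic_on H" by (intro holomorphic_on_sum)
next
  fix i v w and \<tau> :: complex assume a: "i < (3::nat)" "nz7 v w" "Im \<tau> > 0"
  have "(\<Sum>(p, r)\<in>Sset v w. K i v w p r (\<tau> + 1)) = (\<Sum>(p, r)\<in>Sset v w. K (tI i) v (v + w) (1 * p + 0 * r) (1 * p + 1 * r) \<tau>)"
    by (rule sum.cong) (use T[OF a(1,2) Sset_nz a(3)] in auto)
  also have "\<dots> = (\<Sum>(p, r)\<in>Sset v (v + w). K (tI i) v (v + w) p r \<tau>)"
    by (rule sum_Sset_reindex[where a' = 1 and b' = 0 and c' = "-1" and d' = 1])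
       (auto simp: algebra_simps intro: cong[OF tI_less[OF a(1)] a(3)])
  finally show "(\<Sum>(p, r)\<in>Sset v w. K i v w p r (\<tau> + 1)) = (\<Sum>(p, r)\<in>Sset v (v + w). K (tI i) v (v + w) p r \<tau>)" .
  have "(\<Sum>(p, r)\<in>Sset v w. K i v w p r (- 1 / \<tau>)) = (\<Sum>(p, r)\<in>Sset v w. K (sI i) w (- v) (0 * p + 1 * r) (- 1 * p + 0 * r) \<tau>)"
    by (rule sum.cong) (use S[OF a(1,2) Sset_nz a(3)] in auto)
  also have "\<dots> = (\<Sum>(p, r)\<in>Sset w (- v). K (sI i) w (- v) p r \<tau>)"
    by (rule sum_Sset_reindex[where a' = 0 and b' = "-1" and c' = 1 and d' = 0])
       (auto simp: algebra_simps intro: cong[OF sI_less[OF a(1)] a(3)])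
  finally show "(\<Sum>(p, r)\<in>Sset v w. K i v w p r (- 1 / \<tau>)) = (\<Sum>(p, r)\<in>Sset w (- v). K (sI i) w (- v) p r \<tau>)" .
  \<comment> \<open>Since 2 * 4 = 1 mod 7, scaling (p, r) by 4 keeps the determinant when (v, w) is
    doubled.\<close>
  have "(\<Sum>(p, r)\<in>Sset v w. K i v w p r \<tau>) = (\<Sum>(p, r)\<in>Sset v w. K i (2 * v) (2 * w) (4 * p + 0 * r) (0 * p + 4 * r) \<tau>)"
    by (rule sum.cong) (use dbl[OF a(1,2) Sset_nz a(3)] in auto)
  also have "\<dots> = (\<Sum>(p, r)\<in>Sset (2 * v) (2 * w). K i (2 * v) (2 * w) p r \<tau>)"
    by (rule sum_Sset_reindex[where a' = 2 and b' = 0 and c' = 0 and d' = 2])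
       (auto simp: algebra_simps mod_eq_0_iff_dvd intro: cong[OF a(1,3)])
  finally show "(\<Sum>(p, r)\<in>Sset (2 * v) (2 * w). K i (2 * v) (2 * w) p r \<tau>) = (\<Sum>(p, r)\<in>Sset v w. K i v w p r \<tau>)" ..
  have "(\<Sum>(p, r)\<in>Sset v w. K i v w p r \<tau>) = (\<Sum>(p, r)\<in>Sset v w. K i (- v) (- w) (- 1 * p + 0 * r) (0 * p + - 1 * r) \<tau>)"
    by (rule sum.cong) (use neg[OF a(1,2) Sset_nz a(3)] in auto)
  also have "\<dots> = (\<Sum>(p, r)\<in>Sset (- v) (- w). K i (- v) (- w) p r \<tau>)"
    by (rule sum_Sset_reindex[where a' = "- 1" and b' = 0 and c' = 0 and d' = "- 1"])
       (auto simp: algebra_simps intro: cong[OF a(1,3)])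
  finally show "(\<Sum>(p, r)\<in>Sset (- v) (- w). K i (- v) (- w) p r \<tau>) = (\<Sum>(p, r)\<in>Sset v w. K i v w p r \<tau>)" ..
next
  fix i and v w v' w' :: int and \<tau> :: complex assume a: "i < (3::nat)" "nz7 v w" "Im \<tau> > 0" "v' mod 7 = v mod 7" "w' mod 7 = w mod 7"
  have "(v' * r - w' * p + 1) mod 7 = (v * r - w * p + 1) mod 7" for p r
    by (intro mod_add_cong mod_diff_cong mod_mult_cong a refl)
  then have "Sset v' w' = Sset v w" by (simp add: Sset_def)
  moreover have "K i v' w' p r \<tau> = K i v w p r \<tau>" for p r by (rule cong) (use a in auto)
  ultimately show "(\<Sum>(p, r)\<in>Sset v' w'. K i v' w' p r \<tau>) = (\<Sum>(p, r)\<in>Sset v w. K i v w p r \<tau>)" by simp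
qed

section \<open>Growth at the cusps\<close>

definition qb :: "(complex \<Rightarrow> complex) \<Rightarrow> real \<Rightarrow> bool" where
  "qb f r \<longleftrightarrow> (\<exists>C. \<forall>\<tau>. Im \<tau> \<ge> 1/2 \<longrightarrow> norm (f \<tau>) \<le> C * exp (- 2 * pi * r * Im \<tau>))"

text \<open>The exact order in q at infinity, possibly fractional. The lower bound is what permits
  such a function in a denominator.\<close>

definition qo :: "(complex \<Rightarrow> complex) \<Rightarrow> real \<Rightarrow> bool" where
  "qo f r \<longleftrightarrow> (\<exists>c C. c > 0 \<and> (\<forall>\<tau>. Im \<tau> \<ge> 1/2 \<longrightarrow>
     c * exp (- 2 * pi * r * Im \<tau>) \<le> norm (f \<tau>) \<and> norm (f \<tau>) \<le> C * exp (- 2 * pi * r * Im \<tau>)))"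

lemma qo_qb: "qo f r \<Longrightarrow> qb f r"
  by (auto simp: qo_def qb_def)

lemma qb_nonneg_const:
  assumes "qb f r"
  obtains C where "C \<ge> 0" "\<And>\<tau>. Im \<tau> \<ge> 1/2 \<Longrightarrow> norm (f \<tau>) \<le> C * exp (- 2 * pi * r * Im \<tau>)"
proof -
  obtain C where C: "\<And>\<tau>. Im \<tau> \<ge> 1/2 \<Longrightarrow> norm (f \<tau>) \<le> C * exp (- 2 * pi * r * Im \<tau>)"
    using assms by (auto simp: qb_def)
  have "0 \<le> C * exp (- 2 * pi * r * Im \<i>)" by (rule order_trans[OF norm_ge_zero C[of \<i>]]) simp
  then have "C \<ge> 0" by (simp add: zero_le_mult_iff)
  with C show ?thesis using that by blast
qed

lemma qb_mono:
  assumes "qb f r" "r' \<le> r"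
  shows "qb f r'"
proof -
  obtain C where C: "C \<ge> 0" "\<And>\<tau>. Im \<tau> \<ge> 1/2 \<Longrightarrow> norm (f \<tau>) \<le> C * exp (- 2 * pi * r * Im \<tau>)"
    using qb_nonneg_const[OF assms(1)] by blast
  have "C * exp (- 2 * pi * r * Im \<tau>) \<le> C * exp (- 2 * pi * r' * Im \<tau>)" if "Im \<tau> \<ge> 1/2" for \<tau>
    using assms(2) that C(1) by (intro mult_left_mono) (auto intro!: mult_right_mono mult_left_mono)
  then show ?thesis unfolding qb_def using C(2) order_trans by blast
qed

lemma qb_add: "qb f r \<Longrightarrow> qb g r \<Longrightarrow> qb (\<lambda>\<tau>. f \<tau> + g \<tau>) r"
proof -
  assume "qb f r" "qb g r"
  then obtain C D where "\<And>\<tau>. Im \<tau> \<ge> 1/2 \<Longrightarrow> norm (f \<tau>) \<le> C * exp (- 2 * pi * r * Im \<tau>)"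
    "\<And>\<tau>. Im \<tau> \<ge> 1/2 \<Longrightarrow> norm (g \<tau>) \<le> D * exp (- 2 * pi * r * Im \<tau>)" unfolding qb_def by blast
  then have "norm (f \<tau> + g \<tau>) \<le> (C + D) * exp (- 2 * pi * r * Im \<tau>)" if "Im \<tau> \<ge> 1/2" for \<tau>
    using that norm_triangle_mono[of "f \<tau>" _ "g \<tau>"] by (simp add: distrib_right)
  then show ?thesis unfolding qb_def by blast
qed

lemma qb_mult:
  assumes "qb f r" "qb g s"
  shows "qb (\<lambda>\<tau>. f \<tau> * g \<tau>) (r + s)"
proof -
  obtain C where C: "C \<ge> 0" "\<And>\<tau>. Im \<tau> \<ge> 1/2 \<Longrightarrow> norm (f \<tau>) \<le> C * exp (- 2 * pi * r * Im \<tau>)"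
    using qb_nonneg_const[OF assms(1)] by blast
  obtain D where D: "D \<ge> 0" "\<And>\<tau>. Im \<tau> \<ge> 1/2 \<Longrightarrow> norm (g \<tau>) \<le> D * exp (- 2 * pi * s * Im \<tau>)"
    using qb_nonneg_const[OF assms(2)] by blast
  have "norm (f \<tau> * g \<tau>) \<le> (C * D) * exp (- 2 * pi * (r + s) * Im \<tau>)" if "Im \<tau> \<ge> 1/2" for \<tau>
  proof -
    have "norm (f \<tau> * g \<tau>) \<le> (C * exp (- 2 * pi * r * Im \<tau>)) * (D * exp (- 2 * pi * s * Im \<tau>))"
      unfolding norm_mult using C D that by (intro mult_mono) auto
    also have "\<dots> = (C * D) * exp (- 2 * pi * (r + s) * Im \<tau>)"
      by (simp add: exp_add [symmetric] algebra_simps)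
    finally show ?thesis .
  qed
  then show ?thesis unfolding qb_def by blast
qed

lemma qb_const: "qb (\<lambda>\<tau>. c) 0"
  unfolding qb_def by (intro exI[of _ "norm c"]) simp

lemma qb_cmult: "qb f r \<Longrightarrow> qb (\<lambda>\<tau>. c * f \<tau>) r"
  using qb_mult[OF qb_const, of f r c] by simp

lemma qb_diff: "qb f r \<Longrightarrow> qb g r \<Longrightarrow> qb (\<lambda>\<tau>. f \<tau> - g \<tau>) r"
  using qb_add[of f r "\<lambda>\<tau>. (-1) * g \<tau>"] qb_cmult[of g r "-1"] by simp

lemma qb_power: "qb f r \<Longrightarrow> qb (\<lambda>\<tau>. f \<tau> ^ n) (real n * r)"
proof (induction n)
  case 0
  then show ?case using qb_const[of 1] by simp
next
  case (Suc n)
  then show ?case using qb_mult[of f r "\<lambda>\<tau>. f \<tau> ^ n" "real n * r"] by (simp add: algebra_simps)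
qed

lemma qb_zero: "qb (\<lambda>\<tau>. 0) r"
  unfolding qb_def by (intro exI[of _ 0]) simp

lemma qb_sum_list: "(\<And>x. x \<in> set xs \<Longrightarrow> qb (f x) r) \<Longrightarrow> qb (\<lambda>\<tau>. \<Sum>x\<leftarrow>xs. f x \<tau>) r"
  by (induction xs) (auto intro: qb_zero qb_add)

lemma qb_sum: "finite A \<Longrightarrow> (\<And>x. x \<in> A \<Longrightarrow> qb (f x) r) \<Longrightarrow> qb (\<lambda>\<tau>. \<Sum>x\<in>A. f x \<tau>) r"
  by (induction A rule: finite_induct) (auto intro: qb_zero qb_add)

lemma qo_mult:
  assumes "qo f r" "qo g s"
  shows "qo (\<lambda>\<tau>. f \<tau> * g \<tau>) (r + s)"
proof -
  obtain c C where c: "c > 0" "\<And>\<tau>. Im \<tau> \<ge> 1/2 \<Longrightarrow> c * exp (- 2 * pi * r * Im \<tau>) \<le> norm (f \<tau>)"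
    using assms(1) by (auto simp: qo_def)
  obtain d D where d: "d > 0" "\<And>\<tau>. Im \<tau> \<ge> 1/2 \<Longrightarrow> d * exp (- 2 * pi * s * Im \<tau>) \<le> norm (g \<tau>)"
    using assms(2) by (auto simp: qo_def)
  have "(c * d) * exp (- 2 * pi * (r + s) * Im \<tau>) \<le> norm (f \<tau> * g \<tau>)" if "Im \<tau> \<ge> 1/2" for \<tau>
  proof -
    have "(c * d) * exp (- 2 * pi * (r + s) * Im \<tau>) = (c * exp (- 2 * pi * r * Im \<tau>)) * (d * exp (- 2 * pi * s * Im \<tau>))"
      by (simp add: exp_add [symmetric] algebra_simps)
    also have "\<dots> \<le> norm (f \<tau> * g \<tau>)"
      unfolding norm_mult using c d that by (intro mult_mono) auto
    finally show ?thesis .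
  qed
  moreover obtain E where "\<And>\<tau>. Im \<tau> \<ge> 1/2 \<Longrightarrow> norm (f \<tau> * g \<tau>) \<le> E * exp (- 2 * pi * (r + s) * Im \<tau>)"
    using qb_mult[OF qo_qb[OF assms(1)] qo_qb[OF assms(2)]] by (auto simp: qb_def)
  moreover have "c * d > 0" using c d by simp
  ultimately show ?thesis unfolding qo_def by blast
qed

lemma qo_const: "c \<noteq> 0 \<Longrightarrow> qo (\<lambda>\<tau>. c) 0"
  unfolding qo_def by (intro exI[of _ "norm c"]) simp

lemma qo_power: "qo f r \<Longrightarrow> qo (\<lambda>\<tau>. f \<tau> ^ n) (real n * r)"
proof (induction n)
  case 0
  then show ?case using qo_const[of 1] by simp
next
  case (Suc n)
  then show ?case using qo_mult[of f r "\<lambda>\<tau>. f \<tau> ^ n" "real n * r"] by (simp add: algebra_simps)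
qed

lemma qo_inverse:
  assumes "qo f r"
  shows "qo (\<lambda>\<tau>. inverse (f \<tau>)) (- r)"
proof -
  obtain c C where c: "c > 0" "\<And>\<tau>. Im \<tau> \<ge> 1/2 \<Longrightarrow> c * exp (- 2 * pi * r * Im \<tau>) \<le> norm (f \<tau>)"
    "\<And>\<tau>. Im \<tau> \<ge> 1/2 \<Longrightarrow> norm (f \<tau>) \<le> C * exp (- 2 * pi * r * Im \<tau>)"
    using assms by (auto simp: qo_def)
  have "c * exp (- 2 * pi * r * Im \<i>) \<le> C * exp (- 2 * pi * r * Im \<i>)" by (rule order_trans[OF c(2)[of \<i>] c(3)[of \<i>]]) simp_all
  then have C: "C > 0" using c(1) by simp
  have "inverse C * exp (- 2 * pi * (- r) * Im \<tau>) \<le> norm (inverse (f \<tau>)) \<and> norm (inverse (f \<tau>)) \<le> inverse c * exp (- 2 * pi * (- r) * Im \<tau>)"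
    if t: "Im \<tau> \<ge> 1/2" for \<tau>
  proof -
    have e: "inverse K * exp (- 2 * pi * (- r) * Im \<tau>) = inverse (K * exp (- 2 * pi * r * Im \<tau>))" for K
      by (simp add: exp_minus inverse_mult_distrib)
    have pos: "c * exp (- 2 * pi * r * Im \<tau>) > 0" using c(1) by simp
    show ?thesis unfolding e norm_inverse using c(2,3)[OF t] pos
      by (intro conjI le_imp_inverse_le) linarith+
  qed
  then show ?thesis unfolding qo_def using C by (intro exI[of _ "inverse C"] exI[of _ "inverse c"]) auto
qed

lemma qo_divide: "qo f r \<Longrightarrow> qo g s \<Longrightarrow> qo (\<lambda>\<tau>. f \<tau> / g \<tau>) (r - s)"
  using qo_mult[OF _ qo_inverse, of f r g s] by (simp add: divide_inverse)

lemma qo_cong: "qo f r \<Longrightarrow> (\<And>\<tau>. Im \<tau> \<ge> 1/2 \<Longrightarrow> g \<tau> = f \<tau>) \<Longrightarrow> r = s \<Longrightarrow> qo g s"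
  by (auto simp: qo_def)

lemma qb_cong: "qb f r \<Longrightarrow> (\<And>\<tau>. Im \<tau> \<ge> 1/2 \<Longrightarrow> g \<tau> = f \<tau>) \<Longrightarrow> qb g r"
  by (auto simp: qb_def)

lemma qo_nome: "(\<And>\<tau>. Im (g \<tau>) = k * Im \<tau>) \<Longrightarrow> qo (\<lambda>\<tau>. nome (g \<tau>)) k"
  unfolding qo_def norm_nome by (intro exI[of _ 1]) (simp add: mult.assoc)

lemma qo_eul:
  assumes "\<And>\<tau>. Im (g \<tau>) = k * Im \<tau>" "k > 0"
  shows "qo (\<lambda>\<tau>. eul (nome (g \<tau>))) 0"
proof -
  define h where "h = k / 2"
  have h: "h > 0" using assms by (simp add: h_def)
  have "exp (- 2 * pi * h) < 1" using h by simp
  then obtain c C where c: "c > 0" "\<And>x. norm x \<le> exp (- 2 * pi * h) \<Longrightarrow> c \<le> norm (eul x)"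
     "\<And>x. norm x \<le> exp (- 2 * pi * h) \<Longrightarrow> norm (eul x) \<le> C" using eul_bounds[of "exp (- 2 * pi * h)"] by auto
  have "norm (nome (g \<tau>)) \<le> exp (- 2 * pi * h)" if "Im \<tau> \<ge> 1/2" for \<tau>
  proof -
    have "h \<le> k * Im \<tau>" using that assms(2) mult_left_mono[of "1/2" "Im \<tau>" k] by (simp add: h_def)
    then show ?thesis unfolding norm_nome assms by simp
  qed
  then show ?thesis unfolding qo_def using c by (intro exI[of _ c] exI[of _ C]) auto
qed

text \<open>The exponent -2/7 is the factor x^(-2) of \<open>a7_1\<close>, where x^7 = q; the
  product in \<open>a7_0_1\<close> has order 0.\<close>

definition ord7 :: "int \<Rightarrow> real" where "ord7 v = (if v mod 7 = 0 then 0 else - 2 / 7)"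
definition kap :: "nat \<Rightarrow> real" where "kap i = (if i = 2 then 2 else 1 / 2)"

lemma qo_a7:
  assumes "nz7 v w" and g: "\<And>\<tau>. Im (g \<tau>) = k * Im \<tau>" and k: "k > 0"
  shows "qo (\<lambda>\<tau>. a7 v w (g \<tau>)) (k * ord7 v)"
proof -
  have pos: "Im (g \<tau>) > 0" if "Im \<tau> \<ge> 1/2" for \<tau> using that k by (simp add: g)
  show ?thesis
  proof (cases "v mod 7 = 0")
    case True
    then obtain s where s: "s \<in> {1, -1 :: complex}" "\<And>\<tau>. Im \<tau> > 0 \<Longrightarrow> a7 v w \<tau> = s * a7 0 1 \<tau>"
      using a7_cases0[of v w] assms by auto
    have "qo (\<lambda>\<tau>. (s * c7) * eul (nome (of_nat 7 * g \<tau>)) / eul (nome (g \<tau>)) ^ 7) ((0 + 0) - real 7 * 0)"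
      by (intro qo_divide qo_mult qo_power qo_const qo_eul[where k = "7 * k"] qo_eul[where k = k]) (use g k s c7_nonzero in auto)
    then show ?thesis
      by (rule qo_cong) (use s pos a7_0_1 in \<open>auto simp: ord7_def True nome_pow\<close>)
  next
    case False
    then obtain s \<mu> where s: "s \<in> {1, -1 :: complex}" "\<And>\<tau>. Im \<tau> > 0 \<Longrightarrow> a7 v w \<tau> = s * a7 1 \<mu> \<tau>"
      using a7_cases1[of v w] by blast
    have "qo (\<lambda>\<tau>. (- s) * eul (nome ((g \<tau> + of_int \<mu>) / 7)) / (nome ((g \<tau> + of_int \<mu>) / 7) ^ 2 * eul (nome (g \<tau>)) ^ 7)) ((0 + 0) - (real 2 * (k / 7) + real 7 * 0))"
      by (intro qo_divide qo_mult qo_power qo_const qo_nome qo_eul[where k = "k / 7"] qo_eul[where k = k]) (use g k s in auto)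
    then show ?thesis
      by (rule qo_cong) (use s pos a7_1 False in \<open>auto simp: ord7_def\<close>)
  qed
qed

lemma qo_dl:
  assumes g: "\<And>\<tau>. Im (g \<tau>) = k * Im \<tau>" and k: "k > 0"
  shows "qo (\<lambda>\<tau>. dl (g \<tau>)) k"
proof -
  have "qo (\<lambda>\<tau>. nome (g \<tau>) * eul (nome (g \<tau>)) ^ 24) (k + real 24 * 0)"
    by (intro qo_mult qo_power qo_nome qo_eul[where k = k]) (use g k in auto)
  then show ?thesis by (rule qo_cong) (auto simp: dl_def)
qed

lemma ord7_4: "ord7 (4 * v) = ord7 v"
  unfolding ord7_def mod7_4 ..

lemma qo_a14:
  assumes "nz7 v w"
  shows "qo (a14 i v w) (kap i * ord7 v)"
proof -
  note nz = nz7_4[OF assms]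
  have 1: "qo (\<lambda>\<tau>. a7 (4 * v) w (2 * \<tau>)) (2 * ord7 (4 * v))" by (rule qo_a7) (use nz in auto)
  have 2: "qo (\<lambda>\<tau>. a7 v (4 * w) (\<tau> / 2)) (1 / 2 * ord7 v)" by (rule qo_a7) (use nz in auto)
  have 3: "qo (\<lambda>\<tau>. a7 v (4 * (w - v)) ((\<tau> + 1) / 2)) (1 / 2 * ord7 v)" by (rule qo_a7) (use nz in auto)
  have 8: "qo (\<lambda>\<tau>. 8) 0" by (rule qo_const) simp
  show ?thesis
  proof (cases "i = 2")
    case True
    then show ?thesis using 1 by (simp add: a14_def [abs_def] kap_def ord7_4)
  next
    case False
    then show ?thesis using qo_mult[OF 8 2] qo_mult[OF 8 3]
      by (cases "i = 0") (simp_all add: a14_def [abs_def] kap_def)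
  qed
qed

lemma qo_d2: "qo (d2 i) (kap i)"
proof -
  have 1: "qo (\<lambda>\<tau>. dl (2 * \<tau>)) 2" by (rule qo_dl) auto
  have 2: "qo (\<lambda>\<tau>. dl (\<tau> / 2)) (1 / 2)" by (rule qo_dl) auto
  have 3: "qo (\<lambda>\<tau>. dl ((\<tau> + 1) / 2)) (1 / 2)" by (rule qo_dl) auto
  have 8: "qo (\<lambda>\<tau>. 4096) 0" by (rule qo_const) simp
  show ?thesis
  proof (cases "i = 2")
    case True
    then show ?thesis using 1 by (simp add: d2_def [abs_def] kap_def)
  next
    case False
    then show ?thesis using qo_divide[OF 2 8] qo_divide[OF 3 8]
      by (cases "i = 0") (simp_all add: d2_def [abs_def] kap_def)
  qed
qed

lemma qo_a7': "nz7 v w \<Longrightarrow> qo (a7 v w) (ord7 v)"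
  using qo_a7[of v w "\<lambda>\<tau>. \<tau>" 1] by simp

lemma qo_dl': "qo dl 1"
  using qo_dl[of "\<lambda>\<tau>. \<tau>" 1] by simp

lemma qo_Tw: "nz7 v w \<Longrightarrow> qo (Tw i v w) (4 * ord7 v + 1)"
  using qo_mult[OF qo_power[OF qo_a7', of v w 4] qo_dl'] by (simp add: Tw_def [abs_def])

lemma qo_uw: "nz7 v w \<Longrightarrow> qo (uw i v w) (7 * (kap i * ord7 v) + 2 * kap i - (3 * ord7 v + 1))"
  using qo_divide[OF qo_mult[OF qo_power[OF qo_a14[of v w i], of 7] qo_power[OF qo_d2[of i], of 2]] qo_mult[OF qo_power[OF qo_a7', of v w 3] qo_dl']]
  by (simp add: uw_def [abs_def])

lemma qo_upw: "nz7 v w \<Longrightarrow> qo (upw i v w) (- (kap i * ord7 v + 3 * ord7 v + 1))"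
  using qo_divide[OF qo_const[of 1] qo_mult[OF qo_mult[OF qo_a14[of v w i] qo_power[OF qo_a7', of v w 3]] qo_dl']]
  by (simp add: upw_def [abs_def])

lemma qo_Dw: "nz7 v w \<Longrightarrow> nz7 p r \<Longrightarrow> qo (Dw i v w p r) (2 * (kap i * ord7 p - kap i * ord7 v) + 5 * (ord7 v - ord7 p))"
  using qo_mult[OF qo_power[OF qo_divide[OF qo_a14[of p r i] qo_a14[of v w i]], of 2] qo_power[OF qo_divide[OF qo_a7'[of v w] qo_a7'[of p r]], of 5]]
  by (simp add: Dw_def [abs_def])

lemma MF_scale:
  assumes f: "MF f" and i: "i < 3" and nz: "nz7 v w" and t: "Im \<tau> > 0" and c: "c \<in> {1, 2, 4}"
  shows "f i (c * v) (c * w) \<tau> = f i v w \<tau>" "f i (c * (- v)) (c * (- w)) \<tau> = f i v w \<tau>"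
proof -
  have nz2: "nz7 (2 * v) (2 * w)" if "nz7 v w" for v w :: int
    using that by (auto simp: mod_eq_0_iff_dvd coprime_dvd_mult_right_iff)
  have *: "f i (c * v) (c * w) \<tau> = f i v w \<tau>" if nz: "nz7 v w" for v w
    using c MF_D(5)[OF f i nz t] MF_D(5)[OF f i nz2[OF nz] t] by auto
  show "f i (c * v) (c * w) \<tau> = f i v w \<tau>" by (rule *[OF nz])
  have nm: "nz7 (- v) (- w)" using nz by presburger
  show "f i (c * (- v)) (c * (- w)) \<tau> = f i v w \<tau>"
    using *[OF nm] MF_D(6)[OF f i nz t] by simp
qed

lemma MF_zero_row:
  assumes f: "MF f" and i: "i < 3" and w: "v mod 7 = 0" "w mod 7 \<noteq> 0" and t: "Im \<tau> > 0"
  shows "f i v w \<tau> = f i 0 1 \<tau>"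
proof -
  obtain c where c: "c \<in> {1, 2, 4}" "(c * w) mod 7 = 1 \<or> (c * (- w)) mod 7 = 1"
    using unit7_cases[OF w(2)] by blast
  have v0: "(c * v) mod 7 = 0 mod 7" "(c * (- v)) mod 7 = 0 mod 7" using w(1) by auto
  have nz: "nz7 v w" "nz7 0 1" using w by auto
  from c(2) show ?thesis
  proof
    assume "(c * w) mod 7 = 1"
    then show ?thesis using MF_scale(1)[OF f i nz(1) t c(1)] MF_D(4)[OF f i nz(2) t v0(1), of "c * w"] by simp
  next
    assume "(c * (- w)) mod 7 = 1"
    then show ?thesis using MF_scale(2)[OF f i nz(1) t c(1)] MF_D(4)[OF f i nz(2) t v0(2), of "c * (- w)"] by simp
  qed
qed

lemma uw_nonzero: "nz7 v w \<Longrightarrow> Im \<tau> > 0 \<Longrightarrow> uw i v w \<tau> \<noteq> 0"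
  by (simp add: uw_def a7_holomorphic_nonzero(2) a14_holomorphic_nonzero(2) d2_holomorphic_nonzero(2) dl_nonzero)

text \<open>\<open>uw\<close> has order -1/7 where v is nonzero mod 7, order 0 at (0, 1) for i < 2,
  and order 3 at (2, 0, 1). Division by its eighth power turns the three growth conditions into
  orders 0, 0 and 25 - 24 = 1, so the quotient is constant and tends to 0.\<close>

theorem MF_vanish:
  assumes f: "MF f"
    and bd1: "\<And>i v w. i < 3 \<Longrightarrow> v mod 7 \<noteq> 0 \<Longrightarrow> qb (f i v w) (- 8 / 7)"
    and bd2: "\<And>i. i < 2 \<Longrightarrow> qb (f i 0 1) 0"
    and bd3: "qb (f 2 0 1) 25"
    and t: "Im \<tau> > 0"
  shows "f 2 0 1 \<tau> = 0"
proof -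
  define g where "g = (\<lambda>i v w \<tau>. f i v w \<tau> / uw i v w \<tau> ^ 8)"
  have g: "MF g" unfolding g_def
    by (intro MF_divide f MF_power uw_MF) (simp add: uw_nonzero)
  have dv: "qb (\<lambda>\<tau>. f i v w \<tau> / uw i v w \<tau> ^ 8) (a - 8 * b)" if "qb (f i v w) a" "qo (uw i v w) b" for i v w a b
    using qb_mult[OF that(1) qo_qb[OF qo_inverse[OF qo_power[OF that(2), of 8]]]] by (simp add: divide_inverse)
  have G1: "qb (g i v w) 0" if "i < 3" "v mod 7 \<noteq> 0" for i v w
  proof -
    have e: "7 * (kap i * ord7 v) + 2 * kap i - (3 * ord7 v + 1) = - 1 / 7" using that by (simp add: kap_def ord7_def)
    have "qo (uw i v w) (- 1 / 7)" using qo_uw[of v w i, unfolded e] that by simp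
    from dv[OF bd1[OF that] this] show ?thesis by (simp add: g_def)
  qed
  have G2: "qb (g i 0 1) 0" if "i < 2" for i
  proof -
    have e: "7 * (kap i * ord7 0) + 2 * kap i - (3 * ord7 0 + 1) = 0" using that by (simp add: kap_def ord7_def)
    have "qo (uw i 0 1) 0" using qo_uw[of 0 1 i, unfolded e] by simp
    from dv[OF bd2[OF that] this] show ?thesis by (simp add: g_def)
  qed
  have G3: "qb (g 2 0 1) 1"
  proof -
    have e: "7 * (kap 2 * ord7 0) + 2 * kap 2 - (3 * ord7 0 + 1) = 3" by (simp add: kap_def ord7_def)
    have "qo (uw 2 0 1) 3" using qo_uw[of 0 1 2, unfolded e] by simp
    from dv[OF bd3 this] show ?thesis by (simp add: g_def)
  qed
  define F where "F = (\<lambda>(i, v, w). g i v w)"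
  define X where "X = {(i, v, w). i < (3::nat) \<and> v \<in> {0..6} \<and> w \<in> {0..6} \<and> nz7 v w}"
  define tX where "tX = (\<lambda>(i, v, w). (tI i, v, (v + w) mod (7::int)))"
  define sX where "sX = (\<lambda>(i, v, w :: int). (sI i, w, (- v) mod (7::int)))"
  have bd7: "x mod 7 \<le> 6" for x :: int using pos_mod_bound[of 7 x] by simp
  have nzT: "nz7 v (v + w)" if "nz7 v w" for v w :: int using that mod_add_left_eq[of v 7 w] by auto
  have nzS: "nz7 w (- v)" if "nz7 v w" for v w :: int using that by presburger
  have gmod: "g i (v mod 7) (w mod 7) \<tau> = g i v w \<tau>" if "i < 3" "nz7 v w" "Im \<tau> > 0" for i v w \<tau>
    by (rule MF_D(4)[OF g that]) auto
  have gT: "g i v w (\<tau> + of_nat n) = g ((tI ^^ n) i) v (w + int n * v) \<tau>" if "i < 3" "nz7 v w" "Im \<tau> > 0" for i v w \<tau> n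
    using that
  proof (induction n arbitrary: i w)
    case (Suc n)
    have "g i v w (\<tau> + of_nat (Suc n)) = g i v w ((\<tau> + of_nat n) + 1)" by (simp add: algebra_simps)
    also have "\<dots> = g (tI i) v (v + w) (\<tau> + of_nat n)" by (rule MF_D(2)[OF g]) (use Suc.prems in auto)
    also have "\<dots> = g ((tI ^^ n) (tI i)) v (v + w + int n * v) \<tau>"
      by (rule Suc.IH) (use Suc.prems tI_less nzT in auto)
    finally show ?case by (simp add: funpow_swap1 algebra_simps)
  qed simp
  \<comment> \<open>Together with 14 = 0 mod 7 in the second index this shows that 14 is a period of
    every member.\<close>
  have tI14: "(tI ^^ 14) i = i" if "i < 3" for i
  proof -
    have "tI (tI i) = i" using index2_cases[OF that] by (auto simp: tI_def)
    then show ?thesis by (simp add: numeral_eq_Suc)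
  qed
  have "F (2, 0, 1) constant_on H"
  proof (rule modular_liouville[of X "(2, 0, 1)" tX sX F 14])
    show "finite X"
      by (rule finite_subset[of _ "{..<3} \<times> {0..6} \<times> {0..6}"]) (auto simp: X_def)
    show "(2, 0, 1) \<in> X" by (auto simp: X_def)
  next
    fix x assume "x \<in> X"
    then obtain i v w where x: "x = (i, v, w)" "i < 3" "nz7 v w" "v \<in> {0..6}" "w \<in> {0..6}" by (auto simp: X_def)
    show "tX x \<in> X" using x nzT[of v w] tI_less[of i] by (auto simp: X_def tX_def bd7)
    show "sX x \<in> X" using x nzS[of v w] sI_less[of i] by (auto simp: X_def sX_def bd7)
    show "F x holomorphic_on H" using MF_D(1)[OF g x(2,3)] by (simp add: F_def x)
    show "\<exists>M. \<forall>\<tau>. Im \<tau> \<ge> 1/2 \<longrightarrow> norm (F x \<tau>) \<le> M"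
    proof -
      have "qb (F x) 0"
      proof (cases "v mod 7 = 0")
        case False
        then show ?thesis using G1[OF x(2)] by (simp add: F_def x(1))
      next
        case True
        then have w: "w mod 7 \<noteq> 0" using x(3) by simp
        have "qb (g i 0 1) 0" using index2_cases[OF x(2)] G2 qb_mono[OF G3, of 0] by auto
        then show ?thesis
          by (rule qb_cong) (use MF_zero_row[OF g x(2) True w] in \<open>auto simp: F_def x(1)\<close>)
      qed
      then show ?thesis by (simp add: qb_def)
    qed
    fix \<tau> :: complex assume t: "Im \<tau> > 0"
    show "F x (\<tau> + 1) = F (tX x) \<tau>"
      using MF_D(2)[OF g x(2,3) t] gmod[OF tI_less[OF x(2)] nzT[OF x(3)] t] x(4) by (auto simp: F_def tX_def x(1))
    show "F x (- 1 / \<tau>) = F (sX x) \<tau>"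
      using MF_D(3)[OF g x(2,3) t] gmod[OF sI_less[OF x(2)] nzS[OF x(3)] t] x(5) by (auto simp: F_def sX_def x(1))
    show "F x (\<tau> + of_nat 14) = F x \<tau>"
    proof -
      have "F x (\<tau> + of_nat 14) = g i v (w + int 14 * v) \<tau>"
        using gT[OF x(2,3) t, of 14] tI14[OF x(2)] by (simp add: F_def x(1))
      also have "\<dots> = g i v w \<tau>"
        by (rule MF_D(4)[OF g x(2,3) t refl]) (rule mod7_eqI[of _ _ "2 * v"], simp)
      finally show ?thesis by (simp add: F_def x(1))
    qed
  qed auto
  then obtain c where c: "\<And>\<tau>. Im \<tau> > 0 \<Longrightarrow> g 2 0 1 \<tau> = c" by (auto simp: constant_on_def F_def)
  obtain C where C: "\<And>\<tau>. Im \<tau> \<ge> 1/2 \<Longrightarrow> norm (g 2 0 1 \<tau>) \<le> C * exp (- 2 * pi * 1 * Im \<tau>)"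
    using G3 unfolding qb_def by blast
  \<comment> \<open>Evaluation at \<i> n lets the nome tend to 0 while the function stays equal to
    \<open>c\<close>.\<close>
  have "norm c \<le> C * exp (- 2 * pi) ^ n" for n
  proof (cases "n = 0")
    case True
    have "norm c \<le> C * exp (- 2 * pi * 1 * 1)" using C[of \<i>] c[of \<i>] by simp
    moreover have "C \<ge> 0"
      using order_trans[OF norm_ge_zero calculation] by (simp add: zero_le_mult_iff)
    moreover have "C * exp (- 2 * pi * 1 * 1) \<le> C * 1"
      by (rule mult_left_mono) (use \<open>C \<ge> 0\<close> in auto)
    ultimately show ?thesis using True by simp
  next
    case False
    then have "norm c \<le> C * exp (- 2 * pi * 1 * real n)" using C[of "\<i> * of_nat n"] c[of "\<i> * of_nat n"] by simp
    then show ?thesis by (simp add: exp_of_nat_mult [symmetric] mult.commute)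
  qed
  moreover have "(\<lambda>n. C * exp (- 2 * pi) ^ n) \<longlonglongrightarrow> C * 0"
    by (intro tendsto_mult tendsto_const LIMSEQ_power_zero) auto
  ultimately have "norm c \<le> C * 0" using LIMSEQ_le_const by blast
  then have "g 2 0 1 \<tau> = 0" using c[OF t] by simp
  then show ?thesis using uw_nonzero[of 0 1 \<tau> 2] t by (simp add: g_def)
qed

section \<open>Reduction of identities to 25 coefficients\<close>

definition TT :: "complex \<Rightarrow> complex" where
  "TT \<tau> = mod_u \<tau> * mod_t \<tau>"

lemma dedekind_eta_nat_mult:
  "dedekind_eta (of_nat k * \<tau>) = exp (2 * of_real pi * \<i> * \<tau> / 24) ^ k * eul (nome \<tau> ^ k)"
proof -
  have "exp (2 * of_real pi * \<i> * (of_nat k * \<tau>) / 24) = exp (2 * of_real pi * \<i> * \<tau> / 24) ^ k"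
    unfolding exp_of_nat_mult [symmetric] by (intro arg_cong[of _ _ exp]) simp
  then show ?thesis by (simp add: dedekind_eta_def eul_def nome_of_nat_mult)
qed

lemma eta_power_24: "exp (2 * of_real pi * \<i> * \<tau> / 24) ^ 24 = nome \<tau>"
  unfolding exp_of_nat_mult [symmetric] nome_def by (intro arg_cong[of _ _ exp]) simp

context
  fixes \<tau> :: complex
  assumes tau: "Im \<tau> > 0"
begin

lemma eul_pow_nonzero: "k > 0 \<Longrightarrow> eul (nome \<tau> ^ k) \<noteq> 0"
  by (rule eul_nonzero[OF norm_nome_power_less_1[OF tau]])

lemma mod_eul:
  defines "q \<equiv> nome \<tau>"
  shows "mod_t \<tau> = eul (q ^ 2) * eul (q ^ 7) ^ 7 / (q ^ 2 * eul q * eul (q ^ 14) ^ 7)"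
    and "mod_u \<tau> = q ^ 3 * eul (q ^ 14) ^ 7 / (eul q ^ 3 * eul (q ^ 2) * eul (q ^ 7) ^ 3)"
    and "mod_A \<tau> = q ^ 2 * eul (q ^ 2) ^ 2 * eul (q ^ 49) ^ 5 / (eul q ^ 5 * eul (q ^ 98) ^ 2)"
    and "TT \<tau> = q * eul (q ^ 7) ^ 4 / eul q ^ 4"
proof -
  \<comment> \<open>A 24th root of q makes all exponents of the eta factors integral; in each
    quotient they add up to a multiple of 24.\<close>
  define e where "e = exp (2 * of_real pi * \<i> * \<tau> / 24)"
  have e0: "e \<noteq> 0" by (simp add: e_def)
  have e24: "q = e ^ 24" using eta_power_24[of \<tau>] by (simp add: e_def q_def)
  have E: "dedekind_eta (numeral k * \<tau>) = e ^ numeral k * eul (q ^ numeral k)" for k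
    using dedekind_eta_nat_mult[of "numeral k" \<tau>] by (simp add: e_def q_def)
  have E1: "dedekind_eta \<tau> = e * eul q" using dedekind_eta_nat_mult[of 1 \<tau>] by (simp add: e_def q_def)
  define a b c d f g where "a = eul q" and "b = eul (q ^ 2)" and "c = eul (q ^ 7)" and "d = eul (q ^ 14)"
    and "f = eul (q ^ 49)" and "g = eul (q ^ 98)"
  have nz: "a \<noteq> 0" "b \<noteq> 0" "c \<noteq> 0" "d \<noteq> 0" "f \<noteq> 0" "g \<noteq> 0"
    using eul_pow_nonzero[of 1] eul_pow_nonzero[of 2] eul_pow_nonzero[of 7] eul_pow_nonzero[of 14] eul_pow_nonzero[of 49] eul_pow_nonzero[of 98]
    by (auto simp: a_def b_def c_def d_def f_def g_def q_def)
  have "mod_t \<tau> = (e ^ 2 * b * (e ^ 7 * c) ^ 7) / (e * a * (e ^ 14 * d) ^ 7)"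
    by (simp add: mod_t_def E E1 a_def b_def c_def d_def)
  also have "\<dots> = b * c ^ 7 / ((e ^ 24) ^ 2 * a * d ^ 7)"
    by (subst frac_eq_eq) (simp_all add: e0 nz, (algebra)?)
  finally show t: "mod_t \<tau> = eul (q ^ 2) * eul (q ^ 7) ^ 7 / (q ^ 2 * eul q * eul (q ^ 14) ^ 7)"
    by (simp only: e24 [symmetric] a_def b_def c_def d_def)
  have "mod_u \<tau> = (e ^ 14 * d) ^ 7 / ((e * a) ^ 3 * (e ^ 2 * b) * (e ^ 7 * c) ^ 3)"
    by (simp add: mod_u_def E E1 a_def b_def c_def d_def)
  also have "\<dots> = (e ^ 24) ^ 3 * d ^ 7 / (a ^ 3 * b * c ^ 3)"
    by (subst frac_eq_eq) (simp_all add: e0 nz, (algebra)?)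
  finally show u: "mod_u \<tau> = q ^ 3 * eul (q ^ 14) ^ 7 / (eul q ^ 3 * eul (q ^ 2) * eul (q ^ 7) ^ 3)"
    by (simp only: e24 [symmetric] a_def b_def c_def d_def)
  have "mod_A \<tau> = ((e ^ 2 * b) ^ 2 * (e ^ 49 * f) ^ 5) / ((e * a) ^ 5 * (e ^ 98 * g) ^ 2)"
    by (simp add: mod_A_def E E1 a_def b_def f_def g_def)
  also have "\<dots> = (e ^ 24) ^ 2 * b ^ 2 * f ^ 5 / (a ^ 5 * g ^ 2)"
    by (subst frac_eq_eq) (simp_all add: e0 nz, (algebra)?)
  finally show "mod_A \<tau> = q ^ 2 * eul (q ^ 2) ^ 2 * eul (q ^ 49) ^ 5 / (eul q ^ 5 * eul (q ^ 98) ^ 2)"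
    by (simp only: e24 [symmetric] a_def b_def f_def g_def)
  have q0: "q \<noteq> 0" by (simp add: q_def)
  have "TT \<tau> = (q ^ 3 * d ^ 7 / (a ^ 3 * b * c ^ 3)) * (b * c ^ 7 / (q ^ 2 * a * d ^ 7))"
    unfolding TT_def t u a_def b_def c_def d_def ..
  also have "\<dots> = q * c ^ 4 / a ^ 4"
    unfolding times_divide_times_eq by (subst frac_eq_eq) (simp_all add: q0 nz, (algebra)?)
  finally show "TT \<tau> = q * eul (q ^ 7) ^ 4 / eul q ^ 4" by (simp only: a_def c_def)
qed

lemma Tw_0_1: "Tw i 0 1 \<tau> / 49 = TT \<tau>"
proof -
  define a c q where "a = eul (nome \<tau>)" and "c = eul (nome \<tau> ^ 7)" and "q = nome \<tau>"
  have nz: "a \<noteq> 0" "c \<noteq> 0" using eul_pow_nonzero[of 1] eul_pow_nonzero[of 7] by (auto simp: a_def c_def)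
  have "Tw i 0 1 \<tau> = (c7 * c / a ^ 7) ^ 4 * (q * a ^ 24)"
    unfolding Tw_def a7_0_1[OF tau] dl_def a_def c_def q_def ..
  also have "\<dots> = c7 ^ 4 * (q * c ^ 4 / a ^ 4)"
    using nz by (simp add: power_divide power_mult_distrib power_mult [symmetric] divide_simps)
  finally show ?thesis by (simp add: c7_pow4 mod_eul a_def c_def q_def)
qed

lemma uw_0_1: "uw 2 0 1 \<tau> / 49 = mod_u \<tau>"
proof -
  define a b c d q where "a = eul (nome \<tau>)" and "b = eul (nome \<tau> ^ 2)" and "c = eul (nome \<tau> ^ 7)" and "d = eul (nome \<tau> ^ 14)" and "q = nome \<tau>"
  have nz: "a \<noteq> 0" "b \<noteq> 0" "c \<noteq> 0" "d \<noteq> 0" "q \<noteq> 0"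
    using eul_pow_nonzero[of 1] eul_pow_nonzero[of 2] eul_pow_nonzero[of 7] eul_pow_nonzero[of 14] by (auto simp: a_def b_def c_def d_def q_def)
  have n2: "nome (2 * \<tau>) = nome \<tau> ^ 2" by (simp add: nome_numeral_mult)
  have A: "a14 2 0 1 \<tau> = c7 * d / b ^ 7"
    using a7_0_1[of "2 * \<tau>"] tau by (simp add: a14_def n2 b_def d_def power_mult [symmetric])
  have D: "d2 2 \<tau> = q ^ 2 * b ^ 24" by (simp add: d2_def dl_def n2 b_def q_def)
  have "uw 2 0 1 \<tau> = (c7 * d / b ^ 7) ^ 7 * (q ^ 2 * b ^ 24) ^ 2 / ((c7 * c / a ^ 7) ^ 3 * (q * a ^ 24))"
    unfolding uw_def A D a7_0_1[OF tau] dl_def a_def c_def q_def ..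
  also have "\<dots> = c7 ^ 4 * (q ^ 3 * d ^ 7 / (a ^ 3 * b * c ^ 3))"
    unfolding power_divide power_mult_distrib power_mult [symmetric]
    using nz c7_nonzero by (simp add: divide_simps) (algebra)?
  finally show ?thesis by (simp add: c7_pow4 mod_eul a_def b_def c_def d_def q_def)
qed

end

lemma a14_1:
  fixes r :: int
  assumes "Im \<tau> > 0"
  defines "x \<equiv> nome ((\<tau> + of_int r) / 7)"
  shows "a14 2 1 r \<tau> = - eul (x ^ 2) / (x ^ 4 * eul (nome \<tau> ^ 2) ^ 7)"
proof -
  have t2: "Im (2 * \<tau>) > 0" using assms by simp
  have "a14 2 1 r \<tau> = a7 (4 * 1) (4 * (2 * r)) (2 * \<tau>)"
    unfolding a14_def by simp (rule a7_cong[OF t2], simp, rule mod7_eqI[of _ _ "- r"], simp)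
  also have "\<dots> = a7 1 (2 * r) (2 * \<tau>)" by (rule a7_scale[OF t2]) simp
  also have "\<dots> = - eul (nome ((2 * \<tau> + of_int (2 * r)) / 7)) / (nome ((2 * \<tau> + of_int (2 * r)) / 7) ^ 2 * eul (nome (2 * \<tau>)) ^ 7)"
    by (rule a7_1[OF t2])
  also have "(2 * \<tau> + of_int (2 * r)) / 7 = of_nat 2 * ((\<tau> + of_int r) / 7)" by (simp add: field_simps)
  also have "nome (of_nat 2 * ((\<tau> + of_int r) / 7)) = x ^ 2" unfolding x_def by (rule nome_of_nat_mult)
  also have "nome (2 * \<tau>) = nome \<tau> ^ 2" by (simp add: nome_numeral_mult)
  finally show ?thesis by (simp add: power_mult [symmetric])
qed

text \<open>With x the nome at (\<tau> + r)/7, index (1, r) produces \<open>eul\<close> at x and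
  x^2, while index (0, 1) produces \<open>eul\<close> at q^7 = x^49 and at x^98. In
  \<open>Dw\<close> the remaining factors \<open>eul\<close> at q and q^2 cancel, which leaves
  precisely the eta quotient \<open>mod_A\<close>.\<close>

lemma family_at_1:
  fixes r :: int
  assumes tau: "Im \<tau> > 0"
  defines "z \<equiv> (\<tau> + of_int r) / 7"
  shows "Tw 2 1 r \<tau> = 1 / TT z" "upw 2 1 r \<tau> = mod_u z" "Dw 2 0 1 1 r \<tau> = - (c7 ^ 3) * mod_A z"
proof -
  define x where "x = nome z"
  have z: "Im z > 0" using tau by (simp add: z_def)
  have q: "nome \<tau> = x ^ 7"
  proof -
    have "of_nat 7 * z = \<tau> + of_int r" by (simp add: z_def)
    then show ?thesis unfolding x_def nome_of_nat_mult [symmetric] by (simp add: nome_add)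
  qed
  have x0: "x \<noteq> 0" by (simp add: x_def)
  define a b c d f g where "a = eul x" and "b = eul (x ^ 2)" and "c = eul (x ^ 7)" and "d = eul (x ^ 14)"
    and "f = eul (x ^ 49)" and "g = eul (x ^ 98)"
  have nz: "a \<noteq> 0" "b \<noteq> 0" "c \<noteq> 0" "d \<noteq> 0" "f \<noteq> 0" "g \<noteq> 0"
    using eul_pow_nonzero[OF z, of 1] eul_pow_nonzero[OF z, of 2] eul_pow_nonzero[OF z, of 7] eul_pow_nonzero[OF z, of 14]
      eul_pow_nonzero[OF z, of 49] eul_pow_nonzero[OF z, of 98]
    by (auto simp: a_def b_def c_def d_def f_def g_def x_def)
  have A: "a7 1 r \<tau> = - a / (x ^ 2 * c ^ 7)"
    using a7_1[OF tau, of r] by (simp add: a_def c_def q x_def z_def)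
  have B: "a14 2 1 r \<tau> = - b / (x ^ 4 * d ^ 7)"
    using a14_1[OF tau, of r] by (simp add: b_def d_def q x_def z_def power_mult [symmetric])
  have D: "dl \<tau> = x ^ 7 * c ^ 24" by (simp add: dl_def q c_def)
  have A0: "a7 0 1 \<tau> = c7 * f / c ^ 7" using a7_0_1[OF tau] by (simp add: q f_def c_def power_mult [symmetric])
  have n2: "nome (2 * \<tau>) = x ^ 14" unfolding nome_numeral_mult q power_mult [symmetric] by simp
  have B0: "a14 2 0 1 \<tau> = c7 * g / d ^ 7"
    using a7_0_1[of "2 * \<tau>"] tau by (simp add: a14_def n2 g_def d_def power_mult [symmetric])
  have "Tw 2 1 r \<tau> = (- a / (x ^ 2 * c ^ 7)) ^ 4 * (x ^ 7 * c ^ 24)" unfolding Tw_def A D ..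
  also have "\<dots> = a ^ 4 / (x * c ^ 4)"
    unfolding power_divide power_mult_distrib power_mult [symmetric] times_divide_eq_left
    by (subst frac_eq_eq) (simp_all add: x0 nz, (algebra)?)
  finally show "Tw 2 1 r \<tau> = 1 / TT z" by (simp add: mod_eul[OF z] a_def c_def x_def)
  have "upw 2 1 r \<tau> = 1 / ((- b / (x ^ 4 * d ^ 7)) * (- a / (x ^ 2 * c ^ 7)) ^ 3 * (x ^ 7 * c ^ 24))" unfolding upw_def A B D ..
  also have "\<dots> = x ^ 3 * d ^ 7 / (a ^ 3 * b * c ^ 3)"
    using x0 nz by (simp add: divide_simps) (algebra)?
  finally show "upw 2 1 r \<tau> = mod_u z" by (simp add: mod_eul[OF z] a_def b_def c_def d_def x_def)
  have "Dw 2 0 1 1 r \<tau> = ((- b / (x ^ 4 * d ^ 7)) / (c7 * g / d ^ 7)) ^ 2 * ((c7 * f / c ^ 7) / (- a / (x ^ 2 * c ^ 7))) ^ 5"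
    unfolding Dw_def A B A0 B0 ..
  also have "\<dots> = - (c7 ^ 3) * (x ^ 2 * b ^ 2 * f ^ 5 / (a ^ 5 * g ^ 2))"
    using x0 nz c7_nonzero by (simp add: divide_simps) (algebra)?
  finally show "Dw 2 0 1 1 r \<tau> = - (c7 ^ 3) * mod_A z" by (simp add: mod_eul[OF z] a_def b_def f_def g_def x_def)
qed

section \<open>Polynomials and Atkin images as members of families\<close>

definition pol :: "(nat \<times> nat \<times> int) list \<Rightarrow> complex \<Rightarrow> complex \<Rightarrow> complex" where
  "pol tab x y = (\<Sum>(a, l, c)\<leftarrow>tab. of_int c * x ^ a * y ^ l)"

lemma pol_alt: "pol tab x y = (\<Sum>t\<leftarrow>tab. of_int (snd (snd t)) * x ^ fst t * y ^ fst (snd t))"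
  by (simp add: pol_def split_def)

lemma pol_MF: "MF (\<lambda>i v w \<tau>. pol tab (Tw i v w \<tau> / 49) (uw i v w \<tau> / 49))"
proof -
  have "MF (\<lambda>i v w \<tau>. \<Sum>t\<leftarrow>tab. of_int (snd (snd t)) * (Tw i v w \<tau> / 49) ^ fst t * (uw i v w \<tau> / 49) ^ fst (snd t))"
    by (intro MF_sum_list MF_mult MF_power MF_const MF_divide Tw_MF uw_MF) auto
  then show ?thesis by (simp only: pol_alt)
qed

lemma qo_Tw_explicit:
  "v mod 7 \<noteq> 0 \<Longrightarrow> qo (Tw i v w) (- 1 / 7)" "v mod 7 = 0 \<Longrightarrow> w mod 7 \<noteq> 0 \<Longrightarrow> qo (Tw i v w) 1"
  using qo_Tw[of v w i] by (simp_all add: ord7_def)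

lemma qo_uw_explicit:
  "v mod 7 \<noteq> 0 \<Longrightarrow> qo (uw i v w) (- 1 / 7)" "v mod 7 = 0 \<Longrightarrow> w mod 7 \<noteq> 0 \<Longrightarrow> i \<noteq> 2 \<Longrightarrow> qo (uw i v w) 0"
  using qo_uw[of v w i] by (simp_all add: ord7_def kap_def split: if_splits)

lemma qo_upw_explicit:
  "v mod 7 \<noteq> 0 \<Longrightarrow> qo (upw i v w) (if i = 2 then 3 / 7 else 0)" "v mod 7 = 0 \<Longrightarrow> w mod 7 \<noteq> 0 \<Longrightarrow> qo (upw i v w) (- 1)"
  using qo_upw[of v w i] by (simp_all add: ord7_def kap_def split: if_splits)

text \<open>\<open>Tw\<close> and \<open>uw\<close> both have order -1/7 where v is nonzero mod 7,
  so total degree 8 costs at most 8/7; at (0, 1) with i < 2 neither has a pole.\<close>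

lemma pol_growth:
  assumes "\<And>a l c. (a, l, c) \<in> set tab \<Longrightarrow> a + l \<le> 8"
  shows "v mod 7 \<noteq> 0 \<Longrightarrow> qb (\<lambda>\<tau>. pol tab (Tw i v w \<tau> / 49) (uw i v w \<tau> / 49)) (- 8 / 7)"
    and "i \<noteq> 2 \<Longrightarrow> qb (\<lambda>\<tau>. pol tab (Tw i 0 1 \<tau> / 49) (uw i 0 1 \<tau> / 49)) 0"
proof -
  have mono: "qb (\<lambda>\<tau>. of_int c * (Tw i v w \<tau> / 49) ^ a * (uw i v w \<tau> / 49) ^ l) (real a * x + real l * y)"
    if "qo (Tw i v w) x" "qo (uw i v w) y" for c a l v w x y
  proof -
    have "qb (\<lambda>\<tau>. (of_int c / (49 ^ a * 49 ^ l)) * (Tw i v w \<tau> ^ a * uw i v w \<tau> ^ l)) (real a * x + real l * y)"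
      by (intro qb_cmult qb_mult qb_power qo_qb that)
    then show ?thesis by (rule qb_cong) (simp add: power_divide)
  qed
  have P: "qb (\<lambda>\<tau>. pol tab (Tw i v w \<tau> / 49) (uw i v w \<tau> / 49)) z"
    if "qo (Tw i v w) x" "qo (uw i v w) y" "\<And>a l. a + l \<le> 8 \<Longrightarrow> z \<le> real a * x + real l * y" for v w x y z
  proof -
    have "qb (\<lambda>\<tau>. \<Sum>t\<leftarrow>tab. of_int (snd (snd t)) * (Tw i v w \<tau> / 49) ^ fst t * (uw i v w \<tau> / 49) ^ fst (snd t)) z"
    proof (rule qb_sum_list)
      fix t assume "t \<in> set tab"
      then have "fst t + fst (snd t) \<le> 8" using assms[of "fst t" "fst (snd t)" "snd (snd t)"] by simp
      then show "qb (\<lambda>\<tau>. of_int (snd (snd t)) * (Tw i v w \<tau> / 49) ^ fst t * (uw i v w \<tau> / 49) ^ fst (snd t)) z"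
        using qb_mono[OF mono[OF that(1,2)] that(3)] by blast
    qed
    then show ?thesis by (simp only: pol_alt)
  qed
  show "qb (\<lambda>\<tau>. pol tab (Tw i v w \<tau> / 49) (uw i v w \<tau> / 49)) (- 8 / 7)" if "v mod 7 \<noteq> 0"
  proof (rule P[OF qo_Tw_explicit(1)[OF that] qo_uw_explicit(1)[OF that]])
    fix a l :: nat assume "a + l \<le> 8"
    then have "real a + real l \<le> 8" by linarith
    then show "- 8 / 7 \<le> real a * (- 1 / 7) + real l * (- 1 / 7)" by simp
  qed
  show "qb (\<lambda>\<tau>. pol tab (Tw i 0 1 \<tau> / 49) (uw i 0 1 \<tau> / 49)) 0" if "i \<noteq> 2"
    by (rule P[OF qo_Tw_explicit(2) qo_uw_explicit(2)]) (use that in auto)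
qed

lemma Tw_cong: "Im \<tau> > 0 \<Longrightarrow> v' mod 7 = v mod 7 \<Longrightarrow> w' mod 7 = w mod 7 \<Longrightarrow> Tw i v' w' \<tau> = Tw i v w \<tau>"
  using a7_cong[of \<tau> v' v w' w] by (simp add: Tw_def)

lemma upw_cong: "Im \<tau> > 0 \<Longrightarrow> v' mod 7 = v mod 7 \<Longrightarrow> w' mod 7 = w mod 7 \<Longrightarrow> upw i v' w' \<tau> = upw i v w \<tau>"
  using a7_cong[of \<tau> v' v w' w] a14_cong[of \<tau> v' v w' w i] by (simp add: upw_def)

lemma Dw_cong:
  assumes "Im \<tau> > 0" "v' mod 7 = v mod 7" "w' mod 7 = w mod 7" "p' mod 7 = p mod 7" "r' mod 7 = r mod 7"
  shows "Dw i v' w' p' r' \<tau> = Dw i v w p r \<tau>"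
  using a7_cong[OF assms(1-3)] a14_cong[OF assms(1-3), of i] a7_cong[OF assms(1,4,5)] a14_cong[OF assms(1,4,5), of i]
  by (simp add: Dw_def)

lemma GU_MF: "MF (\<lambda>i v w \<tau>. \<Sum>(p, r)\<in>Sset v w. Tw i p r \<tau> ^ m * upw i p r \<tau> ^ b)"
proof (rule MF_Sset_sum[where K = "\<lambda>i v w p r \<tau>. Tw i p r \<tau> ^ m * upw i p r \<tau> ^ b"], goal_cases)
  case (1 i v w p r)
  then show ?case by (intro holomorphic_intros MF_D(1)[OF Tw_MF] MF_D(1)[OF upw_MF])
next
  case (2 i v w p r \<tau>)
  show ?case by (simp only: MF_D(2)[OF Tw_MF 2(1,3,4)] MF_D(2)[OF upw_MF 2(1,3,4)])
next
  case (3 i v w p r \<tau>)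
  show ?case by (simp only: MF_D(3)[OF Tw_MF 3(1,3,4)] MF_D(3)[OF upw_MF 3(1,3,4)])
next
  case (4 i v w p r v' w' p' r' \<tau>)
  show ?case by (simp only: Tw_cong[OF 4(2,5,6)] upw_cong[OF 4(2,5,6)])
next
  case (5 i v w p r \<tau>)
  show ?case using MF_scale(1)[OF Tw_MF 5(1,3,4), of 4] MF_scale(1)[OF upw_MF 5(1,3,4), of 4] by simp
next
  case (6 i v w p r \<tau>)
  show ?case by (simp only: MF_D(6)[OF Tw_MF 6(1,3,4)] MF_D(6)[OF upw_MF 6(1,3,4)])
qed

lemma Dw_laws:
  assumes "Im \<tau> > 0" "i < 3"
  shows "Dw i v w p r (\<tau> + 1) = Dw (tI i) v (v + w) p (p + r) \<tau>"
    and "Dw i v w p r (- 1 / \<tau>) = Dw (sI i) w (- v) r (- p) \<tau>"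
    and "Dw i (2 * v) (2 * w) (4 * p) (4 * r) \<tau> = Dw i v w p r \<tau>"
    and "Dw i (- v) (- w) (- p) (- r) \<tau> = Dw i v w p r \<tau>"
proof -
  show "Dw i v w p r (\<tau> + 1) = Dw (tI i) v (v + w) p (p + r) \<tau>"
    by (simp only: Dw_def a7_T a14_T[OF assms])
  show "Dw i v w p r (- 1 / \<tau>) = Dw (sI i) w (- v) r (- p) \<tau>"
    using nz_tau[OF assms(1)] by (simp only: Dw_def a7_S[OF assms(1)] a14_S[OF assms]) simp
  have 4: "a7 (4 * p) (4 * r) \<tau> = a7 p r \<tau>" "a14 i (4 * p) (4 * r) \<tau> = a14 i p r \<tau>"
    using a7_double[OF assms(1), of p r] a7_double[OF assms(1), of "2 * p" "2 * r"]
      a14_double[OF assms(1), of i p r] a14_double[OF assms(1), of i "2 * p" "2 * r"] by simp_all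
  show "Dw i (2 * v) (2 * w) (4 * p) (4 * r) \<tau> = Dw i v w p r \<tau>"
    by (simp only: Dw_def 4 a7_double[OF assms(1)] a14_double[OF assms(1)])
  show "Dw i (- v) (- w) (- p) (- r) \<tau> = Dw i v w p r \<tau>"
    by (simp add: Dw_def a7_minus[OF assms(1)] a14_minus[OF assms(1)])
qed

lemma GA_MF: "MF (\<lambda>i v w \<tau>. \<Sum>(p, r)\<in>Sset v w. Dw i v w p r \<tau> * (Tw i p r \<tau> ^ m * upw i p r \<tau> ^ b))"
proof (rule MF_Sset_sum[where K = "\<lambda>i v w p r \<tau>. Dw i v w p r \<tau> * (Tw i p r \<tau> ^ m * upw i p r \<tau> ^ b)"], goal_cases)
  case (1 i v w p r)
  have "Dw i v w p r holomorphic_on H" unfolding Dw_def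
    using 1 a7_holomorphic_nonzero(2) a14_holomorphic_nonzero(2)
    by (intro holomorphic_intros a7_holomorphic_nonzero(1) a14_holomorphic_nonzero(1)) auto
  with 1 show ?case by (intro holomorphic_intros MF_D(1)[OF Tw_MF] MF_D(1)[OF upw_MF])
next
  case (2 i v w p r \<tau>)
  show ?case by (simp only: MF_D(2)[OF Tw_MF 2(1,3,4)] MF_D(2)[OF upw_MF 2(1,3,4)] Dw_laws(1)[OF 2(4,1)])
next
  case (3 i v w p r \<tau>)
  show ?case by (simp only: MF_D(3)[OF Tw_MF 3(1,3,4)] MF_D(3)[OF upw_MF 3(1,3,4)] Dw_laws(2)[OF 3(4,1)])
next
  case (4 i v w p r v' w' p' r' \<tau>)
  show ?case by (simp only: Tw_cong[OF 4(2,5,6)] upw_cong[OF 4(2,5,6)] Dw_cong[OF 4(2,3,4,5,6)])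
next
  case (5 i v w p r \<tau>)
  show ?case using MF_scale(1)[OF Tw_MF 5(1,3,4), of 4] MF_scale(1)[OF upw_MF 5(1,3,4), of 4] Dw_laws(3)[OF 5(4,1)] by simp
next
  case (6 i v w p r \<tau>)
  show ?case by (simp only: MF_D(6)[OF Tw_MF 6(1,3,4)] MF_D(6)[OF upw_MF 6(1,3,4)] Dw_laws(4)[OF 6(4,1)])
qed

lemma sum_Sset_0_1:
  "(\<Sum>(p, r)\<in>Sset 0 1. h p r) = (\<Sum>l = 0..(6::nat). h 1 (int l) :: complex)"
proof -
  have p: "p = 1" if "p \<in> {0..6}" "(1 - p) mod 7 = 0" for p :: int
  proof -
    have "p \<in> {0, 1, 2, 3, 4, 5, 6}" using that(1) by auto
    then show ?thesis using that(2) by auto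
  qed
  have "Sset 0 1 = (\<lambda>l. (1, int l)) ` {0..6}"
  proof
    show "Sset 0 1 \<subseteq> (\<lambda>l. (1, int l)) ` {0..6}"
    proof
      fix x assume "x \<in> Sset 0 1"
      then obtain k r where x: "x = (k, r)" "k \<in> {0..6}" "r \<in> {0..6}" "(1 - k) mod 7 = 0" by (auto simp: Sset_def)
      then have "x = (1, int (nat r))" using p by auto
      moreover have "nat r \<in> {0..6}" using x by auto
      ultimately show "x \<in> (\<lambda>l. (1, int l)) ` {0..6}" by blast
    qed
  qed (auto simp: Sset_def)
  then show ?thesis by (simp add: sum.reindex inj_on_def)
qed

text \<open>The factor \<open>TT\<close> belongs to the indices (i, 0, 1) with i < 2, where the
  Atkin sum may have order -1 and \<open>Tw\<close> has order 1. Elsewhere a summand has order at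
  least -1 as well: by \<open>b \<le> m + 1\<close> if p = 0 mod 7, and by \<open>m \<le> 7\<close>
  otherwise. Together with the -1/7 of \<open>Tw\<close> this is the -8/7 of
  \<open>MF_vanish\<close>.\<close>

theorem U7_identity:
  assumes m: "m \<le> 7" "b \<le> m + 1" and tab: "\<And>a l c. (a, l, c) \<in> set tab \<Longrightarrow> a + l \<le> 8"
    and q: "qb (\<lambda>\<tau>. of_int N * TT \<tau> * atkin_U7 (\<lambda>z. mod_u z ^ b / TT z ^ m) \<tau> - pol tab (TT \<tau>) (mod_u \<tau>)) 25"
    and t: "Im \<tau> > 0"
  shows "of_int N * TT \<tau> * atkin_U7 (\<lambda>z. mod_u z ^ b / TT z ^ m) \<tau> = pol tab (TT \<tau>) (mod_u \<tau>)"
proof -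
  \<comment> \<open>The denominator is 49 from \<open>Tw_0_1\<close> times 7 from the Atkin
    operator.\<close>
  define f where "f = (\<lambda>i v w \<tau>. (of_int N / 343) * Tw i v w \<tau> * (\<Sum>(p, r)\<in>Sset v w. Tw i p r \<tau> ^ m * upw i p r \<tau> ^ b)
     - pol tab (Tw i v w \<tau> / 49) (uw i v w \<tau> / 49))"
  have f01: "f 2 0 1 \<tau> = of_int N * TT \<tau> * atkin_U7 (\<lambda>z. mod_u z ^ b / TT z ^ m) \<tau> - pol tab (TT \<tau>) (mod_u \<tau>)" if "Im \<tau> > 0" for \<tau>
  proof -
    have "(\<Sum>(p, r)\<in>Sset 0 1. Tw 2 p r \<tau> ^ m * upw 2 p r \<tau> ^ b) = 7 * atkin_U7 (\<lambda>z. mod_u z ^ b / TT z ^ m) \<tau>"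
      unfolding sum_Sset_0_1 atkin_U7_def family_at_1[OF that] by (simp add: power_divide)
    moreover have "Tw 2 0 1 \<tau> = 49 * TT \<tau>" using Tw_0_1[OF that, of 2] by simp
    ultimately show ?thesis unfolding f_def using Tw_0_1[OF that] uw_0_1[OF that] by simp
  qed
  have "f 2 0 1 \<tau> = 0"
  proof (rule MF_vanish[OF _ _ _ _ t])
    show "MF f" unfolding f_def by (intro MF_diff MF_mult MF_const Tw_MF GU_MF pol_MF)
    show "qb (f 2 0 1) 25" by (rule qb_cong[OF q]) (use f01 in auto)
  next
    fix i v w assume i: "i < (3::nat)" and v: "v mod (7::int) \<noteq> 0"
    have "qb (\<lambda>\<tau>. \<Sum>x\<in>Sset v w. (case x of (p, r) \<Rightarrow> Tw i p r \<tau> ^ m * upw i p r \<tau> ^ b)) (- 1)"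
    proof (rule qb_sum[OF finite_Sset])
      fix x assume "x \<in> Sset v w"
      then obtain p r where x: "x = (p, r)" "nz7 p r" using Sset_nz by (cases x) blast
      have "qb (\<lambda>\<tau>. Tw i p r \<tau> ^ m * upw i p r \<tau> ^ b) (- 1)"
      proof (cases "p mod 7 = 0")
        case True
        have "qb (\<lambda>\<tau>. Tw i p r \<tau> ^ m * upw i p r \<tau> ^ b) (real m * 1 + real b * (- 1))"
          by (intro qb_mult qb_power qo_qb qo_Tw_explicit qo_upw_explicit) (use True x(2) in auto)
        then show ?thesis by (rule qb_mono) (use m(2) in linarith)
      next
        case False
        have "qb (\<lambda>\<tau>. Tw i p r \<tau> ^ m * upw i p r \<tau> ^ b) (real m * (- 1 / 7) + real b * (if i = 2 then 3 / 7 else 0))"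
          by (intro qb_mult qb_power qo_qb qo_Tw_explicit qo_upw_explicit) (use False in auto)
        then show ?thesis by (rule qb_mono) (use m(1) in auto)
      qed
      then show "qb (\<lambda>\<tau>. case x of (p, r) \<Rightarrow> Tw i p r \<tau> ^ m * upw i p r \<tau> ^ b) (- 1)" by (simp add: x)
    qed
    then have "qb (\<lambda>\<tau>. (of_int N / 343) * Tw i v w \<tau> * (\<Sum>(p, r)\<in>Sset v w. Tw i p r \<tau> ^ m * upw i p r \<tau> ^ b)) (- 1 / 7 + - 1)"
      by (rule qb_mult[OF qb_cmult[OF qo_qb[OF qo_Tw_explicit(1)[OF v]]]])
    then show "qb (f i v w) (- 8 / 7)" unfolding f_def
      by (intro qb_diff pol_growth(1)[OF tab v]) simp_all
  next
    fix i assume i: "i < (2::nat)"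
    have "qb (\<lambda>\<tau>. \<Sum>x\<in>Sset 0 1. (case x of (p, r) \<Rightarrow> Tw i p r \<tau> ^ m * upw i p r \<tau> ^ b)) (- 1)"
    proof (rule qb_sum[OF finite_Sset])
      fix x assume x: "x \<in> Sset 0 1"
      obtain p r where pr: "x = (p, r)" by (cases x)
      have p: "p mod 7 \<noteq> 0" using x pr by (auto simp: Sset_def)
      have "qb (\<lambda>\<tau>. Tw i p r \<tau> ^ m * upw i p r \<tau> ^ b) (real m * (- 1 / 7) + real b * (if i = 2 then 3 / 7 else 0))"
        by (intro qb_mult qb_power qo_qb qo_Tw_explicit qo_upw_explicit p)
      then have "qb (\<lambda>\<tau>. Tw i p r \<tau> ^ m * upw i p r \<tau> ^ b) (- 1)" by (rule qb_mono) (use m(1) i in auto)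
      then show "qb (\<lambda>\<tau>. case x of (p, r) \<Rightarrow> Tw i p r \<tau> ^ m * upw i p r \<tau> ^ b) (- 1)" by (simp add: pr)
    qed
    then have "qb (\<lambda>\<tau>. (of_int N / 343) * Tw i 0 1 \<tau> * (\<Sum>(p, r)\<in>Sset 0 1. Tw i p r \<tau> ^ m * upw i p r \<tau> ^ b)) (1 + - 1)"
      by (intro qb_mult[OF qb_cmult[OF qo_qb[OF qo_Tw_explicit(2)]]]) auto
    then show "qb (f i 0 1) 0" unfolding f_def
      by (intro qb_diff pol_growth(2)[OF tab]) (use i in simp_all)
  qed
  then show ?thesis using f01[OF t] by simp
qed

text \<open>Here the kernel takes over the part of the factor \<open>TT\<close>: at (i, 0, 1) with i
  < 2 it has order 8/7, which offsets the pole of order m/7 for \<open>m \<le> 8\<close>. For p = 0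
  mod 7 its order can be as low as -8/7, hence the condition \<open>b \<le> m\<close>.\<close>

theorem UA7_identity:
  assumes m: "m \<le> 8" "b \<le> m" and tab: "\<And>a l c. (a, l, c) \<in> set tab \<Longrightarrow> a + l \<le> 8"
    and q: "qb (\<lambda>\<tau>. of_int N * atkin_U7 (\<lambda>z. mod_A z * (mod_u z ^ b / TT z ^ m)) \<tau> - pol tab (TT \<tau>) (mod_u \<tau>)) 25"
    and t: "Im \<tau> > 0"
  shows "of_int N * atkin_U7 (\<lambda>z. mod_A z * (mod_u z ^ b / TT z ^ m)) \<tau> = pol tab (TT \<tau>) (mod_u \<tau>)"
proof -
  define K where "K = of_int N / (7 * - (c7 ^ 3))"
  define f where "f = (\<lambda>i v w \<tau>. K * (\<Sum>(p, r)\<in>Sset v w. Dw i v w p r \<tau> * (Tw i p r \<tau> ^ m * upw i p r \<tau> ^ b))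
     - pol tab (Tw i v w \<tau> / 49) (uw i v w \<tau> / 49))"
  have f01: "f 2 0 1 \<tau> = of_int N * atkin_U7 (\<lambda>z. mod_A z * (mod_u z ^ b / TT z ^ m)) \<tau> - pol tab (TT \<tau>) (mod_u \<tau>)" if "Im \<tau> > 0" for \<tau>
  proof -
    have "(\<Sum>(p, r)\<in>Sset 0 1. Dw 2 0 1 p r \<tau> * (Tw 2 p r \<tau> ^ m * upw 2 p r \<tau> ^ b)) = (7 * - (c7 ^ 3)) * atkin_U7 (\<lambda>z. mod_A z * (mod_u z ^ b / TT z ^ m)) \<tau>"
      unfolding sum_Sset_0_1 atkin_U7_def family_at_1[OF that] by (simp add: power_divide sum_distrib_left mult_ac)
    then show ?thesis unfolding f_def K_def using Tw_0_1[OF that] uw_0_1[OF that] c7_nonzero by simp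
  qed
  have D1: "qo (Dw i v w p r) (if p mod 7 \<noteq> 0 then 0 else if i = 2 then - 2 / 7 else - 8 / 7)" if "v mod 7 \<noteq> 0" "nz7 p r" for i v w p r
    using qo_Dw[of v w p r i] that by (cases "i = 2") (auto simp: ord7_def kap_def split: if_splits)
  have D2: "qo (Dw i 0 1 p r) (8 / 7)" if "p mod 7 \<noteq> 0" "i \<noteq> 2" for i p r
    using qo_Dw[of 0 1 p r i] that by (simp add: ord7_def kap_def)
  have "f 2 0 1 \<tau> = 0"
  proof (rule MF_vanish[OF _ _ _ _ t])
    show "MF f" unfolding f_def by (intro MF_diff MF_mult MF_const GA_MF pol_MF)
    show "qb (f 2 0 1) 25" by (rule qb_cong[OF q]) (use f01 in auto)
  next
    fix i v w assume i: "i < (3::nat)" and v: "v mod (7::int) \<noteq> 0"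
    have "qb (\<lambda>\<tau>. \<Sum>x\<in>Sset v w. (case x of (p, r) \<Rightarrow> Dw i v w p r \<tau> * (Tw i p r \<tau> ^ m * upw i p r \<tau> ^ b))) (- 8 / 7)"
    proof (rule qb_sum[OF finite_Sset])
      fix x assume "x \<in> Sset v w"
      then obtain p r where x: "x = (p, r)" "nz7 p r" using Sset_nz by (cases x) blast
      have "qb (\<lambda>\<tau>. Dw i v w p r \<tau> * (Tw i p r \<tau> ^ m * upw i p r \<tau> ^ b)) (- 8 / 7)"
      proof (cases "p mod 7 = 0")
        case True
        have "qb (\<lambda>\<tau>. Dw i v w p r \<tau> * (Tw i p r \<tau> ^ m * upw i p r \<tau> ^ b)) ((if p mod 7 \<noteq> 0 then 0 else if i = 2 then - 2 / 7 else - 8 / 7) + (real m * 1 + real b * (- 1)))"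
          by (intro qb_mult qb_power qo_qb D1 v qo_Tw_explicit qo_upw_explicit) (use True x(2) in auto)
        then show ?thesis by (rule qb_mono) (use m(2) True in auto)
      next
        case False
        have "qb (\<lambda>\<tau>. Dw i v w p r \<tau> * (Tw i p r \<tau> ^ m * upw i p r \<tau> ^ b)) ((if p mod 7 \<noteq> 0 then 0 else if i = 2 then - 2 / 7 else - 8 / 7) + (real m * (- 1 / 7) + real b * (if i = 2 then 3 / 7 else 0)))"
          by (intro qb_mult qb_power qo_qb D1 v qo_Tw_explicit qo_upw_explicit) (use False in auto)
        then show ?thesis by (rule qb_mono) (use m(1) False in auto)
      qed
      then show "qb (\<lambda>\<tau>. case x of (p, r) \<Rightarrow> Dw i v w p r \<tau> * (Tw i p r \<tau> ^ m * upw i p r \<tau> ^ b)) (- 8 / 7)" by (simp add: x)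
    qed
    then show "qb (f i v w) (- 8 / 7)" unfolding f_def
      by (intro qb_diff qb_cmult pol_growth(1)[OF tab v]) simp_all
  next
    fix i assume i: "i < (2::nat)"
    have "qb (\<lambda>\<tau>. \<Sum>x\<in>Sset 0 1. (case x of (p, r) \<Rightarrow> Dw i 0 1 p r \<tau> * (Tw i p r \<tau> ^ m * upw i p r \<tau> ^ b))) 0"
    proof (rule qb_sum[OF finite_Sset])
      fix x assume x: "x \<in> Sset 0 1"
      obtain p r where pr: "x = (p, r)" by (cases x)
      have p: "p mod 7 \<noteq> 0" using x pr by (auto simp: Sset_def)
      have "qb (\<lambda>\<tau>. Dw i 0 1 p r \<tau> * (Tw i p r \<tau> ^ m * upw i p r \<tau> ^ b)) (8 / 7 + (real m * (- 1 / 7) + real b * (if i = 2 then 3 / 7 else 0)))"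
        by (intro qb_mult qb_power qo_qb D2 qo_Tw_explicit qo_upw_explicit p) (use i in auto)
      then have "qb (\<lambda>\<tau>. Dw i 0 1 p r \<tau> * (Tw i p r \<tau> ^ m * upw i p r \<tau> ^ b)) 0" by (rule qb_mono) (use m(1) i in auto)
      then show "qb (\<lambda>\<tau>. case x of (p, r) \<Rightarrow> Dw i 0 1 p r \<tau> * (Tw i p r \<tau> ^ m * upw i p r \<tau> ^ b)) 0" by (simp add: pr)
    qed
    then show "qb (f i 0 1) 0" unfolding f_def
      by (intro qb_diff qb_cmult pol_growth(2)[OF tab]) (use i in simp_all)
  qed
  then show ?thesis using f01[OF t] by simp
qed

theorem pol_identity:
  assumes tab: "\<And>a l c. (a, l, c) \<in> set tab \<Longrightarrow> a + l \<le> 8"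
    and q: "qb (\<lambda>\<tau>. pol tab (TT \<tau>) (mod_u \<tau>)) 25" and t: "Im \<tau> > 0"
  shows "pol tab (TT \<tau>) (mod_u \<tau>) = 0"
proof -
  define f where "f = (\<lambda>i v w \<tau>. pol tab (Tw i v w \<tau> / 49) (uw i v w \<tau> / 49))"
  have f01: "f 2 0 1 \<tau> = pol tab (TT \<tau>) (mod_u \<tau>)" if "Im \<tau> > 0" for \<tau>
    by (simp only: f_def Tw_0_1[OF that] uw_0_1[OF that])
  have "f 2 0 1 \<tau> = 0"
  proof (rule MF_vanish[OF _ _ _ _ t])
    show "MF f" unfolding f_def by (rule pol_MF)
    show "qb (f 2 0 1) 25" by (rule qb_cong[OF q]) (use f01 in auto)
    show "qb (f i v w) (- 8 / 7)" if "v mod 7 \<noteq> 0" for i v w unfolding f_def by (rule pol_growth(1)[OF tab that])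
    show "qb (f i 0 1) 0" if "i < 2" for i unfolding f_def by (rule pol_growth(2)[OF tab]) (use that in auto)
  qed
  then show ?thesis using f01[OF t] by simp
qed

section \<open>Truncated expansions in the nome\<close>

fun ev :: "int list \<Rightarrow> complex \<Rightarrow> complex" where
  "ev [] q = 0"
| "ev (c # cs) q = of_int c + q * ev cs q"

definition apx :: "nat \<Rightarrow> (complex \<Rightarrow> complex) \<Rightarrow> (complex \<Rightarrow> complex) \<Rightarrow> bool" where
  "apx n u v \<longleftrightarrow> (\<exists>R. \<forall>q. norm q \<le> 1 \<longrightarrow> norm (u q - v q) \<le> R * norm q ^ n)"

lemma apx_refl: "apx n u u"
  unfolding apx_def by (intro exI[of _ 0]) simp

lemma apx_Suc:
  assumes "apx n u v"
  shows "apx (Suc n) (\<lambda>q. c + q * u q) (\<lambda>q. c + q * v q)"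
proof -
  obtain R where R: "\<And>q. norm q \<le> 1 \<Longrightarrow> norm (u q - v q) \<le> R * norm q ^ n" using assms by (auto simp: apx_def)
  have "norm ((c + q * u q) - (c + q * v q)) \<le> R * norm q ^ Suc n" if "norm q \<le> 1" for q
  proof -
    have "norm ((c + q * u q) - (c + q * v q)) = norm q * norm (u q - v q)"
      by (simp add: norm_mult [symmetric] algebra_simps)
    also have "\<dots> \<le> norm q * (R * norm q ^ n)" by (intro mult_left_mono R that) simp
    finally show ?thesis by (simp add: mult_ac)
  qed
  then show ?thesis unfolding apx_def by blast
qed

lemma apx_trans:
  assumes "apx n u v" "apx n v w"
  shows "apx n u w"
proof -
  obtain R S where "\<And>q. norm q \<le> 1 \<Longrightarrow> norm (u q - v q) \<le> R * norm q ^ n"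
    "\<And>q. norm q \<le> 1 \<Longrightarrow> norm (v q - w q) \<le> S * norm q ^ n" using assms by (auto simp: apx_def)
  then have "norm (u q - w q) \<le> (R + S) * norm q ^ n" if "norm q \<le> 1" for q
    using that norm_triangle_le[of "u q - v q" "v q - w q" "(R + S) * norm q ^ n"] by (force simp: distrib_right)
  then show ?thesis unfolding apx_def by blast
qed

lemma apx_add:
  assumes "apx n u v"
  shows "apx n (\<lambda>q. u q + w q) (\<lambda>q. v q + w q)"
  using assms by (simp add: apx_def)

fun addmul :: "int \<Rightarrow> int list \<Rightarrow> int list \<Rightarrow> int list" where
  "addmul x ys [] = []"
| "addmul x [] (a # as) = a # as"
| "addmul x (y # ys) (a # as) = (a + x * y) # addmul x ys as"

lemma length_addmul [simp]: "length (addmul x ys as) = length as"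
  by (induction x ys as rule: addmul.induct) auto

lemma norm_ev_le: "norm q \<le> 1 \<Longrightarrow> norm (ev cs q) \<le> (\<Sum>c\<leftarrow>cs. \<bar>of_int c\<bar>)"
proof (induction cs)
  case (Cons c cs)
  have "norm (ev (c # cs) q) \<le> norm (of_int c :: complex) + norm (q * ev cs q)"
    unfolding ev.simps by (rule norm_triangle_ineq)
  also have "norm (q * ev cs q) \<le> 1 * norm (ev cs q)" unfolding norm_mult using Cons.prems by (intro mult_right_mono) auto
  finally show ?case using Cons by simp
qed simp

lemma ev_addmul: "apx (length as) (ev (addmul x ys as)) (\<lambda>q. ev as q + of_int x * ev ys q)"
proof (induction x ys as rule: addmul.induct)
  case (1 x ys)
  have "norm (0 - of_int x * ev ys q) \<le> (\<bar>of_int x\<bar> * (\<Sum>c\<leftarrow>ys. \<bar>of_int c\<bar>)) * 1" if "norm q \<le> 1" for q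
    using norm_ev_le[OF that, of ys] by (simp add: norm_mult mult_left_mono)
  then show ?case unfolding apx_def by (intro exI[of _ "\<bar>of_int x\<bar> * (\<Sum>c\<leftarrow>ys. \<bar>of_int c\<bar>)"]) auto
next
  case (2 x a as)
  then show ?case by (simp add: apx_refl)
next
  case (3 x y ys a as)
  have eq: "(\<lambda>q. ev (a # as) q + of_int x * ev (y # ys) q) = (\<lambda>q. of_int (a + x * y) + q * (ev as q + of_int x * ev ys q))"
    by (auto simp: algebra_simps)
  show ?case unfolding eq using apx_Suc[OF 3, of "of_int (a + x * y)"] by simp
qed

text \<open>Adds the product of \<open>xs\<close> and \<open>ys\<close> to the accumulator, whose
  length is the precision. After one coefficient of \<open>xs\<close> the head is final and is split
  off, which performs the shift. Zeros are skipped because the lists for \<open>eul\<close> and its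
  cube are sparse.\<close>

fun lmulacc :: "int list \<Rightarrow> int list \<Rightarrow> int list \<Rightarrow> int list" where
  "lmulacc xs ys [] = []"
| "lmulacc [] ys (a # as) = a # as"
| "lmulacc (x # xs) ys (a # as) = (if x = 0 then a # lmulacc xs ys as
     else (case addmul x ys (a # as) of [] \<Rightarrow> [] | b # bs \<Rightarrow> b # lmulacc xs ys bs))"

lemma lmulacc_Cons: "lmulacc (x # xs) ys (a # as) = (case addmul x ys (a # as) of [] \<Rightarrow> [] | b # bs \<Rightarrow> b # lmulacc xs ys bs)"
proof -
  have "addmul 0 ys as = as" for ys as by (induction "0 :: int" ys as rule: addmul.induct) auto
  then show ?thesis by auto
qed

lemma ev_lmulacc: "length (lmulacc xs ys as) = length as \<and> apx (length as) (ev (lmulacc xs ys as)) (\<lambda>q. ev as q + ev xs q * ev ys q)"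
proof (induction xs arbitrary: as)
  case Nil
  then show ?case by (cases as) (auto simp: apx_refl)
next
  case (Cons x xs)
  show ?case
  proof (cases as)
    case Nil
    have "norm (0 - ev (x # xs) q * ev ys q) \<le> ((\<Sum>c\<leftarrow>x # xs. \<bar>of_int c\<bar>) * (\<Sum>c\<leftarrow>ys. \<bar>of_int c\<bar>)) * 1" if "norm q \<le> 1" for q
      using norm_ev_le[OF that, of "x # xs"] norm_ev_le[OF that, of ys]
      by (simp only: diff_0 norm_minus_cancel norm_mult mult_1_right) (intro mult_mono, auto intro!: add_nonneg_nonneg sum_list_nonneg)
    then show ?thesis unfolding apx_def Nil by (auto intro!: exI[of _ "(\<Sum>c\<leftarrow>x # xs. \<bar>of_int c\<bar>) * (\<Sum>c\<leftarrow>ys. \<bar>of_int c\<bar>)"])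
  next
    case (Cons a as')
    have la: "length (addmul x ys as) = Suc (length as')" unfolding length_addmul using Cons by simp
    then obtain b bs where b: "addmul x ys as = b # bs" "length bs = length as'"
      by (cases "addmul x ys as") auto
    have l: "lmulacc (x # xs) ys as = b # lmulacc xs ys bs" using b Cons lmulacc_Cons by simp
    have 1: "apx (length as) (ev (b # lmulacc xs ys bs)) (\<lambda>q. of_int b + q * (ev bs q + ev xs q * ev ys q))"
    proof -
      have "ev (b # lmulacc xs ys bs) = (\<lambda>q. of_int b + q * ev (lmulacc xs ys bs) q)" by auto
      then show ?thesis
        using apx_Suc[OF Cons.IH[of bs, THEN conjunct2], of "of_int b"] b(2) Cons by simp
    qed
    have 2: "apx (length as) (\<lambda>q. of_int b + q * (ev bs q + ev xs q * ev ys q)) (\<lambda>q. ev as q + ev (x # xs) q * ev ys q)"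
    proof -
      have "(\<lambda>q. of_int b + q * (ev bs q + ev xs q * ev ys q)) = (\<lambda>q. ev (addmul x ys as) q + q * ev xs q * ev ys q)"
        by (auto simp: b algebra_simps)
      moreover have "(\<lambda>q. ev as q + ev (x # xs) q * ev ys q) = (\<lambda>q. (ev as q + of_int x * ev ys q) + q * ev xs q * ev ys q)"
        by (auto simp: algebra_simps)
      ultimately show ?thesis using apx_add[OF ev_addmul[of as x ys]] by simp
    qed
    show ?thesis using apx_trans[OF 1 2] Cons.IH[of bs] b(2) Cons unfolding l by (simp del: ev.simps)
  qed
qed

definition lmul :: "int list \<Rightarrow> int list \<Rightarrow> int list" where
  "lmul xs ys = lmulacc xs ys (map (\<lambda>_. 0) ys)"

lemma ev_zeros: "ev (map (\<lambda>_. 0) ys) q = 0" "ev (replicate n 0) q = 0"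
  by (induction ys, auto) (induction n, auto)

lemma length_lmul [simp]: "length (lmul xs ys) = length ys"
  using ev_lmulacc[of xs ys "map (\<lambda>_. 0) ys"] by (simp add: lmul_def)

lemma ev_lmul: "apx (length ys) (ev (lmul xs ys)) (\<lambda>q. ev xs q * ev ys q)"
  using ev_lmulacc[of xs ys "map (\<lambda>_. 0) ys"] by (simp add: lmul_def ev_zeros)

text \<open>The length of the list is the precision. The estimate is asked on Im \<tau> >= h for
  every positive h, and not only for h = 1/2, because the Atkin operator evaluates at a seventh of
  the height.\<close>

definition tr :: "(complex \<Rightarrow> complex) \<Rightarrow> int list \<Rightarrow> bool" where
  "tr f cs \<longleftrightarrow> (\<forall>h>0. \<exists>C. \<forall>\<tau>. Im \<tau> \<ge> h \<longrightarrow> norm (f \<tau> - ev cs (nome \<tau>)) \<le> C * norm (nome \<tau>) ^ length cs)"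

lemma norm_nome_le_1: "Im \<tau> \<ge> h \<Longrightarrow> h > 0 \<Longrightarrow> norm (nome \<tau>) \<le> 1"
  using norm_nome_less_1[of \<tau>] by simp

lemma tr_obtain:
  assumes "tr f cs" "h > 0"
  obtains C where "C \<ge> 0" "\<And>\<tau>. Im \<tau> \<ge> h \<Longrightarrow> norm (f \<tau> - ev cs (nome \<tau>)) \<le> C * norm (nome \<tau>) ^ length cs"
proof -
  obtain C where C: "\<And>\<tau>. Im \<tau> \<ge> h \<Longrightarrow> norm (f \<tau> - ev cs (nome \<tau>)) \<le> C * norm (nome \<tau>) ^ length cs"
    using assms unfolding tr_def by blast
  have "norm (f \<tau> - ev cs (nome \<tau>)) \<le> max C 0 * norm (nome \<tau>) ^ length cs" if "Im \<tau> \<ge> h" for \<tau>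
    by (rule order_trans[OF C[OF that]]) (intro mult_right_mono, auto)
  then show ?thesis using that[of "max C 0"] by simp
qed

lemma tr_cong: "tr f cs \<Longrightarrow> (\<And>\<tau>. Im \<tau> > 0 \<Longrightarrow> g \<tau> = f \<tau>) \<Longrightarrow> tr g cs"
  unfolding tr_def by (metis less_le_trans)

lemma tr_apx:
  assumes "tr f cs" "apx (length cs) (ev ds) (ev cs)" "length ds = length cs"
  shows "tr f ds"
  unfolding tr_def
proof (intro allI impI)
  fix h :: real assume h: "h > 0"
  obtain C where C: "\<And>\<tau>. Im \<tau> \<ge> h \<Longrightarrow> norm (f \<tau> - ev cs (nome \<tau>)) \<le> C * norm (nome \<tau>) ^ length cs"
    using tr_obtain[OF assms(1) h] by blast
  obtain R where R: "\<And>q. norm q \<le> 1 \<Longrightarrow> norm (ev ds q - ev cs q) \<le> R * norm q ^ length cs"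
    using assms(2) by (auto simp: apx_def)
  have "norm (f \<tau> - ev ds (nome \<tau>)) \<le> (C + R) * norm (nome \<tau>) ^ length ds" if t: "Im \<tau> \<ge> h" for \<tau>
  proof -
    have "norm (f \<tau> - ev ds (nome \<tau>)) \<le> norm (f \<tau> - ev cs (nome \<tau>)) + norm (ev ds (nome \<tau>) - ev cs (nome \<tau>))"
      by (metis diff_diff_eq2 diff_add_cancel norm_triangle_ineq4 add_diff_cancel_right')
    also have "\<dots> \<le> C * norm (nome \<tau>) ^ length cs + R * norm (nome \<tau>) ^ length cs"
      using C[OF t] R[OF norm_nome_le_1[OF t h]] by (rule add_mono)
    finally show ?thesis by (simp add: assms(3) distrib_right)
  qed
  then show "\<exists>C. \<forall>\<tau>. Im \<tau> \<ge> h \<longrightarrow> norm (f \<tau> - ev ds (nome \<tau>)) \<le> C * norm (nome \<tau>) ^ length ds" by blast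
qed

text \<open>Separates the precision from the comparison function, so that untruncated sums and
  products can be formed before \<open>trg_apx\<close> returns to a list.\<close>

definition trg :: "nat \<Rightarrow> (complex \<Rightarrow> complex) \<Rightarrow> (complex \<Rightarrow> complex) \<Rightarrow> bool" where
  "trg n f u \<longleftrightarrow> (\<forall>h>0. \<exists>C. \<forall>\<tau>. Im \<tau> \<ge> h \<longrightarrow> norm (f \<tau> - u (nome \<tau>)) \<le> C * norm (nome \<tau>) ^ n)"

lemma tr_trg: "tr f cs \<longleftrightarrow> trg (length cs) f (ev cs)"
  by (simp add: tr_def trg_def)

lemma trg_apx:
  assumes "trg n f u" "apx n v u"
  shows "trg n f v"
  unfolding trg_def
proof (intro allI impI)
  fix h :: real assume h: "h > 0"
  obtain C where C: "\<And>\<tau>. Im \<tau> \<ge> h \<Longrightarrow> norm (f \<tau> - u (nome \<tau>)) \<le> C * norm (nome \<tau>) ^ n"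
    using assms(1) h unfolding trg_def by blast
  obtain R where R: "\<And>q. norm q \<le> 1 \<Longrightarrow> norm (v q - u q) \<le> R * norm q ^ n"
    using assms(2) by (auto simp: apx_def)
  have "norm (f \<tau> - v (nome \<tau>)) \<le> (C + R) * norm (nome \<tau>) ^ n" if t: "Im \<tau> \<ge> h" for \<tau>
  proof -
    have "norm (f \<tau> - v (nome \<tau>)) \<le> norm (f \<tau> - u (nome \<tau>)) + norm (v (nome \<tau>) - u (nome \<tau>))"
      using norm_triangle_ineq4[of "f \<tau> - u (nome \<tau>)" "v (nome \<tau>) - u (nome \<tau>)"] by simp
    also have "\<dots> \<le> C * norm (nome \<tau>) ^ n + R * norm (nome \<tau>) ^ n"
      using C[OF t] R[OF norm_nome_le_1[OF t h]] by (rule add_mono)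
    finally show ?thesis by (simp add: distrib_right)
  qed
  then show "\<exists>C. \<forall>\<tau>. Im \<tau> \<ge> h \<longrightarrow> norm (f \<tau> - v (nome \<tau>)) \<le> C * norm (nome \<tau>) ^ n" by blast
qed

lemma trg_mult:
  assumes f: "trg n f u" and g: "trg n g v" and bu: "\<And>q. norm q \<le> 1 \<Longrightarrow> norm (u q) \<le> B" and bv: "\<And>q. norm q \<le> 1 \<Longrightarrow> norm (v q) \<le> B'"
  shows "trg n (\<lambda>\<tau>. f \<tau> * g \<tau>) (\<lambda>q. u q * v q)"
  unfolding trg_def
proof (intro allI impI)
  fix h :: real assume h: "h > 0"
  obtain C where C: "\<And>\<tau>. Im \<tau> \<ge> h \<Longrightarrow> norm (f \<tau> - u (nome \<tau>)) \<le> C * norm (nome \<tau>) ^ n"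
    using f h unfolding trg_def by blast
  obtain D where D: "\<And>\<tau>. Im \<tau> \<ge> h \<Longrightarrow> norm (g \<tau> - v (nome \<tau>)) \<le> D * norm (nome \<tau>) ^ n"
    using g h unfolding trg_def by blast
  have "norm (f \<tau> * g \<tau> - u (nome \<tau>) * v (nome \<tau>)) \<le> (\<bar>C\<bar> * (\<bar>D\<bar> + \<bar>B'\<bar>) + \<bar>B\<bar> * \<bar>D\<bar>) * norm (nome \<tau>) ^ n" if t: "Im \<tau> \<ge> h" for \<tau>
  proof -
    let ?q = "nome \<tau>" and ?N = "norm (nome \<tau>) ^ n"
    have q1: "norm ?q \<le> 1" by (rule norm_nome_le_1[OF t h])
    have N1: "?N \<le> 1" using q1 by (simp add: power_le_one)
    have C': "norm (f \<tau> - u ?q) \<le> \<bar>C\<bar> * ?N" by (rule order_trans[OF C[OF t]]) (intro mult_right_mono, auto)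
    have D': "norm (g \<tau> - v ?q) \<le> \<bar>D\<bar> * ?N" by (rule order_trans[OF D[OF t]]) (intro mult_right_mono, auto)
    have "norm (g \<tau>) \<le> norm (g \<tau> - v ?q) + norm (v ?q)" by (metis diff_add_cancel norm_triangle_ineq)
    also have "\<dots> \<le> \<bar>D\<bar> * 1 + \<bar>B'\<bar>"
      using D' bv[OF q1] N1 mult_left_mono[OF N1, of "\<bar>D\<bar>"] by linarith
    finally have G: "norm (g \<tau>) \<le> \<bar>D\<bar> + \<bar>B'\<bar>" by simp
    have U: "norm (u ?q) \<le> \<bar>B\<bar>" using bu[OF q1] by linarith
    have "f \<tau> * g \<tau> - u ?q * v ?q = (f \<tau> - u ?q) * g \<tau> + u ?q * (g \<tau> - v ?q)" by (simp add: algebra_simps)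
    then have "norm (f \<tau> * g \<tau> - u ?q * v ?q) \<le> norm (f \<tau> - u ?q) * norm (g \<tau>) + norm (u ?q) * norm (g \<tau> - v ?q)"
      by (metis norm_mult norm_triangle_ineq)
    also have "\<dots> \<le> (\<bar>C\<bar> * ?N) * (\<bar>D\<bar> + \<bar>B'\<bar>) + \<bar>B\<bar> * (\<bar>D\<bar> * ?N)"
      using C' D' G U by (intro add_mono mult_mono) auto
    finally show ?thesis by (simp add: algebra_simps)
  qed
  then show "\<exists>C. \<forall>\<tau>. Im \<tau> \<ge> h \<longrightarrow> norm (f \<tau> * g \<tau> - u (nome \<tau>) * v (nome \<tau>)) \<le> C * norm (nome \<tau>) ^ n" by blast
qed

lemma tr_mult:
  assumes "tr f cs" "tr g ds" "length cs = length ds"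
  shows "tr (\<lambda>\<tau>. f \<tau> * g \<tau>) (lmul cs ds)"
proof -
  have "trg (length ds) (\<lambda>\<tau>. f \<tau> * g \<tau>) (\<lambda>q. ev cs q * ev ds q)"
    by (rule trg_mult[of _ _ _ _ _ "\<Sum>c\<leftarrow>cs. \<bar>of_int c\<bar>" "\<Sum>c\<leftarrow>ds. \<bar>of_int c\<bar>"]) (use assms norm_ev_le in \<open>auto simp: tr_trg\<close>)
  from trg_apx[OF this ev_lmul] show ?thesis by (simp add: tr_trg)
qed

lemma tr_const: "tr (\<lambda>\<tau>. of_int c) (c # replicate n 0)"
  unfolding tr_def by (auto simp: ev_zeros intro!: exI[of _ 0])

lemma trg_add:
  assumes f: "trg n f u" and g: "trg n g v"
  shows "trg n (\<lambda>\<tau>. f \<tau> + g \<tau>) (\<lambda>q. u q + v q)"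
  unfolding trg_def
proof (intro allI impI)
  fix h :: real assume h: "h > 0"
  obtain C where C: "\<And>\<tau>. Im \<tau> \<ge> h \<Longrightarrow> norm (f \<tau> - u (nome \<tau>)) \<le> C * norm (nome \<tau>) ^ n"
    using f h unfolding trg_def by blast
  obtain D where D: "\<And>\<tau>. Im \<tau> \<ge> h \<Longrightarrow> norm (g \<tau> - v (nome \<tau>)) \<le> D * norm (nome \<tau>) ^ n"
    using g h unfolding trg_def by blast
  have "norm (f \<tau> + g \<tau> - (u (nome \<tau>) + v (nome \<tau>))) \<le> (C + D) * norm (nome \<tau>) ^ n" if t: "Im \<tau> \<ge> h" for \<tau>
    using C[OF t] D[OF t] norm_triangle_ineq[of "f \<tau> - u (nome \<tau>)" "g \<tau> - v (nome \<tau>)"]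
    by (simp add: algebra_simps)
  then show "\<exists>C. \<forall>\<tau>. Im \<tau> \<ge> h \<longrightarrow> norm (f \<tau> + g \<tau> - (u (nome \<tau>) + v (nome \<tau>))) \<le> C * norm (nome \<tau>) ^ n" by blast
qed

lemma trg_cmult:
  assumes f: "trg n f u"
  shows "trg n (\<lambda>\<tau>. c * f \<tau>) (\<lambda>q. c * u q)"
  unfolding trg_def
proof (intro allI impI)
  fix h :: real assume h: "h > 0"
  obtain C where C: "\<And>\<tau>. Im \<tau> \<ge> h \<Longrightarrow> norm (f \<tau> - u (nome \<tau>)) \<le> C * norm (nome \<tau>) ^ n"
    using f h unfolding trg_def by blast
  have "norm (c * f \<tau> - c * u (nome \<tau>)) \<le> (norm c * C) * norm (nome \<tau>) ^ n" if t: "Im \<tau> \<ge> h" for \<tau>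
    using mult_left_mono[OF C[OF t], of "norm c"] by (simp add: norm_mult [symmetric] right_diff_distrib mult.assoc)
  then show "\<exists>C. \<forall>\<tau>. Im \<tau> \<ge> h \<longrightarrow> norm (c * f \<tau> - c * u (nome \<tau>)) \<le> C * norm (nome \<tau>) ^ n" by blast
qed

lemma tr_addmul:
  assumes "tr f cs" "tr g ds" "length cs = length ds"
  shows "tr (\<lambda>\<tau>. f \<tau> + of_int c * g \<tau>) (addmul c ds cs)"
proof -
  have "trg (length cs) (\<lambda>\<tau>. f \<tau> + of_int c * g \<tau>) (\<lambda>q. ev cs q + of_int c * ev ds q)"
    using assms by (intro trg_add trg_cmult) (auto simp: tr_trg)
  from trg_apx[OF this ev_addmul] show ?thesis by (simp add: tr_trg)
qed

lemma ev_take_drop: "ev cs q = ev (take n cs) q + q ^ n * ev (drop n cs) q"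
proof (induction cs arbitrary: n)
  case (Cons c cs)
  show ?case
  proof (cases n)
    case (Suc k)
    then show ?thesis using Cons.IH[of k] by (simp add: algebra_simps)
  qed simp
qed simp

lemma ev_append: "ev (xs @ ys) q = ev xs q + q ^ length xs * ev ys q"
  by (induction xs) (auto simp: algebra_simps)

lemma trg_weaken:
  assumes "trg n f u" "m \<le> n"
  shows "trg m f u"
  unfolding trg_def
proof (intro allI impI)
  fix h :: real assume h: "h > 0"
  obtain C where C: "\<And>\<tau>. Im \<tau> \<ge> h \<Longrightarrow> norm (f \<tau> - u (nome \<tau>)) \<le> C * norm (nome \<tau>) ^ n"
    using assms(1) h unfolding trg_def by blast
  have "norm (f \<tau> - u (nome \<tau>)) \<le> \<bar>C\<bar> * norm (nome \<tau>) ^ m" if t: "Im \<tau> \<ge> h" for \<tau>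
  proof -
    have "C * norm (nome \<tau>) ^ n \<le> \<bar>C\<bar> * norm (nome \<tau>) ^ n" by (intro mult_right_mono) auto
    also have "\<dots> \<le> \<bar>C\<bar> * norm (nome \<tau>) ^ m"
      using norm_nome_le_1[OF t h] assms(2) by (intro mult_left_mono power_decreasing) auto
    finally show ?thesis using C[OF t] by linarith
  qed
  then show "\<exists>C. \<forall>\<tau>. Im \<tau> \<ge> h \<longrightarrow> norm (f \<tau> - u (nome \<tau>)) \<le> C * norm (nome \<tau>) ^ m" by blast
qed

lemma apx_weaken_mult:
  assumes "n \<le> m" "\<And>q. norm q \<le> 1 \<Longrightarrow> norm (w q) \<le> B"
  shows "apx n (\<lambda>q. u q) (\<lambda>q. u q + q ^ m * w q)"
  unfolding apx_def
proof (intro exI[of _ "\<bar>B\<bar>"] allI impI)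
  fix q :: complex assume q: "norm q \<le> 1"
  have "norm (u q - (u q + q ^ m * w q)) = norm q ^ m * norm (w q)" by (simp add: norm_mult norm_power)
  also have "\<dots> \<le> norm q ^ n * \<bar>B\<bar>"
    using q assms(1) assms(2)[OF q] by (intro mult_mono power_decreasing) auto
  finally show "norm (u q - (u q + q ^ m * w q)) \<le> \<bar>B\<bar> * norm q ^ n" by (simp add: mult.commute)
qed

lemma tr_take:
  assumes "tr f cs"
  shows "tr f (take n cs)"
proof -
  have "trg (length (take n cs)) f (ev cs)" using assms by (auto simp: tr_trg intro: trg_weaken)
  moreover have "apx (length (take n cs)) (ev (take n cs)) (ev cs)"
  proof (cases "n \<le> length cs")
    case True
    have "apx (length (take n cs)) (\<lambda>q. ev (take n cs) q) (\<lambda>q. ev (take n cs) q + q ^ n * ev (drop n cs) q)"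
      by (rule apx_weaken_mult[of _ _ _ "\<Sum>c\<leftarrow>drop n cs. \<bar>of_int c\<bar>"]) (use norm_ev_le in auto)
    then show ?thesis by (simp add: ev_take_drop [symmetric])
  qed (simp add: apx_refl)
  ultimately show ?thesis using trg_apx by (auto simp: tr_trg)
qed

lemma tr_shift:
  assumes "tr f cs"
  shows "tr (\<lambda>\<tau>. nome \<tau> ^ k * f \<tau>) (replicate k 0 @ cs)"
  unfolding tr_def
proof (intro allI impI)
  fix h :: real assume h: "h > 0"
  obtain C where C: "\<And>\<tau>. Im \<tau> \<ge> h \<Longrightarrow> norm (f \<tau> - ev cs (nome \<tau>)) \<le> C * norm (nome \<tau>) ^ length cs"
    using tr_obtain[OF assms h] by blast
  have "norm (nome \<tau> ^ k * f \<tau> - ev (replicate k 0 @ cs) (nome \<tau>)) \<le> C * norm (nome \<tau>) ^ length (replicate k 0 @ cs)" if t: "Im \<tau> \<ge> h" for \<tau>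
  proof -
    have "norm (nome \<tau> ^ k * f \<tau> - ev (replicate k 0 @ cs) (nome \<tau>)) = norm (nome \<tau>) ^ k * norm (f \<tau> - ev cs (nome \<tau>))"
      by (simp add: ev_append ev_zeros norm_mult [symmetric] norm_power [symmetric] right_diff_distrib)
    also have "\<dots> \<le> norm (nome \<tau>) ^ k * (C * norm (nome \<tau>) ^ length cs)" by (intro mult_left_mono C t) simp
    finally show ?thesis by (simp add: power_add mult_ac)
  qed
  then show "\<exists>C. \<forall>\<tau>. Im \<tau> \<ge> h \<longrightarrow> norm (nome \<tau> ^ k * f \<tau> - ev (replicate k 0 @ cs) (nome \<tau>)) \<le> C * norm (nome \<tau>) ^ length (replicate k 0 @ cs)" by blast
qed

definition below :: "(complex \<Rightarrow> complex) \<Rightarrow> bool" where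
  "below g \<longleftrightarrow> (\<forall>h>0. \<exists>c>0. \<forall>\<tau>. Im \<tau> \<ge> h \<longrightarrow> c \<le> norm (g \<tau>))"

lemma below_mult:
  assumes "below f" "below g"
  shows "below (\<lambda>\<tau>. f \<tau> * g \<tau>)"
  unfolding below_def
proof (intro allI impI)
  fix h :: real assume h: "h > 0"
  obtain c d where "c > 0" "\<And>\<tau>. Im \<tau> \<ge> h \<Longrightarrow> c \<le> norm (f \<tau>)" "d > 0" "\<And>\<tau>. Im \<tau> \<ge> h \<Longrightarrow> d \<le> norm (g \<tau>)"
    using assms h unfolding below_def by blast
  then show "\<exists>c>0. \<forall>\<tau>. Im \<tau> \<ge> h \<longrightarrow> c \<le> norm (f \<tau> * g \<tau>)"
    by (intro exI[of _ "c * d"]) (auto simp: norm_mult intro!: mult_mono)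
qed

lemma below_1: "below (\<lambda>\<tau>. 1)"
  unfolding below_def by (auto intro!: exI[of _ 1])

lemma below_power: "below f \<Longrightarrow> below (\<lambda>\<tau>. f \<tau> ^ n)"
  by (induction n) (auto intro: below_1 below_mult)

lemma below_eul:
  assumes "k > 0"
  shows "below (\<lambda>\<tau>. eul (nome \<tau> ^ k))"
  unfolding below_def
proof (intro allI impI)
  fix h :: real assume h: "h > 0"
  have "exp (- 2 * pi * h) < 1" using h by simp
  then obtain c C where c: "c > 0" "\<And>x. norm x \<le> exp (- 2 * pi * h) \<Longrightarrow> c \<le> norm (eul x)"
     "\<And>x. norm x \<le> exp (- 2 * pi * h) \<Longrightarrow> norm (eul x) \<le> C" using eul_bounds[of "exp (- 2 * pi * h)"] by auto
  have "norm (nome \<tau> ^ k) \<le> exp (- 2 * pi * h)" if "Im \<tau> \<ge> h" for \<tau>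
  proof -
    have "norm (nome \<tau>) ^ k \<le> norm (nome \<tau>) ^ 1"
      using assms norm_nome_le_1[OF that h] by (intro power_decreasing) auto
    also have "\<dots> \<le> exp (- 2 * pi * h)" using that by (simp add: norm_nome)
    finally show ?thesis by (simp add: norm_power)
  qed
  then show "\<exists>c>0. \<forall>\<tau>. Im \<tau> \<ge> h \<longrightarrow> c \<le> norm (eul (nome \<tau> ^ k))" using c by blast
qed

lemma tr_ev: "tr (\<lambda>\<tau>. ev zs (nome \<tau>)) zs"
  unfolding tr_def by (auto intro!: exI[of _ 0])

text \<open>A proposed expansion of a quotient is certified by multiplying it back; the lower bound
  on the denominator transfers the error estimate.\<close>

lemma tr_divide:
  assumes d: "tr (\<lambda>\<tau>. d \<tau> * ev zs (nome \<tau>)) bs" and b: "tr b bs" and lb: "length bs = length zs" and nb: "below d"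
  shows "tr (\<lambda>\<tau>. b \<tau> / d \<tau>) zs"
  unfolding tr_def
proof (intro allI impI)
  fix h :: real assume h: "h > 0"
  obtain C where C: "\<And>\<tau>. Im \<tau> \<ge> h \<Longrightarrow> norm (d \<tau> * ev zs (nome \<tau>) - ev bs (nome \<tau>)) \<le> C * norm (nome \<tau>) ^ length zs"
    using tr_obtain[OF d h] unfolding lb by blast
  obtain D where D: "\<And>\<tau>. Im \<tau> \<ge> h \<Longrightarrow> norm (b \<tau> - ev bs (nome \<tau>)) \<le> D * norm (nome \<tau>) ^ length zs"
    using tr_obtain[OF b h] unfolding lb by blast
  obtain c where c: "c > 0" "\<And>\<tau>. Im \<tau> \<ge> h \<Longrightarrow> c \<le> norm (d \<tau>)" using nb h unfolding below_def by blast
  have "norm (b \<tau> / d \<tau> - ev zs (nome \<tau>)) \<le> ((C + D) / c) * norm (nome \<tau>) ^ length zs" if t: "Im \<tau> \<ge> h" for \<tau>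
  proof -
    let ?q = "nome \<tau>"
    have d0: "d \<tau> \<noteq> 0" using c t by force
    have "b \<tau> / d \<tau> - ev zs ?q = (b \<tau> - d \<tau> * ev zs ?q) / d \<tau>" using d0 by (simp add: field_simps)
    then have "norm (b \<tau> / d \<tau> - ev zs ?q) = norm (b \<tau> - d \<tau> * ev zs ?q) / norm (d \<tau>)" by (simp add: norm_divide)
    also have "\<dots> \<le> norm (b \<tau> - d \<tau> * ev zs ?q) / c" using c t by (intro divide_left_mono) (auto intro!: mult_pos_pos simp: d0)
    also have "norm (b \<tau> - d \<tau> * ev zs ?q) \<le> norm (b \<tau> - ev bs ?q) + norm (d \<tau> * ev zs ?q - ev bs ?q)"
      using norm_triangle_ineq4[of "b \<tau> - ev bs ?q" "d \<tau> * ev zs ?q - ev bs ?q"] by simp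
    also have "\<dots> \<le> (C + D) * norm ?q ^ length zs" using C[OF t] D[OF t] by (simp add: distrib_right)
    finally show ?thesis using c by (simp add: divide_right_mono)
  qed
  then show "\<exists>C. \<forall>\<tau>. Im \<tau> \<ge> h \<longrightarrow> norm (b \<tau> / d \<tau> - ev zs (nome \<tau>)) \<le> C * norm (nome \<tau>) ^ length zs" by blast
qed

section \<open>The Atkin operator, dilation and Euler's product on coefficient lists\<close>

fun ex7 :: "int list \<Rightarrow> int list" where
  "ex7 (a # b # c # d # e # f # g # xs) = a # ex7 xs"
| "ex7 xs = []"

lemma length7_cases:
  assumes "length (xs :: int list) = 7 * Suc n"
  obtains a b c d e f g ys where "xs = a # b # c # d # e # f # g # ys" "length ys = 7 * n"
proof -
  have "length xs = Suc (Suc (Suc (Suc (Suc (Suc (Suc (7 * n)))))))" using assms by simp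
  then have "\<exists>a b c d e f g ys. xs = a # b # c # d # e # f # g # ys"
    unfolding length_Suc_conv by blast
  then show ?thesis using that assms by auto
qed

lemma length_ex7: "length cs = 7 * n \<Longrightarrow> length (ex7 cs) = n"
proof (induction n arbitrary: cs)
  case (Suc n)
  from length7_cases[OF Suc.prems] Suc.IH show ?case by (metis ex7.simps(1) length_Cons)
qed simp

lemma z7_power_sum:
  assumes "0 < i" "i < 7"
  shows "(\<Sum>l<7. (z7 ^ l) ^ i) = 0"
proof -
  have z: "z7 ^ i \<noteq> 1"
  proof
    assume "z7 ^ i = 1"
    then have "nome (of_nat i * (1 / 7)) = 1" by (simp only: nome_of_nat_mult z7_def)
    then obtain n :: int where "of_nat i * (1 / 7) = (of_int n :: complex)" unfolding nome_eq_1_iff by blast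
    then have "(of_int (int i) :: complex) = of_int (7 * n)" by (simp add: field_simps)
    then have "int i = 7 * n" unfolding of_int_eq_iff .
    then show False using assms by presburger
  qed
  have "(\<Sum>l<7. (z7 ^ l) ^ i) = (\<Sum>l<7. (z7 ^ i) ^ l)" by (simp add: power_mult [symmetric] mult.commute)
  also have "\<dots> = ((z7 ^ i) ^ 7 - 1) / (z7 ^ i - 1)" by (rule geometric_sum[OF z])
  also have "(z7 ^ i) ^ 7 = 1" using z7_pow by (metis mult.commute power_mult power_one)
  finally show ?thesis by simp
qed

text \<open>Orthogonality of the seventh roots of unity removes every exponent that is not a
  multiple of 7. The length must be a multiple of 7, since \<open>ex7\<close> discards an incomplete
  block.\<close>

lemma sum_ev_ex7:
  assumes "length cs = 7 * n"
  shows "(\<Sum>l<7. ev cs (x * z7 ^ l)) = 7 * ev (ex7 cs) (x ^ 7)"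
  using assms
proof (induction n arbitrary: cs)
  case (Suc n)
  obtain c0 c1 c2 c3 c4 c5 c6 ys where cs: "cs = c0 # c1 # c2 # c3 # c4 # c5 # c6 # ys" "length ys = 7 * n"
    using length7_cases[OF Suc.prems] by blast
  have p7: "(x * z7 ^ l) ^ 7 = x ^ 7" for l
    by (simp add: power_mult_distrib power_mult [symmetric] mult.commute[of l 7]) (simp add: power_mult z7_pow)
  have "ev cs y = of_int c0 + of_int c1 * y + of_int c2 * y ^ 2 + of_int c3 * y ^ 3 + of_int c4 * y ^ 4 + of_int c5 * y ^ 5 + of_int c6 * y ^ 6 + y ^ 7 * ev ys y" for y
    by (simp add: cs algebra_simps eval_nat_numeral)
  then have "(\<Sum>l<7. ev cs (x * z7 ^ l)) = (\<Sum>l<7. of_int c0 + of_int c1 * (x * z7 ^ l) + of_int c2 * (x * z7 ^ l) ^ 2 + of_int c3 * (x * z7 ^ l) ^ 3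
      + of_int c4 * (x * z7 ^ l) ^ 4 + of_int c5 * (x * z7 ^ l) ^ 5 + of_int c6 * (x * z7 ^ l) ^ 6 + x ^ 7 * ev ys (x * z7 ^ l))"
    by (simp only: p7)
  also have "\<dots> = 7 * of_int c0 + of_int c1 * x * (\<Sum>l<7. (z7 ^ l) ^ 1) + of_int c2 * x ^ 2 * (\<Sum>l<7. (z7 ^ l) ^ 2) + of_int c3 * x ^ 3 * (\<Sum>l<7. (z7 ^ l) ^ 3)
      + of_int c4 * x ^ 4 * (\<Sum>l<7. (z7 ^ l) ^ 4) + of_int c5 * x ^ 5 * (\<Sum>l<7. (z7 ^ l) ^ 5) + of_int c6 * x ^ 6 * (\<Sum>l<7. (z7 ^ l) ^ 6) + x ^ 7 * (\<Sum>l<7. ev ys (x * z7 ^ l))"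
    by (simp add: sum.distrib sum_distrib_left power_mult_distrib mult.assoc)
  also have "\<dots> = 7 * ev (ex7 cs) (x ^ 7)"
    using Suc.IH[OF cs(2)] by (simp only: z7_power_sum) (simp add: cs algebra_simps)
  finally show ?case .
qed simp

lemma tr_U7:
  assumes "tr f cs" "length cs = 7 * n"
  shows "tr (atkin_U7 f) (ex7 cs)"
  unfolding tr_def
proof (intro allI impI)
  fix h :: real assume h: "h > 0"
  then have h7: "h / 7 > 0" by simp
  obtain C where C: "\<And>\<tau>. Im \<tau> \<ge> h / 7 \<Longrightarrow> norm (f \<tau> - ev cs (nome \<tau>)) \<le> C * norm (nome \<tau>) ^ length cs"
    using tr_obtain[OF assms(1) h7] by blast
  have "norm (atkin_U7 f \<tau> - ev (ex7 cs) (nome \<tau>)) \<le> C * norm (nome \<tau>) ^ length (ex7 cs)" if t: "Im \<tau> \<ge> h" for \<tau>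
  proof -
    define x where "x = nome (\<tau> / 7)"
    have x7: "x ^ 7 = nome \<tau>" unfolding x_def nome_of_nat_mult [symmetric] by simp
    have nl: "nome ((\<tau> + of_nat l) / 7) = x * z7 ^ l" for l
    proof -
      have "(\<tau> + of_nat l) / 7 = \<tau> / 7 + of_nat l * (1 / 7)" by (simp add: add_divide_distrib)
      then show ?thesis by (simp only: nome_add nome_of_nat_mult x_def z7_def)
    qed
    have nn: "norm (nome ((\<tau> + of_nat l) / 7)) = norm x" for l by (simp add: norm_nome x_def)
    have un: "atkin_U7 f \<tau> = 1 / 7 * (\<Sum>l<7. f ((\<tau> + of_nat l) / 7))"
      unfolding atkin_U7_def by (simp add: atLeastAtMost_def lessThan_Suc_atMost [symmetric] eval_nat_numeral atLeast0AtMost)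
    have "atkin_U7 f \<tau> - ev (ex7 cs) (nome \<tau>) = 1 / 7 * (\<Sum>l<7. f ((\<tau> + of_nat l) / 7) - ev cs (nome ((\<tau> + of_nat l) / 7)))"
      unfolding un nl sum_subtractf sum_ev_ex7[OF assms(2)] x7 by (simp add: right_diff_distrib)
    also have "norm \<dots> \<le> 1 / 7 * (\<Sum>l<(7::nat). C * norm x ^ length cs)"
      unfolding norm_mult
    proof (intro mult_mono)
      show "norm (\<Sum>l<7. f ((\<tau> + of_nat l) / 7) - ev cs (nome ((\<tau> + of_nat l) / 7))) \<le> (\<Sum>l<(7::nat). C * norm x ^ length cs)"
      proof (rule sum_norm_le)
        fix l :: nat
        have "Im ((\<tau> + of_nat l) / 7) \<ge> h / 7" using t by simp
        from C[OF this] show "norm (f ((\<tau> + of_nat l) / 7) - ev cs (nome ((\<tau> + of_nat l) / 7))) \<le> C * norm x ^ length cs" by (simp add: nn)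
      qed
    qed auto
    also have "\<dots> = C * norm (nome \<tau>) ^ length (ex7 cs)"
      unfolding x7 [symmetric] length_ex7[OF assms(2)] assms(2) by (simp add: norm_power power_mult)
    finally show ?thesis .
  qed
  then show "\<exists>C. \<forall>\<tau>. Im \<tau> \<ge> h \<longrightarrow> norm (atkin_U7 f \<tau> - ev (ex7 cs) (nome \<tau>)) \<le> C * norm (nome \<tau>) ^ length (ex7 cs)" by blast
qed

lemma tr_qb:
  assumes "tr f cs" "tr g cs"
  shows "qb (\<lambda>\<tau>. f \<tau> - g \<tau>) (real (length cs))"
proof -
  obtain C where C: "\<And>\<tau>. Im \<tau> \<ge> 1/2 \<Longrightarrow> norm (f \<tau> - ev cs (nome \<tau>)) \<le> C * norm (nome \<tau>) ^ length cs"
    using tr_obtain[OF assms(1), of "1/2"] by auto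
  obtain D where D: "\<And>\<tau>. Im \<tau> \<ge> 1/2 \<Longrightarrow> norm (g \<tau> - ev cs (nome \<tau>)) \<le> D * norm (nome \<tau>) ^ length cs"
    using tr_obtain[OF assms(2), of "1/2"] by auto
  have "norm (f \<tau> - g \<tau>) \<le> (C + D) * exp (- 2 * pi * real (length cs) * Im \<tau>)" if "Im \<tau> \<ge> 1/2" for \<tau>
  proof -
    have "norm (f \<tau> - g \<tau>) \<le> norm (f \<tau> - ev cs (nome \<tau>)) + norm (g \<tau> - ev cs (nome \<tau>))"
      using norm_triangle_ineq4[of "f \<tau> - ev cs (nome \<tau>)" "g \<tau> - ev cs (nome \<tau>)"] by simp
    also have "\<dots> \<le> (C + D) * norm (nome \<tau>) ^ length cs" using C[OF that] D[OF that] by (simp add: distrib_right)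
    also have "norm (nome \<tau>) ^ length cs = exp (- 2 * pi * real (length cs) * Im \<tau>)"
      by (simp add: norm_nome exp_of_nat_mult [symmetric] mult_ac)
    finally show ?thesis .
  qed
  then show ?thesis unfolding qb_def by blast
qed

fun dil :: "nat \<Rightarrow> int list \<Rightarrow> int list" where
  "dil k [] = []"
| "dil k (c # cs) = c # replicate (k - 1) 0 @ dil k cs"

lemma length_dil: "k > 0 \<Longrightarrow> length (dil k cs) = k * length cs"
  by (induction cs) auto

lemma ev_dil: "k > 0 \<Longrightarrow> ev (dil k cs) q = ev cs (q ^ k)"
proof (induction cs)
  case (Cons c cs)
  have "q * q ^ (k - 1) = q ^ k" using Cons.prems by (metis Suc_diff_1 power_Suc)
  then show ?case using Cons by (simp add: ev_append ev_zeros algebra_simps)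
qed simp

lemma tr_dil:
  assumes "tr f cs" "k > 0"
  shows "tr (\<lambda>\<tau>. f (of_nat k * \<tau>)) (dil k cs)"
  unfolding tr_def
proof (intro allI impI)
  fix h :: real assume h: "h > 0"
  obtain C where C: "\<And>\<tau>. Im \<tau> \<ge> h \<Longrightarrow> norm (f \<tau> - ev cs (nome \<tau>)) \<le> C * norm (nome \<tau>) ^ length cs"
    using tr_obtain[OF assms(1) h] by blast
  have "norm (f (of_nat k * \<tau>) - ev (dil k cs) (nome \<tau>)) \<le> C * norm (nome \<tau>) ^ length (dil k cs)" if t: "Im \<tau> \<ge> h" for \<tau>
  proof -
    have "real k * Im \<tau> \<ge> 1 * Im \<tau>" using assms(2) t h by (intro mult_right_mono) auto
    then have "Im (of_nat k * \<tau>) \<ge> h" using t by simp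
    from C[OF this] show ?thesis
      by (simp add: ev_dil[OF assms(2)] length_dil[OF assms(2)] nome_of_nat_mult norm_power power_mult)
  qed
  then show "\<exists>C. \<forall>\<tau>. Im \<tau> \<ge> h \<longrightarrow> norm (f (of_nat k * \<tau>) - ev (dil k cs) (nome \<tau>)) \<le> C * norm (nome \<tau>) ^ length (dil k cs)" by blast
qed

fun elist :: "nat \<Rightarrow> int list \<Rightarrow> int list" where
  "elist 0 xs = xs"
| "elist (Suc n) xs = elist n (take (Suc n) xs @ addmul (- 1) xs (drop (Suc n) xs))"

lemma tr_one_minus:
  assumes "tr f xs"
  shows "tr (\<lambda>\<tau>. (1 - nome \<tau> ^ n) * f \<tau>) (take n xs @ addmul (- 1) xs (drop n xs))"
proof -
  define ys where "ys = take n xs @ addmul (- 1) xs (drop n xs)"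
  have ly: "length ys = length xs" by (simp add: ys_def)
  have 1: "trg (length xs) (\<lambda>\<tau>. nome \<tau> ^ n * f \<tau>) (\<lambda>q. q ^ n * ev xs q)"
  proof -
    have "ev (replicate n 0 @ xs) = (\<lambda>q. q ^ n * ev xs q)" by (auto simp: ev_append ev_zeros)
    then show ?thesis using tr_shift[OF assms, of n] by (auto simp: tr_trg intro: trg_weaken)
  qed
  have "trg (length xs) (\<lambda>\<tau>. f \<tau> + (- 1) * (nome \<tau> ^ n * f \<tau>)) (\<lambda>q. ev xs q + (- 1) * (q ^ n * ev xs q))"
    using assms 1 by (intro trg_add trg_cmult) (auto simp: tr_trg)
  then have 2: "trg (length xs) (\<lambda>\<tau>. (1 - nome \<tau> ^ n) * f \<tau>) (\<lambda>q. ev xs q - q ^ n * ev xs q)"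
    by (simp add: algebra_simps)
  have "apx (length xs) (ev ys) (\<lambda>q. ev xs q - q ^ n * ev xs q)"
  proof (cases "n \<le> length xs")
    case True
    obtain R where R: "\<And>q. norm q \<le> 1 \<Longrightarrow> norm (ev (addmul (- 1) xs (drop n xs)) q - (ev (drop n xs) q + of_int (- 1) * ev xs q)) \<le> R * norm q ^ length (drop n xs)"
      using ev_addmul[of "drop n xs" "- 1" xs] by (auto simp: apx_def)
    show ?thesis unfolding apx_def
    proof (intro exI[of _ R] allI impI)
      fix q :: complex assume q: "norm q \<le> 1"
      have "ev ys q - (ev xs q - q ^ n * ev xs q) = q ^ n * (ev (addmul (- 1) xs (drop n xs)) q - (ev (drop n xs) q + of_int (- 1) * ev xs q))"
        using True unfolding ys_def ev_append by (subst ev_take_drop[of xs q n]) (simp add: algebra_simps)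
      then have "norm (ev ys q - (ev xs q - q ^ n * ev xs q)) = norm q ^ n * norm (ev (addmul (- 1) xs (drop n xs)) q - (ev (drop n xs) q + of_int (- 1) * ev xs q))"
        by (simp add: norm_mult norm_power)
      also have "\<dots> \<le> norm q ^ n * (R * norm q ^ length (drop n xs))" by (intro mult_left_mono R q) simp
      also have "\<dots> = R * norm q ^ length xs" using True by (simp add: power_add [symmetric] mult_ac)
      finally show "norm (ev ys q - (ev xs q - q ^ n * ev xs q)) \<le> R * norm q ^ length xs" .
    qed
  next
    case False
    then have "ys = xs" by (simp add: ys_def)
    then show ?thesis using apx_weaken_mult[of "length xs" n "\<lambda>q. - ev xs q" "\<Sum>c\<leftarrow>xs. \<bar>of_int c\<bar>" "ev xs"] False norm_ev_le by simp
  qed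
  then show ?thesis using trg_apx[OF 2] ly by (simp add: tr_trg ys_def)
qed

lemma length_elist: "length (elist n xs) = length xs"
  by (induction n xs rule: elist.induct) auto

lemma tr_elist: "tr f xs \<Longrightarrow> tr (\<lambda>\<tau>. (\<Prod>k<n. 1 - nome \<tau> ^ Suc k) * f \<tau>) (elist n xs)"
proof (induction n xs arbitrary: f rule: elist.induct)
  case (2 n xs)
  from 2(1)[OF tr_one_minus[OF 2(2), of "Suc n"]] show ?case by (simp add: mult_ac)
qed simp

text \<open>The factors omitted after the first \<open>n\<close> contribute 1 + O(q^(n+1)), so the
  product of those \<open>n\<close> factors is exact to n + 1 coefficients.\<close>

lemma tr_qp_tail: "tr (\<lambda>\<tau>. qp (nome \<tau> ^ Suc n) (nome \<tau>)) (1 # replicate n 0)"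
  unfolding tr_def
proof (intro allI impI)
  fix h :: real assume h: "h > 0"
  define r where "r = exp (- 2 * pi * h)"
  have r: "0 < r" "r < 1" using h by (auto simp: r_def)
  define K where "K = 1 / (1 - r)"
  have K: "K > 0" using r by (simp add: K_def)
  have "norm (qp (nome \<tau> ^ Suc n) (nome \<tau>) - ev (1 # replicate n 0) (nome \<tau>)) \<le> (K * exp K) * norm (nome \<tau>) ^ length (1 # replicate n 0 :: int list)" if t: "Im \<tau> \<ge> h" for \<tau>
  proof -
    let ?q = "nome \<tau>"
    have qr: "norm ?q \<le> r" using t by (simp add: norm_nome r_def)
    have q1: "norm ?q < 1" using qr r by simp
    define y where "y = norm (?q ^ Suc n) / (1 - norm ?q)"
    have y0: "y \<ge> 0" using q1 by (simp add: y_def)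
    have "1 / (1 - norm ?q) \<le> K" unfolding K_def using qr r by (intro divide_left_mono) auto
    then have yK: "y \<le> K * norm ?q ^ Suc n"
      unfolding y_def norm_power using mult_left_mono[of "1 / (1 - norm ?q)" K "norm ?q ^ Suc n"] by (simp add: mult.commute)
    have "K * norm ?q ^ Suc n \<le> K * 1" using q1 K by (intro mult_left_mono power_le_one) auto
    then have yK': "y \<le> K" using yK by simp
    have "exp (- y) \<ge> 1 - y" using exp_ge_add_one_self[of "- y"] by simp
    then have "exp y * exp (- y) \<ge> exp y * (1 - y)" by (intro mult_left_mono) auto
    then have "exp y - 1 \<le> y * exp y" by (simp add: exp_minus algebra_simps)
    also have "\<dots> \<le> (K * norm ?q ^ Suc n) * exp K" using y0 yK yK' by (intro mult_mono) auto
    finally have "exp y - 1 \<le> (K * exp K) * norm ?q ^ Suc n" by (simp add: mult_ac)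
    moreover have "norm (qp (?q ^ Suc n) ?q - 1) \<le> exp y - 1" using qp_bound[OF q1, of "?q ^ Suc n"] by (simp add: y_def)
    ultimately show ?thesis by (simp add: ev_zeros)
  qed
  then show "\<exists>C. \<forall>\<tau>. Im \<tau> \<ge> h \<longrightarrow> norm (qp (nome \<tau> ^ Suc n) (nome \<tau>) - ev (1 # replicate n 0) (nome \<tau>)) \<le> C * norm (nome \<tau>) ^ length (1 # replicate n 0 :: int list)" by blast
qed

lemma tr_eul: "tr (\<lambda>\<tau>. eul (nome \<tau>)) (elist n (1 # replicate n 0))"
proof (rule tr_cong[OF tr_elist[OF tr_qp_tail, of n n]])
  fix \<tau> :: complex assume "Im \<tau> > 0"
  then have q: "norm (nome \<tau>) < 1" by (rule norm_nome_less_1)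
  show "eul (nome \<tau>) = (\<Prod>k<n. 1 - nome \<tau> ^ Suc k) * qp (nome \<tau> ^ Suc n) (nome \<tau>)"
  proof (induction n)
    case 0
    then show ?case by (simp add: eul_qp)
  next
    case (Suc n)
    then show ?case using qp_step[OF q, of "nome \<tau> ^ Suc n"] by (simp add: mult_ac)
  qed
qed

lemma lmulacc_take: "lmulacc (take (length as) xs) ys as = lmulacc xs ys as"
proof (induction xs arbitrary: as)
  case Nil
  then show ?case by (cases as) auto
next
  case (Cons x xs)
  show ?case
  proof (cases as)
    case (Cons a as')
    obtain b bs where "addmul x ys (a # as') = b # bs" "length bs = length as'"
      using length_addmul[of x ys "a # as'"] by (cases "addmul x ys (a # as')") auto
    then show ?thesis using Cons.IH[of as'] Cons.IH[of bs] Cons by simp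
  qed simp
qed

lemma lmul_take: "lmul (take (length ds) cs) ds = lmul cs ds"
  unfolding lmul_def using lmulacc_take[of "map (\<lambda>_. 0) ds" cs ds] by simp

lemma tr_mult':
  assumes "tr f cs" "tr g ds" "length ds \<le> length cs"
  shows "tr (\<lambda>\<tau>. f \<tau> * g \<tau>) (lmul cs ds)"
  using tr_mult[OF tr_take[OF assms(1), of "length ds"] assms(2)] assms(3) by (simp add: lmul_take)

lemma qb_below_cancel:
  assumes "qb (\<lambda>\<tau>. d \<tau> * f \<tau>) r" "below d"
  shows "qb f r"
proof -
  obtain C where C: "\<And>\<tau>. Im \<tau> \<ge> 1/2 \<Longrightarrow> norm (d \<tau> * f \<tau>) \<le> C * exp (- 2 * pi * r * Im \<tau>)"
    using assms(1) unfolding qb_def by auto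
  obtain c where c: "c > 0" "\<And>\<tau>. Im \<tau> \<ge> 1/2 \<Longrightarrow> c \<le> norm (d \<tau>)"
    using assms(2) unfolding below_def by (metis half_gt_zero_iff zero_less_one)
  have "norm (f \<tau>) \<le> C / c * exp (- 2 * pi * r * Im \<tau>)" if "Im \<tau> \<ge> 1/2" for \<tau>
  proof -
    have "c * norm (f \<tau>) \<le> norm (d \<tau> * f \<tau>)" using c(2)[OF that] by (simp add: norm_mult mult_right_mono)
    then show ?thesis using C[OF that] c(1) by (simp add: field_simps)
  qed
  then show ?thesis unfolding qb_def by blast
qed

lemma qb_nome_cancel:
  assumes "qb (\<lambda>\<tau>. nome \<tau> ^ p * f \<tau>) (real p + r)"
  shows "qb f r"
proof -
  obtain C where C: "\<And>\<tau>. Im \<tau> \<ge> 1/2 \<Longrightarrow> norm (nome \<tau> ^ p * f \<tau>) \<le> C * exp (- 2 * pi * (real p + r) * Im \<tau>)"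
    using assms(1) unfolding qb_def by auto
  have "norm (f \<tau>) \<le> C * exp (- 2 * pi * r * Im \<tau>)" if "Im \<tau> \<ge> 1/2" for \<tau>
  proof -
    have "norm (nome \<tau> ^ p * f \<tau>) = exp (- 2 * pi * real p * Im \<tau>) * norm (f \<tau>)"
      by (simp add: norm_mult norm_power norm_nome exp_of_nat_mult [symmetric] mult_ac)
    moreover have "exp (- 2 * pi * (real p + r) * Im \<tau>) = exp (- 2 * pi * real p * Im \<tau>) * exp (- 2 * pi * r * Im \<tau>)"
      by (simp add: exp_add [symmetric] algebra_simps)
    ultimately have "exp (- 2 * pi * real p * Im \<tau>) * norm (f \<tau>) \<le> exp (- 2 * pi * real p * Im \<tau>) * (C * exp (- 2 * pi * r * Im \<tau>))"
      using C[OF that] by (simp add: mult_ac)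
    then show ?thesis by simp
  qed
  then show ?thesis unfolding qb_def by blast
qed

lemma ex7_take: "ex7 (take (7 * n) cs) = take n (ex7 cs)"
proof (induction cs arbitrary: n rule: ex7.induct)
  case (1 a b c d e f g xs)
  show ?case
  proof (cases n)
    case (Suc k)
    have "7 * n = Suc (Suc (Suc (Suc (Suc (Suc (Suc (7 * k)))))))" using Suc by simp
    then show ?thesis using 1[of k] Suc by (simp only: take_Suc_Cons ex7.simps)
  qed simp
qed (auto simp: take_Cons' numeral_eq_Suc split: nat.splits)

text \<open>There are 24 of them, which is the dimension that Riemann-Roch gives on X_0(14), a curve
  of genus 1, for poles up to eight times the polar divisor of \<open>mod_u\<close>, whose degree is
  3. The same divisor is polar for \<open>TT\<close>.\<close>

definition mons :: "(nat \<times> nat) list" where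
  "mons = [(a, l). l \<leftarrow> [0..<3], a \<leftarrow> [0..<9 - l]]"

definition dense :: "int list \<Rightarrow> (nat \<times> nat \<times> int) list" where
  "dense cs = map2 (\<lambda>(a, l) c. (a, l, c)) mons cs"

fun pl :: "int list \<Rightarrow> int list list \<Rightarrow> int list \<Rightarrow> int list" where
  "pl (c # cs) (M # Ms) z = (if c = 0 then pl cs Ms z else addmul c M (pl cs Ms z))"
| "pl cs Ms z = z"

lemma tr_pl:
  assumes "list_all2 (\<lambda>f M. tr f M \<and> length M = n) fs Ms" "length cs = length fs" "length z = n" "tr (\<lambda>\<tau>. 0) z"
  shows "tr (\<lambda>\<tau>. \<Sum>(f, c)\<leftarrow>zip fs cs. of_int c * f \<tau>) (pl cs Ms z) \<and> length (pl cs Ms z) = n"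
  using assms(1,2)
proof (induction arbitrary: cs rule: list_all2_induct)
  case Nil
  then show ?case using assms by simp
next
  case (Cons f fs M Ms)
  then obtain c cs' where c: "cs = c # cs'" "length cs' = length fs" by (cases cs) auto
  have IH: "tr (\<lambda>\<tau>. \<Sum>(f, c)\<leftarrow>zip fs cs'. of_int c * f \<tau>) (pl cs' Ms z)" "length (pl cs' Ms z) = n"
    using Cons.IH[OF c(2)] by auto
  show ?case
  proof (cases "c = 0")
    case True
    then show ?thesis using IH c by simp
  next
    case False
    then show ?thesis using tr_addmul[OF IH(1), of f M c] IH Cons c by (simp add: add.commute)
  qed
qed

text \<open>The identity is multiplied by q^p and by a product \<open>Yf\<close> of values of
  \<open>eul\<close>, after which both sides are products of integer lists. \<open>below\<close>
  cancels \<open>Yf\<close> afterwards, and q^p is paid for with \<open>p\<close> additional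
  coefficients.\<close>

lemma chk_step:
  assumes H: "tr h X" and K: "tr Kf K" "length K = p + 25" and Y: "tr Yf Y" and M: "tr Mf M" "length M = 25" "length Y = 25"
    and l: "7 * (p + 25) \<le> k + length X"
    and eq: "map ((*) N) (lmul (ex7 (replicate k 0 @ X)) K) = replicate p 0 @ lmul Y M"
    and b: "below Yf"
    and id: "\<And>\<tau>. Im \<tau> > 0 \<Longrightarrow> nome \<tau> ^ p * Yf \<tau> * F \<tau> = Kf \<tau> * atkin_U7 (\<lambda>z. nome z ^ k * h z) \<tau>"
  shows "qb (\<lambda>\<tau>. of_int N * F \<tau> - Mf \<tau>) 25"
proof -
  let ?L = "replicate k 0 @ X"
  let ?V = "atkin_U7 (\<lambda>z. nome z ^ k * h z)"
  have "tr ?V (ex7 (take (7 * (p + 25)) ?L))"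
    by (rule tr_U7[OF tr_take[OF tr_shift[OF H]], of _ _ "p + 25"]) (use l in simp)
  then have V: "tr ?V (take (length K) (ex7 ?L))" by (simp only: ex7_take K)
  have lV: "length (take (length K) (ex7 ?L)) = length K"
    using length_ex7[of "take (7 * (p + 25)) ?L" "p + 25"] l by (simp only: ex7_take K) simp
  have 1: "tr (\<lambda>\<tau>. ?V \<tau> * Kf \<tau>) (lmul (ex7 ?L) K)" using tr_mult[OF V K(1) lV] by (simp add: lmul_take)
  have am: "addmul c cs (map (\<lambda>_. 0) cs) = map ((*) c) cs" for c cs by (induction cs) auto
  have z: "tr (\<lambda>\<tau>. 0) (map (\<lambda>_. 0) cs)" for cs by (rule tr_cong[OF tr_ev]) (simp add: ev_zeros)
  have 2: "tr (\<lambda>\<tau>. of_int N * (?V \<tau> * Kf \<tau>)) (map ((*) N) (lmul (ex7 ?L) K))"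
    using tr_addmul[OF z 1, of "lmul (ex7 ?L) K" N] by (simp add: am)
  have 3: "tr (\<lambda>\<tau>. nome \<tau> ^ p * (Yf \<tau> * Mf \<tau>)) (replicate p 0 @ lmul Y M)"
    by (intro tr_shift tr_mult Y M) (simp add: M)
  have "qb (\<lambda>\<tau>. of_int N * (?V \<tau> * Kf \<tau>) - nome \<tau> ^ p * (Yf \<tau> * Mf \<tau>)) (real p + 25)"
    using tr_qb[OF 2[unfolded eq] 3] by (simp add: M)
  moreover have "of_int N * (?V \<tau> * Kf \<tau>) - nome \<tau> ^ p * (Yf \<tau> * Mf \<tau>) = nome \<tau> ^ p * (Yf \<tau> * (of_int N * F \<tau> - Mf \<tau>))"
    if "Im \<tau> > 0" for \<tau>
    using id[OF that] by (simp add: algebra_simps)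
  ultimately have "qb (\<lambda>\<tau>. nome \<tau> ^ p * (Yf \<tau> * (of_int N * F \<tau> - Mf \<tau>))) (real p + 25)"
    unfolding qb_def by force
  then show ?thesis by (rule qb_below_cancel[OF qb_nome_cancel b])
qed

section \<open>Clearing denominators under the Atkin operator\<close>

lemma nome_div_7: "nome ((\<tau> + of_nat l) / 7) ^ 7 = nome \<tau>"
  unfolding nome_numeral_mult [symmetric] using nome_of_int[of "int l"] by (simp add: nome_add del: distrib_left_numeral)

lemma atkin_U7_mult:
  assumes "\<And>z. Im z > 0 \<Longrightarrow> nome z ^ 7 = nome \<tau> \<Longrightarrow> c * f z = d * g z" "Im \<tau> > 0"
  shows "c * atkin_U7 f \<tau> = d * atkin_U7 g \<tau>"
proof -
  have "c * f ((\<tau> + of_nat l) / 7) = d * g ((\<tau> + of_nat l) / 7)" for l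
    using assms nome_div_7 by simp
  then have "c * (\<Sum>l=0..(6::nat). f ((\<tau> + of_nat l) / 7)) = d * (\<Sum>l=0..(6::nat). g ((\<tau> + of_nat l) / 7))"
    unfolding sum_distrib_left by simp
  then show ?thesis by (simp add: atkin_U7_def)
qed

text \<open>If x is the nome inside the operator, then q = x^7 is the same in all seven summands,
  and \<open>eul\<close> at q, q^2, q^7 can be taken out. What stays inside is a power of x times a
  quotient of \<open>eul\<close> at x and x^2. Its exponent k = 7 + 3 b - m collects 7 from
  \<open>TT \<tau>\<close>, 3 b from \<open>mod_u\<close> and -m from \<open>TT\<close>.\<close>

lemma U_relation:
  fixes b m k :: nat
  assumes tau: "Im \<tau> > 0" and k: "k + m = 7 + 3 * b"
  defines "q \<equiv> nome \<tau>"
  shows "nome \<tau> ^ 0 * eul q ^ (4 * m + 3 * b + 4) * (TT \<tau> * atkin_U7 (\<lambda>z. mod_u z ^ b / TT z ^ m) \<tau>)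
    = (eul (q ^ 7) ^ 4 * eul (q ^ 2) ^ (7 * b)) * atkin_U7 (\<lambda>z. nome z ^ k * (eul (nome z) ^ (4 * m) / (eul (nome z) ^ (3 * b) * eul (nome z ^ 2) ^ b))) \<tau>"
proof -
  have pt: "(eul q ^ (4 * m + 3 * b + 4) * TT \<tau>) * (mod_u z ^ b / TT z ^ m)
    = (eul (q ^ 7) ^ 4 * eul (q ^ 2) ^ (7 * b)) * (nome z ^ k * (eul (nome z) ^ (4 * m) / (eul (nome z) ^ (3 * b) * eul (nome z ^ 2) ^ b)))"
    if z: "Im z > 0" "nome z ^ 7 = nome \<tau>" for z
  proof -
    define x where "x = nome z"
    define A B C D E where "A = eul x" and "B = eul (x ^ 2)" and "C = eul q" and "D = eul (q ^ 2)" and "E = eul (q ^ 7)"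
    have q: "q = x ^ 7" "q ^ 2 = x ^ 14" using z by (simp_all add: q_def x_def power_mult [symmetric] flip: z(2))
    have nz: "A \<noteq> 0" "B \<noteq> 0" "C \<noteq> 0" "D \<noteq> 0" "E \<noteq> 0" "x \<noteq> 0"
      using eul_pow_nonzero[OF z(1), of 1] eul_pow_nonzero[OF z(1), of 2] eul_pow_nonzero[OF tau, of 1] eul_pow_nonzero[OF tau, of 2] eul_pow_nonzero[OF tau, of 7]
      by (auto simp: A_def B_def C_def D_def E_def x_def q_def)
    have u: "mod_u z = x ^ 3 * D ^ 7 / (A ^ 3 * B * C ^ 3)" unfolding mod_eul(2)[OF z(1)] by (simp add: A_def B_def C_def D_def x_def [symmetric] q [symmetric])
    have T: "TT z = x * C ^ 4 / A ^ 4" unfolding mod_eul(4)[OF z(1)] by (simp add: A_def C_def x_def [symmetric] q [symmetric])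
    have TT: "TT \<tau> = q * E ^ 4 / C ^ 4" unfolding mod_eul(4)[OF tau] by (simp add: E_def C_def q_def)
    have pm: "y ^ (n * j) = (y ^ j) ^ n" for y :: complex and n j by (simp add: power_mult [symmetric] mult.commute)
    have xk: "x ^ k = q * (x ^ b) ^ 3 / x ^ m"
    proof -
      have "x ^ k * x ^ m = q * (x ^ b) ^ 3" unfolding power_add [symmetric] k q(1) by (simp add: power_add pm)
      then show ?thesis using nz by (simp add: field_simps)
    qed
    have "C ^ (4 * m + 3 * b + 4) * TT \<tau> * (mod_u z ^ b / TT z ^ m) = E ^ 4 * D ^ (7 * b) * (x ^ k * (A ^ (4 * m) / (A ^ (3 * b) * B ^ b)))"
    proof -
      define Am Ab Bb Cm Cb Db xb xm where "Am = A ^ m" and "Ab = A ^ b" and "Bb = B ^ b" and "Cm = C ^ m" and "Cb = C ^ b" and "Db = D ^ b" and "xb = x ^ b" and "xm = x ^ m"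
      have nz': "Am \<noteq> 0" "Ab \<noteq> 0" "Bb \<noteq> 0" "Cm \<noteq> 0" "Cb \<noteq> 0" "Db \<noteq> 0" "xb \<noteq> 0" "xm \<noteq> 0"
        using nz by (auto simp: Am_def Ab_def Bb_def Cm_def Cb_def Db_def xb_def xm_def)
      have sw: "(y ^ i) ^ j = (y ^ j) ^ i" for y :: complex and i j by (simp add: power_mult [symmetric] mult.commute)
      have "(C ^ m) ^ 4 * (C ^ b) ^ 3 * C ^ 4 * (q * E ^ 4 / C ^ 4) * (((x ^ b) ^ 3 * (D ^ b) ^ 7 / ((A ^ b) ^ 3 * B ^ b * (C ^ b) ^ 3)) / (x ^ m * (C ^ m) ^ 4 / (A ^ m) ^ 4))
        = E ^ 4 * (D ^ b) ^ 7 * ((q * (x ^ b) ^ 3 / x ^ m) * ((A ^ m) ^ 4 / ((A ^ b) ^ 3 * B ^ b)))"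
        using nz nz' by (simp add: field_simps flip: Am_def Ab_def Bb_def Cm_def Cb_def Db_def xb_def xm_def)
      then show ?thesis
        unfolding u T TT power_add pm xk power_divide power_mult_distrib sw[of _ 3 b] sw[of _ 7 b] sw[of _ 4 m] by simp
    qed
    then show ?thesis by (simp add: A_def B_def C_def D_def E_def x_def)
  qed
  have "(eul q ^ (4 * m + 3 * b + 4) * TT \<tau>) * atkin_U7 (\<lambda>z. mod_u z ^ b / TT z ^ m) \<tau>
    = (eul (q ^ 7) ^ 4 * eul (q ^ 2) ^ (7 * b)) * atkin_U7 (\<lambda>z. nome z ^ k * (eul (nome z) ^ (4 * m) / (eul (nome z) ^ (3 * b) * eul (nome z ^ 2) ^ b))) \<tau>"
    by (rule atkin_U7_mult[OF _ tau]) (rule pt)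
  then show ?thesis by (simp only: power_0 mult_1_left mult.assoc)
qed

text \<open>Now \<open>mod_A\<close> contributes x^2, and the additional factor q = x^7 on the left
  keeps the exponent k = 9 + 3 b - m from becoming negative. This factor is the reason for
  \<open>p = 1\<close> and for 26 instead of 25 coefficients.\<close>

lemma UA_relation:
  fixes b m k :: nat
  assumes tau: "Im \<tau> > 0" and k: "k + m = 9 + 3 * b"
  defines "q \<equiv> nome \<tau>"
  shows "nome \<tau> ^ 1 * (eul (q ^ 14) ^ 2 * eul q ^ (4 * m + 3 * b)) * atkin_U7 (\<lambda>z. mod_A z * (mod_u z ^ b / TT z ^ m)) \<tau>
    = (eul (q ^ 7) ^ 5 * eul (q ^ 2) ^ (7 * b)) * atkin_U7 (\<lambda>z. nome z ^ k * (eul (nome z) ^ (4 * m) * eul (nome z ^ 2) ^ 2 / (eul (nome z) ^ (3 * b + 5) * eul (nome z ^ 2) ^ b))) \<tau>"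
proof -
  have pt: "(nome \<tau> * (eul (q ^ 14) ^ 2 * eul q ^ (4 * m + 3 * b))) * (mod_A z * (mod_u z ^ b / TT z ^ m))
    = (eul (q ^ 7) ^ 5 * eul (q ^ 2) ^ (7 * b)) * (nome z ^ k * (eul (nome z) ^ (4 * m) * eul (nome z ^ 2) ^ 2 / (eul (nome z) ^ (3 * b + 5) * eul (nome z ^ 2) ^ b)))"
    if z: "Im z > 0" "nome z ^ 7 = nome \<tau>" for z
  proof -
    define x where "x = nome z"
    define A B C D E F where "A = eul x" and "B = eul (x ^ 2)" and "C = eul q" and "D = eul (q ^ 2)" and "E = eul (q ^ 7)" and "F = eul (q ^ 14)"
    have q: "q = x ^ 7" "q ^ 2 = x ^ 14" "q ^ 7 = x ^ 49" "q ^ 14 = x ^ 98" using z by (simp_all add: q_def x_def power_mult [symmetric] flip: z(2))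
    have nz: "A \<noteq> 0" "B \<noteq> 0" "C \<noteq> 0" "D \<noteq> 0" "E \<noteq> 0" "F \<noteq> 0" "x \<noteq> 0"
      using eul_pow_nonzero[OF z(1), of 1] eul_pow_nonzero[OF z(1), of 2] eul_pow_nonzero[OF tau, of 1] eul_pow_nonzero[OF tau, of 2] eul_pow_nonzero[OF tau, of 7] eul_pow_nonzero[OF tau, of 14]
      by (auto simp: A_def B_def C_def D_def E_def F_def x_def q_def)
    have u: "mod_u z = x ^ 3 * D ^ 7 / (A ^ 3 * B * C ^ 3)" unfolding mod_eul(2)[OF z(1)] by (simp add: A_def B_def C_def D_def x_def [symmetric] q(1,2) [symmetric])
    have T: "TT z = x * C ^ 4 / A ^ 4" unfolding mod_eul(4)[OF z(1)] by (simp add: A_def C_def x_def [symmetric] q(1) [symmetric])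
    have AA: "mod_A z = x ^ 2 * B ^ 2 * E ^ 5 / (A ^ 5 * F ^ 2)" unfolding mod_eul(3)[OF z(1)] by (simp add: A_def B_def E_def F_def x_def [symmetric] q(3,4) [symmetric])
    have pm: "y ^ (n * j) = (y ^ j) ^ n" for y :: complex and n j by (simp add: power_mult [symmetric] mult.commute)
    have xk: "x ^ k = q * x ^ 2 * (x ^ b) ^ 3 / x ^ m"
    proof -
      have "x ^ k * x ^ m = q * x ^ 2 * (x ^ b) ^ 3" unfolding power_add [symmetric] k q(1) by (simp add: power_add pm)
      then show ?thesis using nz by (simp add: field_simps)
    qed
    have "q * (F ^ 2 * C ^ (4 * m + 3 * b)) * (mod_A z * (mod_u z ^ b / TT z ^ m)) = E ^ 5 * D ^ (7 * b) * (x ^ k * (A ^ (4 * m) * B ^ 2 / (A ^ (3 * b + 5) * B ^ b)))"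
    proof -
      define Am Ab Bb Cm Cb Db xb xm where "Am = A ^ m" and "Ab = A ^ b" and "Bb = B ^ b" and "Cm = C ^ m" and "Cb = C ^ b" and "Db = D ^ b" and "xb = x ^ b" and "xm = x ^ m"
      have nz': "Am \<noteq> 0" "Ab \<noteq> 0" "Bb \<noteq> 0" "Cm \<noteq> 0" "Cb \<noteq> 0" "Db \<noteq> 0" "xb \<noteq> 0" "xm \<noteq> 0"
        using nz by (auto simp: Am_def Ab_def Bb_def Cm_def Cb_def Db_def xb_def xm_def)
      have sw: "(y ^ i) ^ j = (y ^ j) ^ i" for y :: complex and i j by (simp add: power_mult [symmetric] mult.commute)
      have "q * (F ^ 2 * ((C ^ m) ^ 4 * (C ^ b) ^ 3)) * (x ^ 2 * B ^ 2 * E ^ 5 / (A ^ 5 * F ^ 2) * (((x ^ b) ^ 3 * (D ^ b) ^ 7 / ((A ^ b) ^ 3 * B ^ b * (C ^ b) ^ 3)) / (x ^ m * (C ^ m) ^ 4 / (A ^ m) ^ 4)))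
        = E ^ 5 * (D ^ b) ^ 7 * ((q * x ^ 2 * (x ^ b) ^ 3 / x ^ m) * ((A ^ m) ^ 4 * B ^ 2 / ((A ^ b) ^ 3 * A ^ 5 * B ^ b)))"
        using nz nz' by (simp add: field_simps flip: Am_def Ab_def Bb_def Cm_def Cb_def Db_def xb_def xm_def)
      then show ?thesis
        unfolding u T AA power_add pm xk power_divide power_mult_distrib sw[of _ 3 b] sw[of _ 7 b] sw[of _ 4 m] by simp
    qed
    then show ?thesis by (simp add: A_def B_def C_def D_def E_def F_def x_def q_def)
  qed
  have "(nome \<tau> * (eul (q ^ 14) ^ 2 * eul q ^ (4 * m + 3 * b))) * atkin_U7 (\<lambda>z. mod_A z * (mod_u z ^ b / TT z ^ m)) \<tau>
    = (eul (q ^ 7) ^ 5 * eul (q ^ 2) ^ (7 * b)) * atkin_U7 (\<lambda>z. nome z ^ k * (eul (nome z) ^ (4 * m) * eul (nome z ^ 2) ^ 2 / (eul (nome z) ^ (3 * b + 5) * eul (nome z ^ 2) ^ b))) \<tau>"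
    by (rule atkin_U7_mult[OF _ tau]) (rule pt)
  then show ?thesis by (simp only: power_one_right)
qed

fun iter :: "('a \<Rightarrow> 'a) \<Rightarrow> nat \<Rightarrow> 'a \<Rightarrow> 'a list" where
  "iter f 0 x = []"
| "iter f (Suc n) x = x # iter f n (f x)"

text \<open>
  The lists give the first 182 coefficients of \<open>E\<close>, \<open>E ^ 3\<close>, \<open>1 / (E ^ 3 * F)\<close>, \<open>1 / (E ^ 2 * F ^ 2)\<close>,
  \<open>F ^ 2 / E\<close>, \<open>F / E ^ 4\<close> and \<open>1 / E ^ 3\<close>, where \<open>E = eul q\<close> and \<open>F = eul (q ^ 2)\<close>; 182 coefficients leave 26 after
  the Atkin operator. The entries of the tables were found by solving linear equations for the coefficients.
\<close>

section \<open>Tables for the Atkin operator\<close>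

definition EL :: "int list" where
  "EL =
    [1, -1, -1, 0, 0, 1, 0, 1, 0, 0, 0, 0, -1, 0, 0, -1, 0, 0, 0, 0, 0, 0, 1, 0, 0, 0, 1, 0, 0, 0, 0, 0, 0, 0, 0, -1, 0, 0, 0, 0, -1, 0, 0, 0, 0, 0,
     0, 0, 0, 0, 0, 1, 0, 0, 0, 0, 0, 1, 0, 0, 0, 0, 0, 0, 0, 0, 0, 0, 0, 0, -1, 0, 0, 0, 0, 0, 0, -1, 0, 0, 0, 0, 0, 0, 0, 0, 0, 0, 0, 0, 0, 0, 1, 0,
     0, 0, 0, 0, 0, 0, 1, 0, 0, 0, 0, 0, 0, 0, 0, 0, 0, 0, 0, 0, 0, 0, 0, -1, 0, 0, 0, 0, 0, 0, 0, 0, -1, 0, 0, 0, 0, 0, 0, 0, 0, 0, 0, 0, 0, 0, 0, 0,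
     0, 0, 0, 1, 0, 0, 0, 0, 0, 0, 0, 0, 0, 1, 0, 0, 0, 0, 0, 0, 0, 0, 0, 0, 0, 0, 0, 0, 0, 0, 0, 0, 0, 0, -1, 0, 0, 0, 0, 0]"

definition E3L :: "int list" where
  "E3L =
    [1, -3, 0, 5, 0, 0, -7, 0, 0, 0, 9, 0, 0, 0, 0, -11, 0, 0, 0, 0, 0, 13, 0, 0, 0, 0, 0, 0, -15, 0, 0, 0, 0, 0, 0, 0, 17, 0, 0, 0, 0, 0, 0, 0, 0,
     -19, 0, 0, 0, 0, 0, 0, 0, 0, 0, 21, 0, 0, 0, 0, 0, 0, 0, 0, 0, 0, -23, 0, 0, 0, 0, 0, 0, 0, 0, 0, 0, 0, 25, 0, 0, 0, 0, 0, 0, 0, 0, 0, 0, 0, 0,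
     -27, 0, 0, 0, 0, 0, 0, 0, 0, 0, 0, 0, 0, 0, 29, 0, 0, 0, 0, 0, 0, 0, 0, 0, 0, 0, 0, 0, 0, -31, 0, 0, 0, 0, 0, 0, 0, 0, 0, 0, 0, 0, 0, 0, 0, 33,
     0, 0, 0, 0, 0, 0, 0, 0, 0, 0, 0, 0, 0, 0, 0, 0, -35, 0, 0, 0, 0, 0, 0, 0, 0, 0, 0, 0, 0, 0, 0, 0, 0, 0, 37, 0, 0, 0, 0, 0, 0, 0, 0, 0, 0]"

definition HU1 :: "int list" where
  "HU1 =
    [1, 3, 10, 25, 62, 136, 293, 590, 1165, 2205, 4097, 7391, 13120, 22780, 38997, 65613, 109036, 178660, 289575, 463842, 735870, 1155717, 1799620,
     2777795, 4254859, 6467115, 9761770, 14633605, 21799465, 32273399, 47506759, 69537814, 101252595, 146675875, 211451893, 303398921, 433386532,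
     616373760, 872994595, 1231471073, 1730451531, 2422486287, 3379061965, 4696834905, 6506481199, 8983744610, 12364859981, 16965921825, 23209539645,
     31658451159, 43061218803, 58410014927, 79018353865, 106619554660, 143497980177, 192655416644, 258031057877, 344780440375, 459641627935,
     611399364399, 811490555812, 1074771162515, 1420510921545, 1873651896800, 2466432542878, 3240439827262, 4249244969444, 5561728921520,
     7266335336300, 9476427754640, 12337113933090, 16033827167097, 20803217828660, 26946824444570, 34848366258163, 44995408884942, 58006682097206,
     74666241939180, 95966416376165, 123161409559511, 157834498586354, 201981749524228, 258116681451230, 329400415507220, 419803978462120,
     534309749815573, 679162071827783, 862177726513645, 1093131293502010, 1384231694715992, 1750712366014753, 2211559771229955, 2790413710478435,
     3516676708979485, 4426882221852358, 5566377657056935, 6991395965423175, 8771599558455065, 10993205619219565, 13762817586611156,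
     17212123677236732, 21503647628910417, 26837788300525870, 33461421960899515, 41678414443212561, 51862446677200562, 64472661622933962,
     80072725227441535, 99354042868188650, 123163998846153036, 152540298323999062, 188752677835584706, 233353551727546755, 288239436793091130,
     355725425325753702, 438635379381361606, 540411126423096116, 665244523192896165, 818237115697282290, 1005592974393496593, 1234851502806756785,
     1515168247767870712, 1857653463397871060, 2275779951471664515, 2785874135215461387, 3407706863153877543, 4165203872471123141,
     5087299471866118945, 6208961837551545870, 7572423489827191046, 9228657313543647094, 11239145836832288830, 13678001022466499490,
     16634502241190997015, 20216133467586414712, 24552215455021590586, 29798247357717989066, 36141093007279775830, 43805173193794606035,
     53059854457080513100, 64228261360405888672, 77697780108045755755, 93932572153888110355, 113488473661058296555, 137030727285946879725,
     165355072635298121720, 199412819768678580795, 240340641393442353210, 289495955254215937495, 348498922913529694366, 419282279105128056167,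
     504150420463415896210, 605849442135696949405, 727650107962966424370, 873446098128943560243, 1047870288882671796672, 1256432312253839053435,
     1505681210222681882540, 1803397676111514228450, 2158821156054043853948, 2582918014621894561773, 3088698040908249984767, 3691587847852969241415,
     4409871188787448747605, 5265207962273500527468, 6283245691511097739869, 7494339652204860710875, 8934400578561224326745, 10645892135193257852210,
     12679004105106574702154, 15093031683359517865610, 17957996394503754516095, 21356550192161386034190, 25386211278830619362005,
     30161988390521782681817, 35819459775446145920647, 42518384229802491130356, 50446934422759828382275, 59826657826844923195815,
     70918288005290710341185, 84028549415508789146355, 99518122475418052982784]"

definition HU2 :: "int list" where
  "HU2 =
    [1, 2, 7, 14, 35, 66, 140, 252, 485, 840, 1512, 2534, 4347, 7084, 11705, 18622, 29862, 46522, 72779, 111310, 170534, 256586, 386101, 572488,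
     848050, 1240974, 1812979, 2621486, 3782669, 5410360, 7720237, 10932740, 15443120, 21669546, 30327570, 42196022, 58555543, 80832850, 111295142,
     152517120, 208471357, 283740898, 385218606, 520960194, 702814490, 944776938, 1267035259, 1693642068, 2258701900, 3003135480, 3984092244,
     5270534248, 6957486711, 9160138106, 12035320720, 15773827356, 20632658974, 26925337778, 35070138432, 45578399440, 59126411596, 76542205014,
     98912357362, 127568643870, 164246255995, 211073330664, 270804676093, 346819990076, 443468229427, 566084975330, 721498579227, 918084688486,
     1166508434987, 1479846188268, 1874671449140, 2371292845752, 2995339508882, 3778193732850, 4759300810754, 5986919925000, 7521482754506,
     9436854809228, 11825209446696, 14799095386782, 18498496308490, 23094155215844, 28797780304909, 35867307172606, 44621625512709, 55448800423720,
     68827282974030, 85338611699474, 105697905198950, 130773295301992, 161629682702985, 199558215354862, 246138960237525, 303285277862406,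
     373333422367463, 459108878748240, 564054225322833, 692327680892288, 848985232069674, 1040126185724356, 1273152111789460, 1556980676512426,
     1902413118187836, 2322446837761288, 2832795932940456, 3452346043971160, 4203890332716309, 5114788451123974, 6218005212053470, 7553061384691548,
     9167496840198095, 11118237112027080, 13473650687451773, 16315505943596914, 19741858533237596, 23869843982908750, 28839722679593616,
     34818851735742816, 42007341333505912, 50643685891849302, 61012659294926100, 73453274252880858, 88369782686726634, 106242892987883902,
     127645069264844355, 153256295572137800, 183885315998121899, 220491728994334878, 264215422927632547, 316407461418113310, 378670804822212450,
     452903375348832702, 541354293360959463, 646683778668578602, 772040678466584297, 921145589572640600, 1098397556077095907, 1308989149297031346,
     1559053060926737229, 1855821072076925478, 2207825120820619335, 2625116422711575020, 3119540796767473225, 3705040060970013550,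
     4398028421280296372, 5217806183353844080, 6187073463608325386, 7332496935903155898, 8685409836251401381, 10282586838091900752,
     12167196389944174445, 14389858133370999006, 17009936493573987292, 20096980979535198648, 23732480575967324189, 28011821998018275040,
     33046665373157156784, 38967601982706056986, 45927366367579211341, 54104437140002315136, 63707373482580723945, 74979685363463726986,
     88205679344024202078, 103717034721185496856, 121900672418969336843, 143207620099548902820, 168163588962156689076, 197380905408547092022,
     231572707318248389478, 271568977805237543466, 318335572721517196615, 372995733595323128860, 436855555003569653303, 511432805421614814248,
     598490967180470241969, 700077790371170434440, 818570729247363462183, 956728440889591710060]"

definition HA0 :: "int list" where
  "HA0 =
    [1, 1, 0, 1, 0, 0, 1, 0, 0, 0, 1, 0, 0, 0, 0, 1, 0, 0, 0, 0, 0, 1, 0, 0, 0, 0, 0, 0, 1, 0, 0, 0, 0, 0, 0, 0, 1, 0, 0, 0, 0, 0, 0, 0, 0, 1, 0, 0,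
     0, 0, 0, 0, 0, 0, 0, 1, 0, 0, 0, 0, 0, 0, 0, 0, 0, 0, 1, 0, 0, 0, 0, 0, 0, 0, 0, 0, 0, 0, 1, 0, 0, 0, 0, 0, 0, 0, 0, 0, 0, 0, 0, 1, 0, 0, 0, 0,
     0, 0, 0, 0, 0, 0, 0, 0, 0, 1, 0, 0, 0, 0, 0, 0, 0, 0, 0, 0, 0, 0, 0, 0, 1, 0, 0, 0, 0, 0, 0, 0, 0, 0, 0, 0, 0, 0, 0, 0, 1, 0, 0, 0, 0, 0, 0, 0,
     0, 0, 0, 0, 0, 0, 0, 0, 0, 1, 0, 0, 0, 0, 0, 0, 0, 0, 0, 0, 0, 0, 0, 0, 0, 0, 0, 1, 0, 0, 0, 0, 0, 0, 0, 0, 0, 0]"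

definition HA1 :: "int list" where
  "HA1 =
    [1, 4, 13, 36, 90, 208, 455, 948, 1901, 3688, 6955, 12792, 23019, 40612, 70395, 120072, 201822, 334684, 548158, 887500, 1421602, 2254460, 3541928,
     5515900, 8519173, 13055208, 19859113, 29998024, 45012751, 67116436, 99472320, 146580028, 214811311, 313149460, 454206821, 655619380, 941952353,
     1347294468, 1918779898, 2721353324, 3844199155, 5409389704, 7583487064, 10593063324, 14745410274, 20456100252, 28285576163, 38987608660,
     53573321135, 73395586680, 100260035590, 136570741264, 185521017956, 251342778188, 339631771106, 457770951424, 615480535902, 825531305924,
     1104667916313, 1474801886492, 1964550348452, 2611217341664, 3463340661226, 4583960294068, 6054806148413, 7981655159856, 10501173731195,
     13789644072208, 18074076615758, 23646340297448, 30881104622391, 40258589807712, 52393373776977, 68070819214440, 88293075261049, 114337094727388,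
     147827711597215, 190829572359640, 245962642449981, 316547156982272, 406785304208066, 521988682577252, 668862734501491, 855862024497724,
     1093633510411198, 1395568991963600, 1778492880436369, 2263517521916868, 2877105775248887, 3652389698142432, 4630805401245678, 5864117838166668,
     7416926054506782, 9369759879199468, 11822904006458146, 14901115851172184, 18759440633901097, 23590372273357568, 29632663539391665,
     37182155601145688, 46605078072331658, 58354368890438244, 72989682463225515, 91201898792877944, 113843120942345837, 141963359476696068,
     176855357888542783, 220109321484130508, 273679684542683195, 339966499671294896, 421914574620966924, 523134133896897456, 648047567409818751,
     802067772602516516, 991814731522450554, 1225378327876750684, 1512637046161555108, 1865644159094972584, 2299095364673899180, 2830894656264968916,
     3482838588753747939, 4281443148574755848, 5258942273438029589, 6454492850832004400, 7915627933534952188, 9700008159752444436,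
     11877531209405879399, 14532870867985872484, 17768531262506188398, 21708518503530737088, 26502751813856607670, 32332359840767809280,
     39416035935580625632, 48017659569694512280, 58455430719005266045, 71112811143628986248, 86451622380969711271, 105027716565663370412,
     127509714786348861885, 154701400821537901128, 187568468397861011088, 227270450683442095384, 275198815215209342481, 333022390152869903360,
     402741503699820047623, 486752473662450006712, 587924385400488056357, 709690452032173093256, 856156670300194899500, 1032230980241350089284,
     1243776719943986481576, 1497794853706306066128, 1802640260968022281811, 2168278325726390081468, 2606589186641859066427, 3131728325800127556748,
     3760553723180240411092, 4513131624101613621756, 5413335104828246711066, 6489552131473233729288, 7775522752878532254388, 9311328523384868351664,
     11144561302876705386195, 13331703330118397285864, 15939756028885197368391, 19048161521927781787892, 22751068455248359715753,
     27160002660707483326136, 32407013625421480544532, 38648379944085509616972, 46068971198856199166129, 54887380382215662613820,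
     65361960448321142303690, 77797921309136372190020, 92555670119226668096581, 110060608640098084161592, 130814637564241063245277,
     155409659749571248186928, 184543423340130333742641, 219038102857667797280256, 259862082850004330861645, 308155486092981041776408]"

definition HA2 :: "int list" where
  "HA2 =
    [1, 3, 9, 22, 51, 108, 221, 429, 810, 1479, 2640, 4599, 7868, 13209, 21843, 35581, 57222, 90882, 142769, 221910, 341649, 521196, 788460, 1183221,
     1762462, 2606604, 3829437, 5590110, 8111346, 11701998, 16790136, 23964594, 34034391, 48104069, 67679109, 94800537, 132230021, 183686994,
     254170332, 350371088, 481225800, 658626822, 898365204, 1221340197, 1655151489, 2236138826, 3012047298, 4045435515, 5418100581, 7236723897,
     9640159893, 12808713258, 16976054058, 22444345566, 29603582728, 38956080441, 51147644598, 67006939237, 87595398657, 114270097032, 148763165694,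
     193281563784, 250632677790, 324381699990, 419049110067, 540357492807, 695540306883, 893726827236, 1146422320191, 1468105216993, 1876969980867,
     2395848783159, 3053355042465, 3885298927059, 4936439201418, 6262646818988, 7933576194687, 10035957093903, 12677649592650, 15992630479809,
     20147121920736, 25347112298617, 31847580160095, 39963790689714, 50085121744867, 62691963353418, 78376360265406, 97867195292003, 122060891252613,
     152058797291889, 189212682957873, 235180037609481, 291991240709658, 362131066585700, 448637511918588, 555221509510041, 686411838537549,
     847730369560425, 1045903843064817, 1289119567592367, 1587333926761125, 1952644280679522, 2399736973639717, 2946426574994997, 3614304481675488,
     4429518438119514, 5423708757302187, 6635131875635823, 8110007817082753, 9904134982327701, 12084824013762474, 14733212109581767,
     17947030825732887, 21843913904054613, 26565347957114969, 32281387729694370, 39196280363113305, 47555169453333234, 57652081273281780,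
     69839432238882519, 84539340527926515, 102257075752476213, 123597041293499850, 149281754575445700, 180174374475254571, 217305422782914006,
     261904462398544034, 315437629791729459, 379652078644757721, 456628577266879452, 548843721408998124, 659243479230741537, 791330085608354644,
     949264652832416112, 1137988276050206070, 1363364890646592589, 1632349700809753095, 1953187652640048903, 2335647191817624459, 2791295437711993047,
     3333821949698161275, 3979419475256339849, 4747231488289567062, 5659877975099887440, 6744072850665914805, 8031348624154266789,
     9558906540410157174, 11370613451669662745, 13518170200291988025, 16062480385011609003, 19075253144352091852, 22640879111647569456,
     26858625113666600973, 31845200621737362771, 37737757600740785634, 44697395403326946231, 52913253961121379729, 62607291955341107034,
     74039862217532530338, 87516214617937457835, 103394077553518716102, 122092493253152857974, 144102110011539878926, 169997166684910945779,
     200449442036617907760, 236244484527628880593, 278300487832448341068, 327690234680600856744, 385666597793059863887, 453692162970007097052,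
     533473627384492380594, 627001727525397199245, 736597568099991055590, 864966357771199328925, 1015259712599971585310, 1191147866417666497548,
     1396903332641312433735, 1637497798123328004538, 1918714301168055785850, 2247277057922105762841, 2631001660053975718517, 3078968778638739156306]"

text \<open>The expansions of the monomials in the order of \<open>mons\<close>; entries 1 and 9 are
  those of \<open>TT\<close> and \<open>mod_u\<close>, from which the others are checked.\<close>

definition mlists :: "int list list" where
  "mlists =
    [[1, 0, 0, 0, 0, 0, 0, 0, 0, 0, 0, 0, 0, 0, 0, 0, 0, 0, 0, 0, 0, 0, 0, 0, 0],
    [0, 1, 4, 14, 40, 105, 252, 574, 1236, 2564, 5124, 9948, 18788, 34685, 62664, 111132, 193672, 332325, 561996, 937958, 1546132, 2519825, 4062888,
     6486008, 10257324],
    [0, 0, 1, 8, 44, 192, 726, 2464, 7704, 22520, 62273, 164208, 415604, 1014608, 2398998, 5511936, 12340540, 26985624, 57752772, 121172600,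
     249622156, 505571024, 1007881900, 1979776352, 3835351500],
    [0, 0, 0, 1, 12, 90, 520, 2535, 10908, 42614, 153948, 521091, 1668640, 5092698, 14900652, 41993484, 114434412, 302503554, 777833676, 1950011841,
     4775901624, 11447269666, 26893331232, 62011703340, 140512188288],
    [0, 0, 0, 0, 1, 16, 152, 1088, 6460, 33440, 155584, 663920, 2636070, 9842608, 34843744, 117706368, 381411320, 1190584800, 3592920168, 10513885600,
     29910641073, 82908818832, 224351802704, 593677808000, 1538570536740],
    [0, 0, 0, 0, 0, 1, 20, 230, 1960, 13685, 82524, 443870, 2175780, 9869590, 41902780, 167973624, 640164980, 2332471515, 8162162400, 27537267440,
     89860606800, 284415820290, 875212330440, 2623941855500, 7678415784420],
    [0, 0, 0, 0, 0, 0, 1, 24, 324, 3200, 25650, 176256, 1073720, 5930472, 30177999, 143176224, 639172500, 2704499280, 10910087790, 42164041920,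
     156741497748, 562392459832, 1953353924883, 6584278845600, 21586408922880],
    [0, 0, 0, 0, 0, 0, 0, 1, 28, 434, 4872, 44051, 339388, 2306486, 14151596, 79700061, 417138232, 2048387334, 9509050236, 41986757554, 177226018116,
     718148916086, 2803662537396, 10577698448380, 38668868187012],
    [0, 0, 0, 0, 0, 0, 0, 0, 1, 32, 560, 7040, 70840, 604352, 4528832, 30529248, 188312156, 1076466720, 5759085024, 29061958016, 139206814656,
     636246570176, 2786867843664, 11741989736320, 47739793808070],
    [0, 0, 0, 1, 3, 10, 25, 62, 136, 293, 593, 1174, 2235, 4172, 7577, 13528, 23659, 40769, 69114, 115671, 191001, 311872, 503474, 804796, 1273889],
    [0, 0, 0, 0, 1, 7, 36, 147, 527, 1701, 5085, 14252, 37910, 96383, 235753, 557284, 1278225, 2853473, 6216547, 13245820, 27656616, 56677565,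
     114166460, 226317560, 442008490],
    [0, 0, 0, 0, 0, 1, 11, 78, 429, 2004, 8294, 31265, 109247, 358407, 1114306, 3306992, 9421480, 25885288, 68843607, 177792078, 447041495,
     1096863117, 2631319186, 6182288056, 14247113413],
    [0, 0, 0, 0, 0, 0, 1, 15, 136, 935, 5357, 26843, 121193, 502834, 1944325, 7079852, 24471551, 80801271, 256155558, 782948838, 2315377546,
     6644306718, 18548637970, 50484088336, 134214963709],
    [0, 0, 0, 0, 0, 0, 0, 1, 19, 210, 1729, 11706, 68628, 359597, 1719981, 7623356, 31661397, 124280660, 464207955, 1658963180, 5698140735,
     18881491335, 60552062228, 188449199940, 570498795034],
    [0, 0, 0, 0, 0, 0, 0, 0, 1, 23, 300, 2875, 22427, 150305, 894565, 4834008, 24094184, 112080133, 491006445, 2040318926, 8088654915, 30739205595,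
     112428879117, 397097881516, 1358333920761],
    [0, 0, 0, 0, 0, 0, 0, 0, 0, 1, 27, 406, 4437, 39152, 294930, 1962633, 11805531, 65248853, 335434356, 1619135656, 7393386282, 32130228332,
     133554494571, 533197297772, 2051806000521],
    [0, 0, 0, 0, 0, 0, 0, 0, 0, 0, 1, 31, 528, 6479, 63769, 532983, 3917969, 25936094, 157243103, 884169482, 4656123747, 23141554169, 109233956848,
     492223331336, 2126589247468],
    [0, 0, 0, 0, 0, 0, 1, 6, 29, 110, 374, 1144, 3267, 8764, 22410, 54888, 129712, 296814, 660429, 1432592, 3037763, 6308828, 12856550, 25745984,
     50734285],
    [0, 0, 0, 0, 0, 0, 0, 1, 10, 67, 350, 1565, 6222, 22610, 76346, 242580, 731764, 2110571, 5852030, 15668474, 40656790, 102552534, 252101992,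
     605304632, 1422191102],
    [0, 0, 0, 0, 0, 0, 0, 0, 1, 14, 121, 798, 4408, 21364, 93537, 377104, 1419291, 5037494, 16993467, 54821004, 169968913, 508538268, 1473298244,
     4144982296, 11352473618],
    [0, 0, 0, 0, 0, 0, 0, 0, 0, 1, 18, 191, 1518, 9959, 56730, 289432, 1350222, 5845043, 23738258, 91211238, 333794032, 1169705621, 3942438280,
     12827719284, 40419327194],
    [0, 0, 0, 0, 0, 0, 0, 0, 0, 0, 1, 22, 277, 2574, 19530, 127600, 741663, 3919620, 19129856, 87223820, 374874690, 1529427522, 5957193153,
     22256922240, 80076506861],
    [0, 0, 0, 0, 0, 0, 0, 0, 0, 0, 0, 1, 26, 379, 4030, 34689, 255398, 1663646, 9807810, 53183670, 268485384, 1273627157, 5719351386, 24458376696,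
     100097324202],
    [0, 0, 0, 0, 0, 0, 0, 0, 0, 0, 0, 0, 1, 30, 497, 5950, 57260, 468716, 3379005, 21960344, 130832025, 723487114, 3749503093, 18351087440,
     85346321781]]"

text \<open>The row at position i starts with a common denominator N and lists the coefficients of N
  \<open>TT\<close> U(1 / \<open>TT\<close>^i). The first seven rows are initial values of the
  recurrence; the eighth supplies the seventh power sum of the modular equation.\<close>

definition tabU0 :: "(int \<times> int list) list" where
  "tabU0 =
    [(1, [0, 1, 0, 0, 0, 0, 0, 0, 0, 0, 0, 0, 0, 0, 0, 0, 0, 0, 0, 0, 0, 0, 0, 0]),
    (1, [0, -4, -7, 0, 0, 0, 0, 0, 0, 0, 0, 0, 0, 0, 0, 0, 0, 0, 0, 0, 0, 0, 0, 0]),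
    (1, [0, 20, 0, -343, 0, 0, 0, 0, 0, 0, 0, 0, 0, 0, 0, 0, 0, 0, 0, 0, 0, 0, 0, 0]),
    (1, [0, -88, 0, 0, -16807, 0, 0, 0, 0, 0, 0, 0, 0, 0, 0, 0, 0, 0, 0, 0, 0, 0, 0, 0]),
    (1, [0, 260, 0, 0, 0, -823543, 0, 0, 0, 0, 0, 0, 0, 0, 0, 0, 0, 0, 0, 0, 0, 0, 0, 0]),
    (1, [0, 476, 0, 0, 0, 0, -40353607, 0, 0, 0, 0, 0, 0, 0, 0, 0, 0, 0, 0, 0, 0, 0, 0, 0]),
    (1, [0, -16744, 0, 0, 0, 0, 0, -1977326743, 0, 0, 0, 0, 0, 0, 0, 0, 0, 0, 0, 0, 0, 0, 0, 0]),
    (1, [1, 184632, 196882, 20706224, 695893835, 10976181104, 90957030178, 387556041628, 581334062442, 0, 0, 0, 0, 0, 0, 0, 0, 0, 0, 0, 0, 0, 0, 0])]"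

definition tabU1 :: "(int \<times> int list) list" where
  "tabU1 =
    [(1, [0, 0, 62, 7329, 252448, 4016873, 33882912, 149884826, 282475249, 0, -76, -20293, -903462, -15580089, -125413834, -461184080, -564950498, 0,
     616, 175616, 7798448, 126119728, 876249752, 2259801992]),
    (1, [0, 0, -1, 0, 0, 0, 0, 0, 0, 0, 1, 0, 0, 0, 0, 0, 0, 0, 0, 0, 0, 0, 0, 0]),
    (1, [0, 0, -7, -49, 0, 0, 0, 0, 0, 0, 0, 49, 0, 0, 0, 0, 0, 0, 0, 0, 0, 0, 0, 0]),
    (1, [0, 1, 0, -343, -2401, 0, 0, 0, 0, 0, 0, 0, 2401, 0, 0, 0, 0, 0, 0, 0, 0, 0, 0, 0]),
    (1, [0, -13, 512, 10241, 48020, 0, 0, 0, 0, -1, -324, -22197, -297724, -941192, 0, 0, 0, 8, 2352, 115248, 941192, 0, 0, 0]),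
    (1, [0, 120, -7168, -143374, -907578, -2470629, -5764801, 0, 0, 14, 4536, 310758, 4168136, 14823774, 5764801, 0, 0, -112, -32928, -1613472,
     -13176688, 0, 0, 0]),
    (1, [0, -931, 68096, 1362053, 8621991, 15647317, -40353607, -282475249, 0, -133, -43092, -2952201, -39597292, -140825853, 0, 282475249, 0, 1064,
     312816, 15327984, 125178536, 0, 0, 0])]"

text \<open>Begins at the exponent -1 of \<open>TT\<close>, the first that
  \<open>b \<le> m + 1\<close> admits for b = 2. Denominators 4 occur because monomials with
  exponent of \<open>mod_u\<close> at most 2 are not an integral basis: solving the cubic for
  \<open>mod_u^3\<close> divides by 64.\<close>

definition tabU2 :: "(int \<times> int list) list" where
  "tabU2 =
    [(4, [0, 0, 28, 3528, 126224, 2084068, 19882681, 109531219, 282475249, 0, -364, -92904, -4086845, -70186032, -564362253, -2075328360, -2542277241,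
     0, 2940, 798504, 35160244, 567538776, 3943123884, 10169108964]),
    (1, [0, 0, -2, -7, 0, 0, 0, 0, 0, 0, 2, 14, 0, 0, 0, 0, 0, 0, -7, 0, 0, 0, 0, 0]),
    (1, [0, 0, -7, -98, -343, 0, 0, 0, 0, 0, 0, 98, 686, 0, 0, 0, 0, 0, 0, -343, 0, 0, 0, 0]),
    (4, [0, 0, 512, 8869, 45619, 50421, 0, 0, 0, -1, -324, -22197, -278516, -924385, 0, 0, 0, 8, 2352, 115248, 873964, 0, 0, 0]),
    (4, [0, 0, -4608, -92169, -650671, -2000033, -3294172, 0, 0, 9, 2916, 199773, 2679516, 10470761, 6588344, 0, 0, -72, -21168, -1037232, -8470728,
     -3294172, 0, 0]),
    (4, [0, 4, 32256, 645183, 4084101, 4117715, -46118408, -161414428, 0, -63, -20412, -1398411, -18756612, -66706983, 46118408, 322828856, 0, 504,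
     148176, 7260624, 59295096, 0, -161414428, 0]),
    (4, [0, -88, -182784, -2607486, 18790226, 640716454, 5505384955, 21750594173, 33614554631, 382, 125468, 8965334, 135716525, 785660022, 3072638933,
     13558811952, 29659901145, -3052, -912380, -48269704, -550126724, -3089933336, -21468118924, -63274455776])]"

definition tabA0 :: "(int \<times> int list) list" where
  "tabA0 =
    [(1, [0, 1, 0, 0, 0, 0, 0, 0, 0, 0, 0, 0, 0, 0, 0, 0, 0, 0, 0, 0, 0, 0, 0, 0]),
    (1, [1, -3, -48, 0, 0, 0, 0, 0, 0, -16, -16, 0, 0, 0, 0, 0, 0, 64, 0, 0, 0, 0, 0, 0]),
    (1, [-7, -125, -1127, -3969, 0, 0, 0, 0, 0, 112, 2800, 14112, 0, 0, 0, 0, 0, -448, -12544, 0, 0, 0, 0, 0]),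
    (1, [42, 1596, 17290, 76832, 112847, 0, 0, 0, 0, -672, -30464, -131712, 76832, 0, 0, 0, 0, 2688, 131712, -307328, 0, 0, 0, 0]),
    (1, [-215, -15223, -215327, -1490678, -5344626, -7411887, 0, 0, 0, 3456, 259056, 1300656, 2689120, 13176688, 0, 0, 0, -13888, -1053696, 4302592,
     0, 0, 0, 0]),
    (1, [835, 133793, 2687643, 28097874, 159901798, 439771962, 455419279, 0, 0, -13680, -2058672, -18692128, -156506784, -869661408, -1475789056, 0,
     0, 56000, 7771008, -21512960, 210827008, 737894528, 0, 0]),
    (1, [-966, -1108142, -29320816, -359245166, -2095496760, -4317012406, 5245968910, 22880495169, 0, 19488, 15700384, 232844864, 2366963424,
     9856162624, -6456577120, -81352871712, 0, -94080, -54880000, -40874624, -2529924096, 5165261696, 72313663744, 0])]"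

definition tabA1 :: "(int \<times> int list) list" where
  "tabA1 =
    [(1, [0, 36, 7063, 327369, 6819869, 76387815, 480949112, 1614144280, 2259801992, 0, -532, -97461, -3944500, -68185999, -592950960, -2582630848,
     -4519603984, 0, 1960, 334768, 11563216, 158120256, 968486568, 2259801992]),
    (1, [0, -1, -7, 0, 0, 0, 0, 0, 0, 0, 7, 0, 0, 0, 0, 0, 0, 0, 0, 0, 0, 0, 0, 0]),
    (1, [0, -8, -119, -441, 0, 0, 0, 0, 0, 0, 168, 1225, 0, 0, 0, 0, 0, 0, -784, 0, 0, 0, 0, 0]),
    (1, [0, 106, 1750, 9457, 16807, 0, 0, 0, 0, 0, -1750, -14112, -16807, 0, 0, 0, 0, 0, 7056, 0, 0, 0, 0, 0]),
    (1, [1, -1077, -22239, -178017, -662676, -941192, 0, 0, 0, -15, 16156, 190365, 854756, 1882384, 0, 0, 0, 56, -60368, -192080, -941192, 0, 0, 0]),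
    (1, [-16, 9910, 263802, 2925790, 16638930, 46941951, 51883209, 0, 0, 240, -142170, -2595824, -21748258, -92236816, -144120025, 0, 0, -896, 510384,
     5109328, 39530064, 92236816, 0, 0]),
    (1, [169, -82277, -2593073, -32088679, -182540827, -354947033, 639892911, 2542277241, 0, -2535, 1155700, 27617331, 261315236, 928132961,
     -553420896, -7061881225, 0, 9464, -4066608, -66421264, -480949112, -368947264, 4519603984, 0])]"

text \<open>Begins at the exponent -2 of \<open>TT\<close>, as \<open>UA7_identity\<close> requires
  \<open>b \<le> m\<close>.\<close>

definition tabA2 :: "(int \<times> int list) list" where
  "tabA2 =
    [(1, [0, 3, 840, 40474, 850640, 9546376, 60118639, 201768035, 282475249, 0, -42, -11466, -486374, -8504342, -74118870, -322828856, -564950498, 0,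
     147, 39102, 1428595, 19765032, 121060821, 282475249]),
    (1, [0, -1, -14, -49, 0, 0, 0, 0, 0, 0, 14, 98, 0, 0, 0, 0, 0, 0, -49, 0, 0, 0, 0, 0]),
    (1, [0, 10, 189, 1176, 2401, 0, 0, 0, 0, 0, -140, -1666, -4802, 0, 0, 0, 0, 0, 490, 2401, 0, 0, 0, 0]),
    (1, [0, -90, -2142, -19159, -76832, -117649, 0, 0, 0, 0, 1260, 21168, 120050, 235298, 0, 0, 0, 0, -4410, -43218, -117649, 0, 0, 0]),
    (1, [0, 728, 21658, 258622, 1553447, 4705960, 5764801, 0, 0, 0, -10192, -231868, -1997632, -7764834, -11529602, 0, 0, 0, 35672, 561834, 3058874,
     5764801, 0, 0]),
    (1, [0, -5236, -178262, -2297414, -13143074, -22235661, 80707214, 282475249, 0, 0, 73304, 1982540, 18286016, 56000924, -80707214, -564950498, 0,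
     0, -256564, -5142942, -28000462, 0, 282475249, 0]),
    (1, [1, 33383, 1230733, 15265558, 58824500, -253651244, -2663338062, -5931980229, 0, -14, -467264, -13959414, -116001914, -11529602, 3631824630,
     11863960458, 0, 49, 1635081, 37412382, 144120025, -968486568, -5931980229, 0])]"

definition one25 :: "int list" where "one25 = 1 # replicate 24 0"
definition one26 :: "int list" where "one26 = 1 # replicate 25 0"
fun lpow :: "int list \<Rightarrow> nat \<Rightarrow> int list \<Rightarrow> int list" where
  "lpow cs 0 zs = zs"
| "lpow cs (Suc n) zs = lpow cs n (lmul cs zs)"

definition EE :: "nat \<Rightarrow> int list" where "EE k = take 26 (dil k (take 26 EL))"

text \<open>From m to m + 1 the quotient inside the operator and the cleared denominator
  \<open>Y\<close> are multiplied by \<open>eul^4\<close>, and the power of x drops by one, that is,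
  one zero of \<open>Z\<close> disappears. For \<open>X\<close> the factor is split as
  \<open>EL\<close> times \<open>E3L\<close> because these two lists are sparse.\<close>

fun chk :: "int list \<Rightarrow> int list \<Rightarrow> int list \<Rightarrow> int list \<Rightarrow> int list \<Rightarrow> (int \<times> int list) list \<Rightarrow> bool" where
  "chk P K Z X Y [] = True"
| "chk P K Z X Y ((N, cs) # ts) = (map ((*) N) (lmul (ex7 (Z @ X)) K) = P @ lmul Y (pl cs mlists (replicate 25 0)) \<and>
    (if ts = [] then True else chk P K (tl Z) (lmul EL (lmul E3L X)) (lmul (EE 1) (lmul (EE 1) (lmul (EE 1) (lmul (EE 1) Y)))) ts))"

text \<open>This list is recomputed from Euler's product; each of the other long lists is pinned
  down by a product with lists that are already known.\<close>

lemma EL_eq: "elist 181 (1 # replicate 181 0) = EL" by code_simp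
lemma E3L_eq: "lmul EL (lmul EL EL) = E3L" by code_simp
lemma HA2_eq: "lmul E3L HA2 = 1 # replicate 181 0" by code_simp
lemma HU1_eq: "lmul (dil 2 EL) HU1 = HA2" by code_simp
lemma HU2_eq: "lmul (dil 2 EL) HU2 = lmul EL HU1" by code_simp
lemma HA1_eq: "lmul EL HA1 = lmul (dil 2 EL) HA2" by code_simp
lemma HA0_eq: "lmul EL HA0 = lmul (dil 2 EL) (take 182 (dil 2 EL))" by code_simp

text \<open>The product formula for \<open>TT\<close> with its denominator cleared; since
  \<open>eul\<close> has constant term 1 and a lower bound, \<open>tr_lpow_cancel\<close> recovers
  the expansion of \<open>TT\<close> itself.\<close>

lemma TL_eq: "lpow (EE 1) 4 (mlists ! 1) = take 25 (0 # lpow (EE 7) 4 one25)" by code_simp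
lemma UL_eq: "lpow (EE 1) 3 (lmul (EE 2) (lpow (EE 7) 3 (mlists ! 9))) = take 25 ([0, 0, 0] @ lpow (EE 14) 7 one25)" by code_simp
lemma mlists_eq: "mlists = iter (lmul (mlists ! 1)) 9 one25 @ iter (lmul (mlists ! 1)) 8 (mlists ! 9) @ iter (lmul (mlists ! 1)) 7 (lmul (mlists ! 9) (mlists ! 9))"
  by code_simp

lemma cubic_eq: "pl [1, -1, -9, 16, -17, 80, -64] [mlists ! 3, mlists ! 9, mlists ! 10, mlists ! 17, mlists ! 11, mlists ! 18, lmul (mlists ! 9) (mlists ! 17)] (replicate 25 0)
  = replicate 25 0" by code_simp

lemma chk_U0: "chk [] (lpow (EE 7) 4 one25) (replicate 7 0) (1 # replicate 181 0) (lpow (EE 1) 4 one25) tabU0" by code_simp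
lemma chk_U1: "chk [] (lpow (EE 7) 4 (lpow (EE 2) 7 one25)) (replicate 10 0) HU1 (lpow (EE 1) 7 one25) tabU1" by code_simp
lemma chk_U2: "chk [] (lpow (EE 7) 4 (lpow (EE 2) 14 one25)) (replicate 12 0) HU2 (lpow (EE 1) 14 one25) tabU2" by code_simp
lemma chk_A0: "chk [0] (lpow (EE 7) 5 one26) (replicate 8 0) HA0 (lpow (EE 14) 2 (lpow (EE 1) 4 one25)) tabA0" by code_simp
lemma chk_A1: "chk [0] (lpow (EE 7) 5 (lpow (EE 2) 7 one26)) (replicate 11 0) HA1 (lpow (EE 14) 2 (lpow (EE 1) 7 one25)) tabA1" by code_simp
lemma chk_A2: "chk [0] (lpow (EE 7) 5 (lpow (EE 2) 14 one26)) (replicate 13 0) HA2 (lpow (EE 14) 2 (lpow (EE 1) 14 one25)) tabA2" by code_simp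

section \<open>Soundness of the list computations\<close>

lemma length_lpow [simp]: "length (lpow cs n zs) = length zs"
  by (induction n arbitrary: zs) auto

lemma tr_lpow:
  assumes "tr f cs" "tr g zs" "length zs \<le> length cs"
  shows "tr (\<lambda>\<tau>. f \<tau> ^ n * g \<tau>) (lpow cs n zs)"
  using assms(2,3)
proof (induction n arbitrary: g zs)
  case (Suc n)
  from Suc.IH[OF tr_mult'[OF assms(1) Suc.prems]] Suc.prems show ?case by (simp add: mult_ac)
qed simp

lemma tr_one: "tr (\<lambda>\<tau>. 1) (1 # replicate n 0)"
  using tr_const[of 1 n] by simp

lemma tr_zero: "tr (\<lambda>\<tau>. 0) (replicate n 0)"
  by (rule tr_cong[OF tr_ev]) (simp add: ev_zeros)

lemma length_EL: "length EL = 182"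
  unfolding EL_eq [symmetric] by (simp add: length_elist)

lemma tr_EL: "tr (\<lambda>\<tau>. eul (nome \<tau>)) EL"
  using tr_eul[of 181] unfolding EL_eq .

lemma tr_EL_dil: "k > 0 \<Longrightarrow> tr (\<lambda>\<tau>. eul (nome \<tau> ^ k)) (dil k EL)"
  using tr_dil[OF tr_EL, of k] by (simp add: nome_of_nat_mult)

lemma tr_EE:
  assumes "k > 0"
  shows "tr (\<lambda>\<tau>. eul (nome \<tau> ^ k)) (EE k)"
  using tr_take[OF tr_dil[OF tr_take[OF tr_EL, of 26] assms], of 26] by (simp add: nome_of_nat_mult EE_def)

lemma length_EE [simp]: "k > 0 \<Longrightarrow> length (EE k) = 26"
  by (simp add: EE_def length_dil length_EL)

lemma length_H: "length E3L = 182" "length HA2 = 182" "length HU1 = 182" "length HU2 = 182" "length HA1 = 182" "length HA0 = 182"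
proof -
  show 1: "length E3L = 182" unfolding E3L_eq [symmetric] by (simp add: length_EL)
  show 2: "length HA2 = 182" using arg_cong[OF HA2_eq, of length] by simp
  show 3: "length HU1 = 182" using arg_cong[OF HU1_eq, of length] 2 by simp
  show 4: "length HU2 = 182" using arg_cong[OF HU2_eq, of length] 3 by simp
  show "length HA1 = 182" using arg_cong[OF HA1_eq, of length] 2 by simp
  show "length HA0 = 182" using arg_cong[OF HA0_eq, of length] by (simp add: length_dil length_EL)
qed

lemma tr_E3L: "tr (\<lambda>\<tau>. eul (nome \<tau>) ^ 3) E3L"
  using tr_mult[OF tr_EL tr_mult[OF tr_EL tr_EL]] unfolding length_lmul E3L_eq by (simp add: power3_eq_cube mult.assoc)

lemma below_eul_nome: "below (\<lambda>\<tau>. eul (nome \<tau>))"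
  using below_eul[of 1] by simp

lemma tr_divide_lmul:
  assumes "tr d ds" "below d" "tr b (lmul ds zs)" "length zs \<le> length ds"
  shows "tr (\<lambda>\<tau>. b \<tau> / d \<tau>) zs"
  by (rule tr_divide[OF tr_mult'[OF assms(1) tr_ev assms(4)] assms(3) _ assms(2)]) simp

lemma tr_HA2: "tr (\<lambda>\<tau>. 1 / eul (nome \<tau>) ^ 3) HA2"
  by (rule tr_divide_lmul[OF tr_E3L below_power[OF below_eul_nome]]) (use tr_one[of 181] HA2_eq length_H in simp_all)

lemma tr_HU1: "tr (\<lambda>\<tau>. 1 / eul (nome \<tau>) ^ 3 / eul (nome \<tau> ^ 2)) HU1"
  by (rule tr_divide_lmul[OF tr_EL_dil[of 2] below_eul[of 2]]) (use tr_HA2 HU1_eq in \<open>simp_all add: length_H length_dil length_EL\<close>)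

lemma tr_HU2: "tr (\<lambda>\<tau>. eul (nome \<tau>) * (1 / eul (nome \<tau>) ^ 3 / eul (nome \<tau> ^ 2)) / eul (nome \<tau> ^ 2)) HU2"
  by (rule tr_divide_lmul[OF tr_EL_dil[of 2] below_eul[of 2]]) (use tr_mult[OF tr_EL tr_HU1] HU2_eq in \<open>simp_all add: length_H length_dil length_EL\<close>)

lemma tr_HA1: "tr (\<lambda>\<tau>. eul (nome \<tau> ^ 2) * (1 / eul (nome \<tau>) ^ 3) / eul (nome \<tau>)) HA1"
  by (rule tr_divide_lmul[OF tr_EL below_eul_nome]) (use tr_mult'[OF tr_EL_dil[of 2] tr_HA2] HA1_eq in \<open>simp_all add: length_H length_dil length_EL\<close>)

lemma tr_HA0: "tr (\<lambda>\<tau>. eul (nome \<tau> ^ 2) * eul (nome \<tau> ^ 2) / eul (nome \<tau>)) HA0"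
  by (rule tr_divide_lmul[OF tr_EL below_eul_nome]) (use tr_mult'[OF tr_EL_dil[of 2] tr_take[OF tr_EL_dil[of 2], of 182]] HA0_eq in \<open>simp_all add: length_H length_dil length_EL\<close>)

lemma length_mlists: "\<forall>M\<in>set mlists. length M = 25" "length mlists = 24"
  by (simp_all add: mlists_def)

lemma tr_lmul_cancel:
  assumes "tr d ds" "below d" "tr b (lmul ds zs)" "length zs \<le> length ds" "\<And>\<tau>. Im \<tau> > 0 \<Longrightarrow> b \<tau> = d \<tau> * f \<tau>"
  shows "tr f zs"
proof (rule tr_cong[OF tr_divide_lmul[OF assms(1-4)]])
  fix \<tau> :: complex assume t: "Im \<tau> > 0"
  obtain c where "c > 0" "c \<le> norm (d \<tau>)" using assms(2) t unfolding below_def by (metis order_refl)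
  then have "d \<tau> \<noteq> 0" by auto
  then show "f \<tau> = b \<tau> / d \<tau>" using assms(5)[OF t] by simp
qed

lemma tr_lpow_cancel:
  assumes "tr d ds" "below d" "tr (\<lambda>\<tau>. d \<tau> ^ n * f \<tau>) (lpow ds n zs)" "length zs \<le> length ds"
  shows "tr f zs"
  using assms(3,4)
proof (induction n arbitrary: f zs)
  case (Suc n)
  have "tr (\<lambda>\<tau>. d \<tau> * f \<tau>) (lmul ds zs)"
    by (rule Suc.IH) (use Suc.prems in \<open>simp_all add: mult_ac\<close>)
  then show ?case by (rule tr_lmul_cancel[OF assms(1,2)]) (use Suc.prems in auto)
qed simp

lemma tr_TT: "tr TT (mlists ! 1)"
proof (rule tr_lpow_cancel[OF tr_EE[of 1] below_eul[of 1], of 4])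
  have "tr (\<lambda>\<tau>. nome \<tau> ^ 1 * (eul (nome \<tau> ^ 7) ^ 4 * 1)) (take 25 (replicate 1 0 @ lpow (EE 7) 4 one25))"
    by (intro tr_take tr_shift tr_lpow tr_EE) (auto simp: one25_def tr_one)
  then have "tr (\<lambda>\<tau>. nome \<tau> ^ 1 * (eul (nome \<tau> ^ 7) ^ 4 * 1)) (lpow (EE 1) 4 (mlists ! 1))"
    unfolding TL_eq by simp
  then show "tr (\<lambda>\<tau>. eul (nome \<tau> ^ 1) ^ 4 * TT \<tau>) (lpow (EE 1) 4 (mlists ! 1))"
  proof (rule tr_cong)
    fix \<tau> :: complex assume "Im \<tau> > 0"
    then show "eul (nome \<tau> ^ 1) ^ 4 * TT \<tau> = nome \<tau> ^ 1 * (eul (nome \<tau> ^ 7) ^ 4 * 1)"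
      using eul_pow_nonzero[of \<tau> 1] by (simp add: mod_eul(4))
  qed
qed (use length_mlists in \<open>auto simp: all_set_conv_all_nth\<close>)

lemma tr_mod_u: "tr mod_u (mlists ! 9)"
proof -
  have l: "length (mlists ! 9) = 25" using length_mlists by (auto simp: all_set_conv_all_nth)
  have "tr (\<lambda>\<tau>. nome \<tau> ^ 3 * (eul (nome \<tau> ^ 14) ^ 7 * 1)) (take 25 (replicate 3 0 @ lpow (EE 14) 7 one25))"
    by (intro tr_take tr_shift tr_lpow tr_EE) (auto simp: one25_def tr_one)
  then have "tr (\<lambda>\<tau>. nome \<tau> ^ 3 * (eul (nome \<tau> ^ 14) ^ 7 * 1)) (lpow (EE 1) 3 (lmul (EE 2) (lpow (EE 7) 3 (mlists ! 9))))"
    unfolding UL_eq by (simp add: numeral_3_eq_3)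
  then have 1: "tr (\<lambda>\<tau>. eul (nome \<tau> ^ 1) ^ 3 * (eul (nome \<tau> ^ 2) * (eul (nome \<tau> ^ 7) ^ 3 * mod_u \<tau>)))
     (lpow (EE 1) 3 (lmul (EE 2) (lpow (EE 7) 3 (mlists ! 9))))"
  proof (rule tr_cong)
    fix \<tau> :: complex assume "Im \<tau> > 0"
    then show "eul (nome \<tau> ^ 1) ^ 3 * (eul (nome \<tau> ^ 2) * (eul (nome \<tau> ^ 7) ^ 3 * mod_u \<tau>)) = nome \<tau> ^ 3 * (eul (nome \<tau> ^ 14) ^ 7 * 1)"
      using eul_pow_nonzero[of \<tau> 1] eul_pow_nonzero[of \<tau> 2] eul_pow_nonzero[of \<tau> 7] by (simp add: mod_eul(2))
  qed
  have 2: "tr (\<lambda>\<tau>. eul (nome \<tau> ^ 2) * (eul (nome \<tau> ^ 7) ^ 3 * mod_u \<tau>)) (lmul (EE 2) (lpow (EE 7) 3 (mlists ! 9)))"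
    by (rule tr_lpow_cancel[OF tr_EE[of 1] below_eul[of 1] 1]) (simp_all add: l)
  have 3: "tr (\<lambda>\<tau>. eul (nome \<tau> ^ 7) ^ 3 * mod_u \<tau>) (lpow (EE 7) 3 (mlists ! 9))"
    by (rule tr_lmul_cancel[OF tr_EE[of 2] below_eul[of 2] 2]) (simp_all add: l)
  show ?thesis by (rule tr_lpow_cancel[OF tr_EE[of 7] below_eul[of 7] 3]) (simp_all add: l)
qed

abbreviation approx25 :: "(complex \<Rightarrow> complex) \<Rightarrow> int list \<Rightarrow> bool" where
  "approx25 f M \<equiv> tr f M \<and> length M = 25"

lemma approx25_mult: "approx25 f M \<Longrightarrow> approx25 g M' \<Longrightarrow> approx25 (\<lambda>\<tau>. f \<tau> * g \<tau>) (lmul M M')"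
  by (auto intro: tr_mult)

lemma iter_approx25:
  assumes "approx25 f M" "approx25 (\<lambda>\<tau>. f \<tau> ^ j * g \<tau>) M'"
  shows "list_all2 approx25 (map (\<lambda>a \<tau>. f \<tau> ^ a * g \<tau>) [j..<j + n]) (iter (lmul M) n M')"
  using assms(2)
proof (induction n arbitrary: j M')
  case (Suc n)
  have "list_all2 approx25 (map (\<lambda>a \<tau>. f \<tau> ^ a * g \<tau>) [Suc j..<Suc j + n]) (iter (lmul M) n (lmul M M'))"
    by (rule Suc.IH) (use approx25_mult[OF assms(1) Suc.prems] in \<open>simp add: mult.assoc\<close>)
  moreover have "[j..<j + Suc n] = j # [Suc j..<Suc j + n]" by (simp add: upt_rec)
  ultimately show ?case using Suc.prems by simp
qed simp

lemma mlists_approx25: "list_all2 approx25 (map (\<lambda>(a, l) \<tau>. TT \<tau> ^ a * mod_u \<tau> ^ l) mons) mlists"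
proof -
  have l: "length (mlists ! 1) = 25" "length (mlists ! 9) = 25" using length_mlists by (auto simp: all_set_conv_all_nth)
  have T: "approx25 TT (mlists ! 1)" and u: "approx25 mod_u (mlists ! 9)" using l tr_TT tr_mod_u by auto
  have 0: "list_all2 approx25 (map (\<lambda>a \<tau>. TT \<tau> ^ a * mod_u \<tau> ^ 0) [0..<0 + 9]) (iter (lmul (mlists ! 1)) 9 one25)"
    by (rule iter_approx25[OF T]) (simp add: one25_def tr_one)
  have 1: "list_all2 approx25 (map (\<lambda>a \<tau>. TT \<tau> ^ a * mod_u \<tau> ^ 1) [0..<0 + 8]) (iter (lmul (mlists ! 1)) 8 (mlists ! 9))"
    by (rule iter_approx25[OF T]) (simp add: u l)
  have 2: "list_all2 approx25 (map (\<lambda>a \<tau>. TT \<tau> ^ a * mod_u \<tau> ^ 2) [0..<0 + 7]) (iter (lmul (mlists ! 1)) 7 (lmul (mlists ! 9) (mlists ! 9)))"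
    by (rule iter_approx25[OF T]) (use approx25_mult[OF u u] in \<open>simp add: power2_eq_square\<close>)
  have m: "mons = map (\<lambda>a. (a, 0)) [0..<9] @ map (\<lambda>a. (a, 1)) [0..<8] @ map (\<lambda>a. (a, 2)) [0..<7]"
    by (simp add: mons_def upt_rec)
  have "map (\<lambda>(a, l) \<tau>. TT \<tau> ^ a * mod_u \<tau> ^ l) mons =
      map (\<lambda>a \<tau>. TT \<tau> ^ a * mod_u \<tau> ^ 0) [0..<0 + 9] @ map (\<lambda>a \<tau>. TT \<tau> ^ a * mod_u \<tau> ^ 1) [0..<0 + 8] @ map (\<lambda>a \<tau>. TT \<tau> ^ a * mod_u \<tau> ^ 2) [0..<0 + 7]"
    unfolding m by (simp only: map_append map_map o_def prod.case add_0)
  then show ?thesis by (subst mlists_eq) (simp only: list_all2_appendI[OF 0 list_all2_appendI[OF 1 2]])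
qed

lemma length_mons: "length mons = 24"
  by (simp add: mons_def upt_rec)

lemma pol_dense:
  assumes "length cs = 24"
  shows "(\<Sum>(f, c)\<leftarrow>zip (map (\<lambda>(a, l) \<tau>. TT \<tau> ^ a * mod_u \<tau> ^ l) ms) cs. of_int c * f \<tau>) = pol (map2 (\<lambda>(a, l) c. (a, l, c)) ms cs) (TT \<tau>) (mod_u \<tau>)"
  unfolding pol_def
proof (induction ms arbitrary: cs)
  case (Cons x xs)
  then show ?case by (cases cs) (auto simp: split_def)
qed simp

lemma tr_pol_dense:
  assumes "length cs = 24"
  shows "approx25 (\<lambda>\<tau>. pol (dense cs) (TT \<tau>) (mod_u \<tau>)) (pl cs mlists (replicate 25 0))"
  using tr_pl[OF mlists_approx25, of cs "replicate 25 0"] tr_zero assms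
  by (simp add: length_mons pol_dense dense_def)

text \<open>Induction along the rows. The invariant is that \<open>X\<close> and \<open>Y\<close>
  expand \<open>h m\<close> and \<open>Yf m\<close> for the current m, while k + m keeps the value
  \<open>s\<close>.\<close>

lemma chk_sound:
  assumes h: "tr (h m) X" "length X = 182" "\<And>m \<tau>. h (Suc m) \<tau> = eul (nome \<tau>) ^ 4 * h m \<tau>"
    and Y: "tr (Yf m) Y" "length Y = 25" "\<And>m \<tau>. Yf (Suc m) \<tau> = eul (nome \<tau>) ^ 4 * Yf m \<tau>" "\<And>m. below (Yf m)"
    and K: "tr Kf K" "length K = p + 25" "p \<le> 1"
    and id: "\<And>k m \<tau>. k + m = s \<Longrightarrow> Im \<tau> > 0 \<Longrightarrow> nome \<tau> ^ p * Yf m \<tau> * F m \<tau> = Kf \<tau> * atkin_U7 (\<lambda>z. nome z ^ k * h m z) \<tau>"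
    and k: "k + m = s" "length ts \<le> k + 1" "\<And>N cs. (N, cs) \<in> set ts \<Longrightarrow> length cs = 24"
    and c: "chk (replicate p 0) K (replicate k 0) X Y ts" "i < length ts"
  shows "qb (\<lambda>\<tau>. of_int (fst (ts ! i)) * F (m + i) \<tau> - pol (dense (snd (ts ! i))) (TT \<tau>) (mod_u \<tau>)) 25"
  using h(1,2) Y(1,2) k c
proof (induction ts arbitrary: X Y m k i)
  case (Cons t ts)
  obtain N cs where t: "t = (N, cs)" by (cases t)
  have cs: "length cs = 24" using Cons.prems(7) t by auto
  have eq: "map ((*) N) (lmul (ex7 (replicate k 0 @ X)) K) = replicate p 0 @ lmul Y (pl cs mlists (replicate 25 0))"
    using Cons.prems(8) t by simp
  show ?case
  proof (cases i)
    case 0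
    have "qb (\<lambda>\<tau>. of_int N * F m \<tau> - pol (dense cs) (TT \<tau>) (mod_u \<tau>)) 25"
      by (rule chk_step[OF Cons.prems(1) K(1,2) Cons.prems(3) tr_pol_dense[OF cs, THEN conjunct1] tr_pol_dense[OF cs, THEN conjunct2] Cons.prems(4) _ eq Y(4) id[OF Cons.prems(5)]])
        (use Cons.prems(2) K(3) in auto)
    then show ?thesis using 0 t by simp
  next
    case (Suc j)
    then have ne: "ts \<noteq> []" using Cons.prems(9) by auto
    then have "k > 0" using Cons.prems(6) by (cases ts) auto
    then obtain k' where k': "k = Suc k'" using gr0_conv_Suc by blast
    have c': "chk (replicate p 0) K (replicate k' 0) (lmul EL (lmul E3L X)) (lmul (EE 1) (lmul (EE 1) (lmul (EE 1) (lmul (EE 1) Y)))) ts"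
      using Cons.prems(8) t ne k' by simp
    have X': "tr (h (Suc m)) (lmul EL (lmul E3L X))"
      by (rule tr_cong[OF tr_mult[OF tr_EL tr_mult[OF tr_E3L Cons.prems(1)]]])
        (use Cons.prems(2) h(3) in \<open>simp_all add: length_EL length_H power_Suc [symmetric] mult.assoc [symmetric] del: power_Suc\<close>)
    have Y': "tr (Yf (Suc m)) (lmul (EE 1) (lmul (EE 1) (lmul (EE 1) (lmul (EE 1) Y))))"
    proof (rule tr_cong)
      show "tr (\<lambda>\<tau>. eul (nome \<tau> ^ 1) * (eul (nome \<tau> ^ 1) * (eul (nome \<tau> ^ 1) * (eul (nome \<tau> ^ 1) * Yf m \<tau>)))) (lmul (EE 1) (lmul (EE 1) (lmul (EE 1) (lmul (EE 1) Y))))"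
        by (intro tr_mult' tr_EE Cons.prems(3)) (use Cons.prems(4) in simp_all)
    qed (simp add: Y(3) power_numeral_reduce mult_ac)
    have "qb (\<lambda>\<tau>. of_int (fst (ts ! j)) * F (Suc m + j) \<tau> - pol (dense (snd (ts ! j))) (TT \<tau>) (mod_u \<tau>)) 25"
      by (rule Cons.IH[OF X' _ Y' _ _ _ _ c'])
        (use Cons.prems Suc k' in auto)
    then show ?thesis using Suc t by simp
  qed
qed simp

lemma dense_deg: "(a, l, c) \<in> set (dense cs) \<Longrightarrow> a + l \<le> 8"
proof -
  assume "(a, l, c) \<in> set (dense cs)"
  then have "(a, l) \<in> set mons" unfolding dense_def by (auto dest: set_zip_leftD)
  then show ?thesis unfolding mons_def by auto
qed

lemma chk_U:
  assumes X: "tr (\<lambda>\<tau>. eul (nome \<tau>) ^ (4 * m) / (eul (nome \<tau>) ^ (3 * b) * eul (nome \<tau> ^ 2) ^ b)) X" "length X = 182"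
    and ts: "k + m = 7 + 3 * b" "length ts \<le> k + 1" "\<And>N cs. (N, cs) \<in> set ts \<Longrightarrow> length cs = 24" "m + length ts \<le> 8" "b \<le> m + 1"
    and c: "chk [] (lpow (EE 7) 4 (lpow (EE 2) (7 * b) one25)) (replicate k 0) X (lpow (EE 1) (4 * m + 3 * b + 4) one25) ts"
    and i: "i < length ts" and tau: "Im \<tau> > 0"
  shows "of_int (fst (ts ! i)) * TT \<tau> * atkin_U7 (\<lambda>z. mod_u z ^ b / TT z ^ (m + i)) \<tau> = pol (dense (snd (ts ! i))) (TT \<tau>) (mod_u \<tau>)"
proof (rule U7_identity[OF _ _ dense_deg _ tau])
  have one: "tr (\<lambda>\<tau>. 1) one25" "length one25 = 25" by (simp_all add: one25_def tr_one)
  have K: "tr (\<lambda>\<tau>. eul (nome \<tau> ^ 7) ^ 4 * eul (nome \<tau> ^ 2) ^ (7 * b)) (lpow (EE 7) 4 (lpow (EE 2) (7 * b) one25))"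
    using tr_lpow[OF tr_EE[of 7] tr_lpow[OF tr_EE[of 2] one(1), of "7 * b"], of 4] one by simp
  have Y: "tr (\<lambda>\<tau>. eul (nome \<tau>) ^ (4 * m + 3 * b + 4)) (lpow (EE 1) (4 * m + 3 * b + 4) one25)"
    using tr_lpow[OF tr_EE[of 1] one(1), of "4 * m + 3 * b + 4"] one by simp
  have "qb (\<lambda>\<tau>. of_int (fst (ts ! i)) * (TT \<tau> * atkin_U7 (\<lambda>z. mod_u z ^ b / TT z ^ (m + i)) \<tau>) - pol (dense (snd (ts ! i))) (TT \<tau>) (mod_u \<tau>)) 25"
    by (rule chk_sound[where h = "\<lambda>m \<tau>. eul (nome \<tau>) ^ (4 * m) / (eul (nome \<tau>) ^ (3 * b) * eul (nome \<tau> ^ 2) ^ b)"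
        and Yf = "\<lambda>m \<tau>. eul (nome \<tau>) ^ (4 * m + 3 * b + 4)" and p = 0 and m = m and k = k and F = "\<lambda>m \<tau>. TT \<tau> * atkin_U7 (\<lambda>z. mod_u z ^ b / TT z ^ m) \<tau>",
        OF X _ Y _ _ _ K _ _ U_relation ts(1,2,3) _ i])
      (use c in \<open>auto simp: one power_add [symmetric] add_ac intro!: below_power below_eul_nome\<close>)
  then show "qb (\<lambda>\<tau>. of_int (fst (ts ! i)) * TT \<tau> * atkin_U7 (\<lambda>z. mod_u z ^ b / TT z ^ (m + i)) \<tau> - pol (dense (snd (ts ! i))) (TT \<tau>) (mod_u \<tau>)) 25"
    by (simp only: mult.assoc)
qed (use ts i in auto)

lemma chk_A:
  assumes X: "tr (\<lambda>\<tau>. eul (nome \<tau>) ^ (4 * m) * eul (nome \<tau> ^ 2) ^ 2 / (eul (nome \<tau>) ^ (3 * b + 5) * eul (nome \<tau> ^ 2) ^ b)) X" "length X = 182"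
    and ts: "k + m = 9 + 3 * b" "length ts \<le> k + 1" "\<And>N cs. (N, cs) \<in> set ts \<Longrightarrow> length cs = 24" "m + length ts \<le> 9" "b \<le> m"
    and c: "chk [0] (lpow (EE 7) 5 (lpow (EE 2) (7 * b) one26)) (replicate k 0) X (lpow (EE 14) 2 (lpow (EE 1) (4 * m + 3 * b) one25)) ts"
    and i: "i < length ts" and tau: "Im \<tau> > 0"
  shows "of_int (fst (ts ! i)) * atkin_U7 (\<lambda>z. mod_A z * (mod_u z ^ b / TT z ^ (m + i))) \<tau> = pol (dense (snd (ts ! i))) (TT \<tau>) (mod_u \<tau>)"
proof (rule UA7_identity[OF _ _ dense_deg _ tau])
  have one: "tr (\<lambda>\<tau>. 1) one25" "length one25 = 25" "tr (\<lambda>\<tau>. 1) one26" "length one26 = 26" by (simp_all add: one25_def one26_def tr_one)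
  have K: "tr (\<lambda>\<tau>. eul (nome \<tau> ^ 7) ^ 5 * eul (nome \<tau> ^ 2) ^ (7 * b)) (lpow (EE 7) 5 (lpow (EE 2) (7 * b) one26))"
    using tr_lpow[OF tr_EE[of 7] tr_lpow[OF tr_EE[of 2] one(3), of "7 * b"], of 5] one by simp
  have Y: "tr (\<lambda>\<tau>. eul (nome \<tau> ^ 14) ^ 2 * eul (nome \<tau>) ^ (4 * m + 3 * b)) (lpow (EE 14) 2 (lpow (EE 1) (4 * m + 3 * b) one25))"
    using tr_lpow[OF tr_EE[of 14] tr_lpow[OF tr_EE[of 1] one(1), of "4 * m + 3 * b"], of 2] one by simp
  show "qb (\<lambda>\<tau>. of_int (fst (ts ! i)) * atkin_U7 (\<lambda>z. mod_A z * (mod_u z ^ b / TT z ^ (m + i))) \<tau> - pol (dense (snd (ts ! i))) (TT \<tau>) (mod_u \<tau>)) 25"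
    by (rule chk_sound[where h = "\<lambda>m \<tau>. eul (nome \<tau>) ^ (4 * m) * eul (nome \<tau> ^ 2) ^ 2 / (eul (nome \<tau>) ^ (3 * b + 5) * eul (nome \<tau> ^ 2) ^ b)"
        and Yf = "\<lambda>m \<tau>. eul (nome \<tau> ^ 14) ^ 2 * eul (nome \<tau>) ^ (4 * m + 3 * b)" and p = 1 and m = m and k = k and F = "\<lambda>m \<tau>. atkin_U7 (\<lambda>z. mod_A z * (mod_u z ^ b / TT z ^ m)) \<tau>",
        OF X _ Y _ _ _ K _ _ UA_relation ts(1,2,3) _ i])
      (use c in \<open>auto simp: one power_add [symmetric] add_ac mult.left_commute intro!: below_power below_eul_nome below_mult below_eul\<close>)
qed (use ts i in auto)

lemma tab_length:
  "(N, cs) \<in> set tabU0 \<union> set tabU1 \<union> set tabU2 \<union> set tabA0 \<union> set tabA1 \<union> set tabA2 \<Longrightarrow> length cs = 24"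
  unfolding tabU0_def tabU1_def tabU2_def tabA0_def tabA1_def tabA2_def by auto

lemma length_tab: "length tabU0 = 8" "length tabU1 = 7" "length tabU2 = 7" "length tabA0 = 7" "length tabA1 = 7" "length tabA2 = 7"
  by (simp_all add: tabU0_def tabU1_def tabU2_def tabA0_def tabA1_def tabA2_def)

theorem U7_tables:
  assumes "Im \<tau> > 0"
  shows "i < 8 \<Longrightarrow> of_int (fst (tabU0 ! i)) * TT \<tau> * atkin_U7 (\<lambda>z. mod_u z ^ 0 / TT z ^ (0 + i)) \<tau> = pol (dense (snd (tabU0 ! i))) (TT \<tau>) (mod_u \<tau>)"
    and "i < 7 \<Longrightarrow> of_int (fst (tabU1 ! i)) * TT \<tau> * atkin_U7 (\<lambda>z. mod_u z ^ 1 / TT z ^ (0 + i)) \<tau> = pol (dense (snd (tabU1 ! i))) (TT \<tau>) (mod_u \<tau>)"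
    and "i < 7 \<Longrightarrow> of_int (fst (tabU2 ! i)) * TT \<tau> * atkin_U7 (\<lambda>z. mod_u z ^ 2 / TT z ^ (1 + i)) \<tau> = pol (dense (snd (tabU2 ! i))) (TT \<tau>) (mod_u \<tau>)"
    and "i < 7 \<Longrightarrow> of_int (fst (tabA0 ! i)) * atkin_U7 (\<lambda>z. mod_A z * (mod_u z ^ 0 / TT z ^ (1 + i))) \<tau> = pol (dense (snd (tabA0 ! i))) (TT \<tau>) (mod_u \<tau>)"
    and "i < 7 \<Longrightarrow> of_int (fst (tabA1 ! i)) * atkin_U7 (\<lambda>z. mod_A z * (mod_u z ^ 1 / TT z ^ (1 + i))) \<tau> = pol (dense (snd (tabA1 ! i))) (TT \<tau>) (mod_u \<tau>)"
    and "i < 7 \<Longrightarrow> of_int (fst (tabA2 ! i)) * atkin_U7 (\<lambda>z. mod_A z * (mod_u z ^ 2 / TT z ^ (2 + i))) \<tau> = pol (dense (snd (tabA2 ! i))) (TT \<tau>) (mod_u \<tau>)"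
proof -
  have nz: "eul (nome \<tau>) \<noteq> 0" "eul ((nome \<tau>)\<^sup>2) \<noteq> 0" if "Im \<tau> > 0" for \<tau>
    using eul_pow_nonzero[OF that, of 1] eul_pow_nonzero[OF that, of 2] by auto
  have c: "tr f cs \<Longrightarrow> (\<And>\<tau>. eul (nome \<tau>) \<noteq> 0 \<Longrightarrow> eul ((nome \<tau>)\<^sup>2) \<noteq> 0 \<Longrightarrow> g \<tau> = f \<tau>) \<Longrightarrow> tr g cs" for f g cs
    by (erule tr_cong) (use nz in auto)
  note pw = power_numeral_reduce divide_simps
  show "i < 8 \<Longrightarrow> of_int (fst (tabU0 ! i)) * TT \<tau> * atkin_U7 (\<lambda>z. mod_u z ^ 0 / TT z ^ (0 + i)) \<tau> = pol (dense (snd (tabU0 ! i))) (TT \<tau>) (mod_u \<tau>)"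
    by (rule chk_U[where X = "1 # replicate 181 0" and k = 7]) (use chk_U0 assms tab_length in \<open>auto simp: length_tab tr_one\<close>)
  show "i < 7 \<Longrightarrow> of_int (fst (tabU1 ! i)) * TT \<tau> * atkin_U7 (\<lambda>z. mod_u z ^ 1 / TT z ^ (0 + i)) \<tau> = pol (dense (snd (tabU1 ! i))) (TT \<tau>) (mod_u \<tau>)"
    by (rule chk_U[where X = HU1 and k = 10, OF c[OF tr_HU1]]) (use chk_U1 assms tab_length in \<open>auto simp: length_tab length_H\<close>)
  show "i < 7 \<Longrightarrow> of_int (fst (tabU2 ! i)) * TT \<tau> * atkin_U7 (\<lambda>z. mod_u z ^ 2 / TT z ^ (1 + i)) \<tau> = pol (dense (snd (tabU2 ! i))) (TT \<tau>) (mod_u \<tau>)"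
    by (rule chk_U[where X = HU2 and k = 12, OF c[OF tr_HU2]]) (use chk_U2 assms tab_length in \<open>auto simp: length_tab length_H pw\<close>)
  show "i < 7 \<Longrightarrow> of_int (fst (tabA0 ! i)) * atkin_U7 (\<lambda>z. mod_A z * (mod_u z ^ 0 / TT z ^ (1 + i))) \<tau> = pol (dense (snd (tabA0 ! i))) (TT \<tau>) (mod_u \<tau>)"
    by (rule chk_A[where X = HA0 and k = 8, OF c[OF tr_HA0]]) (use chk_A0 assms tab_length in \<open>auto simp: length_tab length_H pw\<close>)
  show "i < 7 \<Longrightarrow> of_int (fst (tabA1 ! i)) * atkin_U7 (\<lambda>z. mod_A z * (mod_u z ^ 1 / TT z ^ (1 + i))) \<tau> = pol (dense (snd (tabA1 ! i))) (TT \<tau>) (mod_u \<tau>)"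
    by (rule chk_A[where X = HA1 and k = 11, OF c[OF tr_HA1]]) (use chk_A1 assms tab_length in \<open>auto simp: length_tab length_H pw\<close>)
  show "i < 7 \<Longrightarrow> of_int (fst (tabA2 ! i)) * atkin_U7 (\<lambda>z. mod_A z * (mod_u z ^ 2 / TT z ^ (2 + i))) \<tau> = pol (dense (snd (tabA2 ! i))) (TT \<tau>) (mod_u \<tau>)"
    by (rule chk_A[where X = HA2 and k = 13, OF c[OF tr_HA2]]) (use chk_A2 assms tab_length in \<open>auto simp: length_tab length_H pw\<close>)
qed

text \<open>\<open>TT\<close> and \<open>mod_u\<close> are functions of degree 3 with the same polar
  divisor on a curve of genus 1; the ten monomials of degree at most 3 lie in a space of dimension
  9, so a plane cubic must exist. \<open>cubic_eq\<close> certifies the 25 vanishing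
  coefficients.\<close>

theorem TT_cubic:
  assumes "Im \<tau> > 0"
  shows "TT \<tau> ^ 3 = mod_u \<tau> + 9 * TT \<tau> * mod_u \<tau> - 16 * mod_u \<tau> ^ 2 + 17 * TT \<tau> ^ 2 * mod_u \<tau> - 80 * TT \<tau> * mod_u \<tau> ^ 2 + 64 * mod_u \<tau> ^ 3"
proof -
  let ?tab = "[(3, 0, 1), (0, 1, -1), (1, 1, -9), (0, 2, 16), (2, 1, -17), (1, 2, 80), (0, 3, -64)] :: (nat \<times> nat \<times> int) list"
  let ?f = "\<lambda>a l \<tau>. TT \<tau> ^ a * mod_u \<tau> ^ l"
  let ?fs = "[?f 3 0, ?f 0 1, ?f 1 1, ?f 0 2, ?f 2 1, ?f 1 2, \<lambda>\<tau>. mod_u \<tau> * ?f 0 2 \<tau>]"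
  have n: "approx25 (\<lambda>\<tau>. TT \<tau> ^ fst (mons ! i) * mod_u \<tau> ^ snd (mons ! i)) (mlists ! i)" if "i < 24" for i
    using list_all2_nthD[OF mlists_approx25, of i] that by (simp add: length_mons split_def)
  have "list_all2 approx25 ?fs [mlists ! 3, mlists ! 9, mlists ! 10, mlists ! 17, mlists ! 11, mlists ! 18, lmul (mlists ! 9) (mlists ! 17)]"
    using n[of 3] n[of 9] n[of 10] n[of 17] n[of 11] n[of 18] approx25_mult[OF n[of 9] n[of 17]]
    by (simp add: mons_def upt_rec power2_eq_square power3_eq_cube mult.assoc)
  from tr_pl[OF this, of "[1, -1, -9, 16, -17, 80, -64]" "replicate 25 0"] tr_zero
  have "tr (\<lambda>\<tau>. pol ?tab (TT \<tau>) (mod_u \<tau>)) (replicate 25 0)"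
    unfolding cubic_eq by (simp add: pol_def power_numeral_reduce mult.assoc)
  from tr_qb[OF this tr_zero] have q: "qb (\<lambda>\<tau>. pol ?tab (TT \<tau>) (mod_u \<tau>)) 25" by simp
  have "pol ?tab (TT \<tau>) (mod_u \<tau>) = 0" by (rule pol_identity[OF _ q assms]) auto
  then show ?thesis by (simp add: pol_def algebra_simps)
qed

section \<open>The modular equation of level 7\<close>

fun esym :: "(nat \<Rightarrow> complex) \<Rightarrow> nat \<Rightarrow> nat \<Rightarrow> complex" where
  "esym w 0 k = (if k = 0 then 1 else 0)"
| "esym w (Suc n) k = esym w n k + (case k of 0 \<Rightarrow> 0 | Suc j \<Rightarrow> w n * esym w n j)"

lemma esym_0 [simp]: "esym w n 0 = 1"
  by (induction n) auto

lemma esym_gt: "n < k \<Longrightarrow> esym w n k = 0"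
  by (induction n arbitrary: k) (auto split: nat.splits)

text \<open>The contribution of the last variable to Newton's identity: inserting the recursion of
  \<open>esym\<close> makes the alternating sum telescope.\<close>

lemma newton_aux: "(\<Sum>i\<le>k. (- 1) ^ i * esym w (Suc n) (k - i) * w n ^ Suc i) = w n * esym w n k"
proof (induction k)
  case (Suc k)
  have "(\<Sum>i\<le>k. (- 1) ^ Suc i * esym w (Suc n) (Suc k - Suc i) * w n ^ Suc (Suc i))
     = - w n * (\<Sum>i\<le>k. (- 1) ^ i * esym w (Suc n) (k - i) * w n ^ Suc i)"
    unfolding sum_distrib_left by (intro sum.cong) (auto simp: algebra_simps)
  then show ?case unfolding Suc sum.atMost_Suc_shift by (simp add: algebra_simps)
qed simp

lemma newton_identity:
  "of_nat (Suc k) * esym w n (Suc k) = (\<Sum>i\<le>k. (- 1) ^ i * esym w n (k - i) * (\<Sum>m<n. w m ^ Suc i))"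
proof (induction n arbitrary: k)
  case (Suc n)
  let ?p = "\<lambda>i. \<Sum>m<n. w m ^ Suc i"
  have "(\<Sum>i\<le>k. (- 1) ^ i * esym w (Suc n) (k - i) * (\<Sum>m<Suc n. w m ^ Suc i))
      = (\<Sum>i\<le>k. (- 1) ^ i * esym w (Suc n) (k - i) * ?p i) + w n * esym w n k"
    unfolding newton_aux [symmetric] by (simp add: algebra_simps sum.distrib)
  also have "(\<Sum>i\<le>k. (- 1) ^ i * esym w (Suc n) (k - i) * ?p i)
      = (\<Sum>i\<le>k. (- 1) ^ i * esym w n (k - i) * ?p i) + w n * (of_nat k * esym w n k)"
  proof (cases k)
    case (Suc j)
    have "(\<Sum>i\<le>k. (- 1) ^ i * esym w (Suc n) (k - i) * ?p i)
      = (\<Sum>i\<le>k. (- 1) ^ i * esym w n (k - i) * ?p i) + (\<Sum>i\<le>k. (- 1) ^ i * (case k - i of 0 \<Rightarrow> 0 | Suc j \<Rightarrow> w n * esym w n j) * ?p i)"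
      by (simp add: algebra_simps sum.distrib)
    also have "(\<Sum>i\<le>k. (- 1) ^ i * (case k - i of 0 \<Rightarrow> 0 | Suc j \<Rightarrow> w n * esym w n j) * ?p i) = (\<Sum>i\<le>j. w n * ((- 1) ^ i * esym w n (j - i) * ?p i))"
      unfolding Suc sum.atMost_Suc by (simp, intro sum.cong) (auto simp: Suc_diff_le algebra_simps)
    also have "\<dots> = w n * (of_nat k * esym w n k)"
      unfolding sum_distrib_left [symmetric] Suc Suc.IH ..
    finally show ?thesis .
  qed simp
  also have "(\<Sum>i\<le>k. (- 1) ^ i * esym w n (k - i) * ?p i) = of_nat (Suc k) * esym w n (Suc k)" using Suc by simp
  finally show ?case by (simp add: algebra_simps)
qed simp

lemma prod_esym: "(\<Prod>m<n. X - w m) = (\<Sum>k\<le>n. (- 1) ^ k * esym w n k * X ^ (n - k))"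
proof (induction n)
  case (Suc n)
  have "(\<Sum>k\<le>Suc n. (- 1) ^ k * esym w (Suc n) k * X ^ (Suc n - k))
     = (\<Sum>k\<le>Suc n. (- 1) ^ k * esym w n k * X ^ (Suc n - k)) + (\<Sum>k\<le>Suc n. (- 1) ^ k * (case k of 0 \<Rightarrow> 0 | Suc j \<Rightarrow> w n * esym w n j) * X ^ (Suc n - k))"
    by (simp add: algebra_simps sum.distrib)
  also have "(\<Sum>k\<le>Suc n. (- 1) ^ k * esym w n k * X ^ (Suc n - k)) = X * (\<Sum>k\<le>n. (- 1) ^ k * esym w n k * X ^ (n - k))"
    unfolding sum.atMost_Suc sum_distrib_left by (simp add: esym_gt, intro sum.cong) (auto simp: Suc_diff_le algebra_simps)
  also have "(\<Sum>k\<le>Suc n. (- 1) ^ k * (case k of 0 \<Rightarrow> 0 | Suc j \<Rightarrow> w n * esym w n j) * X ^ (Suc n - k)) = - w n * (\<Sum>k\<le>n. (- 1) ^ k * esym w n k * X ^ (n - k))"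
    unfolding sum.atMost_Suc_shift sum_distrib_left by (simp, intro sum.cong) (auto simp: algebra_simps)
  finally show ?case using Suc by (simp add: algebra_simps)
qed simp

lemma TT_nonzero: "Im z > 0 \<Longrightarrow> TT z \<noteq> 0"
  using eul_pow_nonzero[of z 1] eul_pow_nonzero[of z 7] by (simp add: mod_eul(4))

lemma Im_div_7: "Im \<tau> > 0 \<Longrightarrow> Im ((\<tau> + of_nat l) / 7) > 0"
  by simp

text \<open>
  The row comes from the power sums of \<open>1 / TT ((\<tau> + l) / 7)\<close>, which the tables give, by Newton's identities.
\<close>

definition mcoef :: "nat \<Rightarrow> nat \<Rightarrow> int" where
  "mcoef j k = [49, 748, 4018, 8624, 5915, 1904, 322, 28, 1] ! (j + 1 + k) * 49 ^ k"

lemma cancel_left: "c * a = c * b \<Longrightarrow> c \<noteq> 0 \<Longrightarrow> a = b" for a b c :: complex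
  by simp

text \<open>Here \<open>p i\<close> is the power sum of exponent i + 1. The factor x in the last
  hypothesis and the last conclusion reflects that the seventh symmetric function is 1 / x, that is,
  the product of \<open>TT\<close> over the seven arguments is \<open>TT \<tau>\<close>.\<close>

lemma power_sums_to_esym:
  fixes e :: "nat \<Rightarrow> complex" and p :: "nat \<Rightarrow> complex" and x :: complex
  assumes n: "\<And>k. of_nat (Suc k) * e (Suc k) = (\<Sum>i\<le>k. (- 1) ^ i * e (k - i) * p i)" and e0: "e 0 = 1"
    and p: "p 0 = - 28 - 49 * x" "p 1 = 140 - 2401 * x ^ 2" "p 2 = - 616 - 117649 * x ^ 3" "p 3 = 1820 - 5764801 * x ^ 4"
      "p 4 = 3332 - 282475249 * x ^ 5" "p 5 = - 117208 - 13841287201 * x ^ 6"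
      "x * p 6 = 7 * (1 + 184632 * x + 196882 * x ^ 2 + 20706224 * x ^ 3 + 695893835 * x ^ 4 + 10976181104 * x ^ 5 + 90957030178 * x ^ 6 + 387556041628 * x ^ 7 + 581334062442 * x ^ 8)"
  shows "e 1 = - (28 + 49 * x)" "e 2 = 322 + 1372 * x + 2401 * x ^ 2" "e 3 = - (1904 + 15778 * x + 67228 * x ^ 2 + 117649 * x ^ 3)"
    "e 4 = 5915 + 93296 * x + 773122 * x ^ 2 + 3294172 * x ^ 3 + 5764801 * x ^ 4"
    "e 5 = - (8624 + 289835 * x + 4571504 * x ^ 2 + 37882978 * x ^ 3 + 161414428 * x ^ 4 + 282475249 * x ^ 5)"
    "e 6 = 4018 + 422576 * x + 14201915 * x ^ 2 + 224003696 * x ^ 3 + 1856265922 * x ^ 4 + 7909306972 * x ^ 5 + 13841287201 * x ^ 6"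
    "x * e 7 = 1"
proof -
  note s = numeral_eq_Suc
  show 1: "e 1 = - (28 + 49 * x)" using n[of 0] p e0 by simp
  have "2 * e 2 = e 1 * p 0 - p 1" using n[of 1] e0 by (simp add: s)
  then have "2 * e 2 = 2 * (322 + 1372 * x + 2401 * x ^ 2)" unfolding 1 p by algebra
  then show 2: "e 2 = 322 + 1372 * x + 2401 * x ^ 2" by (rule cancel_left) simp
  have "3 * e 3 = e 2 * p 0 - e 1 * p 1 + p 2" using n[of 2] e0 by (simp add: s)
  then have "3 * e 3 = 3 * (- (1904 + 15778 * x + 67228 * x ^ 2 + 117649 * x ^ 3))" unfolding 1 2 p by algebra
  then show 3: "e 3 = - (1904 + 15778 * x + 67228 * x ^ 2 + 117649 * x ^ 3)" by (rule cancel_left) simp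
  have "4 * e 4 = e 3 * p 0 - e 2 * p 1 + e 1 * p 2 - p 3" using n[of 3] e0 by (simp add: s)
  then have "4 * e 4 = 4 * (5915 + 93296 * x + 773122 * x ^ 2 + 3294172 * x ^ 3 + 5764801 * x ^ 4)" unfolding 1 2 3 p by algebra
  then show 4: "e 4 = 5915 + 93296 * x + 773122 * x ^ 2 + 3294172 * x ^ 3 + 5764801 * x ^ 4" by (rule cancel_left) simp
  have "5 * e 5 = e 4 * p 0 - e 3 * p 1 + e 2 * p 2 - e 1 * p 3 + p 4" using n[of 4] e0 by (simp add: s)
  then have "5 * e 5 = 5 * (- (8624 + 289835 * x + 4571504 * x ^ 2 + 37882978 * x ^ 3 + 161414428 * x ^ 4 + 282475249 * x ^ 5))" unfolding 1 2 3 4 p by algebra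
  then show 5: "e 5 = - (8624 + 289835 * x + 4571504 * x ^ 2 + 37882978 * x ^ 3 + 161414428 * x ^ 4 + 282475249 * x ^ 5)" by (rule cancel_left) simp
  have "6 * e 6 = e 5 * p 0 - e 4 * p 1 + e 3 * p 2 - e 2 * p 3 + e 1 * p 4 - p 5" using n[of 5] e0 by (simp add: s)
  then have "6 * e 6 = 6 * (4018 + 422576 * x + 14201915 * x ^ 2 + 224003696 * x ^ 3 + 1856265922 * x ^ 4 + 7909306972 * x ^ 5 + 13841287201 * x ^ 6)" unfolding 1 2 3 4 5 p by algebra
  then show 6: "e 6 = 4018 + 422576 * x + 14201915 * x ^ 2 + 224003696 * x ^ 3 + 1856265922 * x ^ 4 + 7909306972 * x ^ 5 + 13841287201 * x ^ 6" by (rule cancel_left) simp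
  have "7 * e 7 = e 6 * p 0 - e 5 * p 1 + e 4 * p 2 - e 3 * p 3 + e 2 * p 4 - e 1 * p 5 + p 6" using n[of 6] e0 by (simp add: s)
  then have "7 * (x * e 7) = x * (e 6 * p 0 - e 5 * p 1 + e 4 * p 2 - e 3 * p 3 + e 2 * p 4 - e 1 * p 5) + x * p 6" by algebra
  then have "7 * (x * e 7) = 7 * 1" unfolding 1 2 3 4 5 6 p by algebra
  then show "x * e 7 = 1" by simp
qed

text \<open>Each 1 / \<open>TT\<close> is a root of the polynomial formed from all seven.
  Multiplication by y^7 reverses this polynomial, and since its last coefficient is 1 / x up to
  sign, multiplication by x isolates y^7.\<close>

theorem modular_equation:
  assumes tau: "Im \<tau> > 0" and l: "l \<le> 6"
  defines "x \<equiv> TT \<tau>" and "y \<equiv> TT ((\<tau> + of_nat l) / 7)"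
  shows "y ^ 7 = (\<Sum>j=1..7. (\<Sum>k\<le>7 - j. of_int (mcoef j k) * x ^ Suc k) * y ^ (7 - j))"
proof -
  define w where "w = (\<lambda>l. 1 / TT ((\<tau> + of_nat l) / 7))"
  define p where "p = (\<lambda>i. \<Sum>m<7. w m ^ Suc i)"
  have x0: "x \<noteq> 0" using TT_nonzero[OF tau] by (simp add: x_def)
  have y0: "y \<noteq> 0" using TT_nonzero[OF Im_div_7[OF tau]] by (simp add: y_def)
  have P: "x * p i = 7 * pol (dense (snd (tabU0 ! Suc i))) x (mod_u \<tau>)" if "i < 7" for i
  proof -
    have f: "fst (tabU0 ! Suc i) = 1" using that by (auto simp: tabU0_def less_Suc_eq numeral_eq_Suc)
    have "7 * atkin_U7 (\<lambda>z. mod_u z ^ 0 / TT z ^ (0 + Suc i)) \<tau> = p i"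
      unfolding atkin_U7_def p_def w_def by (simp add: power_divide atLeast0AtMost lessThan_Suc_atMost [symmetric] numeral_eq_Suc)
    then have "x * p i = 7 * (of_int 1 * TT \<tau> * atkin_U7 (\<lambda>z. mod_u z ^ 0 / TT z ^ (0 + Suc i)) \<tau>)" unfolding x_def by (metis mult.left_commute mult_1 of_int_1)
    moreover have "of_int 1 * TT \<tau> * atkin_U7 (\<lambda>z. mod_u z ^ 0 / TT z ^ (0 + Suc i)) \<tau> = pol (dense (snd (tabU0 ! Suc i))) x (mod_u \<tau>)"
      using U7_tables(1)[OF tau, of "Suc i"] that unfolding f x_def by simp
    ultimately show ?thesis by (simp only:)
  qed
  have P': "p i = 7 * q" if "i < 7" "pol (dense (snd (tabU0 ! Suc i))) x (mod_u \<tau>) = x * q" for i q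
    using P[OF that(1)] x0 unfolding that(2) by simp
  have pp: "p 0 = 7 * (- 4 - 7 * x)" "p 1 = 7 * (20 - 343 * x ^ 2)" "p 2 = 7 * (- 88 - 16807 * x ^ 3)" "p 3 = 7 * (260 - 823543 * x ^ 4)"
      "p 4 = 7 * (476 - 40353607 * x ^ 5)" "p 5 = 7 * (- 16744 - 1977326743 * x ^ 6)"
    by (rule P'; simp add: tabU0_def dense_def mons_def upt_rec pol_def, algebra?)+
  have q6: "pol (dense (snd (tabU0 ! Suc 6))) x (mod_u \<tau>) = 1 + 184632 * x + 196882 * x ^ 2 + 20706224 * x ^ 3 + 695893835 * x ^ 4 + 10976181104 * x ^ 5 + 90957030178 * x ^ 6 + 387556041628 * x ^ 7 + 581334062442 * x ^ 8"
    by (simp add: tabU0_def dense_def mons_def upt_rec pol_def) algebra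
  have p6: "x * p 6 = 7 * (1 + 184632 * x + 196882 * x ^ 2 + 20706224 * x ^ 3 + 695893835 * x ^ 4 + 10976181104 * x ^ 5 + 90957030178 * x ^ 6 + 387556041628 * x ^ 7 + 581334062442 * x ^ 8)"
    using P[of 6] unfolding q6 by simp
  define e where "e = esym w 7"
  have nw: "of_nat (Suc k) * e (Suc k) = (\<Sum>i\<le>k. (- 1) ^ i * e (k - i) * p i)" for k
    unfolding e_def p_def by (rule newton_identity)
  have e0: "e 0 = 1" by (simp add: e_def)
  have pq: "p 0 = - 28 - 49 * x" "p 1 = 140 - 2401 * x ^ 2" "p 2 = - 616 - 117649 * x ^ 3" "p 3 = 1820 - 5764801 * x ^ 4"
      "p 4 = 3332 - 282475249 * x ^ 5" "p 5 = - 117208 - 13841287201 * x ^ 6"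
    unfolding pp by simp_all
  have E: "e 1 = - (28 + 49 * x)" "e 2 = 322 + 1372 * x + 2401 * x ^ 2" "e 3 = - (1904 + 15778 * x + 67228 * x ^ 2 + 117649 * x ^ 3)"
    "e 4 = 5915 + 93296 * x + 773122 * x ^ 2 + 3294172 * x ^ 3 + 5764801 * x ^ 4"
    "e 5 = - (8624 + 289835 * x + 4571504 * x ^ 2 + 37882978 * x ^ 3 + 161414428 * x ^ 4 + 282475249 * x ^ 5)"
    "e 6 = 4018 + 422576 * x + 14201915 * x ^ 2 + 224003696 * x ^ 3 + 1856265922 * x ^ 4 + 7909306972 * x ^ 5 + 13841287201 * x ^ 6"
    "x * e 7 = 1"
    using power_sums_to_esym[OF nw e0 pq p6] .
  have "(\<Prod>m<7. w l - w m) = 0" using l by (intro prod_zero) auto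
  then have r: "(\<Sum>k\<le>7. (- 1) ^ k * e k * w l ^ (7 - k)) = 0" unfolding prod_esym e_def .
  have wy: "y * w l = 1" using y0 by (simp add: w_def y_def)
  have c: "y ^ 7 * w l ^ (7 - k) = y ^ k" if k: "k \<le> 7" for k
  proof -
    have "y ^ 7 = y ^ k * y ^ (7 - k)" unfolding power_add [symmetric] using k by simp
    then have "y ^ 7 * w l ^ (7 - k) = y ^ k * (y * w l) ^ (7 - k)" by (simp only: power_mult_distrib mult.assoc)
    then show ?thesis unfolding wy by simp
  qed
  have "(\<Sum>k\<le>7. (- 1) ^ k * e k * y ^ k) = y ^ 7 * (\<Sum>k\<le>7. (- 1) ^ k * e k * w l ^ (7 - k))"
    unfolding sum_distrib_left by (intro sum.cong refl) (use c in \<open>simp add: mult.left_commute\<close>)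
  then have "(\<Sum>k\<le>7. (- 1) ^ k * e k * y ^ k) = 0" unfolding r by simp
  moreover have "{..7} = {0, 1, 2, 3, 4, 5, 6, 7::nat}" by auto
  ultimately have "1 - e 1 * y + e 2 * y ^ 2 - e 3 * y ^ 3 + e 4 * y ^ 4 - e 5 * y ^ 5 + e 6 * y ^ 6 - e 7 * y ^ 7 = 0"
    using e0 by (simp add: algebra_simps)
  then have "y ^ 7 = x * (1 - e 1 * y + e 2 * y ^ 2 - e 3 * y ^ 3 + e 4 * y ^ 4 - e 5 * y ^ 5 + e 6 * y ^ 6)"
    using E(7) by algebra
  also have "\<dots> = (\<Sum>j=1..7. (\<Sum>k\<le>7 - j. of_int (mcoef j k) * x ^ Suc k) * y ^ (7 - j))"
  proof -
    have 7: "{1..7} = {1, 2, 3, 4, 5, 6, 7::nat}" by auto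
    have m: "{..6} = {0, 1, 2, 3, 4, 5, 6::nat}" "{..5} = {0, 1, 2, 3, 4, 5::nat}" "{..4} = {0, 1, 2, 3, 4::nat}"
      "{..3} = {0, 1, 2, 3::nat}" "{..2} = {0, 1, 2::nat}" "{..1} = {0, 1::nat}" by auto
    show ?thesis unfolding E(1-6) 7 by (simp add: m mcoef_def) algebra
  qed
  finally show ?thesis .
qed

text \<open>The modular equation, multiplied by a power of \<open>TT z\<close>, has coefficients
  that depend on \<tau> only and leave the operator. The exponent is an integer because the initial
  values lie at negative \<open>a\<close>.\<close>

theorem atkin_U7_recurrence:
  assumes tau: "Im \<tau> > 0"
  shows "atkin_U7 (\<lambda>z. g z * TT z powi a) \<tau> =
    (\<Sum>j=1..7. (\<Sum>k\<le>7 - j. of_int (mcoef j k) * TT \<tau> ^ Suc k) * atkin_U7 (\<lambda>z. g z * TT z powi (a - int j)) \<tau>)"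
proof -
  let ?s = "\<lambda>j. \<Sum>k\<le>7 - j. of_int (mcoef j k) * TT \<tau> ^ Suc k"
  have "g z * TT z powi a = (\<Sum>j=1..7. ?s j * (g z * TT z powi (a - int j)))" if z: "z = (\<tau> + of_nat l) / 7" and l: "l \<le> 6" for z l
  proof -
    have T: "TT z \<noteq> 0" unfolding z by (rule TT_nonzero[OF Im_div_7[OF tau]])
    have "TT z powi a = TT z powi (a - 7) * TT z ^ 7" using T by (simp add: power_int_diff)
    also have "\<dots> = (\<Sum>j=1..7. ?s j * (TT z powi (a - 7) * TT z ^ (7 - j)))"
      unfolding modular_equation[OF tau l, folded z] sum_distrib_left by (intro sum.cong) auto
    also have "\<dots> = (\<Sum>j=1..7. ?s j * TT z powi (a - int j))"
    proof (intro sum.cong refl)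
      fix j :: nat assume "j \<in> {1..7}"
      then have "TT z powi (a - int j) = TT z powi (a - 7 + int (7 - j))" by (simp add: of_nat_diff)
      then show "?s j * (TT z powi (a - 7) * TT z ^ (7 - j)) = ?s j * TT z powi (a - int j)"
        by (simp only: power_int_add[OF disjI1[OF T]] power_int_of_nat)
    qed
    finally show ?thesis unfolding sum_distrib_left by (simp add: sum_distrib_left mult_ac)
  qed
  then have "(\<Sum>l=0..6. g ((\<tau> + of_nat l) / 7) * TT ((\<tau> + of_nat l) / 7) powi a)
    = (\<Sum>l=0..(6::nat). \<Sum>j=1..7. ?s j * (g ((\<tau> + of_nat l) / 7) * TT ((\<tau> + of_nat l) / 7) powi (a - int j)))"
    by (intro sum.cong) auto
  also have "\<dots> = (\<Sum>j=1..7. \<Sum>l=0..(6::nat). ?s j * (g ((\<tau> + of_nat l) / 7) * TT ((\<tau> + of_nat l) / 7) powi (a - int j)))"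
    by (rule sum.swap)
  also have "\<dots> = 7 * (\<Sum>j=1..7. ?s j * atkin_U7 (\<lambda>z. g z * TT z powi (a - int j)) \<tau>)"
    unfolding atkin_U7_def sum_distrib_left by (simp add: mult_ac)
  finally show ?thesis unfolding atkin_U7_def[of "\<lambda>z. g z * TT z powi a"] by simp
qed

section \<open>Divisibility by powers of 7\<close>

text \<open>Finite sums of monomials whose exponents of \<open>TT\<close>, \<open>mod_u\<close> and
  7 satisfy \<open>P\<close>. As an inductive predicate it allows sums, products and Atkin images to
  be treated term by term without naming coefficients; the denominators 4^n are those of the
  tables.\<close>

inductive Sp :: "(nat \<Rightarrow> nat \<Rightarrow> nat \<Rightarrow> bool) \<Rightarrow> (complex \<Rightarrow> complex) \<Rightarrow> bool" for P where
  Sp_zero: "(\<And>\<tau>. Im \<tau> > 0 \<Longrightarrow> f \<tau> = 0) \<Longrightarrow> Sp P f"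
| Sp_step: "Sp P g \<Longrightarrow> P i l e \<Longrightarrow> (\<And>\<tau>. Im \<tau> > 0 \<Longrightarrow> f \<tau> = g \<tau> + 7 ^ e * of_int k / 4 ^ n * (TT \<tau> ^ i * mod_u \<tau> ^ l)) \<Longrightarrow> Sp P f"

lemma Sp_cong:
  assumes "Sp P f" "\<And>\<tau>. Im \<tau> > 0 \<Longrightarrow> g \<tau> = f \<tau>"
  shows "Sp P g"
  using assms(1)
proof cases
  case Sp_zero
  then show ?thesis using assms(2) by (auto intro: Sp.Sp_zero)
next
  case (Sp_step g' i l e k n)
  show ?thesis by (rule Sp.Sp_step[OF Sp_step(1,2), of _ k n]) (use Sp_step(3) assms(2) in auto)
qed

lemma Sp_mono:
  assumes "Sp P f" "\<And>i l e. P i l e \<Longrightarrow> Q i l e"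
  shows "Sp Q f"
  using assms(1)
proof induction
  case (Sp_step g i l e f k n)
  show ?case by (rule Sp.Sp_step[OF Sp_step.IH assms(2)[OF Sp_step.hyps(2)]]) (rule Sp_step.hyps(3))
qed (rule Sp_zero)

lemma Sp_add:
  assumes "Sp P f" "Sp P g"
  shows "Sp P (\<lambda>\<tau>. f \<tau> + g \<tau>)"
  using assms(1)
proof induction
  case (Sp_zero f)
  then show ?case using assms(2) by (auto intro: Sp_cong)
next
  case (Sp_step g' i l e f k n)
  show ?case by (rule Sp.Sp_step[OF Sp_step.IH Sp_step.hyps(2), of _ k n]) (use Sp_step.hyps(3) in auto)
qed

lemma Sp_sum:
  assumes "\<And>j. j \<in> A \<Longrightarrow> Sp P (F j)"
  shows "Sp P (\<lambda>\<tau>. \<Sum>j\<in>A. F j \<tau>)"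
proof (cases "finite A")
  case True
  from this assms show ?thesis
  proof (induction A)
    case (insert a A)
    have "Sp P (\<lambda>\<tau>. F a \<tau> + (\<Sum>j\<in>A. F j \<tau>))" by (intro Sp_add) (use insert in auto)
    then show ?case using insert by simp
  qed (auto intro: Sp_zero)
qed (auto intro: Sp_zero)

lemma Sp_monom_mult:
  assumes "Sp P f" "\<And>i l e. P i l e \<Longrightarrow> Q (i + i0) (l + l0) (e + e0)"
  shows "Sp Q (\<lambda>\<tau>. 7 ^ e0 * of_int k0 / 4 ^ n0 * (TT \<tau> ^ i0 * mod_u \<tau> ^ l0) * f \<tau>)"
  using assms(1)
proof induction
  case (Sp_zero f)
  then show ?case by (auto intro: Sp.Sp_zero)
next
  case (Sp_step g i l e f k n)
  show ?case
    by (rule Sp.Sp_step[OF Sp_step.IH assms(2)[OF Sp_step.hyps(2)], of _ "k * k0" "n + n0"])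
      (simp add: Sp_step.hyps(3) power_add field_simps)
qed

lemma Sp_scale:
  assumes "Sp P f" "\<And>i l e. P i l e \<Longrightarrow> Q i l (e + e0)"
  shows "Sp Q (\<lambda>\<tau>. 7 ^ e0 * of_int k0 / 4 ^ n0 * f \<tau>)"
  using Sp_monom_mult[OF assms(1), of Q 0 0 e0 k0 n0] assms(2) by simp

lemma Sp_divide_TT:
  assumes "Sp P f" "\<And>i l e. P i l e \<Longrightarrow> i \<ge> 1 \<and> Q (i - 1) l e"
  shows "Sp Q (\<lambda>\<tau>. f \<tau> / TT \<tau>)"
  using assms(1)
proof induction
  case (Sp_zero f)
  then show ?case by (auto intro: Sp.Sp_zero)
next
  case (Sp_step g i l e f k n)
  obtain j where j: "i = Suc j" using assms(2)[OF Sp_step.hyps(2)] by (cases i) auto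
  show ?case
    by (rule Sp.Sp_step[OF Sp_step.IH conjunct2[OF assms(2)[OF Sp_step.hyps(2)]], of _ k n])
      (use TT_nonzero in \<open>simp add: Sp_step.hyps(3) j add_divide_distrib\<close>)
qed

lemma Sp_pol:
  assumes "\<And>i l c. (i, l, c) \<in> set tab \<Longrightarrow> c = 0 \<or> (\<exists>e. 7 ^ e dvd c \<and> P i l e)"
  shows "Sp P (\<lambda>\<tau>. pol tab (TT \<tau>) (mod_u \<tau>) / 4 ^ n)"
  using assms
proof (induction tab)
  case (Cons t tab)
  obtain i l c where t: "t = (i, l, c)" by (cases t)
  have IH: "Sp P (\<lambda>\<tau>. pol tab (TT \<tau>) (mod_u \<tau>) / 4 ^ n)" by (rule Cons.IH) (use Cons.prems in auto)
  have p: "pol (t # tab) x y = of_int c * x ^ i * y ^ l + pol tab x y" for x y by (simp add: pol_def t)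
  show ?case
  proof (cases "c = 0")
    case True
    then show ?thesis using IH unfolding p by simp
  next
    case False
    then obtain e k where e: "c = 7 ^ e * k" "P i l e" using Cons.prems[of i l c] t by (auto elim!: dvdE)
    show ?thesis by (rule Sp_step[OF IH e(2), of _ k n]) (simp add: p e(1) add_divide_distrib)
  qed
qed (auto intro: Sp_zero simp: pol_def)

text \<open>\<open>R i l\<close> describes the image of a single monomial and \<open>Q\<close>
  combines it with the power of 7 already present. The multiplier \<open>h\<close> will be 1 or
  \<open>mod_A\<close>.\<close>

lemma Sp_atkin_U7:
  assumes "Sp P f" and R: "\<And>i l e. P i l e \<Longrightarrow> Sp (R i l) (atkin_U7 (\<lambda>z. h z * (TT z ^ i * mod_u z ^ l)))"
    and Q: "\<And>i l e i' l' e'. P i l e \<Longrightarrow> R i l i' l' e' \<Longrightarrow> Q i' l' (e' + e)"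
  shows "Sp Q (atkin_U7 (\<lambda>z. h z * f z))"
  using assms(1)
proof induction
  case (Sp_zero f)
  then show ?case by (auto intro!: Sp.Sp_zero simp: atkin_U7_def)
next
  case (Sp_step g i l e f k n)
  have "Sp Q (\<lambda>\<tau>. 7 ^ e * of_int k / 4 ^ n * atkin_U7 (\<lambda>z. h z * (TT z ^ i * mod_u z ^ l)) \<tau>)"
    by (rule Sp_scale[OF R[OF Sp_step.hyps(2)]]) (rule Q[OF Sp_step.hyps(2)])
  from Sp_add[OF Sp_step.IH this] show ?case
  proof (rule Sp_cong)
    fix \<tau> :: complex assume "Im \<tau> > 0"
    then have "h ((\<tau> + of_nat m) / 7) * f ((\<tau> + of_nat m) / 7) = h ((\<tau> + of_nat m) / 7) * g ((\<tau> + of_nat m) / 7) +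
        7 ^ e * of_int k / 4 ^ n * (h ((\<tau> + of_nat m) / 7) * (TT ((\<tau> + of_nat m) / 7) ^ i * mod_u ((\<tau> + of_nat m) / 7) ^ l))" for m
      using Sp_step.hyps(3)[of "(\<tau> + of_nat m) / 7"] by (simp add: algebra_simps)
    then show "atkin_U7 (\<lambda>z. h z * f z) \<tau> = atkin_U7 (\<lambda>z. h z * g z) \<tau> + 7 ^ e * of_int k / 4 ^ n * atkin_U7 (\<lambda>z. h z * (TT z ^ i * mod_u z ^ l)) \<tau>"
      unfolding atkin_U7_def by (simp add: sum.distrib sum_distrib_left algebra_simps)
  qed
qed

text \<open>
  Here \<open>a\<close> and \<open>b\<close> are the exponents of \<open>TT\<close> and \<open>mod_u\<close> before the Atkin operator is applied. The linear bound on
  \<open>e\<close> is the one that the modular equation propagates: each of its coefficients \<open>mcoef j k\<close> has valuation at least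
  \<open>(7 * (k + 1) - j) / 4\<close>. The flag \<open>sp\<close> marks the exceptional exponents for which one extra factor 7 is needed later.
\<close>

definition RR :: "int \<Rightarrow> int \<Rightarrow> int \<Rightarrow> (nat \<Rightarrow> nat) \<Rightarrow> bool \<Rightarrow> int \<Rightarrow> int \<Rightarrow> nat \<Rightarrow> nat \<Rightarrow> nat \<Rightarrow> bool" where
  "RR d s c low sp a b i l e \<longleftrightarrow> l \<le> 2 \<and> int (i + l) \<le> d + max (7 * (a + b) + s) (- a) \<and>
     7 * int (i + l) \<le> 4 * int e + a + b + c \<and> low l \<le> i \<and> (sp \<longrightarrow> 1 \<le> e)"

text \<open>The ceiling of (7 (k + 1) - j)/4, raised to at least 1 except at j = 7, k = 0, where the
  coefficient is 1. Only along that entry can the recurrence fail to contribute a factor 7.\<close>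

definition mval :: "nat \<Rightarrow> nat \<Rightarrow> nat" where
  "mval j k = max ((7 * (k + 1) + 3 - j) div 4) (if j = 7 \<and> k = 0 then 0 else 1)"

lemma mcoef_val_check: "list_all (\<lambda>j. list_all (\<lambda>k. 7 ^ mval j k dvd mcoef j k) [0..<8 - j]) [1..<8]"
  by code_simp

lemma mcoef_dvd: "j \<in> {1..7} \<Longrightarrow> k \<le> 7 - j \<Longrightarrow> 7 ^ mval j k dvd mcoef j k"
  using mcoef_val_check by (auto simp: list_all_iff)

lemma mval_bounds:
  assumes "j \<in> {1..7}" "k \<le> 7 - j"
  shows "7 * (int k + 1) \<le> 4 * int (mval j k) + int j" "mval j k = 0 \<Longrightarrow> j = 7"
proof -
  have *: "7 * (k + 1) \<le> 4 * v + j" if "x + j = 7 * k + 10" "x < 4 * y + 4" "y \<le> v" for x y v :: nat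
    using that by presburger
  have "7 * (k + 1) \<le> 4 * mval j k + j"
  proof (rule *)
    show "(7 * (k + 1) + 3 - j) + j = 7 * k + 10" using assms by auto
    show "7 * (k + 1) + 3 - j < 4 * ((7 * (k + 1) + 3 - j) div 4) + 4" by presburger
    show "(7 * (k + 1) + 3 - j) div 4 \<le> mval j k" by (simp add: mval_def)
  qed
  then have "int (7 * (k + 1)) \<le> int (4 * mval j k + j)" by (simp only: zle_int)
  then show "7 * (int k + 1) \<le> 4 * int (mval j k) + int j" by simp
  show "mval j k = 0 \<Longrightarrow> j = 7" by (auto simp: mval_def split: if_splits)
qed

text \<open>Multiplication by a term of the modular equation raises the degree by k + 1, the
  valuation by at least (7 (k + 1) - j)/4 and \<open>a\<close> by j, which preserves the linear
  bound. The flag needs inheritance from \<open>a - 7\<close> only, by \<open>mval_bounds\<close>.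
  Each use of the recurrence brings a factor \<open>TT\<close>, hence
  \<open>Suc (low l)\<close>.\<close>

lemma recurrence_span:
  fixes G :: "int \<Rightarrow> complex \<Rightarrow> complex"
  assumes G: "\<And>a \<tau>. Im \<tau> > 0 \<Longrightarrow> G a \<tau> = (\<Sum>j=1..7. (\<Sum>k\<le>7 - j. of_int (mcoef j k) * TT \<tau> ^ Suc k) * G (a - int j) \<tau>)"
    and base: "\<And>a. a0 \<le> a \<Longrightarrow> a < a0 + 7 \<Longrightarrow> Sp (RR d s c low (sp a) a b) (G a)"
    and deg: "8 \<le> 8 * (a0 + 7) + 7 * b + s"
    and sp: "\<And>a. a0 + 7 \<le> a \<Longrightarrow> sp a \<Longrightarrow> sp (a - 7)"
    and a: "a0 + 7 \<le> a"
  shows "Sp (RR d s c (\<lambda>l. Suc (low l)) (sp a) a b) (G a)"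
proof -
  have step: "Sp (RR d s c (\<lambda>l. Suc (low l)) (sp a) a b) (G a)"
    if a: "a0 + 7 \<le> a" and IH: "\<And>j. j \<in> {1..7} \<Longrightarrow> Sp (RR d s c low (sp (a - int j)) (a - int j) b) (G (a - int j))" for a
  proof -
    have "Sp (RR d s c (\<lambda>l. Suc (low l)) (sp a) a b) (\<lambda>\<tau>. of_int (mcoef j k) * TT \<tau> ^ Suc k * G (a - int j) \<tau>)"
      if j: "j \<in> {1..7}" and k: "k \<le> 7 - j" for j k
    proof -
      obtain m where m: "mcoef j k = 7 ^ mval j k * m" using mcoef_dvd[OF j k] by (elim dvdE)
      have "Sp (RR d s c (\<lambda>l. Suc (low l)) (sp a) a b) (\<lambda>\<tau>. 7 ^ mval j k * of_int m / 4 ^ 0 * (TT \<tau> ^ Suc k * mod_u \<tau> ^ 0) * G (a - int j) \<tau>)"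
      proof (rule Sp_monom_mult[OF IH[OF j]])
        fix i l e assume R: "RR d s c low (sp (a - int j)) (a - int j) b i l e"
        note mv = mval_bounds[OF j k]
        have jk: "1 \<le> int j" "int j \<le> 7" "int k + int j \<le> 7" using j k by auto
        \<comment> \<open>In the second branch of the maximum j + k + 1 is at most 8, and
          \<open>deg\<close> makes -a + 8 at most 7 (a + b) + s; in the first branch the loss 7 j
          outweighs k + 1.\<close>
        have D: "max (7 * (a - int j + b) + s) (- (a - int j)) + int k + 1 \<le> max (7 * (a + b) + s) (- a)"
          using deg a jk by (simp add: max_def)
        have s1: "1 \<le> e + mval j k" if "sp a"
        proof (cases "mval j k = 0")
          case True
          then have "j = 7" using mv(2) by simp
          then have "sp (a - int j)" using sp[OF a that] by simp
          then show ?thesis using R by (simp add: RR_def)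
        qed simp
        show "RR d s c (\<lambda>l. Suc (low l)) (sp a) a b (i + Suc k) (l + 0) (e + mval j k)"
          using R D s1 mv(1) unfolding RR_def by auto
      qed
      then show ?thesis by (simp add: m mult_ac)
    qed
    then have "Sp (RR d s c (\<lambda>l. Suc (low l)) (sp a) a b) (\<lambda>\<tau>. \<Sum>j=1..7. \<Sum>k\<le>7 - j. of_int (mcoef j k) * TT \<tau> ^ Suc k * G (a - int j) \<tau>)"
      by (intro Sp_sum) auto
    then show ?thesis
    proof (rule Sp_cong)
      fix \<tau> :: complex assume "Im \<tau> > 0"
      from G[OF this, of a] show "G a \<tau> = (\<Sum>j=1..7. \<Sum>k\<le>7 - j. of_int (mcoef j k) * TT \<tau> ^ Suc k * G (a - int j) \<tau>)"
        by (simp only: sum_distrib_right)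
    qed
  qed
  have all: "Sp (RR d s c low (sp (a0 + int n)) (a0 + int n) b) (G (a0 + int n))" for n
  proof (induction n rule: less_induct)
    case (less n)
    show ?case
    proof (cases "n < 7")
      case True
      then show ?thesis by (intro base) auto
    next
      case False
      have "Sp (RR d s c low (sp (a0 + int n - int j)) (a0 + int n - int j) b) (G (a0 + int n - int j))" if "j \<in> {1..7}" for j
      proof -
        have e: "a0 + int n - int j = a0 + int (n - j)" and l: "n - j < n" using that False by auto
        show ?thesis unfolding e by (rule less.IH[OF l])
      qed
      then have "Sp (RR d s c (\<lambda>l. Suc (low l)) (sp (a0 + int n)) (a0 + int n) b) (G (a0 + int n))"
        using False by (intro step) auto
      then show ?thesis by (rule Sp_mono) (auto simp: RR_def)
    qed
  qed
  show ?thesis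
  proof (rule step[OF a])
    fix j :: nat assume "j \<in> {1..7}"
    then have e: "a - int j = a0 + int (nat (a - int j - a0))" using a by auto
    show "Sp (RR d s c low (sp (a - int j)) (a - int j) b) (G (a - int j))" by (subst (1 2 3) e) (rule all)
  qed
qed

text \<open>The least exponent of 7 that \<open>RR\<close> admits for this monomial: the linear
  bound rounded up and cut off at 0, or 1 if the flag demands it. Table entries are tested for
  divisibility at this exponent.\<close>

definition nd :: "int \<Rightarrow> bool \<Rightarrow> int \<Rightarrow> int \<Rightarrow> nat \<Rightarrow> nat \<Rightarrow> nat" where
  "nd c sp a b i l = max (nat ((7 * int (i + l) - a - b - c + 3) div 4)) (if sp then 1 else 0)"

fun tab_ok :: "int \<Rightarrow> int \<Rightarrow> int \<Rightarrow> (nat \<Rightarrow> nat) \<Rightarrow> (int \<Rightarrow> bool) \<Rightarrow> int \<Rightarrow> int \<Rightarrow> (int \<times> int list) list \<Rightarrow> bool" where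
  "tab_ok d s c low sp b a [] = True"
| "tab_ok d s c low sp b a ((N, cs) # ts) = ((N = 1 \<or> N = 4) \<and>
     list_all (\<lambda>(i, l, x). x = 0 \<or> (7 ^ nd c (sp a) a b i l dvd x \<and> RR d s c low (sp a) a b i l (nd c (sp a) a b i l))) (dense cs) \<and>
     tab_ok d s c low sp b (a - 1) ts)"

lemma tab_ok_Sp:
  assumes "tab_ok d s c low sp b a ts" "i < length ts"
    "\<And>\<tau>. Im \<tau> > 0 \<Longrightarrow> of_int (fst (ts ! i)) * f \<tau> = pol (dense (snd (ts ! i))) (TT \<tau>) (mod_u \<tau>)"
  shows "Sp (RR d s c low (sp (a - int i)) (a - int i) b) f"
proof -
  let ?P = "RR d s c low (sp (a - int i)) (a - int i) b"
  have "(fst (ts ! i) = 1 \<or> fst (ts ! i) = 4) \<and>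
      list_all (\<lambda>(k, l, x). x = 0 \<or> (\<exists>e. 7 ^ e dvd x \<and> ?P k l e)) (dense (snd (ts ! i)))"
    using assms(1,2)
  proof (induction ts arbitrary: a i)
    case (Cons t ts)
    obtain N cs where t: "t = (N, cs)" by (cases t)
    show ?case
    proof (cases i)
      case 0
      then show ?thesis using Cons.prems unfolding t by (auto simp: list_all_iff)
    next
      case (Suc j)
      then show ?thesis using Cons.IH[of "a - 1" j] Cons.prems unfolding t by (simp add: algebra_simps)
    qed
  qed simp
  then have N': "fst (ts ! i) = 1 \<or> fst (ts ! i) = 4" and l: "\<And>k l x. (k, l, x) \<in> set (dense (snd (ts ! i))) \<Longrightarrow> x = 0 \<or> (\<exists>e. 7 ^ e dvd x \<and> ?P k l e)"
    unfolding list_all_iff by fast+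
  from N' obtain n where N: "fst (ts ! i) = 4 ^ n" by (metis power_0 power_one_right)
  show ?thesis by (rule Sp_cong[OF Sp_pol[where n = n, OF l]]) (use assms(3) N in \<open>simp_all add: field_simps\<close>)
qed

definition lowU :: "nat \<Rightarrow> nat" where "lowU l = (if l = 0 then 1 else 0)"
definition lowA :: "nat \<Rightarrow> nat" where "lowA l = 0"

text \<open>The flagged exponents are those needed later, 1 and 2 for b = 0 and 1 for b = 1,
  together with the ones lower by 7 from which they inherit the factor.\<close>

lemma tab_ok_U:
  "tab_ok 1 0 17 lowU (\<lambda>a. a \<in> {- 6, - 5, 1, 2}) 0 0 (take 7 tabU0)"
  "tab_ok 1 0 17 lowU (\<lambda>a. a \<in> {- 6, 1}) 1 0 tabU1"
  "tab_ok 1 0 17 lowU (\<lambda>a. False) 2 (- 1) tabU2"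
  by code_simp+

text \<open>The case a = 0, b = 1 lies in the initial range, where the recurrence has not yet
  supplied the additional factor \<open>TT\<close>; the row itself is seen to contain it.\<close>

lemma tab_ok_U1_hd: "tab_ok 1 0 17 (\<lambda>l. Suc (lowU l)) (\<lambda>a. a \<in> {- 6, 1}) 1 0 (take 1 tabU1)"
  by code_simp

text \<open>The flagged exponent 0 with b = 0 stands for the image of \<open>mod_A\<close> alone,
  that is for \<open>L_seq 1\<close>; it inherits its factor 7 from the exponent -7.\<close>

lemma tab_ok_A:
  "tab_ok 0 8 16 lowA (\<lambda>a. a \<in> {- 7, 0}) 0 (- 1) tabA0"
  "tab_ok 0 8 16 lowA (\<lambda>a. False) 1 (- 1) tabA1"
  "tab_ok 0 8 16 lowA (\<lambda>a. False) 2 (- 2) tabA2"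
  by code_simp+

abbreviation VU :: "nat \<Rightarrow> int \<Rightarrow> complex \<Rightarrow> complex" where
  "VU b a \<tau> \<equiv> TT \<tau> * atkin_U7 (\<lambda>z. mod_u z ^ b * TT z powi a) \<tau>"

abbreviation VA :: "nat \<Rightarrow> int \<Rightarrow> complex \<Rightarrow> complex" where
  "VA b a \<equiv> atkin_U7 (\<lambda>z. (mod_A z * mod_u z ^ b) * TT z powi a)"

lemma VU_rec: "Im \<tau> > 0 \<Longrightarrow> VU b a \<tau> = (\<Sum>j=1..7. (\<Sum>k\<le>7 - j. of_int (mcoef j k) * TT \<tau> ^ Suc k) * VU b (a - int j) \<tau>)"
  by (subst atkin_U7_recurrence) (auto simp: sum_distrib_left mult_ac)

lemma powi_minus_nat: "g * x powi (- int m) = g / x ^ m" for x :: complex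
  by (simp add: power_int_minus divide_inverse)

lemma VU_base:
  assumes "tab_ok d s c low sp (int b) (- int m) ts" "i < length ts"
    "\<And>\<tau>. Im \<tau> > 0 \<Longrightarrow> of_int (fst (ts ! i)) * TT \<tau> * atkin_U7 (\<lambda>z. mod_u z ^ b / TT z ^ (m + i)) \<tau> = pol (dense (snd (ts ! i))) (TT \<tau>) (mod_u \<tau>)"
    "a = - int m - int i"
  shows "Sp (RR d s c low (sp a) a (int b)) (VU b a)"
proof -
  have a: "a = - int (m + i)" using assms(4) by simp
  have "Sp (RR d s c low (sp (- int m - int i)) (- int m - int i) (int b)) (VU b a)"
    by (rule tab_ok_Sp[OF assms(1,2)]) (use assms(3) in \<open>simp only: a powi_minus_nat mult.assoc\<close>)
  then show ?thesis using assms(4) by simp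
qed

lemma VA_base:
  assumes "tab_ok d s c low sp (int b) (- int m) ts" "i < length ts"
    "\<And>\<tau>. Im \<tau> > 0 \<Longrightarrow> of_int (fst (ts ! i)) * atkin_U7 (\<lambda>z. mod_A z * (mod_u z ^ b / TT z ^ (m + i))) \<tau> = pol (dense (snd (ts ! i))) (TT \<tau>) (mod_u \<tau>)"
    "a = - int m - int i"
  shows "Sp (RR d s c low (sp a) a (int b)) (VA b a)"
proof -
  have a: "a = - int (m + i)" using assms(4) by simp
  have "Sp (RR d s c low (sp (- int m - int i)) (- int m - int i) (int b)) (VA b a)"
    by (rule tab_ok_Sp[OF assms(1,2)]) (use assms(3) in \<open>simp only: a powi_minus_nat mult.assoc times_divide_eq_right\<close>)
  then show ?thesis using assms(4) by simp
qed

lemma VU_span: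
  assumes "b \<le> 2" "a + b \<ge> 1"
  shows "Sp (RR 1 0 17 (\<lambda>l. Suc (lowU l)) (a = 1 \<and> b \<le> 1 \<or> a = 2 \<and> b = 0) (int a) (int b)) (VU b (int a))"
proof -
  have "b = 0 \<or> b = 1 \<or> b = 2" using assms by auto
  then show ?thesis
  proof (elim disjE)
    assume b: "b = 0"
    have "Sp (RR 1 0 17 (\<lambda>l. Suc (lowU l)) (int a \<in> {- 6, - 5, 1, 2}) (int a) (int 0)) (VU 0 (int a))"
    proof (rule recurrence_span[of "VU 0" "- 6" 1 0 17 lowU "\<lambda>a. a \<in> {- 6, - 5, 1, 2}" "int 0" "int a"])
        show "\<And>a \<tau>. Im \<tau> > 0 \<Longrightarrow> VU 0 a \<tau> = (\<Sum>j=1..7. (\<Sum>k\<le>7 - j. of_int (mcoef j k) * TT \<tau> ^ Suc k) * VU 0 (a - int j) \<tau>)"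
          by (rule VU_rec)
      fix a :: int assume a: "- 6 \<le> a" "a < - 6 + 7"
      have n: "take 7 tabU0 ! nat (- a) = tabU0 ! nat (- a)" using a by simp
      show "Sp (RR 1 0 17 lowU (a \<in> {- 6, - 5, 1, 2}) a (int 0)) (VU 0 a)"
        by (rule VU_base[where m = 0 and i = "nat (- a)" and sp = "\<lambda>a. a \<in> {- 6, - 5, 1, 2}" and ts = "take 7 tabU0"])
          (use tab_ok_U(1) U7_tables(1)[of _ "nat (- a)"] a n in \<open>auto simp: length_tab\<close>)
    qed (use assms b in auto)
    then show ?thesis unfolding b by (rule Sp_mono) (auto simp: RR_def)
  next
    assume b: "b = 1"
    show ?thesis
    proof (cases "a = 0")
      case True
      have "Sp (RR 1 0 17 (\<lambda>l. Suc (lowU l)) (int a \<in> {- 6, 1}) (int a) (int 1)) (VU 1 (int a))"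
        by (rule VU_base[where m = 0 and i = 0 and sp = "\<lambda>a. a \<in> {- 6, 1}" and ts = "take 1 tabU1"])
          (use tab_ok_U1_hd U7_tables(2)[of _ 0] True in \<open>auto simp: length_tab\<close>)
      then show ?thesis unfolding b by (rule Sp_mono) (auto simp: RR_def True)
    next
      case False
      have "Sp (RR 1 0 17 (\<lambda>l. Suc (lowU l)) (int a \<in> {- 6, 1}) (int a) (int 1)) (VU 1 (int a))"
      proof (rule recurrence_span[of "VU 1" "- 6" 1 0 17 lowU "\<lambda>a. a \<in> {- 6, 1}" "int 1" "int a"])
        show "\<And>a \<tau>. Im \<tau> > 0 \<Longrightarrow> VU 1 a \<tau> = (\<Sum>j=1..7. (\<Sum>k\<le>7 - j. of_int (mcoef j k) * TT \<tau> ^ Suc k) * VU 1 (a - int j) \<tau>)"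
          by (rule VU_rec)
        fix a :: int assume a: "- 6 \<le> a" "a < - 6 + 7"
        show "Sp (RR 1 0 17 lowU (a \<in> {- 6, 1}) a (int 1)) (VU 1 a)"
          by (rule VU_base[where m = 0 and i = "nat (- a)" and sp = "\<lambda>a. a \<in> {- 6, 1}" and ts = tabU1])
            (use tab_ok_U(2) U7_tables(2)[of _ "nat (- a)"] a in \<open>auto simp: length_tab\<close>)
      qed (use False in auto)
      then show ?thesis unfolding b by (rule Sp_mono) (auto simp: RR_def)
    qed
  next
    assume b: "b = 2"
    have "Sp (RR 1 0 17 (\<lambda>l. Suc (lowU l)) False (int a) (int 2)) (VU 2 (int a))"
    proof (rule recurrence_span[of "VU 2" "- 7" 1 0 17 lowU "\<lambda>a. False" "int 2" "int a"])
        show "\<And>a \<tau>. Im \<tau> > 0 \<Longrightarrow> VU 2 a \<tau> = (\<Sum>j=1..7. (\<Sum>k\<le>7 - j. of_int (mcoef j k) * TT \<tau> ^ Suc k) * VU 2 (a - int j) \<tau>)"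
          by (rule VU_rec)
      fix a :: int assume a: "- 7 \<le> a" "a < - 7 + 7"
      show "Sp (RR 1 0 17 lowU False a (int 2)) (VU 2 a)"
        by (rule VU_base[where m = 1 and i = "nat (- a - 1)" and sp = "\<lambda>a. False" and ts = tabU2])
          (use tab_ok_U(3) U7_tables(3)[of _ "nat (- a - 1)"] a in \<open>auto simp: length_tab\<close>)
    qed auto
    then show ?thesis unfolding b by (rule Sp_mono) (auto simp: RR_def)
  qed
qed

lemma VA_span:
  assumes "b \<le> 2"
  shows "Sp (RR 0 8 16 (\<lambda>l. Suc (lowA l)) (a = 0 \<and> b = 0) (int a) (int b)) (VA b (int a))"
proof -
  have "b = 0 \<or> b = 1 \<or> b = 2" using assms by auto
  then show ?thesis
  proof (elim disjE)
    assume b: "b = 0"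
    have "Sp (RR 0 8 16 (\<lambda>l. Suc (lowA l)) (int a \<in> {- 7, 0}) (int a) (int 0)) (VA 0 (int a))"
    proof (rule recurrence_span[of "VA 0" "- 7" 0 8 16 lowA "\<lambda>a. a \<in> {- 7, 0}" "int 0" "int a"])
        show "\<And>a \<tau>. Im \<tau> > 0 \<Longrightarrow> VA 0 a \<tau> = (\<Sum>j=1..7. (\<Sum>k\<le>7 - j. of_int (mcoef j k) * TT \<tau> ^ Suc k) * VA 0 (a - int j) \<tau>)"
          by (rule atkin_U7_recurrence)
      fix a :: int assume a: "- 7 \<le> a" "a < - 7 + 7"
      show "Sp (RR 0 8 16 lowA (a \<in> {- 7, 0}) a (int 0)) (VA 0 a)"
        by (rule VA_base[where m = 1 and i = "nat (- a - 1)" and sp = "\<lambda>a. a \<in> {- 7, 0}" and ts = tabA0])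
          (use tab_ok_A(1) U7_tables(4)[of _ "nat (- a - 1)"] a in \<open>auto simp: length_tab\<close>)
    qed auto
    then show ?thesis unfolding b by (rule Sp_mono) (auto simp: RR_def)
  next
    assume b: "b = 1"
    have "Sp (RR 0 8 16 (\<lambda>l. Suc (lowA l)) False (int a) (int 1)) (VA 1 (int a))"
    proof (rule recurrence_span[of "VA 1" "- 7" 0 8 16 lowA "\<lambda>a. False" "int 1" "int a"])
        show "\<And>a \<tau>. Im \<tau> > 0 \<Longrightarrow> VA 1 a \<tau> = (\<Sum>j=1..7. (\<Sum>k\<le>7 - j. of_int (mcoef j k) * TT \<tau> ^ Suc k) * VA 1 (a - int j) \<tau>)"
          by (rule atkin_U7_recurrence)
      fix a :: int assume a: "- 7 \<le> a" "a < - 7 + 7"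
      show "Sp (RR 0 8 16 lowA False a (int 1)) (VA 1 a)"
        by (rule VA_base[where m = 1 and i = "nat (- a - 1)" and sp = "\<lambda>a. False" and ts = tabA1])
          (use tab_ok_A(2) U7_tables(5)[of _ "nat (- a - 1)"] a in \<open>auto simp: length_tab\<close>)
    qed auto
    then show ?thesis unfolding b by (rule Sp_mono) (auto simp: RR_def)
  next
    assume b: "b = 2"
    have "Sp (RR 0 8 16 (\<lambda>l. Suc (lowA l)) False (int a) (int 2)) (VA 2 (int a))"
    proof (rule recurrence_span[of "VA 2" "- 8" 0 8 16 lowA "\<lambda>a. False" "int 2" "int a"])
        show "\<And>a \<tau>. Im \<tau> > 0 \<Longrightarrow> VA 2 a \<tau> = (\<Sum>j=1..7. (\<Sum>k\<le>7 - j. of_int (mcoef j k) * TT \<tau> ^ Suc k) * VA 2 (a - int j) \<tau>)"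
          by (rule atkin_U7_recurrence)
      fix a :: int assume a: "- 8 \<le> a" "a < - 8 + 7"
      show "Sp (RR 0 8 16 lowA False a (int 2)) (VA 2 a)"
        by (rule VA_base[where m = 2 and i = "nat (- a - 2)" and sp = "\<lambda>a. False" and ts = tabA2])
          (use tab_ok_A(3) U7_tables(6)[of _ "nat (- a - 2)"] a in \<open>auto simp: length_tab\<close>)
    qed auto
    then show ?thesis unfolding b by (rule Sp_mono) (auto simp: RR_def)
  qed
qed

text \<open>The bound for \<open>VU\<close> after division by \<open>TT\<close>, with 10 = 17 - 7.
  The flag covers \<open>TT\<close>, \<open>TT mod_u\<close> and \<open>TT^2\<close>, which are u t,
  u^2 t and u^2 t^2: exactly the terms that have only 7^\<alpha> at odd index.\<close>

definition RU :: "nat \<Rightarrow> nat \<Rightarrow> nat \<Rightarrow> nat \<Rightarrow> nat \<Rightarrow> bool" where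
  "RU a b i l e \<longleftrightarrow> l \<le> 2 \<and> 1 \<le> i + l \<and> i + l \<le> 7 * (a + b) \<and> 7 * (i + l) \<le> 4 * e + a + b + 10 \<and>
     (a = 1 \<and> b \<le> 1 \<or> a = 2 \<and> b = 0 \<longrightarrow> 1 \<le> e)"

text \<open>The condition \<open>1 \<le> i\<close> settles the clause of \<open>PO\<close> on
  \<open>i = 0\<close> after each odd step; pure powers of \<open>mod_u\<close> of higher exponent
  appear only when the cubic is applied.\<close>

definition RA :: "nat \<Rightarrow> nat \<Rightarrow> nat \<Rightarrow> nat \<Rightarrow> nat \<Rightarrow> bool" where
  "RA a b i l e \<longleftrightarrow> l \<le> 2 \<and> 1 \<le> i \<and> i + l \<le> 7 * (a + b) + 8 \<and> 7 * (i + l) \<le> 4 * e + a + b + 16 \<and>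
     (a = 0 \<and> b = 0 \<longrightarrow> 1 \<le> e)"

lemma RU_span:
  assumes "b \<le> 2" "1 \<le> a + b"
  shows "Sp (RU a b) (atkin_U7 (\<lambda>z. 1 * (TT z ^ a * mod_u z ^ b)))"
proof -
  have "Sp (RU a b) (\<lambda>\<tau>. VU b (int a) \<tau> / TT \<tau>)"
    by (rule Sp_divide_TT[OF VU_span[OF assms]]) (auto simp: RR_def RU_def lowU_def split: if_splits)
  then show ?thesis by (rule Sp_cong) (use TT_nonzero in \<open>simp add: mult.commute\<close>)
qed

lemma RA_span:
  assumes "b \<le> 2"
  shows "Sp (RA a b) (atkin_U7 (\<lambda>z. mod_A z * (TT z ^ a * mod_u z ^ b)))"
proof -
  have "Sp (RA a b) (VA b (int a))"
    by (rule Sp_mono[OF VA_span[OF assms]]) (auto simp: RR_def RA_def)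
  then show ?thesis by (rule Sp_cong) (simp add: mult_ac)
qed

text \<open>
  In terms of \<open>d = i + l\<close> the bounds on \<open>e\<close> are those of the theorem, because \<open>TT = mod_u * mod_t\<close> turns
  \<open>u^d t^i\<close> into a monomial of degree \<open>d\<close> in \<open>TT\<close> and \<open>mod_u\<close>.
\<close>

definition PO :: "nat \<Rightarrow> nat \<Rightarrow> nat \<Rightarrow> nat \<Rightarrow> bool" where
  "PO \<alpha> i l e \<longleftrightarrow> 1 \<le> i + l \<and> 6 * (i + l) + 1 \<le> 7 ^ (2 * \<alpha>) \<and> \<alpha> \<le> e \<and> (i = 0 \<longrightarrow> \<alpha> + 1 \<le> e) \<and>
     (3 \<le> i + l \<longrightarrow> \<alpha> + 1 \<le> e \<and> 7 * (i + l) + 26 * (\<alpha> + 1) \<le> 26 * e + 24)"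

definition PE :: "nat \<Rightarrow> nat \<Rightarrow> nat \<Rightarrow> nat \<Rightarrow> bool" where
  "PE \<alpha> i l e \<longleftrightarrow> 1 \<le> i + l \<and> 6 * (i + l) + 7 \<le> 7 ^ (2 * \<alpha> + 1) \<and> \<alpha> + 1 \<le> e \<and>
     (3 \<le> i + l \<longrightarrow> 7 * (i + l) + 3 + 26 * (\<alpha> + 1) \<le> 26 * e)"

text \<open>For the degree, 6 * 7 d + 7 = 7 (6 d + 1). For the valuation the step guarantees e' >=
  (7 d' - d - 10)/4, and for d >= 3 the loss d/4 is covered by the 7 d / 26 already present. For d
  <= 2 the factor 7 to be gained is present if \<open>i = 0\<close> and comes from the flag of
  \<open>RU\<close> otherwise.\<close>

lemma PO_PE:
  assumes "PO \<alpha> i l e" "l \<le> 2" "RU i l i' l' e'"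
  shows "PE \<alpha> i' l' (e' + e)"
proof -
  define d d' where "d = i + l" and "d' = i' + l'"
  have R: "1 \<le> d'" "d' \<le> 7 * d" "7 * d' \<le> 4 * e' + d + 10"
    using assms(3) by (auto simp: RU_def d_def d'_def)
  have O: "6 * d + 1 \<le> 7 ^ (2 * \<alpha>)" "\<alpha> \<le> e" "i = 0 \<longrightarrow> \<alpha> + 1 \<le> e" "3 \<le> d \<longrightarrow> \<alpha> + 1 \<le> e \<and> 7 * d + 26 * (\<alpha> + 1) \<le> 26 * e + 24"
    using assms(1) by (auto simp: PO_def d_def)
  have deg: "6 * d' + 7 \<le> 7 ^ (2 * \<alpha> + 1)"
    using O(1) R(2) by simp
  have "\<alpha> + 1 \<le> e' + e \<and> (3 \<le> d' \<longrightarrow> 7 * d' + 3 + 26 * (\<alpha> + 1) \<le> 26 * (e' + e))"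
  proof (cases "3 \<le> d")
    case True
    then show ?thesis using O R by auto
  next
    case False
    show ?thesis
    proof (cases "i = 0")
      case True
      then show ?thesis using False O R by auto
    next
      case i: False
      have "i = 1 \<and> l \<le> 1 \<or> i = 2 \<and> l = 0" using False i by (auto simp: d_def)
      then have "1 \<le> e'" using assms(3) by (auto simp: RU_def)
      then show ?thesis using False O R by auto
    qed
  qed
  then show ?thesis using R(1) deg by (simp add: PE_def d'_def)
qed

text \<open>For the degree, 6 (7 d + 8) + 1 = 7 (6 d + 7). If d >= 3 then 7 * 3 + 3 = 24 > 0 already
  forces e >= \<alpha> + 2. If d <= 2, only images of degree at least 3 must gain a factor 7, and
  for them the linear bound gives e' >= 1.\<close>

lemma PE_PO:
  assumes "PE \<alpha> i l e" "RA i l i' l' e'"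
  shows "PO (Suc \<alpha>) i' l' (e' + e)"
proof -
  define d d' where "d = i + l" and "d' = i' + l'"
  have R: "1 \<le> i'" "d' \<le> 7 * d + 8" "7 * d' \<le> 4 * e' + d + 16"
    using assms(2) by (auto simp: RA_def d_def d'_def)
  have E: "6 * d + 7 \<le> 7 ^ (2 * \<alpha> + 1)" "\<alpha> + 1 \<le> e" "3 \<le> d \<longrightarrow> 7 * d + 3 + 26 * (\<alpha> + 1) \<le> 26 * e"
    using assms(1) by (auto simp: PE_def d_def)
  have deg: "6 * d' + 1 \<le> 7 ^ (2 * Suc \<alpha>)"
    using E(1) R(2) by simp
  have "3 \<le> d' \<longrightarrow> \<alpha> + 2 \<le> e' + e \<and> 7 * d' + 26 * (\<alpha> + 2) \<le> 26 * (e' + e) + 24"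
  proof (cases "3 \<le> d")
    case True
    then have "\<alpha> + 2 \<le> e" using E by auto
    then show ?thesis using True E R by auto
  next
    case False
    show ?thesis
    proof (cases "d' \<le> 3")
      case d': True
      show ?thesis
      proof
        assume "3 \<le> d'"
        then have "d' = 3" "1 \<le> e'" using d' R False by auto
        then show "\<alpha> + 2 \<le> e' + e \<and> 7 * d' + 26 * (\<alpha> + 2) \<le> 26 * (e' + e) + 24" using E by auto
      qed
    next
      case d': False
      then have "1 \<le> e'" using R False by auto
      then show ?thesis using d' False E R by auto
    qed
  qed
  then show ?thesis using R(1) E deg by (simp add: PO_def d'_def)
qed

lemma RA_PO: "RA 0 0 i l e \<Longrightarrow> PO 1 i l e"
proof -
  assume R: "RA 0 0 i l e"
  define d where "d = i + l"
  have d: "1 \<le> i" "d \<le> 8" "7 * d \<le> 4 * e + 16" "1 \<le> e" using R by (auto simp: RA_def d_def)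
  have "3 \<le> d \<longrightarrow> 2 \<le> e \<and> 7 * d + 52 \<le> 26 * e + 24"
  proof (cases "d \<le> 3")
    case True
    show ?thesis
    proof
      assume "3 \<le> d"
      then have "d = 3" "2 \<le> e" using d True by presburger+
      then show "2 \<le> e \<and> 7 * d + 52 \<le> 26 * e + 24" by simp
    qed
  qed (use d in auto)
  then show ?thesis using d by (simp add: PO_def d_def)
qed

section \<open>The induction along \<open>L_seq\<close>\<close>

lemma L_seq_odd: "L_seq (2 * \<alpha> + 1) = atkin_U7 (\<lambda>z. mod_A z * L_seq (2 * \<alpha>) z)"
  by simp

lemma L_seq_even: "L_seq (2 * \<alpha> + 2) = atkin_U7 (\<lambda>z. 1 * L_seq (2 * \<alpha> + 1) z)"
proof -
  have "L_seq (Suc (2 * \<alpha> + 1)) = atkin_U7 (L_seq (2 * \<alpha> + 1))" by (subst L_seq.simps(2)) simp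
  moreover have "2 * \<alpha> + 2 = Suc (2 * \<alpha> + 1)" by simp
  ultimately show ?thesis by (simp only: mult_1_left)
qed

lemma even_step:
  assumes "Sp (\<lambda>i l e. l \<le> 2 \<and> PO \<alpha> i l e) f"
  shows "Sp (\<lambda>i l e. l \<le> 2 \<and> PE \<alpha> i l e) (atkin_U7 (\<lambda>z. 1 * f z))"
proof (rule Sp_atkin_U7[OF assms, where R = RU])
  show "Sp (RU i l) (atkin_U7 (\<lambda>z. 1 * (TT z ^ i * mod_u z ^ l)))" if "l \<le> 2 \<and> PO \<alpha> i l e" for i l e
    using that by (intro RU_span) (auto simp: PO_def)
  show "l' \<le> 2 \<and> PE \<alpha> i' l' (e' + e)" if "l \<le> 2 \<and> PO \<alpha> i l e" "RU i l i' l' e'" for i l e i' l' e'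
    using that PO_PE[of \<alpha> i l e i' l' e'] by (auto simp: RU_def)
qed

lemma odd_step:
  assumes "Sp (\<lambda>i l e. l \<le> 2 \<and> PE \<alpha> i l e) f"
  shows "Sp (\<lambda>i l e. l \<le> 2 \<and> PO (Suc \<alpha>) i l e) (atkin_U7 (\<lambda>z. mod_A z * f z))"
proof (rule Sp_atkin_U7[OF assms, where R = RA])
  show "Sp (RA i l) (atkin_U7 (\<lambda>z. mod_A z * (TT z ^ i * mod_u z ^ l)))" if "l \<le> 2 \<and> PE \<alpha> i l e" for i l e
    using that by (intro RA_span) auto
  show "l' \<le> 2 \<and> PO (Suc \<alpha>) i' l' (e' + e)" if "l \<le> 2 \<and> PE \<alpha> i l e" "RA i l i' l' e'" for i l e i' l' e'
    using that PE_PO[of \<alpha> i l e i' l' e'] by (auto simp: RA_def)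
qed

lemma L_seq_span:
  "Sp (\<lambda>i l e. l \<le> 2 \<and> PO (Suc \<alpha>) i l e) (L_seq (2 * \<alpha> + 1)) \<and> Sp (\<lambda>i l e. l \<le> 2 \<and> PE (Suc \<alpha>) i l e) (L_seq (2 * \<alpha> + 2))"
proof (induction \<alpha>)
  case 0
  \<comment> \<open>The constant \<open>L_seq 0\<close> is the monomial with both exponents
    0.\<close>
  have "Sp (RA 0 0) (atkin_U7 (\<lambda>z. mod_A z * (TT z ^ 0 * mod_u z ^ 0)))" by (rule RA_span) simp
  then have "Sp (\<lambda>i l e. l \<le> 2 \<and> PO 1 i l e) (atkin_U7 (\<lambda>z. mod_A z * (TT z ^ 0 * mod_u z ^ 0)))"
    by (rule Sp_mono) (use RA_PO in \<open>auto simp: RA_def\<close>)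
  then have 1: "Sp (\<lambda>i l e. l \<le> 2 \<and> PO (Suc 0) i l e) (L_seq (2 * 0 + 1))" by simp
  show ?case using 1 even_step[OF 1] unfolding L_seq_even by blast
next
  case (Suc \<alpha>)
  have 1: "Sp (\<lambda>i l e. l \<le> 2 \<and> PO (Suc (Suc \<alpha>)) i l e) (L_seq (2 * Suc \<alpha> + 1))"
    unfolding L_seq_odd using odd_step[OF conjunct2[OF Suc]] by simp
  show ?case using 1 even_step[OF 1] unfolding L_seq_even by blast
qed

section \<open>Passing to exponents of \<open>TT\<close> at most 2\<close>

lemma Sp_monom:
  assumes "P i l e"
  shows "Sp P (\<lambda>\<tau>. 7 ^ e * of_int k / 4 ^ n * (TT \<tau> ^ i * mod_u \<tau> ^ l))"
  by (rule Sp_step[where P = P and g = "\<lambda>_. 0" and k = k and n = n, OF _ assms]) (auto intro: Sp_zero)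

text \<open>Replacing \<open>TT^3\<close> lowers the exponent of \<open>TT\<close>. The six
  monomials on the right of the cubic have degree between 1 and 3 and integral coefficients, so
  neither the total degree nor the denominator grows. The exponent of 7 stays the same, hence the
  monotonicity asked of \<open>Q\<close>.\<close>

lemma Sp_cubic_monom:
  assumes Q: "\<And>i l i' l' e. Q i l e \<Longrightarrow> 3 \<le> i \<Longrightarrow> 1 \<le> i' + l' \<Longrightarrow> i' + l' \<le> i + l \<Longrightarrow> Q i' l' e"
    and "Q i l e"
  shows "Sp (\<lambda>i l e. i \<le> 2 \<and> Q i l e) (\<lambda>\<tau>. 7 ^ e * of_int k / 4 ^ n * (TT \<tau> ^ i * mod_u \<tau> ^ l))"
  using assms(2)
proof (induction i arbitrary: l k rule: less_induct)
  case (less i)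
  show ?case
  proof (cases "i \<le> 2")
    case True
    then show ?thesis using less.prems by (intro Sp_monom) auto
  next
    case False
    then obtain j where j: "i = Suc (Suc (Suc j))" by (metis not_less_eq_eq numeral_2_eq_2 Suc_le_D)
    let ?m = "\<lambda>x a b \<tau>. 7 ^ e * of_int (x * k) / 4 ^ n * (TT \<tau> ^ a * mod_u \<tau> ^ b)"
    have S: "Sp (\<lambda>i l e. i \<le> 2 \<and> Q i l e) (?m x a b)" if "a < i" "a + b \<le> i + l" "1 \<le> a + b" for x a b
      by (rule less.IH[OF that(1) Q[OF less.prems _ that(3,2)]]) (simp add: j)
    have "Sp (\<lambda>i l e. i \<le> 2 \<and> Q i l e) (\<lambda>\<tau>. ?m 1 j (l + 1) \<tau> + (?m 9 (j + 1) (l + 1) \<tau> + (?m (- 16) j (l + 2) \<tau> +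
        (?m 17 (j + 2) (l + 1) \<tau> + (?m (- 80) (j + 1) (l + 2) \<tau> + ?m 64 j (l + 3) \<tau>)))))"
      by (intro Sp_add S) (auto simp: j)
    then show ?thesis
    proof (rule Sp_cong)
      fix \<tau> :: complex assume t: "Im \<tau> > 0"
      have "TT \<tau> ^ i = TT \<tau> ^ j * TT \<tau> ^ 3" by (simp add: j power3_eq_cube mult_ac)
      then have e: "TT \<tau> ^ i = TT \<tau> ^ j * (mod_u \<tau> + 9 * TT \<tau> * mod_u \<tau> - 16 * mod_u \<tau> ^ 2 + 17 * TT \<tau> ^ 2 * mod_u \<tau> - 80 * TT \<tau> * mod_u \<tau> ^ 2 + 64 * mod_u \<tau> ^ 3)"
        unfolding TT_cubic[OF t] .
      show "7 ^ e * of_int k / 4 ^ n * (TT \<tau> ^ i * mod_u \<tau> ^ l) = ?m 1 j (l + 1) \<tau> + (?m 9 (j + 1) (l + 1) \<tau> + (?m (- 16) j (l + 2) \<tau> +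
        (?m 17 (j + 2) (l + 1) \<tau> + (?m (- 80) (j + 1) (l + 2) \<tau> + ?m 64 j (l + 3) \<tau>))))"
        unfolding e by (simp add: power_add power2_eq_square power3_eq_cube field_simps)
    qed
  qed
qed

lemma Sp_cubic:
  assumes Q: "\<And>i l i' l' e. Q i l e \<Longrightarrow> 3 \<le> i \<Longrightarrow> 1 \<le> i' + l' \<Longrightarrow> i' + l' \<le> i + l \<Longrightarrow> Q i' l' e"
    and f: "Sp P f" and PQ: "\<And>i l e. P i l e \<Longrightarrow> Q i l e"
  shows "Sp (\<lambda>i l e. i \<le> 2 \<and> Q i l e) f"
  using f
proof induction
  case (Sp_step g i l e f k n)
  have "Sp (\<lambda>i l e. i \<le> 2 \<and> Q i l e) (\<lambda>\<tau>. 7 ^ e * of_int k / 4 ^ n * (TT \<tau> ^ i * mod_u \<tau> ^ l))"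
    by (rule Sp_cubic_monom[of Q], erule (3) Q, rule PQ[OF Sp_step.hyps(2)])
  from Sp_cong[OF Sp_add[OF Sp_step.IH this] Sp_step.hyps(3)] show ?case .
qed (rule Sp_zero)

text \<open>\<open>3 \<le> i\<close> implies degree at least 3, where \<alpha> + 1 \<le> e holds;
  this pays for the new monomials without \<open>TT\<close>.\<close>

lemma PO_down: "PO \<alpha> i l e \<Longrightarrow> 3 \<le> i \<Longrightarrow> 1 \<le> i' + l' \<Longrightarrow> i' + l' \<le> i + l \<Longrightarrow> PO \<alpha> i' l' e"
  unfolding PO_def by auto

lemma PE_down: "PE \<alpha> i l e \<Longrightarrow> 3 \<le> i \<Longrightarrow> 1 \<le> i' + l' \<Longrightarrow> i' + l' \<le> i + l \<Longrightarrow> PE \<alpha> i' l' e"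
  unfolding PE_def by auto

lemma L_seq_reduced:
  "Sp (\<lambda>i l e. i \<le> 2 \<and> PO (Suc \<alpha>) i l e) (L_seq (2 * \<alpha> + 1))"
  "Sp (\<lambda>i l e. i \<le> 2 \<and> PE (Suc \<alpha>) i l e) (L_seq (2 * \<alpha> + 2))"
  by (rule Sp_cubic[OF PO_down conjunct1[OF L_seq_span]]; blast) (rule Sp_cubic[OF PE_down conjunct2[OF L_seq_span]]; blast)

section \<open>Integrality\<close>

lemma apx_sym: "apx n u v \<Longrightarrow> apx n v u"
  by (simp add: apx_def norm_minus_commute)

text \<open>Coefficients are isolated from the lowest upwards: at a sufficiently small real point
  the constant terms are seen to differ by less than 1, and being integers they agree; then one
  divides by q.\<close>

lemma tr_unique:
  assumes "tr f cs" "tr f ds" "length cs = length ds"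
  shows "cs = ds"
proof -
  have main: "cs = ds" if "length cs = length ds" "\<And>q. q \<noteq> 0 \<Longrightarrow> norm q \<le> r \<Longrightarrow> norm (ev cs q - ev ds q) \<le> C * norm q ^ length cs"
    "r > 0" for r C cs ds
    using that(1,2)
  proof (induction cs arbitrary: ds)
    case (Cons c cs)
    then obtain d ds' where ds: "ds = d # ds'" "length cs = length ds'" by (cases ds) auto
    define K where "K = \<bar>C\<bar> + (\<Sum>c\<leftarrow>cs. \<bar>of_int c\<bar>) + (\<Sum>c\<leftarrow>ds'. \<bar>of_int c\<bar>) + (1::real)"
    have K: "K > 0" unfolding K_def by (intro add_nonneg_pos add_nonneg_nonneg sum_list_nonneg) auto
    define x where "x = min (min r 1) (1 / (2 * K))"
    have x: "0 < x" "x \<le> r" "x \<le> 1" "K * x < 1"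
    proof -
      show "0 < x" "x \<le> r" "x \<le> 1" using that(3) K by (auto simp: x_def)
      have "K * x \<le> K * (1 / (2 * K))" using K by (intro mult_left_mono) (auto simp: x_def)
      then show "K * x < 1" using K by simp
    qed
    have q: "norm (complex_of_real x) = x" using x by simp
    have b: "norm (ev (c # cs) x - ev ds x) \<le> C * x ^ length (c # cs)" using Cons.prems(2)[of "complex_of_real x"] x q by simp
    also have "\<dots> = (C * x ^ length cs) * x" by simp
    also have "\<dots> \<le> (\<bar>C\<bar> * 1) * x"
      using x power_le_one[of x "length cs"] by (intro mult_right_mono mult_mono) auto
    finally have b: "norm (ev (c # cs) x - ev ds x) \<le> \<bar>C\<bar> * x" by simp
    have e: "of_int (c - d) = (ev (c # cs) x - ev ds x) - complex_of_real x * (ev cs x - ev ds' x)"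
      by (simp add: ds algebra_simps)
    have "norm (of_int (c - d) :: complex) \<le> norm (ev (c # cs) x - ev ds x) + norm (complex_of_real x * (ev cs x - ev ds' x))"
      unfolding e by (rule norm_triangle_ineq4)
    also have "norm (complex_of_real x * (ev cs x - ev ds' x)) \<le> x * ((\<Sum>c\<leftarrow>cs. \<bar>of_int c\<bar>) + (\<Sum>c\<leftarrow>ds'. \<bar>of_int c\<bar>))"
      unfolding norm_mult q using x norm_ev_le[of "complex_of_real x" cs] norm_ev_le[of "complex_of_real x" ds'] norm_triangle_ineq4[of "ev cs x" "ev ds' x"]
      by (intro mult_left_mono) auto
    finally have "norm (of_int (c - d) :: complex) \<le> K * x" using b x(1) unfolding K_def by (simp add: algebra_simps)
    then have "\<bar>real_of_int (c - d)\<bar> < 1" using x(4) unfolding norm_of_int by linarith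
    then have cd: "c = d" by linarith
    have "cs = ds'"
    proof (rule Cons.IH[OF ds(2)])
      fix q :: complex assume q: "q \<noteq> 0" "norm q \<le> r"
      have "norm q * norm (ev cs q - ev ds' q) = norm (ev (c # cs) q - ev ds q)"
        unfolding norm_mult [symmetric] by (simp add: ds cd algebra_simps)
      also have "\<dots> \<le> norm q * (C * norm q ^ length cs)" using Cons.prems(2)[OF q] by (simp add: mult_ac)
      finally show "norm (ev cs q - ev ds' q) \<le> C * norm q ^ length cs" using q by simp
    qed
    then show ?case using ds cd by simp
  qed simp
  obtain C where C: "\<And>\<tau>. Im \<tau> \<ge> 1 \<Longrightarrow> norm (f \<tau> - ev cs (nome \<tau>)) \<le> C * norm (nome \<tau>) ^ length cs"
    using assms(1) unfolding tr_def by (meson zero_less_one)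
  obtain D where D: "\<And>\<tau>. Im \<tau> \<ge> 1 \<Longrightarrow> norm (f \<tau> - ev ds (nome \<tau>)) \<le> D * norm (nome \<tau>) ^ length ds"
    using assms(2) unfolding tr_def by (meson zero_less_one)
  show ?thesis
  proof (rule main[OF assms(3), of "exp (- 2 * pi)" "C + D"])
    fix q :: complex assume q: "q \<noteq> 0" "norm q \<le> exp (- 2 * pi)"
    define \<tau> where "\<tau> = Ln q / (2 * of_real pi * \<i>)"
    have n: "nome \<tau> = q" using q by (simp add: nome_def \<tau>_def)
    have "exp (- 2 * pi * Im \<tau>) \<le> exp (- 2 * pi * 1)" using q(2) norm_nome[of \<tau>] unfolding n by simp
    then have t: "Im \<tau> \<ge> 1" by simp
    have "norm (ev cs q - ev ds q) \<le> norm (f \<tau> - ev cs q) + norm (f \<tau> - ev ds q)"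
      using norm_triangle_ineq4[of "f \<tau> - ev ds q" "f \<tau> - ev cs q"] by simp
    then show "norm (ev cs q - ev ds q) \<le> (C + D) * norm q ^ length cs"
      using C[OF t] D[OF t] unfolding n assms(3) by (simp add: distrib_right)
  qed simp
qed

definition iq :: "(complex \<Rightarrow> complex) \<Rightarrow> bool" where
  "iq f \<longleftrightarrow> (\<forall>n. \<exists>cs. length cs = n \<and> tr f cs)"

text \<open>Integral power series with constant term 1 are closed under products and inverses, so
  eta quotients without their leading power of q belong here.\<close>

definition iu :: "(complex \<Rightarrow> complex) \<Rightarrow> bool" where
  "iu f \<longleftrightarrow> (\<forall>n. \<exists>cs. length cs = n \<and> tr f (1 # cs))"

lemma iqI: "(\<And>n. \<exists>cs. length cs \<ge> n \<and> tr f cs) \<Longrightarrow> iq f"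
  unfolding iq_def by (metis length_take min.absorb2 tr_take)

lemma iuI:
  assumes "\<And>n. \<exists>cs. length cs \<ge> n \<and> tr f (1 # cs)"
  shows "iu f"
  unfolding iu_def
proof
  fix n
  obtain cs where "length cs \<ge> n" "tr f (1 # cs)" using assms by blast
  then show "\<exists>cs. length cs = n \<and> tr f (1 # cs)" using tr_take[of f "1 # cs" "Suc n"] by (intro exI[of _ "take n cs"]) auto
qed

lemma iu_iq: "iu f \<Longrightarrow> iq f"
  by (rule iqI) (metis iu_def length_Cons le_SucI order_refl)

lemma iq_mult: "iq f \<Longrightarrow> iq g \<Longrightarrow> iq (\<lambda>\<tau>. f \<tau> * g \<tau>)"
  unfolding iq_def by (metis tr_mult length_lmul)

lemma iu_mult:
  assumes "iu f" "iu g"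
  shows "iu (\<lambda>\<tau>. f \<tau> * g \<tau>)"
  unfolding iu_def
proof
  fix n
  obtain cs ds where c: "length cs = n" "tr f (1 # cs)" and d: "length ds = n" "tr g (1 # ds)" using assms unfolding iu_def by meson
  have "\<exists>es. lmul (1 # cs) (1 # ds) = 1 # es" by (simp add: lmul_def)
  then obtain es where es: "lmul (1 # cs) (1 # ds) = 1 # es" by blast
  have "length es = n" using arg_cong[OF es, of length] d by simp
  then show "\<exists>cs. length cs = n \<and> tr (\<lambda>\<tau>. f \<tau> * g \<tau>) (1 # cs)" using tr_mult[OF c(2) d(2)] c d unfolding es by auto
qed

lemma iu_one: "iu (\<lambda>\<tau>. 1)"
  unfolding iu_def using tr_one by (metis length_replicate)

lemma iu_power: "iu f \<Longrightarrow> iu (\<lambda>\<tau>. f \<tau> ^ n)"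
  by (induction n) (auto intro: iu_one iu_mult)

lemma elist_Cons: "\<exists>ys. elist n (1 # xs) = 1 # ys"
  by (induction n arbitrary: xs) auto

lemma iu_eul:
  assumes "k > 0"
  shows "iu (\<lambda>\<tau>. eul (nome \<tau> ^ k))"
proof (rule iuI)
  fix n
  obtain ys where ys: "elist n (1 # replicate n 0) = 1 # ys" using elist_Cons by blast
  have l: "length ys = n" using arg_cong[OF ys, of length] by (simp add: length_elist)
  have "tr (\<lambda>\<tau>. eul (nome \<tau> ^ k)) (dil k (1 # ys))"
    using tr_dil[OF tr_eul[of n] assms] unfolding ys by (simp add: nome_of_nat_mult)
  moreover have "length (dil k (1 # ys)) = k * Suc n" using length_dil[OF assms, of "1 # ys"] l by simp
  moreover have "n \<le> k * Suc n - 1" using assms by (cases k) auto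
  ultimately show "\<exists>cs. length cs \<ge> n \<and> tr (\<lambda>\<tau>. eul (nome \<tau> ^ k)) (1 # cs)"
    by (intro exI[of _ "tl (dil k (1 # ys))"]) auto
qed

text \<open>Long division by a series with constant term 1 stays within the integers.\<close>

lemma ev_divide:
  "\<exists>zs. length zs = length bs \<and> apx (length bs) (\<lambda>q. ev (1 # ds) q * ev zs q) (ev bs) \<and> (bs \<noteq> [] \<longrightarrow> hd zs = hd bs)"
proof (induction "length bs" arbitrary: bs)
  case 0
  then show ?case using norm_ev_le by (auto simp: apx_def)
next
  case (Suc n)
  then obtain b bs' where bs: "bs = b # bs'" "length bs' = n" by (cases bs) auto
  let ?r = "addmul (- b) ds bs'"
  obtain zs where zs: "length zs = n" "apx n (\<lambda>q. ev (1 # ds) q * ev zs q) (ev ?r)"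
    using Suc.hyps(1)[of ?r] bs by auto
  have 1: "apx n (\<lambda>q. ev (1 # ds) q * ev zs q) (\<lambda>q. ev bs' q + of_int (- b) * ev ds q)"
    using apx_trans[OF zs(2)] ev_addmul[of bs' "- b" ds] bs(2) by simp
  have "apx (Suc n) (\<lambda>q. of_int b + q * (ev (1 # ds) q * ev zs q + of_int b * ev ds q)) (\<lambda>q. of_int b + q * ((ev bs' q + of_int (- b) * ev ds q) + of_int b * ev ds q))"
    by (intro apx_Suc apx_add 1)
  moreover have "(\<lambda>q. of_int b + q * (ev (1 # ds) q * ev zs q + of_int b * ev ds q)) = (\<lambda>q. ev (1 # ds) q * ev (b # zs) q)"
    by (auto simp: algebra_simps)
  moreover have "(\<lambda>q. of_int b + q * ((ev bs' q + of_int (- b) * ev ds q) + of_int b * ev ds q)) = ev bs"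
    by (auto simp: bs algebra_simps)
  ultimately show ?case using zs(1) bs by (intro exI[of _ "b # zs"]) auto
qed

lemma iu_inverse:
  assumes "iu d" "below d"
  shows "iu (\<lambda>\<tau>. 1 / d \<tau>)"
  unfolding iu_def
proof
  fix n
  obtain ds where ds: "length ds = n" "tr d (1 # ds)" using assms(1) unfolding iu_def by meson
  let ?b = "1 # replicate n (0::int)"
  obtain zs where zs: "length zs = Suc n" "apx (Suc n) (\<lambda>q. ev (1 # ds) q * ev zs q) (ev ?b)" "hd zs = 1"
    using ev_divide[of ?b ds] by auto
  then obtain z where z: "zs = 1 # z" "length z = n" by (cases zs) auto
  have "apx (Suc n) (ev ?b) (ev (lmul (1 # ds) zs))"
    using apx_trans[OF apx_sym[OF zs(2)] apx_sym] ev_lmul[of zs "1 # ds"] zs(1) by simp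
  then have "tr (\<lambda>\<tau>. d \<tau> * ev zs (nome \<tau>)) ?b"
    using tr_apx[OF tr_mult[OF ds(2) tr_ev[of zs]]] zs(1) ds(1) by simp
  from tr_divide[OF this tr_one _ assms(2)] zs(1) have "tr (\<lambda>\<tau>. 1 / d \<tau>) zs" by simp
  then show "\<exists>cs. length cs = n \<and> tr (\<lambda>\<tau>. 1 / d \<tau>) (1 # cs)" using z by auto
qed

lemma iu_cong: "iu f \<Longrightarrow> (\<And>\<tau>. Im \<tau> > 0 \<Longrightarrow> g \<tau> = f \<tau>) \<Longrightarrow> iu g"
  unfolding iu_def using tr_cong by metis

lemma iq_cong: "iq f \<Longrightarrow> (\<And>\<tau>. Im \<tau> > 0 \<Longrightarrow> g \<tau> = f \<tau>) \<Longrightarrow> iq g"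
  unfolding iq_def using tr_cong by metis

lemma iq_shift: "iq f \<Longrightarrow> iq (\<lambda>\<tau>. nome \<tau> ^ k * f \<tau>)"
  by (rule iqI) (metis iq_def tr_shift length_append le_add2)

lemma iq_addmul: "iq f \<Longrightarrow> iq g \<Longrightarrow> iq (\<lambda>\<tau>. f \<tau> + of_int c * g \<tau>)"
  unfolding iq_def by (metis tr_addmul length_addmul)

lemma iq_sub_sum:
  assumes "iq f" "\<And>r :: nat. iq (g r)"
  shows "iq (\<lambda>\<tau>. f \<tau> - (\<Sum>r<n. of_int (c r) * g r \<tau>))"
proof (induction n)
  case (Suc n)
  from iq_addmul[OF Suc assms(2), of "- c n" n] show ?case by (rule iq_cong) (simp add: algebra_simps)
qed (use assms in simp)

lemma iq_atkin_U7: "iq f \<Longrightarrow> iq (atkin_U7 f)"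
  unfolding iq_def by (metis tr_U7 length_ex7)

lemma iu_TT: "iu (\<lambda>\<tau>. TT \<tau> / nome \<tau>)"
  by (rule iu_cong[OF iu_mult[OF iu_power[OF iu_eul[of 7], of 4] iu_inverse[OF iu_power[OF iu_eul[of 1]] below_power[OF below_eul[of 1]], of 4]]])
    (simp_all add: mod_eul(4))

lemma iu_mod_u: "iu (\<lambda>\<tau>. mod_u \<tau> / nome \<tau> ^ 3)"
  by (rule iu_cong[OF iu_mult[OF iu_power[OF iu_eul[of 14], of 7] iu_inverse[OF
      iu_mult[OF iu_mult[OF iu_power[OF iu_eul[of 1], of 3] iu_eul[of 2]] iu_power[OF iu_eul[of 7], of 3]]
      below_mult[OF below_mult[OF below_power[OF below_eul[of 1], of 3] below_eul[of 2]] below_power[OF below_eul[of 7], of 3]]]]])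
    (simp_all add: mod_eul(2))

lemma iq_mod_A: "iq mod_A"
proof -
  have "iu (\<lambda>\<tau>. (eul (nome \<tau> ^ 2) ^ 2 * eul (nome \<tau> ^ 49) ^ 5) * (1 / (eul (nome \<tau> ^ 1) ^ 5 * eul (nome \<tau> ^ 98) ^ 2)))"
    by (intro iu_mult iu_power iu_eul iu_inverse below_mult below_power below_eul) auto
  from iq_shift[OF iu_iq[OF this], of 2] show ?thesis by (rule iq_cong) (simp add: mod_eul(3))
qed

lemma iq_L_seq: "iq (L_seq n)"
proof (induction n)
  case 0
  then show ?case using iu_iq[OF iu_one] by simp
next
  case (Suc n)
  then show ?case by (auto intro: iq_atkin_U7 iq_mult iq_mod_A)
qed

text \<open>The system is triangular. Once \<open>M\<close> divides all earlier coefficients, their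
  terms can be subtracted from \<open>f\<close> with integral coefficients; then \<open>M\<close>
  times the remainder begins with \<open>c r\<close> at q^r, and comparison of that coefficient
  gives the next divisibility.\<close>

lemma leading_coeff_dvd:
  fixes c :: "nat \<Rightarrow> int" and h :: "nat \<Rightarrow> complex \<Rightarrow> complex"
  assumes f: "iq f" and h: "\<And>r. iu (h r)"
    and eq: "\<And>\<tau>. Im \<tau> > 0 \<Longrightarrow> of_int M * f \<tau> = (\<Sum>r<R. of_int (c r) * (nome \<tau> ^ r * h r \<tau>))"
    and r: "r < R"
  shows "M dvd c r"
  using r
proof (induction r rule: less_induct)
  case (less r)
  define c' where "c' = (\<lambda>s. c s div M)"
  have c': "c s = M * c' s" if "s < r" for s using less.IH[of s] less.prems that by (simp add: c'_def)
  define f' where "f' = (\<lambda>\<tau>. f \<tau> - (\<Sum>s<r. of_int (c' s) * (nome \<tau> ^ s * h s \<tau>)))"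
  define S where "S = (\<lambda>\<tau>. of_int (c r) * h r \<tau> + (\<Sum>s\<in>{Suc r..<R}. of_int (c s) * (nome \<tau> ^ (s - r) * h s \<tau>)))"
  have "iq f'" unfolding f'_def by (intro iq_sub_sum f iq_shift iu_iq h)
  then obtain cs where cs: "length cs = Suc r" "tr f' cs" unfolding iq_def by meson
  have am: "addmul x xs (map (\<lambda>_. 0) xs) = map ((*) x) xs" for x xs by (induction xs) auto
  have z: "tr (\<lambda>\<tau>. 0) (map (\<lambda>_. 0) xs)" for xs by (rule tr_cong[OF tr_ev]) (simp add: ev_zeros)
  have 1: "tr (\<lambda>\<tau>. of_int M * f' \<tau>) (map ((*) M) cs)"
    using tr_addmul[OF z cs(2), of cs M] by (simp add: am)
  \<comment> \<open>One coefficient of precision is enough: each later term carries a positive power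
    of q and does not affect the constant term.\<close>
  have T: "tr (\<lambda>\<tau>. \<Sum>s\<in>A. of_int (c s) * (nome \<tau> ^ (s - r) * h s \<tau>)) [0]" if "finite A" "\<And>s. s \<in> A \<Longrightarrow> r < s" for A
    using that
  proof (induction A rule: finite_induct)
    case empty
    then show ?case using tr_zero[of 1] by simp
  next
    case (insert s A)
    obtain hs where "length hs = 1" "tr (h s) (1 # hs)" using h[of s] unfolding iu_def by meson
    then have "tr (\<lambda>\<tau>. nome \<tau> ^ (s - r) * h s \<tau>) (take 1 (replicate (s - r) 0 @ 1 # hs))" by (intro tr_take tr_shift)
    moreover have "take 1 (replicate (s - r) (0::int) @ 1 # hs) = [0]" using insert.prems[of s] by (cases "s - r") auto
    ultimately have "tr (\<lambda>\<tau>. nome \<tau> ^ (s - r) * h s \<tau>) [0]" by simp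
    from tr_addmul[OF insert.IH this, of "c s"] insert show ?case by (simp add: add.commute)
  qed
  have S: "tr S [c r]"
  proof -
    obtain hs where "length hs = 0" "tr (h r) (1 # hs)" using h[of r] unfolding iu_def by meson
    then have "tr (h r) [1]" by simp
    from tr_addmul[OF T[of "{Suc r..<R}"] this, of "c r"] show ?thesis unfolding S_def by (simp add: add.commute)
  qed
  have "tr (\<lambda>\<tau>. nome \<tau> ^ r * S \<tau>) (replicate r 0 @ [c r])" by (rule tr_shift[OF S])
  moreover have "of_int M * f' \<tau> = nome \<tau> ^ r * S \<tau>" if "Im \<tau> > 0" for \<tau>
  proof -
    have "(\<Sum>s<R. of_int (c s) * (nome \<tau> ^ s * h s \<tau>)) = (\<Sum>s<r. of_int (c s) * (nome \<tau> ^ s * h s \<tau>)) + (\<Sum>s\<in>{r..<R}. of_int (c s) * (nome \<tau> ^ s * h s \<tau>))"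
      using less.prems by (subst sum.union_disjoint [symmetric]) (auto intro!: sum.cong)
    also have "(\<Sum>s<r. of_int (c s) * (nome \<tau> ^ s * h s \<tau>)) = of_int M * (\<Sum>s<r. of_int (c' s) * (nome \<tau> ^ s * h s \<tau>))"
      unfolding sum_distrib_left by (intro sum.cong) (auto simp: c')
    also have "(\<Sum>s\<in>{r..<R}. of_int (c s) * (nome \<tau> ^ s * h s \<tau>)) = of_int (c r) * (nome \<tau> ^ r * h r \<tau>) + (\<Sum>s\<in>{Suc r..<R}. of_int (c s) * (nome \<tau> ^ s * h s \<tau>))"
      using less.prems by (rule sum.atLeast_Suc_lessThan)
    also have "(\<Sum>s\<in>{Suc r..<R}. of_int (c s) * (nome \<tau> ^ s * h s \<tau>)) = nome \<tau> ^ r * (\<Sum>s\<in>{Suc r..<R}. of_int (c s) * (nome \<tau> ^ (s - r) * h s \<tau>))"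
      unfolding sum_distrib_left
    proof (intro sum.cong refl)
      fix s assume "s \<in> {Suc r..<R}"
      then have "nome \<tau> ^ s = nome \<tau> ^ r * nome \<tau> ^ (s - r)" by (simp add: power_add [symmetric])
      then show "of_int (c s) * (nome \<tau> ^ s * h s \<tau>) = nome \<tau> ^ r * (of_int (c s) * (nome \<tau> ^ (s - r) * h s \<tau>))" by simp
    qed
    finally show ?thesis using eq[OF that] unfolding f'_def S_def by (simp add: algebra_simps)
  qed
  ultimately have 2: "tr (\<lambda>\<tau>. of_int M * f' \<tau>) (replicate r 0 @ [c r])" by (rule tr_cong)
  have "map ((*) M) cs = replicate r 0 @ [c r]" by (rule tr_unique[OF 1 2]) (simp add: cs)
  then have "map ((*) M) cs ! r = (replicate r 0 @ [c r]) ! r" by simp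
  then have "c r = M * cs ! r" using cs(1) by (simp add: nth_append)
  then show ?case by simp
qed

section \<open>Clearing the powers of 4\<close>

abbreviation monm :: "nat \<Rightarrow> complex \<Rightarrow> complex" where
  "monm r \<tau> \<equiv> TT \<tau> ^ (r mod 3) * mod_u \<tau> ^ (r div 3)"

text \<open>All terms are brought to a common denominator 4^N, and the surplus over the prescribed
  exponent \<open>E\<close> of 7 is absorbed into the integers \<open>k r\<close>. The first clause
  retains which exponents can occur, from which the degree bound is recovered later.\<close>

lemma Sp_collect:
  assumes "Sp (\<lambda>i l e. i \<le> 2 \<and> Q i l e) f"
    and Q: "\<And>i l e. Q i l e \<Longrightarrow> l \<le> D \<and> E i l \<le> e"
  shows "\<exists>N k. (\<forall>r. k r \<noteq> 0 \<longrightarrow> (\<exists>e. Q (r mod 3) (r div 3) e)) \<and>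
    (\<forall>\<tau>. Im \<tau> > 0 \<longrightarrow> 4 ^ N * f \<tau> = (\<Sum>r<3 * (D + 1). 7 ^ E (r mod 3) (r div 3) * of_int (k r :: int) * monm r \<tau>))"
  using assms(1)
proof induction
  case (Sp_zero f)
  then show ?case by (intro exI[of _ 0] exI[of _ "\<lambda>_. 0"]) simp
next
  case (Sp_step g i l e f x n)
  obtain N k where k: "\<And>r. k r \<noteq> 0 \<Longrightarrow> \<exists>e. Q (r mod 3) (r div 3) e"
    "\<And>\<tau>. Im \<tau> > 0 \<Longrightarrow> 4 ^ N * g \<tau> = (\<Sum>r<3 * (D + 1). 7 ^ E (r mod 3) (r div 3) * of_int (k r :: int) * monm r \<tau>)"
    using Sp_step.IH by blast
  have il: "i \<le> 2" "Q i l e" using Sp_step.hyps(2) by auto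
  have le: "l \<le> D" "E i l \<le> e" using Q[OF il(2)] by auto
  define r0 where "r0 = 3 * l + i"
  have r0: "r0 mod 3 = i" "r0 div 3 = l" "r0 < 3 * (D + 1)" using il le by (auto simp: r0_def)
  define y where "y = 4 ^ N * x * 7 ^ (e - E i l)"
  define k' where "k' = (\<lambda>r. 4 ^ n * k r + (if r = r0 then y else 0))"
  show ?case
  proof (rule exI[of _ "N + n"], rule exI[of _ k'], intro conjI allI impI)
    fix r assume "k' r \<noteq> 0"
    then show "\<exists>e. Q (r mod 3) (r div 3) e" using k(1)[of r] il r0 by (cases "r = r0") (auto simp: k'_def)
  next
    fix \<tau> :: complex assume t: "Im \<tau> > 0"
    have y: "7 ^ E i l * of_int y = 4 ^ N * of_int x * (7 ^ e :: complex)"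
    proof -
      have "(7::complex) ^ e = 7 ^ E i l * 7 ^ (e - E i l)" using le by (simp add: power_add [symmetric])
      then show ?thesis by (simp add: y_def)
    qed
    have "(\<Sum>r<3 * (D + 1). 7 ^ E (r mod 3) (r div 3) * of_int (k' r) * monm r \<tau>)
      = 4 ^ n * (\<Sum>r<3 * (D + 1). 7 ^ E (r mod 3) (r div 3) * of_int (k r) * monm r \<tau>) +
        (\<Sum>r<3 * (D + 1). if r = r0 then 7 ^ E (r mod 3) (r div 3) * of_int y * monm r \<tau> else 0)"
      unfolding sum_distrib_left sum.distrib [symmetric] by (intro sum.cong refl) (simp add: k'_def algebra_simps)
    also have "(\<Sum>r<3 * (D + 1). if r = r0 then 7 ^ E (r mod 3) (r div 3) * of_int y * monm r \<tau> else 0) = 7 ^ E i l * of_int y * (TT \<tau> ^ i * mod_u \<tau> ^ l)"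
      using r0 by (subst sum.delta) auto
    also have "\<dots> = 4 ^ N * of_int x * 7 ^ e * (TT \<tau> ^ i * mod_u \<tau> ^ l)" unfolding y ..
    finally show "4 ^ (N + n) * f \<tau> = (\<Sum>r<3 * (D + 1). 7 ^ E (r mod 3) (r div 3) * of_int (k' r) * monm r \<tau>)"
      unfolding k(2)[OF t, symmetric] Sp_step.hyps(3)[OF t] by (simp add: power_add field_simps)
  qed
qed

lemma iu_monm: "iu (\<lambda>\<tau>. (TT \<tau> / nome \<tau>) ^ (r mod 3) * (mod_u \<tau> / nome \<tau> ^ 3) ^ (r div 3))"
  by (intro iu_mult iu_power iu_TT iu_mod_u)

text \<open>The order at infinity is 3 (r div 3) + r mod 3 = r, so this enumeration lists the basis
  by its orders.\<close>

lemma monm_nome: "monm r \<tau> = nome \<tau> ^ r * ((TT \<tau> / nome \<tau>) ^ (r mod 3) * (mod_u \<tau> / nome \<tau> ^ 3) ^ (r div 3))"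
proof -
  have e: "nome \<tau> ^ r = nome \<tau> ^ (r mod 3) * (nome \<tau> ^ 3) ^ (r div 3)"
    unfolding power_mult [symmetric] power_add [symmetric] by simp
  show ?thesis unfolding e power_divide by (simp add: power_mult [symmetric])
qed

text \<open>\<open>leading_coeff_dvd\<close> shows that 4^N divides the coefficient together with
  its power of 7; as 4 and 7 are coprime, it divides \<open>k r\<close>, and the power of 7 survives
  the division intact.\<close>

lemma Sp_integral:
  assumes "Sp (\<lambda>i l e. i \<le> 2 \<and> Q i l e) f" and iq: "iq f"
    and Q: "\<And>i l e. Q i l e \<Longrightarrow> l \<le> D \<and> E i l \<le> e"
  shows "\<exists>k. (\<forall>r. k r \<noteq> 0 \<longrightarrow> (\<exists>e. Q (r mod 3) (r div 3) e)) \<and>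
    (\<forall>\<tau>. Im \<tau> > 0 \<longrightarrow> f \<tau> = (\<Sum>r<3 * (D + 1). 7 ^ E (r mod 3) (r div 3) * of_int (k r :: int) * monm r \<tau>))"
proof -
  have "\<exists>N k. (\<forall>r. k r \<noteq> 0 \<longrightarrow> (\<exists>e. Q (r mod 3) (r div 3) e)) \<and>
    (\<forall>\<tau>. Im \<tau> > 0 \<longrightarrow> 4 ^ N * f \<tau> = (\<Sum>r<3 * (D + 1). 7 ^ E (r mod 3) (r div 3) * of_int (k r :: int) * monm r \<tau>))"
    by (rule Sp_collect[OF assms(1)]) (rule Q)
  then obtain N k where k0: "\<forall>r. k r \<noteq> 0 \<longrightarrow> (\<exists>e. Q (r mod 3) (r div 3) e)"
    "\<forall>\<tau>. Im \<tau> > 0 \<longrightarrow> 4 ^ N * f \<tau> = (\<Sum>r<3 * (D + 1). 7 ^ E (r mod 3) (r div 3) * of_int (k r :: int) * monm r \<tau>)"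
    by (elim exE conjE) (rule that)
  note k = k0(1)[rule_format] k0(2)[rule_format]
  have dvd: "4 ^ N dvd k r" if "r < 3 * (D + 1)" for r
  proof -
    have M: "(4 ^ N :: int) dvd 7 ^ E (r mod 3) (r div 3) * k r"
    proof (rule leading_coeff_dvd[OF iq iu_monm _ that])
      fix \<tau> :: complex assume "Im \<tau> > 0"
      from k(2)[OF this] show "of_int (4 ^ N) * f \<tau> = (\<Sum>r<3 * (D + 1). of_int (7 ^ E (r mod 3) (r div 3) * k r) *
          (nome \<tau> ^ r * ((TT \<tau> / nome \<tau>) ^ (r mod 3) * (mod_u \<tau> / nome \<tau> ^ 3) ^ (r div 3))))"
        unfolding monm_nome [symmetric] by simp
    qed
    have "coprime (4 :: int) 7"
    proof (rule coprimeI)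
      fix x :: int assume "x dvd 4" "x dvd 7"
      then have "x dvd 2 * 4 - 7" by (intro dvd_diff dvd_mult)
      then show "is_unit x" by simp
    qed
    then have "coprime (4 ^ N :: int) (7 ^ E (r mod 3) (r div 3))"
      by simp
    with M show ?thesis by (simp add: coprime_dvd_mult_right_iff)
  qed
  show ?thesis
  proof (intro exI[of _ "\<lambda>r. k r div 4 ^ N"] conjI allI impI)
    fix r assume "k r div 4 ^ N \<noteq> 0"
    then have "k r \<noteq> 0" by auto
    then show "\<exists>e. Q (r mod 3) (r div 3) e" by (rule k(1))
  next
    fix \<tau> :: complex assume "Im \<tau> > 0"
    have "(\<Sum>r<3 * (D + 1). 7 ^ E (r mod 3) (r div 3) * of_int (k r) * monm r \<tau>) = 4 ^ N * (\<Sum>r<3 * (D + 1). 7 ^ E (r mod 3) (r div 3) * of_int (k r div 4 ^ N) * monm r \<tau>)"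
      unfolding sum_distrib_left
    proof (intro sum.cong refl)
      fix r assume "r \<in> {..<3 * (D + 1)}"
      then have "k r = 4 ^ N * (k r div 4 ^ N)" using dvd by simp
      then have "of_int (k r) = (4 ^ N * of_int (k r div 4 ^ N) :: complex)" by (metis of_int_mult of_int_numeral of_int_power)
      then show "7 ^ E (r mod 3) (r div 3) * of_int (k r) * monm r \<tau> = 4 ^ N * (7 ^ E (r mod 3) (r div 3) * of_int (k r div 4 ^ N) * monm r \<tau>)"
        by simp
    qed
    then show "f \<tau> = (\<Sum>r<3 * (D + 1). 7 ^ E (r mod 3) (r div 3) * of_int (k r div 4 ^ N) * monm r \<tau>)"
      using k(2)[OF \<open>Im \<tau> > 0\<close>] by simp
  qed
qed

lemma sum_triples: "(\<Sum>r<3 * n. F r) = (\<Sum>l<n. F (3 * l) + F (3 * l + 1) + F (3 * l + 2 :: nat))" for F :: "nat \<Rightarrow> complex"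
proof (induction n)
  case (Suc n)
  have "3 * Suc n = Suc (Suc (Suc (3 * n)))" by simp
  then show ?case using Suc by (simp only: sum.lessThan_Suc) (simp add: algebra_simps)
qed simp

lemma sum_shift_degree:
  fixes h :: "nat \<Rightarrow> complex"
  assumes "\<And>l. l + j > D \<Longrightarrow> h l = 0"
  shows "(\<Sum>l<D + 1. h l) = (\<Sum>i=j..D. h (i - j))"
proof -
  have "(\<Sum>l<D + 1. h l) = (\<Sum>l=0..D. h l)" by (simp add: atLeast0AtMost lessThan_Suc_atMost)
  also have "\<dots> = (\<Sum>i=0 + j..D + j. h (i - j))" unfolding sum.shift_bounds_cl_nat_ivl by simp
  also have "\<dots> = (\<Sum>i=j..D. h (i - j))" by (rule sum.mono_neutral_right) (auto intro!: assms)
  finally show ?thesis .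
qed

lemma sum_split_3:
  fixes F :: "nat \<Rightarrow> complex"
  assumes "3 \<le> D" "j \<le> 2"
  shows "(\<Sum>i=j..D. F i) = (\<Sum>i=j..2. F i) + (\<Sum>i=3..D. F i)"
proof -
  have "{j..D} = {j..2} \<union> {3..D}" using assms by auto
  then show ?thesis by (simp only:) (rule sum.union_disjoint, auto)
qed

text \<open>Since \<open>TT^j mod_u^l\<close> is u^(j + l) t^j, the sums are reindexed by the total
  degree. This is why the sum with t^j starts at degree j; the constant term drops out because
  \<open>Q\<close> requires degree at least 1.\<close>

lemma basis_expansion:
  fixes Q :: "nat \<Rightarrow> nat \<Rightarrow> nat \<Rightarrow> bool" and E :: "nat \<Rightarrow> nat \<Rightarrow> nat"
  assumes "Sp (\<lambda>i l e. i \<le> 2 \<and> Q i l e) f" "iq f"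
    and Q': "\<forall>i l e. Q i l e \<longrightarrow> 1 \<le> i + l \<and> i + l \<le> D \<and> E i (i + l) \<le> e" and D: "3 \<le> D"
  shows "\<exists>a b c :: nat \<Rightarrow> int. \<forall>\<tau>. Im \<tau> > 0 \<longrightarrow> f \<tau> =
      7 ^ E 0 1 * of_int (a 1) * mod_u \<tau> + 7 ^ E 0 2 * of_int (a 2) * mod_u \<tau> ^ 2
    + (\<Sum>i=3..D. 7 ^ E 0 i * of_int (a i) * mod_u \<tau> ^ i)
    + 7 ^ E 1 1 * of_int (b 1) * mod_u \<tau> * mod_t \<tau> + 7 ^ E 1 2 * of_int (b 2) * mod_u \<tau> ^ 2 * mod_t \<tau>
    + (\<Sum>i=3..D. 7 ^ E 1 i * of_int (b i) * mod_u \<tau> ^ i * mod_t \<tau>)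
    + 7 ^ E 2 2 * of_int (c 2) * mod_u \<tau> ^ 2 * mod_t \<tau> ^ 2
    + (\<Sum>i=3..D. 7 ^ E 2 i * of_int (c i) * mod_u \<tau> ^ i * mod_t \<tau> ^ 2)"
proof -
  note Q = Q'[rule_format]
  have "\<exists>k. (\<forall>r. k r \<noteq> 0 \<longrightarrow> (\<exists>e. Q (r mod 3) (r div 3) e)) \<and>
    (\<forall>\<tau>. Im \<tau> > 0 \<longrightarrow> f \<tau> = (\<Sum>r<3 * (D + 1). 7 ^ (\<lambda>i l. E i (i + l)) (r mod 3) (r div 3) * of_int (k r :: int) * monm r \<tau>))"
    by (rule Sp_integral[OF assms(1,2)]) (use Q in fastforce)
  then obtain k where k0: "\<forall>r. k r \<noteq> 0 \<longrightarrow> (\<exists>e. Q (r mod 3) (r div 3) e)"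
    and k1: "\<forall>\<tau>. Im \<tau> > 0 \<longrightarrow> f \<tau> = (\<Sum>r<3 * (D + 1). 7 ^ (\<lambda>i l. E i (i + l)) (r mod 3) (r div 3) * of_int (k r :: int) * monm r \<tau>)"
    by (elim exE conjE) (rule that)
  have z: "k (3 * l + j) = 0" if "j \<le> 2" "\<not> (1 \<le> j + l \<and> j + l \<le> D)" for j l
  proof (rule ccontr)
    assume "k (3 * l + j) \<noteq> 0"
    then obtain e where "Q ((3 * l + j) mod 3) ((3 * l + j) div 3) e" using k0 by blast
    moreover have "(3 * l + j) mod 3 = j" "(3 * l + j) div 3 = l" using that(1) by auto
    ultimately show False using Q[of j l e] that(2) by simp
  qed
  show ?thesis
  proof (intro exI allI impI)
    fix \<tau> :: complex assume t: "Im \<tau> > 0"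
    define h where "h = (\<lambda>j l. 7 ^ E j (j + l) * of_int (k (3 * l + j)) * (TT \<tau> ^ j * mod_u \<tau> ^ l))"
    have h: "(\<Sum>l<D + 1. h j l) = (\<Sum>i=j..2. h j (i - j)) + (\<Sum>i=3..D. h j (i - j))" if "j \<le> 2" for j
    proof -
      have "(\<Sum>l<D + 1. h j l) = (\<Sum>i=j..D. h j (i - j))"
        by (rule sum_shift_degree) (use z[OF that] in \<open>auto simp: h_def\<close>)
      then show ?thesis using sum_split_3[OF D that] by simp
    qed
    have hi: "h j (i - j) = 7 ^ E j i * of_int (k (3 * (i - j) + j)) * (mod_u \<tau> ^ i * mod_t \<tau> ^ j)" if "j \<le> i" for j i
    proof -
      have "TT \<tau> ^ j * mod_u \<tau> ^ (i - j) = (mod_u \<tau> ^ j * mod_u \<tau> ^ (i - j)) * mod_t \<tau> ^ j"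
        by (simp add: TT_def power_mult_distrib)
      then show ?thesis using that by (simp add: h_def power_add [symmetric])
    qed
    have h00: "h 0 0 = 0" using z[of 0 0] by (simp add: h_def)
    have "f \<tau> = (\<Sum>r<3 * (D + 1). 7 ^ E (r mod 3) (r mod 3 + r div 3) * of_int (k r) * monm r \<tau>)" using k1 t by simp
    also have "\<dots> = (\<Sum>l<D + 1. h 0 l + h 1 l + h 2 l)"
    proof (subst sum_triples, intro sum.cong refl)
      fix l :: nat
      have m: "3 * l mod 3 = 0" "3 * l div 3 = l" "(3 * l + 1) mod 3 = 1" "(3 * l + 1) div 3 = l" "(3 * l + 2) mod 3 = 2" "(3 * l + 2) div 3 = l"
        by presburger+
      show "7 ^ E (3 * l mod 3) (3 * l mod 3 + 3 * l div 3) * of_int (k (3 * l)) * monm (3 * l) \<tau>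
        + 7 ^ E ((3 * l + 1) mod 3) ((3 * l + 1) mod 3 + (3 * l + 1) div 3) * of_int (k (3 * l + 1)) * monm (3 * l + 1) \<tau>
        + 7 ^ E ((3 * l + 2) mod 3) ((3 * l + 2) mod 3 + (3 * l + 2) div 3) * of_int (k (3 * l + 2)) * monm (3 * l + 2) \<tau> = h 0 l + h 1 l + h 2 l"
        unfolding m h_def by simp
    qed
    also have "\<dots> = (h 0 0 + h 0 (1 - 0) + h 0 (2 - 0) + (\<Sum>i=3..D. h 0 (i - 0))) + (h 1 (1 - 1) + h 1 (2 - 1) + (\<Sum>i=3..D. h 1 (i - 1))) + (h 2 (2 - 2) + (\<Sum>i=3..D. h 2 (i - 2)))"
    proof -
      have "{0..2} = {0, 1, 2::nat}" "{1..2} = {1, 2::nat}" by auto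
      then show ?thesis unfolding sum.distrib using h[of 0] h[of 1] h[of 2] by simp
    qed
    also have "(\<Sum>i=3..D. h 0 (i - 0)) = (\<Sum>i=3..D. 7 ^ E 0 i * of_int (k (3 * i)) * mod_u \<tau> ^ i)"
      by (intro sum.cong refl) (simp add: h_def)
    also have "(\<Sum>i=3..D. h 1 (i - 1)) = (\<Sum>i=3..D. 7 ^ E 1 i * of_int (k (3 * (i - 1) + 1)) * mod_u \<tau> ^ i * mod_t \<tau>)"
      by (intro sum.cong refl) (use hi[of 1] in simp)
    also have "(\<Sum>i=3..D. h 2 (i - 2)) = (\<Sum>i=3..D. 7 ^ E 2 i * of_int (k (3 * (i - 2) + 2)) * mod_u \<tau> ^ i * mod_t \<tau> ^ 2)"
      by (intro sum.cong refl) (use hi[of 2] in simp)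
    finally show "f \<tau> =
        7 ^ E 0 1 * of_int ((\<lambda>i. k (3 * i)) 1) * mod_u \<tau> + 7 ^ E 0 2 * of_int ((\<lambda>i. k (3 * i)) 2) * mod_u \<tau> ^ 2
      + (\<Sum>i=3..D. 7 ^ E 0 i * of_int ((\<lambda>i. k (3 * i)) i) * mod_u \<tau> ^ i)
      + 7 ^ E 1 1 * of_int ((\<lambda>i. k (3 * (i - 1) + 1)) 1) * mod_u \<tau> * mod_t \<tau> + 7 ^ E 1 2 * of_int ((\<lambda>i. k (3 * (i - 1) + 1)) 2) * mod_u \<tau> ^ 2 * mod_t \<tau>
      + (\<Sum>i=3..D. 7 ^ E 1 i * of_int ((\<lambda>i. k (3 * (i - 1) + 1)) i) * mod_u \<tau> ^ i * mod_t \<tau>)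
      + 7 ^ E 2 2 * of_int ((\<lambda>i. k (3 * (i - 2) + 2)) 2) * mod_u \<tau> ^ 2 * mod_t \<tau> ^ 2
      + (\<Sum>i=3..D. 7 ^ E 2 i * of_int ((\<lambda>i. k (3 * (i - 2) + 2)) i) * mod_u \<tau> ^ i * mod_t \<tau> ^ 2)"
      using h00 hi[of 0 1] hi[of 0 2] hi[of 1 1] hi[of 1 2] hi[of 2 2] by (simp add: algebra_simps)
  qed
qed

section \<open>The exponents of the theorem\<close>

definition Eo :: "nat \<Rightarrow> nat \<Rightarrow> nat \<Rightarrow> nat" where
  "Eo \<alpha> j d = (if 3 \<le> d then \<alpha> + 1 + nat \<lceil>(7 * real d - 24) / 26\<rceil> else if j = 0 then \<alpha> + 1 else \<alpha>)"

definition Ee :: "nat \<Rightarrow> nat \<Rightarrow> nat \<Rightarrow> nat" where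
  "Ee \<alpha> j d = (if 3 \<le> d then \<alpha> + 1 + nat \<lceil>(7 * real d + 3) / 26\<rceil> else \<alpha> + 1)"

lemma PO_bounds:
  assumes "PO \<alpha> i l e"
  shows "1 \<le> i + l \<and> i + l \<le> (7 ^ (2 * \<alpha>) - 1) div 6 \<and> Eo \<alpha> i (i + l) \<le> e"
proof -
  define d where "d = i + l"
  have 1: "1 \<le> d" "6 * d + 1 \<le> 7 ^ (2 * \<alpha>)" "\<alpha> \<le> e" "i = 0 \<longrightarrow> \<alpha> + 1 \<le> e" "3 \<le> d \<longrightarrow> \<alpha> + 1 \<le> e \<and> 7 * d + 26 * (\<alpha> + 1) \<le> 26 * e + 24"
    using assms by (auto simp: PO_def d_def)
  have "6 * d \<le> 7 ^ (2 * \<alpha>) - 1" using 1(2) by simp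
  then have 2: "d \<le> (7 ^ (2 * \<alpha>) - 1) div 6" by (simp add: less_eq_div_iff_mult_less_eq mult.commute)
  have "Eo \<alpha> i d \<le> e"
  proof (cases "3 \<le> d")
    case True
    have "real (7 * d + 26 * (\<alpha> + 1)) \<le> real (26 * e + 24)" using 1(5) True of_nat_mono by blast
    then have "\<lceil>(7 * real d - 24) / 26\<rceil> \<le> int e - int (\<alpha> + 1)" by (intro ceiling_le) simp
    also have "\<dots> = int (e - (\<alpha> + 1))" using 1(5) True by (simp add: of_nat_diff)
    finally have N: "nat \<lceil>(7 * real d - 24) / 26\<rceil> \<le> e - (\<alpha> + 1)" by (simp only: nat_le_iff)
    have "Eo \<alpha> i d = \<alpha> + 1 + nat \<lceil>(7 * real d - 24) / 26\<rceil>" using True by (simp add: Eo_def)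
    then show ?thesis using N True 1(5) by linarith
  qed (use 1 in \<open>auto simp: Eo_def\<close>)
  then show ?thesis using 1(1) 2 by (simp add: d_def)
qed

lemma PE_bounds:
  assumes "PE \<alpha> i l e"
  shows "1 \<le> i + l \<and> i + l \<le> (7 ^ (2 * \<alpha> + 1) - 7) div 6 \<and> Ee \<alpha> i (i + l) \<le> e"
proof -
  define d where "d = i + l"
  have 1: "1 \<le> d" "6 * d + 7 \<le> 7 ^ (2 * \<alpha> + 1)" "\<alpha> + 1 \<le> e" "3 \<le> d \<longrightarrow> 7 * d + 3 + 26 * (\<alpha> + 1) \<le> 26 * e"
    using assms by (auto simp: PE_def d_def)
  have "6 * d \<le> 7 ^ (2 * \<alpha> + 1) - 7" using 1(2) by linarith
  then have 2: "d \<le> (7 ^ (2 * \<alpha> + 1) - 7) div 6" by (simp add: less_eq_div_iff_mult_less_eq mult.commute)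
  have "Ee \<alpha> i d \<le> e"
  proof (cases "3 \<le> d")
    case True
    have "real (7 * d + 3 + 26 * (\<alpha> + 1)) \<le> real (26 * e)" using 1(4) True of_nat_mono by blast
    then have "\<lceil>(7 * real d + 3) / 26\<rceil> \<le> int e - int (\<alpha> + 1)" by (intro ceiling_le) simp
    also have "\<dots> = int (e - (\<alpha> + 1))" using 1(3) by (simp add: of_nat_diff)
    finally have N: "nat \<lceil>(7 * real d + 3) / 26\<rceil> \<le> e - (\<alpha> + 1)" by (simp only: nat_le_iff)
    have "Ee \<alpha> i d = \<alpha> + 1 + nat \<lceil>(7 * real d + 3) / 26\<rceil>" using True by (simp add: Ee_def)
    then show ?thesis using N 1(3) by linarith
  qed (use 1 in \<open>auto simp: Ee_def\<close>)
  then show ?thesis using 1(1) 2 by (simp add: d_def)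
qed

text \<open>At i = 3 the argument of the ceiling is -3/26, which still exceeds -1, so the ceiling is
  nonnegative for all i >= 3 and the truncation by \<open>nat\<close> in \<open>Eo\<close> is
  harmless.\<close>

lemma Eo_weight:
  assumes "3 \<le> i"
  shows "(7::complex) ^ Eo \<alpha> j i = 7 ^ (\<alpha> + 1) * 7 powi \<lceil>(7 * real i - 24) / 26\<rceil>"
proof -
  have "3 \<le> real i" using assms by simp
  then have "- 1 < (7 * real i - 24) / 26" by simp
  then have "0 \<le> \<lceil>(7 * real i - 24) / 26\<rceil>" by (simp only: zero_le_ceiling)
  then show ?thesis using assms by (simp add: Eo_def power_add power_int_def)
qed

lemma Ee_weight:
  assumes "3 \<le> i"
  shows "(7::complex) ^ Ee \<alpha> j i = 7 ^ (\<alpha> + 1) * 7 powi \<lceil>(7 * real i + 3) / 26\<rceil>"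
proof -
  have "3 \<le> real i" using assms by simp
  then have "- 1 < (7 * real i + 3) / 26" by simp
  then have "0 \<le> \<lceil>(7 * real i + 3) / 26\<rceil>" by (simp only: zero_le_ceiling)
  then show ?thesis using assms by (simp add: Ee_def power_add power_int_def)
qed

lemma degree_bound: "1 \<le> \<alpha> \<Longrightarrow> 49 \<le> (7::nat) ^ (2 * \<alpha>)"
  using power_increasing[of 2 "2 * \<alpha>" "7::nat"] by simp

theorem theorem4p1:
  fixes \<alpha> :: nat
  assumes "\<alpha> \<ge> 1"
  shows "\<exists>a b c :: nat \<Rightarrow> nat \<Rightarrow> int.
    (\<forall>\<tau> \<in> upper_half_plane.
       L_seq (2 * \<alpha> - 1) \<tau> =
           7 ^ (\<alpha> + 1) * of_int (a (2 * \<alpha> - 1) 1) * mod_u \<tau>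
         + 7 ^ (\<alpha> + 1) * of_int (a (2 * \<alpha> - 1) 2) * mod_u \<tau> ^ 2
         + 7 ^ (\<alpha> + 1) * (\<Sum>i = 3..(7 ^ (2 * \<alpha>) - 1) div 6.
             7 powi \<lceil>(7 * real i - 24) / 26\<rceil> * of_int (a (2 * \<alpha> - 1) i) * mod_u \<tau> ^ i)
         + 7 ^ \<alpha> * of_int (b (2 * \<alpha> - 1) 1) * mod_u \<tau> * mod_t \<tau>
         + 7 ^ \<alpha> * of_int (b (2 * \<alpha> - 1) 2) * mod_u \<tau> ^ 2 * mod_t \<tau>
         + 7 ^ (\<alpha> + 1) * (\<Sum>i = 3..(7 ^ (2 * \<alpha>) - 1) div 6.
             7 powi \<lceil>(7 * real i - 24) / 26\<rceil> * of_int (b (2 * \<alpha> - 1) i) * mod_u \<tau> ^ i * mod_t \<tau>)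
         + 7 ^ \<alpha> * of_int (c (2 * \<alpha> - 1) 2) * mod_u \<tau> ^ 2 * mod_t \<tau> ^ 2
         + 7 ^ (\<alpha> + 1) * (\<Sum>i = 3..(7 ^ (2 * \<alpha>) - 1) div 6.
             7 powi \<lceil>(7 * real i - 24) / 26\<rceil> * of_int (c (2 * \<alpha> - 1) i) * mod_u \<tau> ^ i * mod_t \<tau> ^ 2))
  \<and> (\<forall>\<tau> \<in> upper_half_plane.
       L_seq (2 * \<alpha>) \<tau> =
           7 ^ (\<alpha> + 1) * of_int (a (2 * \<alpha>) 1) * mod_u \<tau>
         + 7 ^ (\<alpha> + 1) * of_int (a (2 * \<alpha>) 2) * mod_u \<tau> ^ 2
         + 7 ^ (\<alpha> + 1) * (\<Sum>i = 3..(7 ^ (2 * \<alpha> + 1) - 7) div 6.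
             7 powi \<lceil>(7 * real i + 3) / 26\<rceil> * of_int (a (2 * \<alpha>) i) * mod_u \<tau> ^ i)
         + 7 ^ (\<alpha> + 1) * of_int (b (2 * \<alpha>) 1) * mod_u \<tau> * mod_t \<tau>
         + 7 ^ (\<alpha> + 1) * of_int (b (2 * \<alpha>) 2) * mod_u \<tau> ^ 2 * mod_t \<tau>
         + 7 ^ (\<alpha> + 1) * (\<Sum>i = 3..(7 ^ (2 * \<alpha> + 1) - 7) div 6.
             7 powi \<lceil>(7 * real i + 3) / 26\<rceil> * of_int (b (2 * \<alpha>) i) * mod_u \<tau> ^ i * mod_t \<tau>)
         + 7 ^ (\<alpha> + 1) * of_int (c (2 * \<alpha>) 2) * mod_u \<tau> ^ 2 * mod_t \<tau> ^ 2
         + 7 ^ (\<alpha> + 1) * (\<Sum>i = 3..(7 ^ (2 * \<alpha> + 1) - 7) div 6.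
             7 powi \<lceil>(7 * real i + 3) / 26\<rceil> * of_int (c (2 * \<alpha>) i) * mod_u \<tau> ^ i * mod_t \<tau> ^ 2))"
proof -
  obtain \<beta> where \<beta>: "\<alpha> = Suc \<beta>" using assms by (cases \<alpha>) auto
  have n: "2 * \<alpha> - 1 = 2 * \<beta> + 1" "2 * \<alpha> = 2 * \<beta> + 2" using \<beta> by auto
  let ?D = "(7 ^ (2 * \<alpha>) - 1) div 6 :: nat" and ?D' = "(7 ^ (2 * \<alpha> + 1) - 7) div 6 :: nat"
  have D: "3 \<le> ?D" "3 \<le> ?D'" using degree_bound[OF assms] by auto
  have so: "Sp (\<lambda>i l e. i \<le> 2 \<and> PO \<alpha> i l e) (L_seq (2 * \<alpha> - 1))" using L_seq_reduced(1)[of \<beta>] by (simp only: n(1) \<beta> [symmetric])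
  have se: "Sp (\<lambda>i l e. i \<le> 2 \<and> PE \<alpha> i l e) (L_seq (2 * \<alpha>))" using L_seq_reduced(2)[of \<beta>] by (simp only: n(2) \<beta> [symmetric])
  have Qo: "\<forall>i l e. PO \<alpha> i l e \<longrightarrow> 1 \<le> i + l \<and> i + l \<le> ?D \<and> Eo \<alpha> i (i + l) \<le> e"
    by (intro allI impI) (rule PO_bounds)
  have Qe: "\<forall>i l e. PE \<alpha> i l e \<longrightarrow> 1 \<le> i + l \<and> i + l \<le> ?D' \<and> Ee \<alpha> i (i + l) \<le> e"
    by (intro allI impI) (rule PE_bounds)
  obtain a b c :: "nat \<Rightarrow> int" where o: "\<forall>\<tau>. Im \<tau> > 0 \<longrightarrow> L_seq (2 * \<alpha> - 1) \<tau> =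
      7 ^ Eo \<alpha> 0 1 * of_int (a 1) * mod_u \<tau> + 7 ^ Eo \<alpha> 0 2 * of_int (a 2) * mod_u \<tau> ^ 2
    + (\<Sum>i=3..?D. 7 ^ Eo \<alpha> 0 i * of_int (a i) * mod_u \<tau> ^ i)
    + 7 ^ Eo \<alpha> 1 1 * of_int (b 1) * mod_u \<tau> * mod_t \<tau> + 7 ^ Eo \<alpha> 1 2 * of_int (b 2) * mod_u \<tau> ^ 2 * mod_t \<tau>
    + (\<Sum>i=3..?D. 7 ^ Eo \<alpha> 1 i * of_int (b i) * mod_u \<tau> ^ i * mod_t \<tau>)
    + 7 ^ Eo \<alpha> 2 2 * of_int (c 2) * mod_u \<tau> ^ 2 * mod_t \<tau> ^ 2
    + (\<Sum>i=3..?D. 7 ^ Eo \<alpha> 2 i * of_int (c i) * mod_u \<tau> ^ i * mod_t \<tau> ^ 2)"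
    using basis_expansion[OF so iq_L_seq Qo D(1)] by (elim exE) (rule that)
  obtain a' b' c' :: "nat \<Rightarrow> int" where e: "\<forall>\<tau>. Im \<tau> > 0 \<longrightarrow> L_seq (2 * \<alpha>) \<tau> =
      7 ^ Ee \<alpha> 0 1 * of_int (a' 1) * mod_u \<tau> + 7 ^ Ee \<alpha> 0 2 * of_int (a' 2) * mod_u \<tau> ^ 2
    + (\<Sum>i=3..?D'. 7 ^ Ee \<alpha> 0 i * of_int (a' i) * mod_u \<tau> ^ i)
    + 7 ^ Ee \<alpha> 1 1 * of_int (b' 1) * mod_u \<tau> * mod_t \<tau> + 7 ^ Ee \<alpha> 1 2 * of_int (b' 2) * mod_u \<tau> ^ 2 * mod_t \<tau>
    + (\<Sum>i=3..?D'. 7 ^ Ee \<alpha> 1 i * of_int (b' i) * mod_u \<tau> ^ i * mod_t \<tau>)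
    + 7 ^ Ee \<alpha> 2 2 * of_int (c' 2) * mod_u \<tau> ^ 2 * mod_t \<tau> ^ 2
    + (\<Sum>i=3..?D'. 7 ^ Ee \<alpha> 2 i * of_int (c' i) * mod_u \<tau> ^ i * mod_t \<tau> ^ 2)"
    using basis_expansion[OF se iq_L_seq Qe D(2)] by (elim exE) (rule that)
  \<comment> \<open>The odd and the even expansion sit at different indices, so one family can hold
    the coefficients of both.\<close>
  let ?s = "\<lambda>(f :: nat \<Rightarrow> int) g s. if s = 2 * \<alpha> then g else f"
  have ne: "2 * \<alpha> - 1 \<noteq> 2 * \<alpha>" using assms by linarith
  have s: "?s f g (2 * \<alpha> - 1) = f" "?s f g (2 * \<alpha>) = g" for f g using ne by auto
  have Eo: "Eo \<alpha> 0 1 = \<alpha> + 1" "Eo \<alpha> 0 2 = \<alpha> + 1" "Eo \<alpha> 1 1 = \<alpha>" "Eo \<alpha> 1 2 = \<alpha>" "Eo \<alpha> 2 2 = \<alpha>" by (simp_all add: Eo_def)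
  have Ee: "Ee \<alpha> 0 1 = \<alpha> + 1" "Ee \<alpha> 0 2 = \<alpha> + 1" "Ee \<alpha> 1 1 = \<alpha> + 1" "Ee \<alpha> 1 2 = \<alpha> + 1" "Ee \<alpha> 2 2 = \<alpha> + 1" by (simp_all add: Ee_def)
  have so: "(\<Sum>i=3..?D. 7 ^ Eo \<alpha> j i * of_int (x i) * y i) = 7 ^ (\<alpha> + 1) * (\<Sum>i=3..?D. 7 powi \<lceil>(7 * real i - 24) / 26\<rceil> * of_int (x i) * y i)"
    for j and x :: "nat \<Rightarrow> int" and y :: "nat \<Rightarrow> complex"
    unfolding sum_distrib_left by (intro sum.cong refl) (simp add: Eo_weight)
  have so2: "(\<Sum>i=3..?D. 7 ^ Eo \<alpha> j i * of_int (x i) * y i * z) = 7 ^ (\<alpha> + 1) * (\<Sum>i=3..?D. 7 powi \<lceil>(7 * real i - 24) / 26\<rceil> * of_int (x i) * y i * z)"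
    for j and x :: "nat \<Rightarrow> int" and y :: "nat \<Rightarrow> complex" and z :: complex
    unfolding sum_distrib_left by (intro sum.cong refl) (simp add: Eo_weight)
  have se: "(\<Sum>i=3..?D'. 7 ^ Ee \<alpha> j i * of_int (x i) * y i) = 7 ^ (\<alpha> + 1) * (\<Sum>i=3..?D'. 7 powi \<lceil>(7 * real i + 3) / 26\<rceil> * of_int (x i) * y i)"
    for j and x :: "nat \<Rightarrow> int" and y :: "nat \<Rightarrow> complex"
    unfolding sum_distrib_left by (intro sum.cong refl) (simp add: Ee_weight)
  have se2: "(\<Sum>i=3..?D'. 7 ^ Ee \<alpha> j i * of_int (x i) * y i * z) = 7 ^ (\<alpha> + 1) * (\<Sum>i=3..?D'. 7 powi \<lceil>(7 * real i + 3) / 26\<rceil> * of_int (x i) * y i * z)"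
    for j and x :: "nat \<Rightarrow> int" and y :: "nat \<Rightarrow> complex" and z :: complex
    unfolding sum_distrib_left by (intro sum.cong refl) (simp add: Ee_weight)
  show ?thesis
  proof (rule exI[of _ "?s a a'"], rule exI[of _ "?s b b'"], rule exI[of _ "?s c c'"], unfold s, intro conjI ballI, goal_cases)
    case (1 \<tau>)
    then have t: "Im \<tau> > 0" by (simp add: upper_half_plane_def)
    from o[rule_format, OF t, unfolded Eo so so2] show ?case .
  next
    case (2 \<tau>)
    then have t: "Im \<tau> > 0" by (simp add: upper_half_plane_def)
    from e[rule_format, OF t, unfolded Ee se se2] show ?case .
  qed
qed

end
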